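(* Let $1\le p\le n$, let $\mathcal{F}:\mathbb{R}^{n\times p}\to\mathbb{R}$ be smooth, and let $\sigma(t)\equiv\sigma_0$ be constant. Let $X(t)$, $t_0\le t\le T$, be a solution, with $X(t_0)\in\mathcal{M}_{n,p}$, of the Stratonovich SDE on the Stiefel manifold $$\mathrm{d}X(t)=-\nabla_{\mathcal{M}}\mathcal{F}(X(t))\,\mathrm{d}t+\sigma_0\sum_{u=1}^n\sum_{v=1}^pP_{uv}(X(t))\circ\mathrm{d}B_{uv}(t).$$ Let $t_0=\tau_0<\tau_1<\dots<\tau_K=T$ be a time discretization, $\delta_k=\tau_{k+1}-\tau_k$, and $\delta=\max_k\{\delta_k\}$. Let $Y_0=X(t_0)$ and, for $k=0,\dots,K-1$, let $$Z_k=-\delta_kG_k+\sigma_0(I_n-\beta Y_kY_k^\top)\,\delta B_k,\qquad A_k=Z_kY_k^\top-Y_kZ_k^\top,\qquad Y_{k+1}=\Bigl(I-\frac{A_k}{2}\Bigr)^{-1}\Bigl(I+\frac{A_k}{2}\Bigr)Y_k,$$ where $G_k=\bigl(\partial_{ij}\mathcal{F}(Y_k)\bigr)_{i,j}\in\mathbb{R}^{n\times p}$ is the Euclidean gradient and $\delta B_k=B(\tau_{k+1})-B(\tau_k)\in\mathbb{R}^{n\times p}$ with $B=(B_{uv})$. Then there exist a constant $C=C(T)>0$ independent of $\delta$ and a constant $\delta_0>0$ such that $$\mathbb{E}\|X(T)-Y_K\|_2^2\le C\delta\qquad\text{for all }\delta\in(0,\delta_0).$$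
   Context: $\mathcal{M}_{n,p}=\{X\in\mathbb{R}^{n\times p}: X^\top X=I_p\}$ is the Stiefel manifold. $\nabla_{\mathcal{M}}\mathcal{F}(X)=G-XG^\top X$ with $G=(\partial_{ij}\mathcal{F}(X))_{i,j}$ is the gradient of $\mathcal{F}$ with respect to the canonical metric $g^c(Z_1,Z_2)=\mathrm{tr}(Z_1^\top(I-\frac12XX^\top)Z_2)$. $P_{uv}(X)=E_{uv}-\alpha XE_{uv}^\top X-\beta XX^\top E_{uv}$, where $E_{uv}\in\mathbb{R}^{n\times p}$ has $(u,v)$ entry $1$ and all other entries $0$, $\alpha=\sqrt2/2$, $\beta=1-\sqrt2/2$. $\{B_{uv}(t)\}$ are independent one-dimensional standard Brownian motions, so the entries of the $\delta B_k$ are independent $N(0,\delta_k)$ variables. $\circ\,\mathrm{d}B$ is the Stratonovich differential. The solution $X(t)$ started on $\mathcal{M}_{n,p}$ stays on $\mathcal{M}_{n,p}$ almost surely. $\|\cdot\|_2$ is the matrix 2-norm. *)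

theory Defs
  imports "HOL-Probability.Probability"
begin

section \<open>Smooth functions, matrices and the Stiefel manifold\<close>

primrec C_k :: "nat \<Rightarrow> ('a::real_normed_vector \<Rightarrow> 'b::real_normed_vector) \<Rightarrow> bool" where
  "C_k 0 f \<longleftrightarrow> continuous_on UNIV f"
| "C_k (Suc k) f \<longleftrightarrow>
     (\<forall>x. f differentiable (at x)) \<and> (\<forall>v. C_k k (\<lambda>x. frechet_derivative f (at x) v))"

definition smooth :: "('a::real_normed_vector \<Rightarrow> 'b::real_normed_vector) \<Rightarrow> bool" where
  "smooth f \<longleftrightarrow> (\<forall>k. C_k k f)"

text \<open>An \<open>n \<times> p\<close> matrix is an element of \<open>real ^ 'p ^ 'n\<close>, so \<open>n = CARD('n)\<close> and
  \<open>p = CARD('p)\<close>.\<close>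

definition unit_mat :: "'n \<Rightarrow> 'p \<Rightarrow> real ^ 'p ^ 'n" where
  "unit_mat u v = (\<chi> i j. if i = u \<and> j = v then 1 else 0)"

definition norm2 :: "real ^ 'p ^ 'n \<Rightarrow> real" where
  "norm2 A = onorm (\<lambda>x. A *v x)"

definition stiefel :: "(real ^ 'p ^ 'n) set" where
  "stiefel = {X. transpose X ** X = mat 1}"

definition egrad :: "(real ^ 'p ^ 'n \<Rightarrow> real) \<Rightarrow> real ^ 'p ^ 'n \<Rightarrow> real ^ 'p ^ 'n" where
  "egrad f X = (\<chi> i j. frechet_derivative f (at X) (unit_mat i j))"

text \<open>The gradient with respect to the canonical metric of the Stiefel manifold.\<close>

definition stiefel_grad :: "(real ^ 'p ^ 'n \<Rightarrow> real) \<Rightarrow> real ^ 'p ^ 'n \<Rightarrow> real ^ 'p ^ 'n" where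
  "stiefel_grad f X = egrad f X - X ** transpose (egrad f X) ** X"

definition st_alpha :: real where "st_alpha = sqrt 2 / 2"

definition st_beta :: real where "st_beta = 1 - sqrt 2 / 2"

definition P_field :: "'n \<Rightarrow> 'p \<Rightarrow> real ^ 'p ^ 'n \<Rightarrow> real ^ 'p ^ 'n" where
  "P_field u v X = unit_mat u v
     - st_alpha *\<^sub>R (X ** transpose (unit_mat u v) ** X)
     - st_beta *\<^sub>R (X ** transpose X ** unit_mat u v)"


section \<open>Time grids\<close>

text \<open>The points of a grid are \<open>\<tau> 0, \<dots>, \<tau> K\<close>; the values of \<open>\<tau>\<close> beyond \<open>K\<close> are irrelevant.\<close>

definition time_grid :: "real \<Rightarrow> real \<Rightarrow> nat \<Rightarrow> (nat \<Rightarrow> real) \<Rightarrow> bool" where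
  "time_grid a b K \<tau> \<longleftrightarrow> \<tau> 0 = a \<and> \<tau> K = b \<and> (\<forall>k<K. \<tau> k < \<tau> (Suc k))"

text \<open>The inserted \<open>0\<close> only matters for the trivial grid \<open>K = 0\<close>.\<close>

definition mesh :: "nat \<Rightarrow> (nat \<Rightarrow> real) \<Rightarrow> real" where
  "mesh K \<tau> = Max (insert 0 ((\<lambda>k. \<tau> (Suc k) - \<tau> k) ` {..<K}))"


section \<open>Stochastic processes\<close>

text \<open>Filtrations are indexed by all reals because the library locale \<open>filtration\<close> is indexed by a
  type; only times \<open>t \<ge> 0\<close> play a role.\<close>

definition filtered_prob_space :: "'a measure \<Rightarrow> (real \<Rightarrow> 'a measure) \<Rightarrow> bool" where
  "filtered_prob_space M \<F> \<longleftrightarrow>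
     prob_space M \<and> filtration (space M) \<F> \<and> (\<forall>t. subalgebra M (\<F> t))"

definition adapted_on ::
    "real set \<Rightarrow> (real \<Rightarrow> 'a measure) \<Rightarrow> (real \<Rightarrow> 'a \<Rightarrow> 'e::topological_space) \<Rightarrow> bool" where
  "adapted_on I \<F> H \<longleftrightarrow> (\<forall>t\<in>I. H t \<in> borel_measurable (\<F> t))"

definition standard_brownian_motion :: "'a measure \<Rightarrow> (real \<Rightarrow> 'a \<Rightarrow> real) \<Rightarrow> bool" where
  "standard_brownian_motion M W \<longleftrightarrow>
     (\<forall>t\<ge>0. W t \<in> borel_measurable M) \<and>
     (AE \<omega> in M. W 0 \<omega> = 0) \<and>
     (AE \<omega> in M. continuous_on {0..} (\<lambda>t. W t \<omega>)) \<and>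
     (\<forall>s t. 0 \<le> s \<and> s < t \<longrightarrow>
        distributed M lborel (\<lambda>\<omega>. W t \<omega> - W s \<omega>) (normal_density 0 (sqrt (t - s)))) \<and>
     (\<forall>K \<tau>. 0 \<le> \<tau> 0 \<and> (\<forall>k<K. \<tau> k < \<tau> (Suc k)) \<longrightarrow>
        prob_space.indep_vars M (\<lambda>_. borel) (\<lambda>k \<omega>. W (\<tau> (Suc k)) \<omega> - W (\<tau> k) \<omega>) {..<K})"

text \<open>A matrix whose entries are standard Brownian motions that are independent as random elements
  of the path space \<open>\<real>\<^bsup>[0,\<infinity>)\<^esup>\<close>, and that is a Brownian motion relative to the filtration:
  it is adapted and its increments after time \<open>s\<close> are independent of \<open>\<F> s\<close>.\<close>

definition matrix_brownian_motion ::
    "'a measure \<Rightarrow> (real \<Rightarrow> 'a measure) \<Rightarrow> (real \<Rightarrow> 'a \<Rightarrow> real ^ 'p ^ 'n) \<Rightarrow> bool" where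
  "matrix_brownian_motion M \<F> B \<longleftrightarrow>
     (\<forall>u v. standard_brownian_motion M (\<lambda>t \<omega>. B t \<omega> $ u $ v)) \<and>
     prob_space.indep_vars M (\<lambda>_. PiM {0..} (\<lambda>_. borel))
       (\<lambda>(u, v) \<omega>. \<lambda>t\<in>{0..}. B t \<omega> $ u $ v) UNIV \<and>
     adapted_on {0..} \<F> B \<and>
     (\<forall>s t. 0 \<le> s \<and> s < t \<longrightarrow>
        prob_space.indep_set M (sets (\<F> s))
          (sets (vimage_algebra (space M) (\<lambda>\<omega>. B t \<omega> - B s \<omega>) borel)))"

definition martingale_on ::
    "real \<Rightarrow> real \<Rightarrow> 'a measure \<Rightarrow> (real \<Rightarrow> 'a measure) \<Rightarrow> (real \<Rightarrow> 'a \<Rightarrow> real) \<Rightarrow> bool" where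
  "martingale_on a b M \<F> N \<longleftrightarrow>
     adapted_on {a..b} \<F> N \<and> (\<forall>t\<in>{a..b}. integrable M (N t)) \<and>
     (\<forall>s t. a \<le> s \<and> s \<le> t \<and> t \<le> b \<longrightarrow>
        (AE \<omega> in M. real_cond_exp M (\<F> s) (N t) \<omega> = N s \<omega>))"

text \<open>On a compact time interval a localising sequence may be taken real-valued; it has to reach
  the right end point eventually.\<close>

definition continuous_local_martingale_on ::
    "real \<Rightarrow> real \<Rightarrow> 'a measure \<Rightarrow> (real \<Rightarrow> 'a measure) \<Rightarrow> (real \<Rightarrow> 'a \<Rightarrow> real) \<Rightarrow> bool" where
  "continuous_local_martingale_on a b M \<F> N \<longleftrightarrow>
     adapted_on {a..b} \<F> N \<and>
     (AE \<omega> in M. continuous_on {a..b} (\<lambda>t. N t \<omega>)) \<and>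
     (\<exists>S :: nat \<Rightarrow> 'a \<Rightarrow> real.
        (\<forall>m. stopping_time \<F> (S m) \<and> (\<forall>\<omega>\<in>space M. a \<le> S m \<omega>)) \<and>
        (AE \<omega> in M. incseq (\<lambda>m. S m \<omega>) \<and> (\<exists>m. b \<le> S m \<omega>)) \<and>
        (\<forall>m. martingale_on a b M \<F> (\<lambda>t \<omega>. N (min t (S m \<omega>)) \<omega> - N a \<omega>)))"

definition bounded_variation_on :: "real \<Rightarrow> real \<Rightarrow> (real \<Rightarrow> real) \<Rightarrow> bool" where
  "bounded_variation_on a b f \<longleftrightarrow>
     (\<exists>L. \<forall>K \<tau>. time_grid a b K \<tau> \<longrightarrow> (\<Sum>k<K. \<bar>f (\<tau> (Suc k)) - f (\<tau> k)\<bar>) \<le> L)"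

definition continuous_semimartingale_on ::
    "real \<Rightarrow> real \<Rightarrow> 'a measure \<Rightarrow> (real \<Rightarrow> 'a measure) \<Rightarrow> (real \<Rightarrow> 'a \<Rightarrow> real) \<Rightarrow> bool" where
  "continuous_semimartingale_on a b M \<F> H \<longleftrightarrow>
     adapted_on {a..b} \<F> H \<and>
     (\<exists>N V. continuous_local_martingale_on a b M \<F> N \<and> adapted_on {a..b} \<F> V \<and>
        (AE \<omega> in M. continuous_on {a..b} (\<lambda>t. V t \<omega>) \<and> bounded_variation_on a b (\<lambda>t. V t \<omega>)) \<and>
        (AE \<omega> in M. \<forall>t\<in>{a..b}. H t \<omega> = N t \<omega> + V t \<omega>))"


section \<open>Stratonovich integral and Stratonovich equation\<close>

text \<open>The random variable \<open>J\<close> is a version of the Stratonovich integral \<open>\<integral>\<^sub>a\<^sup>b H \<circ> dW\<close>, that is, the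
  limit in probability of the trapezoidal sums as the mesh of the grid tends to \<open>0\<close>.\<close>

definition trapezoidal_sum ::
    "(real \<Rightarrow> 'a \<Rightarrow> 'e::real_vector) \<Rightarrow> (real \<Rightarrow> 'a \<Rightarrow> real) \<Rightarrow> nat \<Rightarrow> (nat \<Rightarrow> real) \<Rightarrow> 'a \<Rightarrow> 'e" where
  "trapezoidal_sum H W K \<tau> \<omega> =
     (\<Sum>k<K. (W (\<tau> (Suc k)) \<omega> - W (\<tau> k) \<omega>) *\<^sub>R ((1/2) *\<^sub>R (H (\<tau> k) \<omega> + H (\<tau> (Suc k)) \<omega>)))"

definition has_stratonovich_integral ::
    "'a measure \<Rightarrow> (real \<Rightarrow> 'a \<Rightarrow> 'e::real_normed_vector) \<Rightarrow> (real \<Rightarrow> 'a \<Rightarrow> real) \<Rightarrow>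
       real \<Rightarrow> real \<Rightarrow> ('a \<Rightarrow> 'e) \<Rightarrow> bool" where
  "has_stratonovich_integral M H W a b J \<longleftrightarrow>
     J \<in> borel_measurable M \<and>
     (\<forall>\<epsilon>>0. \<forall>\<eta>>0. \<exists>d>0. \<forall>K \<tau>. time_grid a b K \<tau> \<and> mesh K \<tau> < d \<longrightarrow>
        measure M {\<omega> \<in> space M. \<epsilon> < norm (trapezoidal_sum H W K \<tau> \<omega> - J \<omega>)} < \<eta>)"

text \<open>A solution on \<open>[t0,T]\<close> of
  \<open>dX = - stiefel_grad f X dt + \<sigma> (\<Sum>u v. P_field u v X \<circ> dB\<^sub>u\<^sub>v)\<close>: an adapted process with continuous
  paths whose entries are semimartingales and which satisfies the integrated equation. By path
  continuity it is enough that the equation holds almost surely for each time \<open>t\<close>.\<close>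

definition stiefel_sde_solution ::
    "'a measure \<Rightarrow> (real \<Rightarrow> 'a measure) \<Rightarrow> (real \<Rightarrow> 'a \<Rightarrow> real ^ 'p ^ 'n) \<Rightarrow>
       (real ^ 'p ^ 'n \<Rightarrow> real) \<Rightarrow> real \<Rightarrow> real \<Rightarrow> real \<Rightarrow> (real \<Rightarrow> 'a \<Rightarrow> real ^ 'p ^ 'n) \<Rightarrow> bool" where
  "stiefel_sde_solution M \<F> B f \<sigma> t0 T X \<longleftrightarrow>
     adapted_on {t0..T} \<F> X \<and>
     (AE \<omega> in M. continuous_on {t0..T} (\<lambda>t. X t \<omega>)) \<and>
     (\<forall>i j. continuous_semimartingale_on t0 T M \<F> (\<lambda>t \<omega>. X t \<omega> $ i $ j)) \<and>
     (\<forall>t\<in>{t0..T}. \<exists>J.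
        (\<forall>u v. has_stratonovich_integral M
           (\<lambda>s \<omega>. P_field u v (X s \<omega>)) (\<lambda>s \<omega>. B s \<omega> $ u $ v) t0 t (J u v)) \<and>
        (AE \<omega> in M. X t \<omega> = X t0 \<omega> - integral {t0..t} (\<lambda>s. stiefel_grad f (X s \<omega>))
           + \<sigma> *\<^sub>R (\<Sum>u\<in>UNIV. \<Sum>v\<in>UNIV. J u v \<omega>)))"


section \<open>The numerical scheme\<close>

text \<open>One step from \<open>Y\<close> with time increment \<open>h\<close> and Brownian increment \<open>D\<close>. The matrix \<open>A\<close> is
  skew-symmetric, so \<open>I - A / 2\<close> is invertible and \<open>matrix_inv\<close> is its inverse.\<close>

definition cayley_step ::
    "(real ^ 'p ^ 'n \<Rightarrow> real) \<Rightarrow> real \<Rightarrow> real \<Rightarrow> real ^ 'p ^ 'n \<Rightarrow> real ^ 'p ^ 'n \<Rightarrow> real ^ 'p ^ 'n" where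
  "cayley_step f \<sigma> h D Y =
     (let Z = - (h *\<^sub>R egrad f Y) + \<sigma> *\<^sub>R ((mat 1 - st_beta *\<^sub>R (Y ** transpose Y)) ** D);
          A = Z ** transpose Y - Y ** transpose Z
      in matrix_inv (mat 1 - (1/2) *\<^sub>R A) ** (mat 1 + (1/2) *\<^sub>R A) ** Y)"

primrec cayley_scheme ::
    "(real ^ 'p ^ 'n \<Rightarrow> real) \<Rightarrow> real \<Rightarrow> (nat \<Rightarrow> real) \<Rightarrow> (real \<Rightarrow> 'a \<Rightarrow> real ^ 'p ^ 'n) \<Rightarrow>
       ('a \<Rightarrow> real ^ 'p ^ 'n) \<Rightarrow> nat \<Rightarrow> 'a \<Rightarrow> real ^ 'p ^ 'n" where
  "cayley_scheme f \<sigma> \<tau> B Y0 0 = Y0"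
| "cayley_scheme f \<sigma> \<tau> B Y0 (Suc k) =
     (\<lambda>\<omega>. cayley_step f \<sigma> (\<tau> (Suc k) - \<tau> k) (B (\<tau> (Suc k)) \<omega> - B (\<tau> k) \<omega>)
            (cayley_scheme f \<sigma> \<tau> B Y0 k \<omega>))"

end

theory Submission imports Defs
begin

text \<open>
  The solution is only given as a semimartingale satisfying a Stratonovich equation in the sense of
  limits in probability of trapezoidal sums, so everything is done with sums over grids. Along
  refining grids the squared increments of the solution are bounded in probability, and this turns
  the trapezoidal sums into Euler sums with the Stratonovich-corrected drift. On the Stiefel
  manifold one Cayley step agrees with an Euler step of the corrected equation up to a
  conditionally centred term of size \<open>h\<close> and a remainder of size \<open>h\<^sup>3\<^sup>/\<^sup>2\<close>.
  A Gronwall argument on an auxiliary fine grid, stopped when the solution leaves a large ball, then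
  bounds \<open>\<bar>X - Y\<bar>\<^sup>2\<close> by a multiple of the mesh. The scheme never leaves the manifold; letting the mesh
  tend to 0 shows that the solution does not leave it either, so the stopping is void.
\<close>

section \<open>Matrices with the Frobenius norm\<close>

text \<open>The obstacle is integrability. The solution comes without moments, its martingale part
  is only local, and the Stratonovich integrals are limits in probability without a rate. Facts
  about the solution are therefore stated outside events of small probability and drawn from path
  continuity; moments are taken only of sums whose terms are switched off by an indicator known at
  the left end point of the step. The correction of the drift arises because the trapezoidal rule
  exceeds the left-point rule by half the change of the noise coefficient over a step. To evaluate
  that change one needs the increments of the solution to leading order, and these come from
  comparing a dyadic level \<open>l\<close> with a level \<open>l + r\<close> chosen after it. The
  final estimate is in mean square nevertheless: the scheme has constant norm, the truncated error
  is bounded, and the Gronwall constant does not involve the auxiliary level, which can be sent to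
  infinity while the scheme is fixed. The relation \<open>st_alpha + st_beta = 1\<close> makes the
  noise term and the mean of the second-order term of the Cayley step agree with the
  equation.\<close>

lemma norm_sq_matrix: "(norm (A :: real ^ 'p ^ 'n))\<^sup>2 = (\<Sum>i\<in>UNIV. \<Sum>j\<in>UNIV. (A $ i $ j)\<^sup>2)"
  unfolding power2_norm_eq_inner by (simp add: inner_vec_def power2_eq_square)

lemma norm_sq_rows: "(norm (A :: real ^ 'p ^ 'n))\<^sup>2 = (\<Sum>i\<in>UNIV. (norm (A $ i))\<^sup>2)"
  unfolding power2_norm_eq_inner by (simp add: inner_vec_def)

lemma norm_transpose [simp]: "norm (transpose (A :: real ^ 'p ^ 'n)) = norm A"
proof -
  have "(norm (transpose A))\<^sup>2 = (norm A)\<^sup>2"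
    unfolding norm_sq_matrix by (subst sum.swap) (simp add: transpose_def)
  then show ?thesis by simp
qed

lemma norm_matrix_mult_le: "norm ((A :: real ^ 'm ^ 'n) ** (B :: real ^ 'p ^ 'm)) \<le> norm A * norm B"
proof (rule power2_le_imp_le)
  have "(norm (A ** B))\<^sup>2 = (\<Sum>i\<in>UNIV. \<Sum>j\<in>UNIV. (A $ i \<bullet> transpose B $ j)\<^sup>2)"
    unfolding norm_sq_matrix by (simp add: matrix_matrix_mult_def inner_vec_def transpose_def)
  also have "\<dots> \<le> (\<Sum>i\<in>UNIV. \<Sum>j\<in>UNIV. (norm (A $ i))\<^sup>2 * (norm (transpose B $ j))\<^sup>2)"
    unfolding power2_norm_eq_inner by (intro sum_mono Cauchy_Schwarz_ineq)
  also have "\<dots> = (norm A)\<^sup>2 * (norm (transpose B))\<^sup>2"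
    by (simp only: norm_sq_rows sum_product)
  finally show "(norm (A ** B))\<^sup>2 \<le> (norm A * norm B)\<^sup>2" by (simp add: power_mult_distrib)
qed simp

lemma norm_matrix_mult3_le:
  "norm ((A :: real ^ 'm ^ 'n) ** (B :: real ^ 'p ^ 'm) ** (C :: real ^ 'q ^ 'p)) \<le> norm A * norm B * norm C"
  by (rule order_trans[OF norm_matrix_mult_le]) (intro mult_right_mono norm_matrix_mult_le norm_ge_zero)

lemma norm_unit_mat [simp]: "norm (unit_mat u v :: real ^ 'p ^ 'n) = 1"
proof -
  have "(norm (unit_mat u v :: real ^ 'p ^ 'n))\<^sup>2 = (\<Sum>i\<in>UNIV. \<Sum>j\<in>UNIV. if i = u \<and> j = v then 1 else 0)"
    unfolding norm_sq_matrix unit_mat_def by (intro sum.cong refl) auto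
  also have "\<dots> = (\<Sum>i\<in>UNIV. if i = u then 1 else 0)"
    by (intro sum.cong refl) auto
  also have "\<dots> = 1" by simp
  finally show ?thesis by (simp add: power2_eq_1_iff) (smt (verit) norm_ge_zero)
qed

lemma matrix_add_rdistrib: "(B + C) ** A = B ** A + C ** (A :: 'a::ring_1 ^ _ ^ _)"
  by (simp add: vec_eq_iff matrix_matrix_mult_def distrib_right sum.distrib)

lemma matrix_diff_ldistrib: "A ** (B - C) = A ** B - A ** (C :: 'a::ring_1 ^ _ ^ _)"
  by (simp add: vec_eq_iff matrix_matrix_mult_def right_diff_distrib sum_subtractf)

lemma matrix_diff_rdistrib: "(B - C) ** A = B ** A - C ** (A :: 'a::ring_1 ^ _ ^ _)"
  by (simp add: vec_eq_iff matrix_matrix_mult_def left_diff_distrib sum_subtractf)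

lemma matrix_uminus_left [simp]: "(- A) ** B = - (A ** (B :: 'a::ring_1 ^ _ ^ _))"
  by (simp add: vec_eq_iff matrix_matrix_mult_def sum_negf)

lemma matrix_uminus_right [simp]: "A ** (- B) = - (A ** (B :: 'a::ring_1 ^ _ ^ _))"
  by (simp add: vec_eq_iff matrix_matrix_mult_def sum_negf)

lemma matrix_scaleR_left [simp]: "(c *\<^sub>R A) ** B = c *\<^sub>R (A ** (B :: real ^ _ ^ _))"
  by (simp add: vec_eq_iff matrix_matrix_mult_def sum_distrib_left algebra_simps)

lemma matrix_scaleR_right [simp]: "A ** (c *\<^sub>R B) = c *\<^sub>R (A ** (B :: real ^ _ ^ _))"
  by (simp add: vec_eq_iff matrix_matrix_mult_def sum_distrib_left algebra_simps)

lemma matrix_sum_left: "(\<Sum>i\<in>I. A i) ** B = (\<Sum>i\<in>I. A i ** (B :: real ^ _ ^ _))"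
  by (induction I rule: infinite_finite_induct) (simp_all add: matrix_add_rdistrib)

lemma matrix_sum_right: "A ** (\<Sum>i\<in>I. B i) = (\<Sum>i\<in>I. A ** (B i :: real ^ _ ^ _))"
  by (induction I rule: infinite_finite_induct) (simp_all add: matrix_add_ldistrib)

lemma transpose_add: "transpose (A + B) = transpose A + transpose (B :: real ^ _ ^ _)"
  by (simp add: transpose_def vec_eq_iff)

lemma transpose_diff: "transpose (A - B) = transpose A - transpose (B :: real ^ _ ^ _)"
  by (simp add: transpose_def vec_eq_iff)

lemma transpose_uminus: "transpose (- B) = - transpose (B :: real ^ _ ^ _)"
  by (simp add: transpose_def vec_eq_iff)

lemma transpose_scaleR: "transpose (c *\<^sub>R B) = c *\<^sub>R transpose (B :: real ^ _ ^ _)"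
  by (simp add: transpose_def vec_eq_iff)

lemma transpose_sum: "transpose (\<Sum>i\<in>I. A i) = (\<Sum>i\<in>I. transpose (A i :: real ^ _ ^ _))"
  by (induction I rule: infinite_finite_induct) (simp_all add: transpose_add, simp_all add: transpose_def vec_eq_iff)

lemmas transpose_simps = transpose_add transpose_diff transpose_uminus transpose_scaleR
  matrix_transpose_mul transpose_transpose transpose_mat

lemmas matrix_ring_simps = matrix_add_ldistrib matrix_add_rdistrib matrix_diff_ldistrib
  matrix_diff_rdistrib matrix_mul_assoc

lemma bounded_linear_transpose: "bounded_linear (transpose :: real ^ 'p ^ 'n \<Rightarrow> _)"
  by (rule bounded_linear_intro[where K=1]) (auto simp: transpose_simps)

lemma bounded_bilinear_matrix_mult:
  "bounded_bilinear ((**) :: real ^ 'm ^ 'n \<Rightarrow> real ^ 'p ^ 'm \<Rightarrow> _)"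
  by (rule bounded_bilinear.intro)
    (auto simp: matrix_ring_simps intro!: exI[of _ 1] norm_matrix_mult_le)

lemma inner_matrix_mult_left:
  "((A :: real ^ 'm ^ 'n) ** (M :: real ^ 'p ^ 'm)) \<bullet> N = M \<bullet> (transpose A ** N)"
proof -
  have "(A ** M) \<bullet> N = (\<Sum>i\<in>UNIV. \<Sum>j\<in>UNIV. \<Sum>k\<in>UNIV. A $ i $ k * M $ k $ j * N $ i $ j)"
    by (simp add: inner_vec_def matrix_matrix_mult_def sum_distrib_right)
  also have "\<dots> = (\<Sum>k\<in>UNIV. \<Sum>j\<in>UNIV. \<Sum>i\<in>UNIV. A $ i $ k * M $ k $ j * N $ i $ j)"
    by (subst sum.swap, subst (2) sum.swap, subst sum.swap, rule refl)
  also have "\<dots> = M \<bullet> (transpose A ** N)"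
    by (simp add: inner_vec_def matrix_matrix_mult_def sum_distrib_left transpose_def mult_ac)
  finally show ?thesis .
qed

lemma sum_delta_pair:
  fixes g :: "'n::finite \<Rightarrow> 'p::finite \<Rightarrow> 'b::comm_monoid_add"
  shows "(\<Sum>u\<in>UNIV. \<Sum>v\<in>UNIV. if u = i \<and> v = j then g u v else 0) = g i j"
proof -
  have "(\<Sum>u\<in>UNIV. \<Sum>v\<in>UNIV. if u = i \<and> v = j then g u v else 0)
    = (\<Sum>u\<in>UNIV. if u = i then (\<Sum>v\<in>UNIV. if v = j then g u v else 0) else 0)"
    by (intro sum.cong refl) auto
  then show ?thesis by simp
qed

lemma matrix_unit_expansion: "(D :: real ^ 'p ^ 'n) = (\<Sum>u\<in>UNIV. \<Sum>v\<in>UNIV. D $ u $ v *\<^sub>R unit_mat u v)"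
proof -
  have *: "D $ u $ v * (unit_mat u v :: real ^ 'p ^ 'n) $ i $ j = (if u = i \<and> v = j then D $ u $ v else 0)"
    for u v i j by (auto simp: unit_mat_def)
  show ?thesis by (simp add: vec_eq_iff sum_component * sum_delta_pair)
qed

text \<open>Turns a random linear map applied to a noise increment into scalar entries with random
  coefficients. Moments and measurability of matrix-valued noise terms are reduced to real variables
  in this way.\<close>

lemma linear_unit_expansion:
  assumes "linear L"
  shows "L (D :: real ^ 'p ^ 'n) = (\<Sum>u\<in>UNIV. \<Sum>v\<in>UNIV. D $ u $ v *\<^sub>R L (unit_mat u v))"
  by (subst matrix_unit_expansion) (simp add: linear_sum[OF assms] linear_scale[OF assms])

lemma abs_component_le_norm: "\<bar>(A :: real ^ 'p ^ 'n) $ i $ j\<bar> \<le> norm A"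
  by (meson component_le_norm_cart Finite_Cartesian_Product.norm_nth_le order_trans)

text \<open>Cauchy-Schwarz in each row. The argument runs in the Frobenius norm, which comes from an
  inner product, and passes to the matrix 2-norm only at the very end.\<close>

lemma norm2_le_norm: "norm2 (A :: real ^ 'p ^ 'n) \<le> norm A"
  unfolding norm2_def
proof (rule onorm_le)
  fix x :: "real ^ 'p"
  have "(norm (A *v x))\<^sup>2 = (\<Sum>i\<in>UNIV. (A $ i \<bullet> x)\<^sup>2)"
    unfolding power2_norm_eq_inner by (simp add: inner_vec_def matrix_vector_mult_def power2_eq_square)
  also have "\<dots> \<le> (\<Sum>i\<in>UNIV. (norm (A $ i))\<^sup>2 * (norm x)\<^sup>2)"
    unfolding power2_norm_eq_inner by (intro sum_mono Cauchy_Schwarz_ineq)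
  also have "\<dots> = (norm A * norm x)\<^sup>2"
    by (simp add: norm_sq_rows[of A] sum_distrib_right power_mult_distrib)
  finally show "norm (A *v x) \<le> norm A * norm x" by (rule power2_le_imp_le) simp
qed

lemma norm2_nonneg: "0 \<le> norm2 (A :: real ^ 'p ^ 'n)"
  unfolding norm2_def by (rule onorm_pos_le) (rule matrix_vector_mul_bounded_linear)

lemma continuous_norm2: "continuous_on UNIV (norm2 :: real ^ 'p ^ 'n \<Rightarrow> real)"
proof (rule lipschitz_on_continuous_on)
  have *: "norm2 A \<le> norm2 B + norm (A - B)" for A B :: "real ^ 'p ^ 'n"
  proof -
    have "norm2 (B + (A - B)) \<le> norm2 B + norm2 (A - B)"
      unfolding norm2_def matrix_vector_mult_add_rdistrib
      by (rule onorm_triangle) (rule matrix_vector_mul_bounded_linear)+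
    then show ?thesis using norm2_le_norm[of "A - B"] by simp
  qed
  show "1-lipschitz_on UNIV (norm2 :: real ^ 'p ^ 'n \<Rightarrow> real)"
    using * by (intro lipschitz_onI) (simp_all add: dist_norm, smt (verit) norm_minus_commute)
qed

text \<open>Covariance identities in disguise: for \<open>D\<close> with independent standard normal
  entries the four sums are the expectations of \<open>D ** M ** D\<close>, of its transpose, of
  \<open>D ** N ** transpose D\<close> and of \<open>transpose D ** L ** D\<close>.\<close>

lemma sum_unit_mat_sandwich:
  fixes M :: "real ^ 'n ^ 'p" and N :: "real ^ 'p ^ 'p" and L :: "real ^ 'n ^ 'n"
  shows "(\<Sum>u\<in>UNIV. \<Sum>v\<in>UNIV. unit_mat u v ** M ** (unit_mat u v :: real ^ 'p ^ 'n)) = transpose M"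
    and "(\<Sum>u\<in>UNIV. \<Sum>v\<in>UNIV. transpose (unit_mat u v :: real ^ 'p ^ 'n) ** transpose M ** transpose (unit_mat u v)) = M"
    and "(\<Sum>u\<in>UNIV. \<Sum>v\<in>UNIV. (unit_mat u v :: real ^ 'p ^ 'n) ** N ** transpose (unit_mat u v)) = trace N *\<^sub>R mat 1"
    and "(\<Sum>u\<in>UNIV. \<Sum>v\<in>UNIV. transpose (unit_mat u v :: real ^ 'p ^ 'n) ** L ** unit_mat u v) = trace L *\<^sub>R mat 1"
proof -
  have 1: "(unit_mat u v ** M ** (unit_mat u v :: real ^ 'p ^ 'n)) $ i $ j
      = (if u = i \<and> v = j then M $ v $ u else 0)" for u v i j
    by (auto simp: matrix_matrix_mult_def unit_mat_def sum_distrib_right if_distrib[of "\<lambda>x. x * _"]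
        if_distrib[of "\<lambda>x. _ * x"] cong: if_cong)
  have 3: "((unit_mat u v :: real ^ 'p ^ 'n) ** N ** transpose (unit_mat u v)) $ i $ j
      = (if u = i \<and> u = j then N $ v $ v else 0)" for u v i j
    by (cases "u = i"; cases "u = j")
      (auto simp: matrix_matrix_mult_def unit_mat_def transpose_def sum_distrib_right if_distrib[of "\<lambda>x. x * _"]
        if_distrib[of "\<lambda>x. _ * x"] cong: if_cong)
  have 4: "(transpose (unit_mat u v :: real ^ 'p ^ 'n) ** L ** unit_mat u v) $ i $ j
      = (if v = i \<and> v = j then L $ u $ u else 0)" for u v i j
    by (cases "v = i"; cases "v = j") (auto simp: matrix_matrix_mult_def unit_mat_def transpose_def sum_distrib_right if_distrib[of "\<lambda>x. x * _"]
        if_distrib[of "\<lambda>x. _ * x"] cong: if_cong)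

  show S1: "(\<Sum>u\<in>UNIV. \<Sum>v\<in>UNIV. unit_mat u v ** M ** (unit_mat u v :: real ^ 'p ^ 'n)) = transpose M"
    by (simp add: vec_eq_iff sum_component 1 sum_delta_pair) (simp add: transpose_def)
  show "(\<Sum>u\<in>UNIV. \<Sum>v\<in>UNIV. transpose (unit_mat u v :: real ^ 'p ^ 'n) ** transpose M ** transpose (unit_mat u v)) = M"
    using arg_cong[OF S1, of transpose] by (simp add: transpose_sum matrix_transpose_mul transpose_transpose matrix_mul_assoc)
  show "(\<Sum>u\<in>UNIV. \<Sum>v\<in>UNIV. (unit_mat u v :: real ^ 'p ^ 'n) ** N ** transpose (unit_mat u v)) = trace N *\<^sub>R mat 1"
  proof -
    have "(\<Sum>u\<in>UNIV. \<Sum>v\<in>UNIV. if u = i \<and> u = j then N $ v $ v else 0) = (if i = j then trace N else 0)"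
      for i j :: 'n
      by (subst sum.swap) (auto simp: trace_def intro!: sum.cong sum.neutral)
    then show ?thesis by (simp add: vec_eq_iff sum_component 3) (auto simp: mat_def)
  qed
  show "(\<Sum>u\<in>UNIV. \<Sum>v\<in>UNIV. transpose (unit_mat u v :: real ^ 'p ^ 'n) ** L ** unit_mat u v) = trace L *\<^sub>R mat 1"
  proof -
    have "(\<Sum>u\<in>UNIV. \<Sum>v\<in>UNIV. if v = i \<and> v = j then L $ u $ u else 0) = (if i = j then trace L else 0)"
      for i j :: 'p
      by (auto simp: trace_def intro!: sum.cong sum.neutral)
    then show ?thesis by (simp add: vec_eq_iff sum_component 4) (auto simp: mat_def)
  qed
qed

text \<open>The squared Frobenius norm is the trace of \<open>transpose Y ** Y\<close>. As the
  scheme stays on the manifold, its norm is constant, and local Lipschitz bounds suffice on its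
  side.\<close>

lemma norm_stiefel: "(Y :: real ^ 'p ^ 'n) \<in> stiefel \<Longrightarrow> norm Y = sqrt CARD('p)"
proof -
  assume "Y \<in> stiefel"
  then have "(transpose Y ** Y) $ j $ j = 1" for j by (simp add: stiefel_def mat_def)
  then have "(\<Sum>i\<in>UNIV. (Y $ i $ j)\<^sup>2) = 1" for j
    by (simp add: matrix_matrix_mult_def transpose_def power2_eq_square)
  then have "(norm Y)\<^sup>2 = CARD('p)" unfolding norm_sq_matrix by (subst sum.swap) simp
  then show ?thesis by (metis norm_ge_zero real_sqrt_unique)
qed

section \<open>Locally Lipschitz coefficients\<close>

text \<open>Lipschitz on every ball instead of globally, because \<open>pf\<close> is quadratic and
  \<open>corr\<close> cubic in the state. Closure under sums and bounded bilinear products reduces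
  all coefficients to constants, the identity and \<open>egrad f\<close>.\<close>

definition loclip :: "('a::real_normed_vector \<Rightarrow> 'b::real_normed_vector) \<Rightarrow> bool" where
  "loclip g \<longleftrightarrow> (\<forall>R. \<exists>L\<ge>0. \<forall>x\<in>cball 0 R. \<forall>y\<in>cball 0 R. norm (g x - g y) \<le> L * norm (x - y))"

lemma loclipD:
  assumes "loclip g"
  obtains L where "0 \<le> L" "\<And>x y. norm x \<le> R \<Longrightarrow> norm y \<le> R \<Longrightarrow> norm (g x - g y) \<le> L * norm (x - y)"
  using assms unfolding loclip_def by (metis mem_cball_0)

lemma loclip_bounded:
  assumes "loclip g"
  obtains C where "0 \<le> C" "\<And>x. norm x \<le> R \<Longrightarrow> norm (g x) \<le> C"
proof -
  obtain L where L: "0 \<le> L" "\<And>x y. norm x \<le> \<bar>R\<bar> \<Longrightarrow> norm y \<le> \<bar>R\<bar> \<Longrightarrow> norm (g x - g y) \<le> L * norm (x - y)"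
    using loclipD[OF assms] by metis
  have "norm (g x) \<le> norm (g 0) + L * \<bar>R\<bar>" if "norm x \<le> R" for x
  proof -
    have "norm (g x) \<le> norm (g 0) + norm (g x - g 0)" by norm
    also have "norm (g x - g 0) \<le> L * norm x" using L(2)[of x 0] that by simp
    also have "L * norm x \<le> L * \<bar>R\<bar>" using that L(1) by (intro mult_left_mono) auto
    finally show ?thesis by simp
  qed
  then show ?thesis using that[of "norm (g 0) + L * \<bar>R\<bar>"] L(1) by simp
qed

lemma loclip_const: "loclip (\<lambda>x. c)"
  unfolding loclip_def by (auto intro!: exI[of _ 0])

lemma loclip_id: "loclip (\<lambda>x. x)"
  unfolding loclip_def by (auto intro!: exI[of _ 1])

lemma loclip_bilinear:
  assumes "bounded_bilinear bop" "loclip f" "loclip g"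
  shows "loclip (\<lambda>x. bop (f x) (g x))"
  unfolding loclip_def
proof
  fix R
  interpret bounded_bilinear "bop" by fact
  obtain L where L: "0 \<le> L" "\<And>x y. norm x \<le> R \<Longrightarrow> norm y \<le> R \<Longrightarrow> norm (f x - f y) \<le> L * norm (x - y)"
    using loclipD[OF assms(2)] by metis
  obtain L' where L': "0 \<le> L'" "\<And>x y. norm x \<le> R \<Longrightarrow> norm y \<le> R \<Longrightarrow> norm (g x - g y) \<le> L' * norm (x - y)"
    using loclipD[OF assms(3)] by metis
  obtain C where C: "0 \<le> C" "\<And>x. norm x \<le> R \<Longrightarrow> norm (f x) \<le> C"
    using loclip_bounded[OF assms(2)] by metis
  obtain C' where C': "0 \<le> C'" "\<And>x. norm x \<le> R \<Longrightarrow> norm (g x) \<le> C'"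
    using loclip_bounded[OF assms(3)] by metis
  obtain K where K: "0 \<le> K" "\<And>a b. norm (bop a b) \<le> norm a * norm b * K"
    using nonneg_bounded by auto
  have "norm (bop (f x) (g x) - bop (f y) (g y)) \<le> (C * L' * K + L * C' * K) * norm (x - y)"
    if "norm x \<le> R" "norm y \<le> R" for x y
  proof -
    have "bop (f x) (g x) - bop (f y) (g y) = bop (f x) (g x - g y) + bop (f x - f y) (g y)"
      by (simp add: diff_left diff_right)
    also have "norm \<dots> \<le> norm (f x) * norm (g x - g y) * K + norm (f x - f y) * norm (g y) * K"
      by (rule norm_triangle_le) (intro add_mono K)
    also have "\<dots> \<le> C * (L' * norm (x - y)) * K + (L * norm (x - y)) * C' * K"
      using that by (intro add_mono mult_mono C C' L L' K mult_nonneg_nonneg norm_ge_zero) auto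
    finally show ?thesis by (simp add: algebra_simps)
  qed
  then show "\<exists>L\<ge>0. \<forall>x\<in>cball 0 R. \<forall>y\<in>cball 0 R. norm (bop (f x) (g x) - bop (f y) (g y)) \<le> L * norm (x - y)"
    using C C' L L' K by (intro exI[of _ "C * L' * K + L * C' * K"]) auto
qed

lemma loclip_linear:
  assumes "bounded_linear T" "loclip f"
  shows "loclip (\<lambda>x. T (f x))"
  unfolding loclip_def
proof
  fix R
  interpret bounded_linear T by fact
  obtain L where L: "0 \<le> L" "\<And>x y. norm x \<le> R \<Longrightarrow> norm y \<le> R \<Longrightarrow> norm (f x - f y) \<le> L * norm (x - y)"
    using loclipD[OF assms(2)] by metis
  obtain K where K: "0 \<le> K" "\<And>a. norm (T a) \<le> norm a * K"
    using nonneg_bounded by auto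
  have "norm (T (f x) - T (f y)) \<le> L * K * norm (x - y)" if "norm x \<le> R" "norm y \<le> R" for x y
    using K(2)[of "f x - f y"] mult_right_mono[OF L(2)[OF that] K(1)] by (simp add: diff mult_ac)
  then show "\<exists>L\<ge>0. \<forall>x\<in>cball 0 R. \<forall>y\<in>cball 0 R. norm (T (f x) - T (f y)) \<le> L * norm (x - y)"
    using L K by (intro exI[of _ "L * K"]) auto
qed

lemma loclip_add:
  assumes "loclip f" "loclip g"
  shows "loclip (\<lambda>x. f x + g x)"
  unfolding loclip_def
proof
  fix R
  obtain L where L: "0 \<le> L" "\<And>x y. norm x \<le> R \<Longrightarrow> norm y \<le> R \<Longrightarrow> norm (f x - f y) \<le> L * norm (x - y)"
    using loclipD[OF assms(1)] by metis
  obtain L' where L': "0 \<le> L'" "\<And>x y. norm x \<le> R \<Longrightarrow> norm y \<le> R \<Longrightarrow> norm (g x - g y) \<le> L' * norm (x - y)"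
    using loclipD[OF assms(2)] by metis
  have "norm (f x + g x - (f y + g y)) \<le> (L + L') * norm (x - y)" if "norm x \<le> R" "norm y \<le> R" for x y
    using L(2)[OF that] L'(2)[OF that] norm_triangle_ineq[of "f x - f y" "g x - g y"]
    by (simp add: algebra_simps)
  then show "\<exists>L\<ge>0. \<forall>x\<in>cball 0 R. \<forall>y\<in>cball 0 R. norm (f x + g x - (f y + g y)) \<le> L * norm (x - y)"
    using L L' by (intro exI[of _ "L + L'"]) auto
qed

lemma loclip_uminus: "loclip f \<Longrightarrow> loclip (\<lambda>x. - f x)"
  by (rule loclip_linear[OF bounded_linear_minus[OF bounded_linear_ident]])

lemma loclip_diff: "loclip f \<Longrightarrow> loclip g \<Longrightarrow> loclip (\<lambda>x. f x - g x)"
  using loclip_add[OF _ loclip_uminus, of f g] by simp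

lemma loclip_scaleR: "loclip f \<Longrightarrow> loclip (\<lambda>x. c *\<^sub>R f x)"
  by (rule loclip_linear[OF bounded_linear_scaleR_right])

lemma loclip_sum: "(\<And>i. i \<in> I \<Longrightarrow> loclip (f i)) \<Longrightarrow> loclip (\<lambda>x. \<Sum>i\<in>I. f i x)"
  by (induction I rule: infinite_finite_induct) (auto intro: loclip_const loclip_add)

lemmas loclip_mult = loclip_bilinear[OF bounded_bilinear_matrix_mult]
lemmas loclip_transpose = loclip_linear[OF bounded_linear_transpose]

lemmas loclip_intros = loclip_const loclip_id loclip_add loclip_diff loclip_scaleR loclip_sum
  loclip_mult loclip_transpose

lemma loclip_continuous:
  fixes f :: "'a::real_normed_vector \<Rightarrow> 'b::real_normed_vector"
  assumes "loclip f"
  shows "continuous_on UNIV f"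
proof (rule continuous_at_imp_continuous_on, rule ballI)
  fix x :: 'a
  obtain L where L: "0 \<le> L" "\<And>y z. norm y \<le> norm x + 1 \<Longrightarrow> norm z \<le> norm x + 1 \<Longrightarrow> norm (f y - f z) \<le> L * norm (y - z)"
    using loclipD[OF assms] by metis
  have "L-lipschitz_on (ball 0 (norm x + 1)) f"
    using L by (intro lipschitz_onI) (auto simp: dist_norm)
  then have "continuous_on (ball 0 (norm x + 1)) f" by (rule lipschitz_on_continuous_on)
  then show "isCont f x" by (rule continuous_on_interior) simp
qed

text \<open>\<open>C_k\<close> only provides continuity of each directional derivative. On a compact
  ball the derivatives along the basis are bounded, their sum bounds the operator norm, and the mean
  value inequality applies since the ball is convex.\<close>

lemma loclip_C1:
  fixes g :: "'a::euclidean_space \<Rightarrow> real"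
  assumes "C_k (Suc 0) g"
  shows "loclip g"
  unfolding loclip_def
proof
  fix R :: real
  have d: "(g has_derivative frechet_derivative g (at x)) (at x)" for x
    using assms by (simp add: frechet_derivative_works)
  have "\<exists>B. \<forall>x\<in>cball 0 R. \<bar>frechet_derivative g (at x) v\<bar> \<le> B" for v
  proof -
    have "continuous_on (cball 0 R) (\<lambda>x. frechet_derivative g (at x) v)"
      using assms by (auto intro: continuous_on_subset)
    then have "bounded ((\<lambda>x. frechet_derivative g (at x) v) ` cball 0 R)"
      by (intro compact_imp_bounded compact_continuous_image) auto
    then show ?thesis by (auto simp: bounded_iff)
  qed
  then obtain B where B: "\<And>x v. x \<in> cball 0 R \<Longrightarrow> \<bar>frechet_derivative g (at x) v\<bar> \<le> B v" by metis
  define L where "L = (\<Sum>b\<in>Basis. \<bar>B b\<bar>)"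
  have on: "onorm (frechet_derivative g (at x)) \<le> L" if "x \<in> cball 0 R" for x
  proof (rule onorm_le)
    fix v :: 'a
    interpret linear "frechet_derivative g (at x)" using d has_derivative_linear by blast
    have "frechet_derivative g (at x) v = frechet_derivative g (at x) (\<Sum>b\<in>Basis. (v \<bullet> b) *\<^sub>R b)"
      by (simp add: euclidean_representation)
    also have "\<dots> = (\<Sum>b\<in>Basis. (v \<bullet> b) * frechet_derivative g (at x) b)" by (simp add: sum scale)
    also have "\<bar>\<dots>\<bar> \<le> (\<Sum>b\<in>Basis. \<bar>v \<bullet> b\<bar> * \<bar>frechet_derivative g (at x) b\<bar>)"
      by (rule order_trans[OF sum_abs]) (simp add: abs_mult)
    also have "\<dots> \<le> (\<Sum>b\<in>Basis. norm v * \<bar>B b\<bar>)"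
      using B[OF that] by (intro sum_mono mult_mono) (auto intro: Basis_le_norm order_trans[OF _ abs_ge_self])
    finally show "norm (frechet_derivative g (at x) v) \<le> L * norm v"
      by (simp add: L_def sum_distrib_left mult_ac)
  qed
  have "norm (g x - g y) \<le> L * norm (x - y)" if "x \<in> cball 0 R" "y \<in> cball 0 R" for x y
    by (rule differentiable_bound[OF convex_cball[of 0 R] has_derivative_at_withinI[OF d] on that]) assumption
  then show "\<exists>L\<ge>0. \<forall>x\<in>cball 0 R. \<forall>y\<in>cball 0 R. norm (g x - g y) \<le> L * norm (x - y)"
    by (intro exI[of _ L]) (auto simp: L_def intro!: sum_nonneg)
qed

lemma loclip_egrad:
  assumes "smooth (f :: real ^ 'p::finite ^ 'n::finite \<Rightarrow> real)"
  shows "loclip (egrad f)"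
proof -
  have "C_k (Suc (Suc 0)) f" using assms by (simp only: smooth_def)
  then have *: "loclip (\<lambda>X. frechet_derivative f (at X) v)" for v by (intro loclip_C1) simp
  have "egrad f = (\<lambda>X. \<Sum>u\<in>UNIV. \<Sum>v\<in>UNIV. frechet_derivative f (at X) (unit_mat u v) *\<^sub>R unit_mat u v)"
    by (rule ext, subst matrix_unit_expansion[of "egrad f _"]) (simp add: egrad_def)
  then show ?thesis
    by (simp add: loclip_sum loclip_linear[OF bounded_linear_scaleR_left] *)
qed

lemma loclip_stiefel_grad: "smooth f \<Longrightarrow> loclip (stiefel_grad f)"
  unfolding stiefel_grad_def by (intro loclip_intros loclip_egrad)

subsection \<open>The noise coefficient\<close>

text \<open>Besides tying the scheme to the equation, these relations make the two nonlinear parts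
  of \<open>pf\<close> a convex combination, which keeps the norm bounds free of both
  constants.\<close>

lemma st_bounds: "0 \<le> st_alpha" "0 \<le> st_beta" "st_alpha + st_beta = 1" "st_alpha \<le> 1" "st_beta \<le> 1"
  by (auto simp: st_alpha_def st_beta_def sqrt2_less_2 less_imp_le)

text \<open>Linear extension of the fields \<open>P_field u v X\<close> from unit matrices to an
  arbitrary noise increment \<open>D\<close>.\<close>

definition pf :: "real ^ 'p ^ 'n \<Rightarrow> real ^ 'p ^ 'n \<Rightarrow> real ^ 'p ^ 'n" where
  "pf X D = D - st_alpha *\<^sub>R (X ** transpose D ** X) - st_beta *\<^sub>R (X ** transpose X ** D)"

text \<open>The derivative of \<open>pf X D\<close> with respect to \<open>X\<close> in the
  direction \<open>H\<close>.\<close>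

definition dpf :: "real ^ 'p ^ 'n \<Rightarrow> real ^ 'p ^ 'n \<Rightarrow> real ^ 'p ^ 'n \<Rightarrow> real ^ 'p ^ 'n" where
  "dpf X D H = - (st_alpha *\<^sub>R (H ** transpose D ** X + X ** transpose D ** H)
     + st_beta *\<^sub>R (H ** transpose X ** D + X ** transpose H ** D))"

text \<open>The Stratonovich correction \<open>\<onehalf> \<Sum> P\<^sub>u\<^sub>v' P\<^sub>u\<^sub>v\<close>.\<close>

definition corr :: "real ^ 'p ^ 'n \<Rightarrow> real ^ 'p ^ 'n" where
  "corr X = (1/2) *\<^sub>R (\<Sum>u\<in>UNIV. \<Sum>v\<in>UNIV. dpf X (unit_mat u v) (pf X (unit_mat u v)))"

text \<open>The drift of the Ito form of the equation. The noise coefficient is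
  \<open>\<sigma> *\<^sub>R pf X\<close>, hence the factor \<open>\<sigma>\<^sup>2\<close> at the
  correction.\<close>

definition drift :: "(real ^ 'p ^ 'n \<Rightarrow> real) \<Rightarrow> real \<Rightarrow> real ^ 'p ^ 'n \<Rightarrow> real ^ 'p ^ 'n" where
  "drift f \<sigma> X = \<sigma>\<^sup>2 *\<^sub>R corr X - stiefel_grad f X"

lemma P_field_eq_pf: "P_field u v X = pf X (unit_mat u v)"
  by (simp add: P_field_def pf_def)

lemma loclip_pf: "loclip (\<lambda>X. pf X D)"
  unfolding pf_def by (intro loclip_intros)

lemma loclip_dpf_pf: "loclip (\<lambda>X. dpf X D (pf X E))"
  unfolding dpf_def by (intro loclip_intros loclip_uminus loclip_pf)

lemma loclip_corr: "loclip corr"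
proof -
  have "loclip (\<lambda>X :: real ^ 'p ^ 'n. corr X)" unfolding corr_def by (intro loclip_intros loclip_dpf_pf)
  then show ?thesis by simp
qed

lemma loclip_drift: assumes "smooth f" shows "loclip (drift f \<sigma>)"
proof -
  have "loclip (\<lambda>X. drift f \<sigma> X)" unfolding drift_def
    using loclip_stiefel_grad[OF assms] by (intro loclip_intros loclip_corr)
  then show ?thesis by simp
qed

lemma linear_pf: "linear (pf X)"
  by (rule linearI) (auto simp: pf_def transpose_simps matrix_ring_simps algebra_simps)

lemma linear_dpf: "linear (dpf X D)" "linear (\<lambda>D. dpf X D H)"
  by (rule linearI; auto simp: dpf_def transpose_simps matrix_ring_simps algebra_simps)+

lemma pf_zero [simp]: "pf X 0 = 0"
  by (rule linear_0[OF linear_pf])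

lemma norm_pf_le: "norm (pf X D) \<le> (1 + (norm X)\<^sup>2) * norm D"
proof -
  have 1: "norm (X ** transpose D ** X) \<le> (norm X)\<^sup>2 * norm D"
    using norm_matrix_mult3_le[of X "transpose D" X] by (simp add: power2_eq_square mult_ac)
  have 2: "norm (X ** transpose X ** D) \<le> (norm X)\<^sup>2 * norm D"
    using norm_matrix_mult3_le[of X "transpose X" D] by (simp add: power2_eq_square mult_ac)
  have "norm (pf X D) \<le> norm D + st_alpha * norm (X ** transpose D ** X) + st_beta * norm (X ** transpose X ** D)"
    unfolding pf_def using st_bounds
    by (intro order_trans[OF norm_triangle_ineq4] add_mono order_refl) (simp_all)
  also have "\<dots> \<le> norm D + st_alpha * ((norm X)\<^sup>2 * norm D) + st_beta * ((norm X)\<^sup>2 * norm D)"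
    using st_bounds by (intro add_mono mult_left_mono 1 2) auto
  also have "\<dots> = norm D + (st_alpha + st_beta) * ((norm X)\<^sup>2 * norm D)" by (simp add: algebra_simps)
  finally show ?thesis using st_bounds by (simp add: algebra_simps)
qed

lemma norm_dpf_le: "norm (dpf X D H) \<le> 2 * norm X * norm D * norm H"
proof -
  have *: "norm (A + B) \<le> 2 * c" if "norm A \<le> c" "norm B \<le> c" for A B :: "real ^ 'p ^ 'n" and c
    using that by norm
  have 1: "norm (H ** transpose D ** X + X ** transpose D ** H) \<le> 2 * (norm X * norm D * norm H)"
    using norm_matrix_mult3_le[of H "transpose D" X] norm_matrix_mult3_le[of X "transpose D" H]
    by (intro *) (simp_all add: mult_ac)
  have 2: "norm (H ** transpose X ** D + X ** transpose H ** D) \<le> 2 * (norm X * norm D * norm H)"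
    using norm_matrix_mult3_le[of H "transpose X" D] norm_matrix_mult3_le[of X "transpose H" D]
    by (intro *) (simp_all add: mult_ac)
  have "norm (dpf X D H) \<le> st_alpha * norm (H ** transpose D ** X + X ** transpose D ** H)
      + st_beta * norm (H ** transpose X ** D + X ** transpose H ** D)"
    unfolding dpf_def norm_minus_cancel using st_bounds
    by (intro order_trans[OF norm_triangle_ineq]) simp
  also have "\<dots> \<le> st_alpha * (2 * (norm X * norm D * norm H)) + st_beta * (2 * (norm X * norm D * norm H))"
    using st_bounds by (intro add_mono mult_left_mono 1 2) auto
  also have "\<dots> = (st_alpha + st_beta) * (2 * (norm X * norm D * norm H))" by (simp add: algebra_simps)
  finally show ?thesis using st_bounds by simp
qed

text \<open>\<open>pf\<close> is quadratic in the state, so the Taylor remainder is exactly its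
  quadratic part evaluated at \<open>H\<close>.\<close>

lemma norm_pf_second_order: "norm (pf (X + H) D - pf X D - dpf X D H) \<le> (norm H)\<^sup>2 * norm D"
proof -
  have "pf (X + H) D - pf X D - dpf X D H = - (st_alpha *\<^sub>R (H ** transpose D ** H) + st_beta *\<^sub>R (H ** transpose H ** D))"
    by (simp add: pf_def dpf_def transpose_simps matrix_ring_simps algebra_simps)
  also have "norm \<dots> \<le> st_alpha * norm (H ** transpose D ** H) + st_beta * norm (H ** transpose H ** D)"
    unfolding norm_minus_cancel using st_bounds by (intro order_trans[OF norm_triangle_ineq]) simp
  also have "\<dots> \<le> st_alpha * ((norm H)\<^sup>2 * norm D) + st_beta * ((norm H)\<^sup>2 * norm D)"
    using norm_matrix_mult3_le[of H "transpose D" H] norm_matrix_mult3_le[of H "transpose H" D] st_bounds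
    by (intro add_mono mult_left_mono) (simp_all add: power2_eq_square mult_ac)
  also have "\<dots> = (st_alpha + st_beta) * ((norm H)\<^sup>2 * norm D)" by (simp add: algebra_simps)
  finally show ?thesis using st_bounds by simp
qed

lemma norm_pf_diff_le: "norm (pf X D - pf Y D) \<le> (norm X + norm Y) * norm (X - Y) * norm D"
proof -
  define A where "A = X ** transpose D ** (X - Y) + (X - Y) ** transpose D ** Y"
  define B where "B = X ** transpose (X - Y) ** D + (X - Y) ** transpose Y ** D"
  have "pf X D - pf Y D = - (st_alpha *\<^sub>R A + st_beta *\<^sub>R B)"
    by (simp add: A_def B_def pf_def transpose_simps matrix_ring_simps algebra_simps)
  also have "norm \<dots> \<le> st_alpha * norm A + st_beta * norm B"
    unfolding norm_minus_cancel using st_bounds by (intro order_trans[OF norm_triangle_ineq]) simp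
  also have "\<dots> \<le> st_alpha * ((norm X + norm Y) * norm (X - Y) * norm D) + st_beta * ((norm X + norm Y) * norm (X - Y) * norm D)"
  proof (intro add_mono mult_left_mono st_bounds)
    show "norm A \<le> (norm X + norm Y) * norm (X - Y) * norm D"
      unfolding A_def using norm_matrix_mult3_le[of X "transpose D" "X - Y"] norm_matrix_mult3_le[of "X - Y" "transpose D" Y]
      by (intro order_trans[OF norm_triangle_ineq]) (simp add: algebra_simps)
    show "norm B \<le> (norm X + norm Y) * norm (X - Y) * norm D"
      unfolding B_def using norm_matrix_mult3_le[of X "transpose (X - Y)" D] norm_matrix_mult3_le[of "X - Y" "transpose Y" D]
      by (intro order_trans[OF norm_triangle_ineq]) (simp add: algebra_simps)
  qed
  also have "\<dots> = (st_alpha + st_beta) * ((norm X + norm Y) * norm (X - Y) * norm D)" by (simp add: algebra_simps)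
  finally show ?thesis using st_bounds by simp
qed

section \<open>The Cayley step\<close>

definition skw :: "real ^ 'p ^ 'n \<Rightarrow> real ^ 'p ^ 'n \<Rightarrow> real ^ 'n ^ 'n" where
  "skw Y Z = Z ** transpose Y - Y ** transpose Z"

definition znoise :: "real ^ 'p ^ 'n \<Rightarrow> real ^ 'p ^ 'n \<Rightarrow> real ^ 'p ^ 'n" where
  "znoise Y D = (mat 1 - st_beta *\<^sub>R (Y ** transpose Y)) ** D"

definition cayley_gen :: "(real ^ 'p ^ 'n \<Rightarrow> real) \<Rightarrow> real \<Rightarrow> real \<Rightarrow> real ^ 'p ^ 'n \<Rightarrow> real ^ 'p ^ 'n \<Rightarrow> real ^ 'n ^ 'n" where
  "cayley_gen f \<sigma> h D Y = skw Y (- (h *\<^sub>R egrad f Y) + \<sigma> *\<^sub>R znoise Y D)"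

lemma transpose_skw: "transpose (skw Y Z) = - skw Y Z"
  by (simp add: skw_def transpose_simps)

lemma skw_linear: "skw Y (Z + Z') = skw Y Z + skw Y Z'" "skw Y (c *\<^sub>R Z) = c *\<^sub>R skw Y Z"
    "skw Y (- Z) = - skw Y Z" "skw Y (Z - Z') = skw Y Z - skw Y Z'"
  by (auto simp: skw_def transpose_simps matrix_ring_simps algebra_simps)

lemma norm_skw_le: "norm (skw Y Z) \<le> 2 * norm Y * norm Z"
  unfolding skw_def using norm_matrix_mult_le[of Z "transpose Y"] norm_matrix_mult_le[of Y "transpose Z"]
  by (intro order_trans[OF norm_triangle_ineq4]) (simp add: mult_ac)

lemma norm_znoise_le: "norm (znoise Y D) \<le> (1 + (norm Y)\<^sup>2) * norm D"
proof -
  have "znoise Y D = D - st_beta *\<^sub>R (Y ** transpose Y ** D)"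
    by (simp add: znoise_def matrix_ring_simps)
  also have "norm \<dots> \<le> norm D + st_beta * norm (Y ** transpose Y ** D)"
    using st_bounds by (intro order_trans[OF norm_triangle_ineq4]) simp
  also have "\<dots> \<le> norm D + 1 * ((norm Y)\<^sup>2 * norm D)"
    using norm_matrix_mult3_le[of Y "transpose Y" D] st_bounds
    by (intro add_mono mult_mono) (auto simp: power2_eq_square mult_ac)
  finally show ?thesis by (simp add: algebra_simps)
qed

text \<open>For skew-symmetric \<open>A\<close> one has \<open>|M - AM/2|\<^sup>2 = |M|\<^sup>2 + |AM/2|\<^sup>2\<close>.\<close>

lemma norm_le_skew:
  assumes "transpose A = - (A :: real ^ 'n ^ 'n)"
  shows "norm (M :: real ^ 'p ^ 'n) \<le> norm ((mat 1 - (1/2) *\<^sub>R A) ** M)"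
proof (rule power2_le_imp_le)
  have "(A ** M) \<bullet> M = - (M \<bullet> (A ** M))"
    by (simp add: inner_matrix_mult_left assms)
  then have 0: "(A ** M) \<bullet> M = 0" by (simp add: inner_commute)
  have "(norm ((mat 1 - (1/2) *\<^sub>R A) ** M))\<^sup>2 = (norm M)\<^sup>2 + (norm ((1/2) *\<^sub>R (A ** M)))\<^sup>2"
    unfolding matrix_diff_rdistrib power2_norm_eq_inner using 0
    by (simp add: inner_diff_left inner_diff_right inner_commute)
  then show "(norm M)\<^sup>2 \<le> (norm ((mat 1 - (1/2) *\<^sub>R A) ** M))\<^sup>2" by simp
qed simp

text \<open>By \<open>norm_le_skew\<close> the matrix is injective, hence invertible in finite
  dimension. Since \<open>matrix_inv\<close> is a choice operator, its equation has to be drawn from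
  the existence of an inverse.\<close>

lemma skew_resolvent:
  assumes "transpose A = - (A :: real ^ 'n ^ 'n)"
  shows "(mat 1 - (1/2) *\<^sub>R A) ** matrix_inv (mat 1 - (1/2) *\<^sub>R A) = mat 1"
proof -
  let ?B = "mat 1 - (1/2) *\<^sub>R A"
  have "inj ((*v) ?B)"
  proof (rule injI)
    fix x y :: "real ^ 'n" assume "?B *v x = ?B *v y"
    then have *: "?B *v (x - y) = 0" by (simp add: matrix_vector_mult_diff_distrib)
    \<comment> \<open>\<open>norm_le_skew\<close> speaks of matrices, so the vector is turned into a
      one-column matrix.\<close>
    define M :: "real ^ 1 ^ 'n" where "M = (\<chi> i j. (x - y) $ i)"
    have "?B ** M = 0" using * by (simp add: M_def vec_eq_iff matrix_matrix_mult_def matrix_vector_mult_def)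
    then have "M = 0" using norm_le_skew[OF assms, of M] by simp
    then show "x = y" by (simp add: M_def vec_eq_iff)
  qed
  then have "invertible ?B" by (simp add: invertible_left_inverse matrix_left_invertible_injective)
  then have "\<exists>A'. ?B ** A' = mat 1 \<and> A' ** ?B = mat 1" by (simp add: invertible_def)
  then have "?B ** matrix_inv ?B = mat 1 \<and> matrix_inv ?B ** ?B = mat 1"
    unfolding matrix_inv_def by (rule someI_ex)
  then show ?thesis ..
qed

lemma cayley_step_eq:
  "(mat 1 - (1/2) *\<^sub>R cayley_gen f \<sigma> h D Y) ** cayley_step f \<sigma> h D Y
     = (mat 1 + (1/2) *\<^sub>R cayley_gen f \<sigma> h D Y) ** Y"
proof -
  have "cayley_step f \<sigma> h D Y = matrix_inv (mat 1 - (1/2) *\<^sub>R cayley_gen f \<sigma> h D Y)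
      ** (mat 1 + (1/2) *\<^sub>R cayley_gen f \<sigma> h D Y) ** Y"
    by (simp add: cayley_step_def cayley_gen_def skw_def znoise_def Let_def)
  then show ?thesis
    by (simp add: matrix_mul_assoc skew_resolvent cayley_gen_def transpose_skw)
qed

text \<open>With \<open>S = Y' - Y\<close> and \<open>M = Y' + Y\<close> the step reads \<open>S = AM/2\<close>, and
  \<open>Y'\<^sup>TY' - Y\<^sup>TY\<close> is the symmetric part of \<open>S\<^sup>TM\<close>.\<close>

lemma cayley_step_stiefel:
  assumes "Y \<in> stiefel"
  shows "cayley_step f \<sigma> h D Y \<in> stiefel"
proof -
  define A where "A = cayley_gen f \<sigma> h D Y"
  define Y' where "Y' = cayley_step f \<sigma> h D Y"
  define M where "M = Y' + Y"
  have A: "transpose A = - A" by (simp add: A_def cayley_gen_def transpose_skw)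
  have eq: "Y' - Y = (1/2) *\<^sub>R (A ** M)"
    using cayley_step_eq[of f \<sigma> h D Y]
    by (simp add: M_def A_def[symmetric] Y'_def[symmetric] matrix_ring_simps algebra_simps)
  have "2 *\<^sub>R (transpose Y' ** Y') - 2 *\<^sub>R (transpose Y ** Y)
      = transpose (Y' - Y) ** M + transpose M ** (Y' - Y)"
    by (simp add: M_def transpose_simps matrix_ring_simps algebra_simps scaleR_2)
  also have "\<dots> = 0"
    unfolding eq by (simp add: transpose_simps A matrix_mul_assoc)
  finally show ?thesis using assms by (simp add: stiefel_def Y'_def[symmetric])
qed

text \<open>The Cayley map expands as I + A + A^2/2 + A^3/4 + ... . Multiplying the truncation error
  by \<open>mat 1 - (1/2) *\<^sub>R A\<close> leaves exactly A^3 Y / 4, and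
  \<open>norm_le_skew\<close> removes the factor again. The bound is thus valid for \<open>A\<close>
  of any size, which matters because the Gaussian increment inside \<open>A\<close> is
  unbounded.\<close>

lemma cayley_step_expansion:
  fixes f \<sigma> h D Y and A :: "real ^ 'n::finite ^ 'n" defines "A \<equiv> cayley_gen f \<sigma> h D Y"
  shows "norm (cayley_step f \<sigma> h D Y - Y - A ** Y - (1/2) *\<^sub>R (A ** A ** Y)) \<le> (1/4) * norm A ^ 3 * norm Y"
proof -
  define Y' where "Y' = cayley_step f \<sigma> h D Y"
  define E where "E = Y' - Y - A ** Y - (1/2) *\<^sub>R (A ** A ** Y)"
  have A: "transpose A = - A" by (simp add: A_def cayley_gen_def transpose_skw)
  have "(mat 1 - (1/2) *\<^sub>R A) ** Y' = (mat 1 + (1/2) *\<^sub>R A) ** Y"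
    unfolding A_def Y'_def by (rule cayley_step_eq)
  then have "(mat 1 - (1/2) *\<^sub>R A) ** E = (mat 1 + (1/2) *\<^sub>R A) ** Y
      - (mat 1 - (1/2) *\<^sub>R A) ** (Y + A ** Y + (1/2) *\<^sub>R (A ** A ** Y))"
    by (simp add: E_def matrix_diff_ldistrib matrix_add_ldistrib)
  also have "\<dots> = (1/4) *\<^sub>R (A ** A ** A ** Y)"
    by (simp add: matrix_ring_simps algebra_simps) (simp add: vec_eq_iff)
  finally have "norm E \<le> norm ((1/4) *\<^sub>R (A ** A ** A ** Y))"
    using norm_le_skew[OF A, of E] by simp
  also have "\<dots> \<le> (1/4) * (norm A * norm A * norm A * norm Y)"
    using norm_matrix_mult_le[of "A ** A ** A" Y] norm_matrix_mult3_le[of A A A]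
    by (smt (verit) mult_right_mono norm_ge_zero norm_scaleR real_norm_def divide_nonneg_nonneg mult_left_mono)
  finally show ?thesis by (simp add: E_def Y'_def power3_eq_cube mult_ac)
qed

section \<open>The Cayley step compared with an Euler step on the manifold\<close>

lemma stiefelD: "Y \<in> stiefel \<Longrightarrow> transpose Y ** Y = mat 1"
  by (simp add: stiefel_def)

lemma stiefel_mult [simp]:
  assumes "Y \<in> stiefel" shows "M ** transpose Y ** Y = M"
  by (metis assms matrix_mul_assoc matrix_mul_rid stiefelD)

text \<open>This explains the factor \<open>mat 1 - st_beta *\<^sub>R (Y ** transpose Y)\<close> in
  the scheme: by \<open>transpose Y ** Y = mat 1\<close> the transposed part collects the
  coefficient \<open>1 - st_beta\<close>, which is \<open>st_alpha\<close>, so the first-order noise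
  of the step is the noise field of the equation.\<close>

lemma skw_znoise_mult:
  assumes "Y \<in> stiefel"
  shows "skw Y (znoise Y D) ** Y = pf Y D"
proof -
  have "skw Y (znoise Y D) ** Y = D - st_beta *\<^sub>R (Y ** transpose Y ** D)
      - Y ** transpose D ** Y + st_beta *\<^sub>R (Y ** transpose D ** Y)"
    using assms by (simp add: skw_def znoise_def transpose_simps matrix_ring_simps algebra_simps)
  moreover have b: "st_alpha = 1 - st_beta" using st_bounds by simp
  ultimately show ?thesis unfolding pf_def b by (simp add: algebra_simps)
qed

lemma skw_egrad_mult:
  assumes "Y \<in> stiefel"
  shows "skw Y (egrad f Y) ** Y = stiefel_grad f Y"
  using assms by (simp add: skw_def stiefel_grad_def matrix_ring_simps)

text \<open>The noise part of the second-order term A^2 Y / 2 for \<open>\<sigma> = 1\<close>,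
  polarised to a bilinear form so that it can be centred by covariances.\<close>

definition qf :: "real ^ 'p ^ 'n \<Rightarrow> real ^ 'p ^ 'n \<Rightarrow> real ^ 'p ^ 'n \<Rightarrow> real ^ 'p ^ 'n" where
  "qf Y D E = (1/2) *\<^sub>R (skw Y (znoise Y D) ** skw Y (znoise Y E) ** Y)"

lemma linear_znoise: "linear (znoise Y)"
  by (rule linearI) (auto simp: znoise_def matrix_ring_simps)

lemma linear_qf: "linear (qf Y D)" "linear (\<lambda>D. qf Y D E)"
  by (rule linearI; simp add: qf_def linear_add[OF linear_znoise] linear_scale[OF linear_znoise] skw_linear
      matrix_ring_simps scaleR_add_right)+

lemma norm_qf_le: "norm (qf Y D E) \<le> 2 * norm Y ^ 3 * (1 + (norm Y)\<^sup>2)\<^sup>2 * norm D * norm E"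
proof -
  have *: "norm (skw Y (znoise Y D)) \<le> 2 * norm Y * ((1 + (norm Y)\<^sup>2) * norm D)" for D
    by (rule order_trans[OF norm_skw_le]) (intro mult_left_mono norm_znoise_le, simp)
  have "norm (qf Y D E) \<le> (1/2) * (norm (skw Y (znoise Y D)) * norm (skw Y (znoise Y E)) * norm Y)"
    using norm_matrix_mult3_le[of "skw Y (znoise Y D)" "skw Y (znoise Y E)" Y] by (simp add: qf_def)
  also have "\<dots> \<le> (1/2) * ((2 * norm Y * ((1 + (norm Y)\<^sup>2) * norm D)) * (2 * norm Y * ((1 + (norm Y)\<^sup>2) * norm E)) * norm Y)"
    by (intro mult_left_mono mult_mono *) auto
  also have "\<dots> = 2 * norm Y ^ 3 * (1 + (norm Y)\<^sup>2)\<^sup>2 * norm D * norm E"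
  proof -
    have "(1/2) * ((2 * y * (c * d)) * (2 * y * (c * e)) * y) = 2 * y ^ 3 * c\<^sup>2 * d * e" for y c d e :: real
      by (simp add: power2_eq_square power3_eq_cube)
    then show ?thesis .
  qed
  finally show ?thesis .
qed

text \<open>In expectation the second-order term of the Cayley step is the Stratonovich correction: both are
  combinations of the seven sums below, each a multiple of \<open>Y\<close>.\<close>

lemma sum_qf_eq_corr:
  fixes Y :: "real ^ 'p ^ 'n"
  assumes Y: "Y \<in> stiefel"
  shows "(\<Sum>u\<in>UNIV. \<Sum>v\<in>UNIV. qf Y (unit_mat u v) (unit_mat u v)) = corr Y"
proof -
  define SS :: "(real ^ 'p ^ 'n \<Rightarrow> real ^ 'p ^ 'n) \<Rightarrow> real ^ 'p ^ 'n"
    where "SS g = (\<Sum>u\<in>UNIV. \<Sum>v\<in>UNIV. g (unit_mat u v))" for g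
  let ?p = "real CARD('p)" and ?n = "real CARD('n)"
  have SS_lin: "SS (\<lambda>E. g E + g' E) = SS g + SS g'" "SS (\<lambda>E. g E - g' E) = SS g - SS g'"
      "SS (\<lambda>E. c *\<^sub>R g E) = c *\<^sub>R SS g" "SS (\<lambda>E. - g E) = - SS g" for g g' c
    by (simp_all add: SS_def sum.distrib sum_subtractf scaleR_sum_right sum_negf)
  have YY: "transpose Y ** Y = mat 1" using Y by (rule stiefelD)
  have [simp]: "M ** transpose Y ** Y = M" for M :: "real ^ 'p ^ 'q" using Y by simp
  have tr_p: "trace (mat 1 :: real ^ 'p ^ 'p) = ?p" "trace (mat 1 :: real ^ 'n ^ 'n) = ?n"
    by (simp_all add: trace_def mat_def)
  have tr_Y: "trace (Y ** transpose Y) = ?p"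
    using trace_mul_sym[of Y "transpose Y"] tr_p YY by simp
  note sums = sum_unit_mat_sandwich
  \<comment> \<open>Fixed outer factors are moved out of the sums, so that the unit matrices stand
    as in \<open>sum_unit_mat_sandwich\<close>.\<close>
  have pull: "(\<Sum>u\<in>UNIV. \<Sum>v\<in>UNIV. L ** g u v ** R) = L ** (\<Sum>u\<in>UNIV. \<Sum>v\<in>UNIV. g u v) ** R"
    for L R and g :: "'n \<Rightarrow> 'p \<Rightarrow> real ^ _ ^ _"
    by (simp add: matrix_sum_left matrix_sum_right)
  have s1: "SS (\<lambda>E. E ** transpose Y ** E) = Y"
    using sums(1)[of "transpose Y"] by (simp add: SS_def)
  have s2: "SS (\<lambda>E. E ** transpose E ** Y) = ?p *\<^sub>R Y"
    using pull[of "mat 1" "\<lambda>u v. unit_mat u v ** mat 1 ** transpose (unit_mat u v)" Y]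
    unfolding sums(3) by (simp add: SS_def tr_p)
  have s3: "SS (\<lambda>E. Y ** transpose Y ** E ** transpose Y ** E) = Y"
    using pull[of "Y ** transpose Y" "\<lambda>u v. unit_mat u v ** transpose Y ** unit_mat u v" "mat 1"]
    unfolding sums(1) by (simp add: SS_def matrix_mul_assoc)
  have s4: "SS (\<lambda>E. Y ** transpose Y ** E ** transpose E ** Y) = ?p *\<^sub>R Y"
    using pull[of "Y ** transpose Y" "\<lambda>u v. unit_mat u v ** mat 1 ** transpose (unit_mat u v)" Y]
    unfolding sums(3) by (simp add: SS_def matrix_mul_assoc tr_p)
  have s5: "SS (\<lambda>E. Y ** transpose E ** E) = ?n *\<^sub>R Y"
    using pull[of Y "\<lambda>u v. transpose (unit_mat u v) ** mat 1 ** unit_mat u v" "mat 1"]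
    unfolding sums(4) by (simp add: SS_def matrix_mul_assoc tr_p)
  have s6: "SS (\<lambda>E. Y ** transpose E ** Y ** transpose E ** Y) = Y"
    using pull[of Y "\<lambda>u v. transpose (unit_mat u v) ** transpose (transpose Y) ** transpose (unit_mat u v)" Y]
    unfolding sums(2) by (simp add: SS_def matrix_mul_assoc transpose_transpose)
  have s7: "SS (\<lambda>E. Y ** transpose E ** Y ** transpose Y ** E) = ?p *\<^sub>R Y"
    using pull[of Y "\<lambda>u v. transpose (unit_mat u v) ** (Y ** transpose Y) ** unit_mat u v" "mat 1"]
    unfolding sums(4) by (simp add: SS_def matrix_mul_assoc tr_Y)
  note s = s1 s2 s3 s4 s5 s6 s7
  have "(\<lambda>E. qf Y E E) = (\<lambda>E. (1/2) *\<^sub>R (st_alpha *\<^sub>R (E ** transpose Y ** E) - st_alpha *\<^sub>R (E ** transpose E ** Y)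
      - (st_alpha * st_beta) *\<^sub>R (Y ** transpose Y ** E ** transpose Y ** E)
      + (st_alpha * st_beta) *\<^sub>R (Y ** transpose Y ** E ** transpose E ** Y)
      - Y ** transpose E ** E + st_alpha *\<^sub>R (Y ** transpose E ** Y ** transpose E ** Y)
      + st_beta *\<^sub>R (Y ** transpose E ** Y ** transpose Y ** E)
      + (st_alpha * st_beta) *\<^sub>R (Y ** transpose E ** Y ** transpose Y ** E)
      - (st_alpha * st_beta) *\<^sub>R (Y ** transpose E ** Y ** transpose E ** Y)))"
  proof
    fix E :: "real ^ 'p ^ 'n"
    have b: "st_beta = 1 - st_alpha" using st_bounds by simp
    have "qf Y E E = (1/2) *\<^sub>R (skw Y (znoise Y E) ** pf Y E)"
      using skw_znoise_mult[OF Y, of E] by (simp add: qf_def matrix_mul_assoc[symmetric])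
    also have "\<dots> = (1/2) *\<^sub>R (znoise Y E ** (transpose Y ** pf Y E) - Y ** (transpose (znoise Y E) ** pf Y E))"
      by (simp add: skw_def matrix_ring_simps)
    also have "transpose Y ** pf Y E = st_alpha *\<^sub>R (transpose Y ** E) - st_alpha *\<^sub>R (transpose E ** Y)"
      by (simp add: pf_def matrix_ring_simps YY b algebra_simps)
    finally show "qf Y E E = (1/2) *\<^sub>R (st_alpha *\<^sub>R (E ** transpose Y ** E) - st_alpha *\<^sub>R (E ** transpose E ** Y)
      - (st_alpha * st_beta) *\<^sub>R (Y ** transpose Y ** E ** transpose Y ** E)
      + (st_alpha * st_beta) *\<^sub>R (Y ** transpose Y ** E ** transpose E ** Y)
      - Y ** transpose E ** E + st_alpha *\<^sub>R (Y ** transpose E ** Y ** transpose E ** Y)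
      + st_beta *\<^sub>R (Y ** transpose E ** Y ** transpose Y ** E)
      + (st_alpha * st_beta) *\<^sub>R (Y ** transpose E ** Y ** transpose Y ** E)
      - (st_alpha * st_beta) *\<^sub>R (Y ** transpose E ** Y ** transpose E ** Y))"
      by (simp add: pf_def znoise_def transpose_simps matrix_ring_simps YY b algebra_simps)
  qed
  then have L: "SS (\<lambda>E. qf Y E E) = (1/2) *\<^sub>R (st_alpha *\<^sub>R Y - st_alpha *\<^sub>R ?p *\<^sub>R Y
      - (st_alpha * st_beta) *\<^sub>R Y + (st_alpha * st_beta) *\<^sub>R ?p *\<^sub>R Y
      - ?n *\<^sub>R Y + st_alpha *\<^sub>R Y + st_beta *\<^sub>R ?p *\<^sub>R Y
      + (st_alpha * st_beta) *\<^sub>R ?p *\<^sub>R Y - (st_alpha * st_beta) *\<^sub>R Y)"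
    by (simp only: SS_lin s)
  have "(\<lambda>E. dpf Y E (pf Y E)) = (\<lambda>E. - (st_alpha *\<^sub>R (E ** transpose E ** Y
        - st_alpha *\<^sub>R (Y ** transpose E ** Y ** transpose E ** Y)
        - st_beta *\<^sub>R (Y ** transpose Y ** E ** transpose E ** Y)
        + (Y ** transpose E ** E - st_alpha *\<^sub>R (Y ** transpose E ** Y ** transpose E ** Y)
        - st_beta *\<^sub>R (Y ** transpose E ** Y ** transpose Y ** E)))
      + st_beta *\<^sub>R (E ** transpose Y ** E - st_alpha *\<^sub>R (Y ** transpose E ** Y ** transpose Y ** E)
        - st_beta *\<^sub>R (Y ** transpose Y ** E ** transpose Y ** E)
        + (Y ** transpose E ** E - st_alpha *\<^sub>R (Y ** transpose Y ** E ** transpose Y ** E)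
        - st_beta *\<^sub>R (Y ** transpose E ** Y ** transpose Y ** E)))))"
    by (rule ext) (simp add: dpf_def pf_def transpose_simps matrix_ring_simps YY)
  then have R: "SS (\<lambda>E. dpf Y E (pf Y E)) = - (st_alpha *\<^sub>R (?p *\<^sub>R Y - st_alpha *\<^sub>R Y - st_beta *\<^sub>R ?p *\<^sub>R Y
        + (?n *\<^sub>R Y - st_alpha *\<^sub>R Y - st_beta *\<^sub>R ?p *\<^sub>R Y))
      + st_beta *\<^sub>R (Y - st_alpha *\<^sub>R ?p *\<^sub>R Y - st_beta *\<^sub>R Y
        + (?n *\<^sub>R Y - st_alpha *\<^sub>R Y - st_beta *\<^sub>R ?p *\<^sub>R Y)))"
    by (simp only: SS_lin s)
  \<comment> \<open>Both sums are now numerical multiples of \<open>Y\<close>; this relation makes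
    the two numbers agree.\<close>
  have b: "st_beta = 1 - st_alpha" using st_bounds by simp
  have "SS (\<lambda>E. qf Y E E) = (1/2) *\<^sub>R SS (\<lambda>E. dpf Y E (pf Y E))"
    unfolding L R b by (simp add: vec_eq_iff algebra_simps)
  then show ?thesis by (simp add: SS_def corr_def)
qed

lemma cube_sum_le: "(a + b) ^ 3 \<le> 4 * (a ^ 3 + b ^ 3)" if "0 \<le> a" "0 \<le> b" for a b :: real
proof -
  have "4 * (a ^ 3 + b ^ 3) - (a + b) ^ 3 = 3 * (a + b) * (a - b)\<^sup>2"
    by (simp add: power2_eq_square power3_eq_cube algebra_simps)
  also have "\<dots> \<ge> 0" using that by simp
  finally show ?thesis by simp
qed

text \<open>The difference \<open>qf Y D D - h *\<^sub>R corr Y\<close> is only of order h, but it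
  is centred given the past and is therefore kept apart. The remaining terms are of order h^(3/2)
  when \<open>D\<close> is a Brownian increment over time \<open>h\<close>.\<close>

lemma cayley_step_remainder:
  fixes f :: "real ^ 'p::finite ^ 'n::finite \<Rightarrow> real"
  assumes f: "smooth f"
  obtains C where "0 \<le> C" and "\<And>Y D h. Y \<in> stiefel \<Longrightarrow> 0 \<le> h \<Longrightarrow> h \<le> H \<Longrightarrow>
    norm (cayley_step f \<sigma> h D Y - Y - h *\<^sub>R drift f \<sigma> Y - \<sigma> *\<^sub>R pf Y D - \<sigma>\<^sup>2 *\<^sub>R (qf Y D D - h *\<^sub>R corr Y))
      \<le> C * (h\<^sup>2 + h * norm D + norm D ^ 3)"
proof -
  obtain G where G: "0 \<le> G" "\<And>Y. norm Y \<le> sqrt CARD('p) \<Longrightarrow> norm (egrad f Y) \<le> G"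
    using loclip_bounded[OF loclip_egrad[OF f]] by metis
  define y where "y = sqrt CARD('p)"
  \<comment> \<open>\<open>s\<close> bounds the gradient part of the generator per unit of time,
    \<open>c\<close> its noise part per unit of \<open>norm D\<close>.\<close>
  define s where "s = 2 * y * G"
  define c where "c = \<bar>\<sigma>\<bar> * (2 * y * (1 + y\<^sup>2))"
  have pos: "0 \<le> y" "0 \<le> s" "0 \<le> c" using G by (auto simp: y_def s_def c_def)
  \<comment> \<open>The first two products come from the cubic remainder, with one factor of
    \<open>h ^ 3\<close> absorbed by \<open>h \<le> H\<close>; the last two come from the
    gradient-gradient and the mixed parts of A^2 Y / 2.\<close>
  define C where "C = \<bar>H\<bar> * s ^ 3 * y + c ^ 3 * y + s\<^sup>2 * y + s * c * y"
  have "norm (cayley_step f \<sigma> h D Y - Y - h *\<^sub>R drift f \<sigma> Y - \<sigma> *\<^sub>R pf Y D - \<sigma>\<^sup>2 *\<^sub>R (qf Y D D - h *\<^sub>R corr Y))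
      \<le> C * (h\<^sup>2 + h * norm D + norm D ^ 3)"
    if Y: "Y \<in> stiefel" and h: "0 \<le> h" "h \<le> H" for Y D :: "real ^ 'p ^ 'n" and h
  proof -
    define S where "S = skw Y (egrad f Y)"
    define N where "N = \<sigma> *\<^sub>R skw Y (znoise Y D)"
    define A where "A = cayley_gen f \<sigma> h D Y"
    define d where "d = norm D"
    have nY: "norm Y = y" using norm_stiefel[OF Y] by (simp add: y_def)
    have d: "0 \<le> d" by (simp add: d_def)
    have A: "A = - (h *\<^sub>R S) + N"
      by (simp add: A_def cayley_gen_def skw_linear S_def N_def)
    have nS: "norm S \<le> s"
    proof -
      have "norm S \<le> 2 * y * norm (egrad f Y)"
        using norm_skw_le[of Y "egrad f Y"] unfolding S_def nY .
      also have "\<dots> \<le> 2 * y * G" using G(2)[of Y] nY pos by (intro mult_left_mono) (auto simp: y_def)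
      finally show ?thesis by (simp add: s_def)
    qed
    have "norm (skw Y (znoise Y D)) \<le> 2 * y * ((1 + y\<^sup>2) * d)"
      unfolding d_def nY[symmetric]
      by (rule order_trans[OF norm_skw_le]) (intro mult_left_mono norm_znoise_le, simp)
    then have nN: "norm N \<le> c * d"
      unfolding N_def c_def norm_scaleR by (metis abs_ge_zero mult.assoc mult_left_mono)
    have nA: "norm A \<le> h * s + c * d"
      unfolding A using nS nN h by (intro order_trans[OF norm_triangle_ineq] add_mono) (auto intro: mult_left_mono)
    have AY: "A ** Y = \<sigma> *\<^sub>R pf Y D - h *\<^sub>R stiefel_grad f Y"
      unfolding A by (simp add: matrix_ring_simps S_def N_def skw_egrad_mult[OF Y] skw_znoise_mult[OF Y])
    define r where "r = h\<^sup>2 *\<^sub>R (S ** S ** Y) - h *\<^sub>R (S ** N ** Y + N ** S ** Y)"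
    have AAY: "A ** A ** Y = r + 2 *\<^sub>R \<sigma>\<^sup>2 *\<^sub>R qf Y D D"
      unfolding A r_def
      by (simp add: matrix_ring_simps qf_def N_def algebra_simps power2_eq_square)
    have "norm r \<le> h\<^sup>2 * (s * s * y) + h * (s * (c * d) * y + (c * d) * s * y)"
    proof -
      have *: "norm (P ** Q ** Y) \<le> a * b * y" if "norm P \<le> a" "norm Q \<le> b" "0 \<le> a" for P Q :: "real ^ 'n ^ 'n" and a b
        using norm_matrix_mult3_le[of P Q Y] that pos mult_mono[OF that(1,2) that(3)]
        by (metis nY mult_right_mono norm_ge_zero order_trans)
      have "norm r \<le> h\<^sup>2 * norm (S ** S ** Y) + h * (norm (S ** N ** Y) + norm (N ** S ** Y))"
        unfolding r_def using h
        by (intro order_trans[OF norm_triangle_ineq4] add_mono) (auto intro: mult_left_mono norm_triangle_ineq)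
      also have "\<dots> \<le> h\<^sup>2 * (s * s * y) + h * (s * (c * d) * y + (c * d) * s * y)"
        using h pos d by (intro add_mono mult_left_mono * nS nN) auto
      finally show ?thesis .
    qed
    then have r: "(1/2) * norm r \<le> s\<^sup>2 * y * h\<^sup>2 + s * c * y * (h * d)"
    proof -
      have "(1/2) * norm r \<le> (1/2) * (h\<^sup>2 * (s * s * y) + h * (s * (c * d) * y + (c * d) * s * y))"
        using \<open>norm r \<le> _\<close> by (rule mult_left_mono) simp
      also have "\<dots> = s\<^sup>2 * y * h\<^sup>2 + s * c * y * (h * d) - (1/2) * (h\<^sup>2 * (s * s * y))"
        by (simp add: power2_eq_square algebra_simps)
      also have "\<dots> \<le> s\<^sup>2 * y * h\<^sup>2 + s * c * y * (h * d)" using pos by simp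
      finally show ?thesis .
    qed
    have "norm A ^ 3 \<le> (h * s + c * d) ^ 3" by (intro power_mono nA) simp
    also have "\<dots> \<le> 4 * ((h * s) ^ 3 + (c * d) ^ 3)" using h pos d by (intro cube_sum_le) auto
    also have "(h * s) ^ 3 = h * (h\<^sup>2 * s ^ 3)" by (simp add: power2_eq_square power3_eq_cube)
    also have "\<dots> \<le> \<bar>H\<bar> * (h\<^sup>2 * s ^ 3)" using h pos by (intro mult_right_mono) auto
    finally have "norm A ^ 3 \<le> 4 * (\<bar>H\<bar> * (h\<^sup>2 * s ^ 3) + (c * d) ^ 3)" by simp
    then have "(1/4) * norm A ^ 3 * y \<le> (1/4) * (4 * (\<bar>H\<bar> * (h\<^sup>2 * s ^ 3) + (c * d) ^ 3)) * y"
      using pos by (intro mult_right_mono mult_left_mono) auto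
    also have "\<dots> = \<bar>H\<bar> * s ^ 3 * y * h\<^sup>2 + c ^ 3 * y * d ^ 3"
      by (simp add: power_mult_distrib algebra_simps)
    finally have A3: "(1/4) * norm A ^ 3 * y \<le> \<bar>H\<bar> * s ^ 3 * y * h\<^sup>2 + c ^ 3 * y * d ^ 3" .
    define E where "E = cayley_step f \<sigma> h D Y - Y - A ** Y - (1/2) *\<^sub>R (A ** A ** Y)"
    have E: "norm E \<le> (1/4) * norm A ^ 3 * y"
      using cayley_step_expansion[of f \<sigma> h D Y] by (simp add: E_def A_def nY)
    have "cayley_step f \<sigma> h D Y - Y - h *\<^sub>R drift f \<sigma> Y - \<sigma> *\<^sub>R pf Y D - \<sigma>\<^sup>2 *\<^sub>R (qf Y D D - h *\<^sub>R corr Y)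
        = E + (1/2) *\<^sub>R r"
      unfolding E_def AAY AY by (simp add: drift_def algebra_simps)
    then have "norm (cayley_step f \<sigma> h D Y - Y - h *\<^sub>R drift f \<sigma> Y - \<sigma> *\<^sub>R pf Y D - \<sigma>\<^sup>2 *\<^sub>R (qf Y D D - h *\<^sub>R corr Y))
        \<le> norm E + (1/2) * norm r" by (simp add: norm_triangle_le)
    also have "\<dots> \<le> (\<bar>H\<bar> * s ^ 3 * y * h\<^sup>2 + c ^ 3 * y * d ^ 3) + (s\<^sup>2 * y * h\<^sup>2 + s * c * y * (h * d))"
      using E A3 r by linarith
    also have "\<dots> \<le> C * (h\<^sup>2 + h * d + d ^ 3)"
    proof -
      have "0 \<le> \<bar>H\<bar> * s ^ 3 * y" "0 \<le> c ^ 3 * y" "0 \<le> s\<^sup>2 * y" "0 \<le> s * c * y" "0 \<le> h\<^sup>2" "0 \<le> h * d" "0 \<le> d ^ 3"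
        using pos h d by auto
      then show ?thesis
        unfolding C_def ring_distribs by (smt (verit) mult_nonneg_nonneg)
    qed
    finally show ?thesis by (simp add: d_def)
  qed
  moreover have "0 \<le> C" using pos by (simp add: C_def)
  ultimately show ?thesis using that by blast
qed

text \<open>Serves the measurability of the scheme. Continuity of \<open>matrix_inv\<close> is
  bypassed: multiplying the difference of two steps by \<open>mat 1 - (1/2) *\<^sub>R A\<close> does
  not shrink it and leaves only differences of \<open>A\<close> and of the right-hand side, which
  are continuous.\<close>

lemma continuous_cayley_step:
  fixes f :: "real ^ 'p::finite ^ 'n::finite \<Rightarrow> real"
  assumes f: "smooth f"
  shows "continuous_on UNIV (\<lambda>(D, Y). cayley_step f \<sigma> h D Y)"
  unfolding continuous_on_def
proof
  fix z :: "(real ^ 'p ^ 'n) \<times> (real ^ 'p ^ 'n)"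
  obtain D0 Y0 where z: "z = (D0, Y0)" by (cases z)
  let ?g = "\<lambda>(D, Y). cayley_step f \<sigma> h D Y" and ?A = "\<lambda>z. cayley_gen f \<sigma> h (fst z) (snd z)"
  let ?b = "\<lambda>z. (mat 1 + (1/2) *\<^sub>R ?A z) ** snd z"
  have [tendsto_intros]: "((\<lambda>x. transpose (g x)) \<longlongrightarrow> transpose l) F"
    if "(g \<longlongrightarrow> l) F" for g and l :: "real ^ 'p ^ 'n" and F :: "((real ^ 'p ^ 'n) \<times> (real ^ 'p ^ 'n)) filter"
    by (rule bounded_linear.tendsto[OF bounded_linear_transpose that])
  note [tendsto_intros] = bounded_bilinear.tendsto[OF bounded_bilinear_matrix_mult]
  have "isCont (egrad f) Y0"
    using loclip_continuous[OF loclip_egrad[OF f]] by (simp add: continuous_on_eq_continuous_at)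
  then have "((\<lambda>x. egrad f (snd x)) \<longlongrightarrow> egrad f Y0) (at z within UNIV)"
    unfolding z by (intro isCont_tendsto_compose[where g="egrad f"] tendsto_eq_intros) auto
  then have A: "(?A \<longlongrightarrow> ?A z) (at z within UNIV)"
    unfolding cayley_gen_def skw_def znoise_def
    by (intro tendsto_intros) (auto simp: z)
  have b: "(?b \<longlongrightarrow> ?b z) (at z within UNIV)"
    by (intro tendsto_intros A)
  have "((\<lambda>x. norm (?b x - ?b z) + (1/2) * (norm (?A x - ?A z) * norm (?g z))) \<longlongrightarrow>
     norm (?b z - ?b z) + (1/2) * (norm (?A z - ?A z) * norm (?g z))) (at z within UNIV)"
    by (intro tendsto_intros A b)
  then have lim: "((\<lambda>x. norm (?b x - ?b z) + (1/2) * (norm (?A x - ?A z) * norm (?g z))) \<longlongrightarrow> 0) (at z within UNIV)"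
    by simp
  have bound: "norm (?g x - ?g z) \<le> norm (?b x - ?b z) + (1/2) * (norm (?A x - ?A z) * norm (?g z))" for x
  proof -
    have eq: "(mat 1 - (1/2) *\<^sub>R ?A w) ** ?g w = ?b w" for w
      using cayley_step_eq[of f \<sigma> h "fst w" "snd w"] by (simp add: case_prod_unfold)
    have "norm (?g x - ?g z) \<le> norm ((mat 1 - (1/2) *\<^sub>R ?A x) ** (?g x - ?g z))"
      by (rule norm_le_skew) (simp add: cayley_gen_def transpose_skw)
    also have "(mat 1 - (1/2) *\<^sub>R ?A x) ** (?g x - ?g z) = ?b x - ?b z + (1/2) *\<^sub>R ((?A x - ?A z) ** ?g z)"
    proof -
      have "(mat 1 - (1/2) *\<^sub>R ?A x) ** (?g x - ?g z)
          = ?b x - ?b z + ((mat 1 - (1/2) *\<^sub>R ?A z) ** ?g z - (mat 1 - (1/2) *\<^sub>R ?A x) ** ?g z)"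
        by (simp only: matrix_diff_ldistrib eq) simp
      also have "(mat 1 - (1/2) *\<^sub>R ?A z) ** w - (mat 1 - (1/2) *\<^sub>R ?A x) ** w = (1/2) *\<^sub>R ((?A x - ?A z) ** w)" for w
        by (simp add: matrix_diff_rdistrib scaleR_diff_right)
      finally show ?thesis .
    qed
    also have "norm \<dots> \<le> norm (?b x - ?b z) + (1/2) * (norm (?A x - ?A z) * norm (?g z))"
      using norm_matrix_mult_le[of "?A x - ?A z" "?g z"] by (intro order_trans[OF norm_triangle_ineq] add_mono) auto
    finally show ?thesis .
  qed
  show "(?g \<longlongrightarrow> ?g z) (at z within UNIV)"
    by (rule Lim_null[THEN iffD2], rule Lim_null_comparison[OF _ lim]) (use bound in auto)
qed

section \<open>Independent increments\<close>

lemma sum_power_le: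
  fixes x :: "'i \<Rightarrow> real"
  assumes "finite A" "A \<noteq> {}" "\<And>i. i \<in> A \<Longrightarrow> 0 \<le> x i"
  shows "(\<Sum>i\<in>A. x i) ^ k \<le> real (card A) ^ k * (\<Sum>i\<in>A. x i ^ k)"
proof -
  define m where "m = Max (x ` A)"
  obtain j where j: "j \<in> A" "m = x j" using assms by (metis (no_types) Max_in finite_imageI imageE image_is_empty m_def)
  have "x i \<le> m" if "i \<in> A" for i using that assms by (simp add: m_def)
  then have "(\<Sum>i\<in>A. x i) \<le> real (card A) * m" using sum_bounded_above by (metis of_nat_id)
  then have "(\<Sum>i\<in>A. x i) ^ k \<le> (real (card A) * m) ^ k"
    using assms by (intro power_mono sum_nonneg) auto
  also have "\<dots> \<le> real (card A) ^ k * (\<Sum>i\<in>A. x i ^ k)"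
    unfolding power_mult_distrib j(2) using assms j
    by (intro mult_left_mono member_le_sum[of j A "\<lambda>i. x i ^ k"]) auto
  finally show ?thesis .
qed

lemma norm_sum_sq_le:
  "(norm (\<Sum>q\<in>Q. a q))\<^sup>2 \<le> real (card Q) * (\<Sum>q\<in>Q. (norm (a q))\<^sup>2)"
proof -
  have "(norm (\<Sum>q\<in>Q. a q))\<^sup>2 \<le> (\<Sum>q\<in>Q. norm (a q))\<^sup>2"
    by (intro power_mono norm_sum) simp
  also have "\<dots> \<le> real (card Q) * (\<Sum>q\<in>Q. (norm (a q))\<^sup>2)"
    using sum_squared_le_sum_of_squares[of "\<lambda>q. norm (a q)" Q] by (simp add: mult.commute)
  finally show ?thesis .
qed

lemma norm_add_sq_le: "(norm (a + b))\<^sup>2 \<le> 2 * (norm a)\<^sup>2 + 2 * (norm b)\<^sup>2"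
proof -
  have "(norm (a + b))\<^sup>2 \<le> (norm a + norm b)\<^sup>2" by (intro power_mono norm_triangle_ineq) simp
  also have "\<dots> \<le> 2 * (norm a)\<^sup>2 + 2 * (norm b)\<^sup>2"
    using zero_le_power2[of "norm a - norm b"] by (simp add: power2_eq_square algebra_simps)
  finally show ?thesis .
qed

lemma norm_add3_sq_le: "(norm (a + b + c))\<^sup>2 \<le> 3 * (norm a)\<^sup>2 + 3 * (norm b)\<^sup>2 + 3 * (norm c)\<^sup>2"
proof -
  have "(norm (a + b + c))\<^sup>2 \<le> (norm a + norm b + norm c)\<^sup>2" by (intro power_mono) norm+
  also have "\<dots> \<le> 3 * (norm a)\<^sup>2 + 3 * (norm b)\<^sup>2 + 3 * (norm c)\<^sup>2"
    using zero_le_power2[of "norm a - norm b"] zero_le_power2[of "norm a - norm c"] zero_le_power2[of "norm b - norm c"]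
    by (simp add: power2_eq_square algebra_simps)
  finally show ?thesis .
qed

lemma integrable_dominated:
  fixes f :: "'a \<Rightarrow> 'b::{banach, second_countable_topology}"
  assumes "integrable M g" "f \<in> borel_measurable M" "\<And>\<omega>. norm (f \<omega>) \<le> g \<omega>"
  shows "integrable M f"
  using assms by (intro Bochner_Integration.integrable_bound[OF assms(1)])
    (auto intro!: AE_I2 order_trans[OF _ abs_ge_self])

lemma (in prob_space) integrable_of_sq:
  fixes X :: "'a \<Rightarrow> real"
  assumes "X \<in> borel_measurable M" "integrable M (\<lambda>\<omega>. (X \<omega>)\<^sup>2)"
  shows "integrable M X"
proof (rule Bochner_Integration.integrable_bound[of M "\<lambda>\<omega>. 1 + (X \<omega>)\<^sup>2"])
  show "AE \<omega> in M. norm (X \<omega>) \<le> norm (1 + (X \<omega>)\<^sup>2)"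
  proof (rule AE_I2)
    fix \<omega>
    have "0 \<le> (\<bar>X \<omega>\<bar> - 1)\<^sup>2" by simp
    then show "norm (X \<omega>) \<le> norm (1 + (X \<omega>)\<^sup>2)" by (simp add: power2_diff)
  qed
qed (use assms in auto)

lemma (in prob_space) integrable_inner:
  fixes X Y :: "'a \<Rightarrow> 'e::euclidean_space"
  assumes "X \<in> borel_measurable M" "Y \<in> borel_measurable M"
    "integrable M (\<lambda>\<omega>. (norm (X \<omega>))\<^sup>2)" "integrable M (\<lambda>\<omega>. (norm (Y \<omega>))\<^sup>2)"
  shows "integrable M (\<lambda>\<omega>. X \<omega> \<bullet> Y \<omega>)"
proof (rule Bochner_Integration.integrable_bound[of M "\<lambda>\<omega>. (norm (X \<omega>))\<^sup>2 + (norm (Y \<omega>))\<^sup>2"])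
  show "AE \<omega> in M. norm (X \<omega> \<bullet> Y \<omega>) \<le> norm ((norm (X \<omega>))\<^sup>2 + (norm (Y \<omega>))\<^sup>2)"
  proof (rule AE_I2)
    fix \<omega>
    have "\<bar>X \<omega> \<bullet> Y \<omega>\<bar> \<le> norm (X \<omega>) * norm (Y \<omega>)" by (rule Cauchy_Schwarz_ineq2)
    also have "\<dots> \<le> (norm (X \<omega>))\<^sup>2 + (norm (Y \<omega>))\<^sup>2"
      using zero_le_power2[of "norm (X \<omega>) - norm (Y \<omega>)"] zero_le_power2[of "norm (X \<omega>)"] zero_le_power2[of "norm (Y \<omega>)"]
      unfolding power2_diff by linarith
    finally show "norm (X \<omega> \<bullet> Y \<omega>) \<le> norm ((norm (X \<omega>))\<^sup>2 + (norm (Y \<omega>))\<^sup>2)" by simp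
  qed
qed (use assms in auto)

text \<open>\<open>fact (2 * k) / (2 ^ k * fact k)\<close> is the moment of order
  \<open>2 * k\<close> of a standard normal variable. For a vector with \<open>d\<close> entries,
  \<open>sum_power_le\<close> costs \<open>d ^ k\<close> and adding up the entries costs one more
  factor \<open>d\<close>.\<close>

definition mom :: "nat \<Rightarrow> nat \<Rightarrow> real" where
  "mom d k = real d ^ (k + 1) * (fact (2 * k) / (2 ^ k * fact k))"

lemma mom_nonneg: "0 \<le> mom d k" by (simp add: mom_def)

locale matrix_bm =
  fixes M :: "'a measure" and F :: "real \<Rightarrow> 'a measure"
    and B :: "real \<Rightarrow> 'a \<Rightarrow> real ^ 'p::finite ^ 'n::finite"
  assumes fps: "filtered_prob_space M F" and bm: "matrix_brownian_motion M F B"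
begin

sublocale prob_space M
  using fps by (simp add: filtered_prob_space_def)

lemma subalg: "subalgebra M (F t)"
  using fps by (simp add: filtered_prob_space_def)

lemma space_F [simp]: "space (F t) = space M"
  using subalg by (simp add: subalgebra_def)

lemma sets_F_mono: "s \<le> t \<Longrightarrow> sets (F s) \<subseteq> sets (F t)"
  using fps by (simp add: filtered_prob_space_def filtration_def)

lemma sets_F_M: "sets (F t) \<subseteq> sets M"
  using subalg by (simp add: subalgebra_def)

lemma measurable_F_mono: "g \<in> measurable (F s) N \<Longrightarrow> s \<le> t \<Longrightarrow> g \<in> measurable (F t) N"
  using sets_F_mono[of s t] by (auto simp: measurable_def)

lemma measurable_F_M: "g \<in> measurable (F s) N \<Longrightarrow> g \<in> measurable M N"
  by (rule measurable_from_subalg[OF subalg])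

lemma B_measurable_F: "0 \<le> s \<Longrightarrow> s \<le> t \<Longrightarrow> B s \<in> borel_measurable (F t)"
  using bm by (auto simp: matrix_brownian_motion_def adapted_on_def intro: measurable_F_mono)

lemma B_measurable: "0 \<le> s \<Longrightarrow> B s \<in> borel_measurable M"
  by (rule measurable_F_M[OF B_measurable_F]) auto

lemma increment_measurable_F: "0 \<le> s \<Longrightarrow> s \<le> t \<Longrightarrow> (\<lambda>\<omega>. B t \<omega> - B s \<omega>) \<in> borel_measurable (F t)"
  by (intro borel_measurable_diff B_measurable_F) auto

lemma increment_measurable: "0 \<le> s \<Longrightarrow> s \<le> t \<Longrightarrow> (\<lambda>\<omega>. B t \<omega> - B s \<omega>) \<in> borel_measurable M"
  by (rule measurable_F_M[OF increment_measurable_F])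

text \<open>The events generated by \<open>U\<close>, and those generated by a function of the
  increment, lie in the two sigma-algebras that the Brownian hypothesis declares
  independent.\<close>

lemma increment_indep:
  assumes st: "0 \<le> s" "s < t" and U: "U \<in> borel_measurable (F s)" and \<psi>: "\<psi> \<in> borel_measurable borel"
  shows "indep_var borel (U :: 'a \<Rightarrow> real) borel (\<lambda>\<omega>. \<psi> (B t \<omega> - B s \<omega>) :: real)"
proof -
  let ?D = "\<lambda>\<omega>. B t \<omega> - B s \<omega>"
  have D: "?D \<in> borel_measurable M" using st by (intro increment_measurable) auto
  have ind: "indep_set (sets (F s)) (sets (vimage_algebra (space M) ?D borel))"
    using bm st by (auto simp: matrix_brownian_motion_def)
  have 1: "sigma_sets (space M) {U -` A \<inter> space M | A. A \<in> sets borel} \<subseteq> sets (F s)"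
  proof (rule sets.sigma_sets_subset[of _ "F s", simplified])
    show "{U -` A \<inter> space M |A. A \<in> sets borel} \<subseteq> sets (F s)"
      using measurable_sets[OF U] by auto
  qed
  have 2: "sigma_sets (space M) {(\<lambda>\<omega>. \<psi> (?D \<omega>)) -` A \<inter> space M | A. A \<in> sets borel}
      \<subseteq> sets (vimage_algebra (space M) ?D borel)"
  proof (rule sets.sigma_sets_subset[of _ "vimage_algebra (space M) ?D borel", simplified], safe)
    fix A :: "real set" assume "A \<in> sets borel"
    then have "\<psi> -` A \<in> sets borel" using measurable_sets[OF \<psi>] by simp
    then have "?D -` (\<psi> -` A) \<inter> space M \<in> sets (vimage_algebra (space M) ?D borel)"
      by (rule in_vimage_algebra)
    then show "(\<lambda>\<omega>. \<psi> (?D \<omega>)) -` A \<inter> space M \<in> sets (vimage_algebra (space M) ?D borel)"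
      by (simp add: vimage_def)
  qed
  show ?thesis
    unfolding indep_var_eq
  proof (intro conjI)
    show "indep_set (sigma_sets (space M) {U -` A \<inter> space M | A. A \<in> sets borel})
        (sigma_sets (space M) {(\<lambda>\<omega>. \<psi> (?D \<omega>)) -` A \<inter> space M | A. A \<in> sets borel})"
      using ind 1 2 unfolding indep_sets2_eq by (meson subset_iff order_trans)
    show "random_variable borel U" by (rule measurable_F_M[OF U])
    show "random_variable borel (\<lambda>\<omega>. \<psi> (?D \<omega>))" by (rule measurable_compose[OF D \<psi>])
  qed
qed

lemma increment_integral:
  assumes "0 \<le> s" "s < t" "U \<in> borel_measurable (F s)" "\<psi> \<in> borel_measurable borel"
    and "integrable M U" "integrable M (\<lambda>\<omega>. \<psi> (B t \<omega> - B s \<omega>))"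
  shows "integrable M (\<lambda>\<omega>. U \<omega> * \<psi> (B t \<omega> - B s \<omega>) :: real)"
    and "expectation (\<lambda>\<omega>. U \<omega> * \<psi> (B t \<omega> - B s \<omega>)) = expectation U * expectation (\<lambda>\<omega>. \<psi> (B t \<omega> - B s \<omega>))"
  using indep_var_integrable[OF increment_indep[OF assms(1-4)] assms(5,6)]
    indep_var_lebesgue_integral[OF increment_indep[OF assms(1-4)] assms(5,6)] by auto

section \<open>Moments of Brownian increments and of sums weighted by them\<close>

lemma component_measurable: "(\<lambda>D :: real ^ 'p ^ 'n. D $ u $ v) \<in> borel_measurable borel"
  by (intro borel_measurable_continuous_onI continuous_intros)

lemma increment_distributed:
  assumes "0 \<le> s" "s < t"
  shows "distributed M lborel (\<lambda>\<omega>. (B t \<omega> - B s \<omega>) $ u $ v) (normal_density 0 (sqrt (t - s)))"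
  using bm assms by (simp add: matrix_brownian_motion_def standard_brownian_motion_def)

lemma entry_moment:
  assumes "0 \<le> s" "s < t"
  shows "integrable M (\<lambda>\<omega>. ((B t \<omega> - B s \<omega>) $ u $ v) ^ k)"
    and "expectation (\<lambda>\<omega>. ((B t \<omega> - B s \<omega>) $ u $ v) ^ (2 * k)) = fact (2 * k) / (2 ^ k * fact k) * (t - s) ^ k"
    and "expectation (\<lambda>\<omega>. (B t \<omega> - B s \<omega>) $ u $ v) = 0"
proof -
  note d = increment_distributed[OF assms, of u v]
  have pos: "0 < sqrt (t - s)" using assms by simp
  show "integrable M (\<lambda>\<omega>. ((B t \<omega> - B s \<omega>) $ u $ v) ^ k)"
    using distributed_integrable[OF d, of "\<lambda>x. x ^ k"] integrable_normal_moment[OF pos, of 0 k] by simp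
  have "(\<integral>x. normal_density 0 (sqrt (t - s)) x * x ^ (2 * k) \<partial>lborel) = expectation (\<lambda>\<omega>. ((B t \<omega> - B s \<omega>) $ u $ v) ^ (2 * k))"
    using distributed_integral[OF d, of "\<lambda>x. x ^ (2 * k)"] by simp
  then show "expectation (\<lambda>\<omega>. ((B t \<omega> - B s \<omega>) $ u $ v) ^ (2 * k)) = fact (2 * k) / (2 ^ k * fact k) * (t - s) ^ k"
    using integral_normal_moment_even[OF pos, of 0 k] assms by (simp add: power_divide field_simps)
  have "(\<integral>x. normal_density 0 (sqrt (t - s)) x * x \<partial>lborel) = expectation (\<lambda>\<omega>. (B t \<omega> - B s \<omega>) $ u $ v)"
    using distributed_integral[OF d, of "\<lambda>x. x"] by simp
  then show "expectation (\<lambda>\<omega>. (B t \<omega> - B s \<omega>) $ u $ v) = 0"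
    using integral_normal_moment_nz_1[OF pos, of 0] by simp
qed


lemma increment_moment:
  assumes st: "0 \<le> s" "s < t"
  shows "integrable M (\<lambda>\<omega>. norm (B t \<omega> - B s \<omega>) ^ (2 * k))"
    and "expectation (\<lambda>\<omega>. norm (B t \<omega> - B s \<omega>) ^ (2 * k)) \<le> mom (CARD('n) * CARD('p)) k * (t - s) ^ k"
proof -
  let ?D = "\<lambda>\<omega>. B t \<omega> - B s \<omega>"
  have le: "norm D ^ (2 * k) \<le> real (CARD('n) * CARD('p)) ^ k * (\<Sum>(u, v)\<in>UNIV. (D $ u $ v) ^ (2 * k))" for D :: "real ^ 'p ^ 'n"
  proof -
    have "norm D ^ (2 * k) = (\<Sum>(u, v)\<in>UNIV. (D $ u $ v)\<^sup>2) ^ k"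
      unfolding power_mult norm_sq_matrix by (simp add: sum.cartesian_product)
    also have "\<dots> \<le> real (CARD('n) * CARD('p)) ^ k * (\<Sum>(u, v)\<in>UNIV. ((D $ u $ v)\<^sup>2) ^ k)"
      using sum_power_le[of "UNIV :: ('n \<times> 'p) set" "\<lambda>(u, v). (D $ u $ v)\<^sup>2" k]
      by (auto simp: case_prod_unfold)
    finally show ?thesis by (simp add: power_mult)
  qed
  have int: "integrable M (\<lambda>\<omega>. real (CARD('n) * CARD('p)) ^ k * (\<Sum>(u, v)\<in>UNIV. (?D \<omega> $ u $ v) ^ (2 * k)))"
    unfolding case_prod_unfold by (intro integrable_mult_right Bochner_Integration.integrable_sum entry_moment[OF st])
  have meas: "?D \<in> borel_measurable M" using st by (intro increment_measurable) auto
  show I: "integrable M (\<lambda>\<omega>. norm (?D \<omega>) ^ (2 * k))"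
  proof (rule integrable_dominated[OF int])
    show "(\<lambda>\<omega>. norm (?D \<omega>) ^ (2 * k)) \<in> borel_measurable M" using meas by measurable
    show "norm (norm (?D \<omega>) ^ (2 * k)) \<le> real (CARD('n) * CARD('p)) ^ k * (\<Sum>(u, v)\<in>UNIV. (?D \<omega> $ u $ v) ^ (2 * k))" for \<omega>
      using le[of "?D \<omega>"] by simp
  qed
  have "expectation (\<lambda>\<omega>. norm (?D \<omega>) ^ (2 * k)) \<le> expectation (\<lambda>\<omega>. real (CARD('n) * CARD('p)) ^ k * (\<Sum>(u, v)\<in>UNIV. (?D \<omega> $ u $ v) ^ (2 * k)))"
    by (intro integral_mono I int le)
  also have "\<dots> = real (CARD('n) * CARD('p)) ^ k * (\<Sum>(u, v)\<in>(UNIV :: ('n \<times> 'p) set). fact (2 * k) / (2 ^ k * fact k) * (t - s) ^ k)"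
    unfolding case_prod_unfold
    by (subst integral_mult_right_zero, subst Bochner_Integration.integral_sum)
      (simp_all add: entry_moment[OF st] del: vector_minus_component)
  also have "\<dots> = mom (CARD('n) * CARD('p)) k * (t - s) ^ k"
    by (simp add: mom_def)
  finally show "expectation (\<lambda>\<omega>. norm (?D \<omega>) ^ (2 * k)) \<le> mom (CARD('n) * CARD('p)) k * (t - s) ^ k" .
qed

lemma increment_cov:
  assumes st: "0 \<le> s" "s < t"
  shows "expectation (\<lambda>\<omega>. (B t \<omega> - B s \<omega>) $ u $ v * (B t \<omega> - B s \<omega>) $ u' $ v')
    = (if u = u' \<and> v = v' then t - s else 0)"
proof (cases "u = u' \<and> v = v'")
  case True
  then show ?thesis using entry_moment(2)[OF st, of u v 1] by (simp add: power2_eq_square)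
next
  case False
  have "indep_vars (\<lambda>_. PiM {0..} (\<lambda>_. borel)) (\<lambda>(u, v) \<omega>. \<lambda>t\<in>{0..}. B t \<omega> $ u $ v) UNIV"
    using bm by (simp add: matrix_brownian_motion_def)
  \<comment> \<open>The increment of an entry is a measurable function of its path, so independence
    on path space passes to increments.\<close>
  then have "indep_vars (\<lambda>_. borel) (\<lambda>q \<omega>. (\<lambda>g. g t - g s) ((\<lambda>(u, v) \<omega>. \<lambda>t\<in>{0..}. B t \<omega> $ u $ v) q \<omega>)) UNIV"
    by (rule indep_vars_compose2)
      (use st in \<open>auto intro!: borel_measurable_diff measurable_component_singleton\<close>)
  then have "indep_vars (\<lambda>_. borel) (\<lambda>(u, v) \<omega>. (B t \<omega> - B s \<omega>) $ u $ v) UNIV"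
    using st by (simp add: case_prod_unfold)
  then have ind: "indep_vars (\<lambda>_. borel) (\<lambda>(u, v) \<omega>. (B t \<omega> - B s \<omega>) $ u $ v) {(u, v), (u', v')}"
    by (rule indep_vars_subset) simp
  have "expectation (\<lambda>\<omega>. \<Prod>q\<in>{(u, v), (u', v')}. (case q of (u, v) \<Rightarrow> \<lambda>\<omega>. (B t \<omega> - B s \<omega>) $ u $ v) \<omega>)
      = (\<Prod>q\<in>{(u, v), (u', v')}. expectation (case q of (u, v) \<Rightarrow> \<lambda>\<omega>. (B t \<omega> - B s \<omega>) $ u $ v))"
    by (rule indep_vars_lebesgue_integral[OF _ ind])
      (use entry_moment(1)[OF st, of _ _ 1] in auto)
  then show ?thesis using False entry_moment(3)[OF st] by (auto simp: if_distrib)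
qed


text \<open>A discrete Ito isometry in the form of an inequality. \<open>V i\<close> is known at
  time \<open>u i\<close> and the weight is a centred function of the next increment, so the mixed
  terms vanish. A general \<open>\<psi>\<close> covers the entries of an increment as well as their
  centred products.\<close>

lemma weighted_sum_L2:
  fixes V :: "nat \<Rightarrow> 'a \<Rightarrow> 'e::euclidean_space" and u :: "nat \<Rightarrow> real"
  assumes u: "0 \<le> u 0" "\<And>i. i < N \<Longrightarrow> u i < u (Suc i)"
    and V: "\<And>i. i < N \<Longrightarrow> V i \<in> borel_measurable (F (u i))" "\<And>i. i < N \<Longrightarrow> integrable M (\<lambda>\<omega>. (norm (V i \<omega>))\<^sup>2)"
    and \<psi>: "\<And>i. i < N \<Longrightarrow> \<psi> i \<in> borel_measurable borel"
      "\<And>i. i < N \<Longrightarrow> integrable M (\<lambda>\<omega>. (\<psi> i (B (u (Suc i)) \<omega> - B (u i) \<omega>))\<^sup>2)"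
      "\<And>i. i < N \<Longrightarrow> expectation (\<lambda>\<omega>. \<psi> i (B (u (Suc i)) \<omega> - B (u i) \<omega>)) = 0"
      "\<And>i. i < N \<Longrightarrow> expectation (\<lambda>\<omega>. (\<psi> i (B (u (Suc i)) \<omega> - B (u i) \<omega>))\<^sup>2) \<le> v i"
  defines "S \<equiv> \<lambda>n \<omega>. \<Sum>i<n. \<psi> i (B (u (Suc i)) \<omega> - B (u i) \<omega>) *\<^sub>R V i \<omega>"
  shows "S N \<in> borel_measurable (F (u N)) \<and> integrable M (\<lambda>\<omega>. (norm (S N \<omega>))\<^sup>2) \<and>
    expectation (\<lambda>\<omega>. (norm (S N \<omega>))\<^sup>2) \<le> (\<Sum>i<N. v i * expectation (\<lambda>\<omega>. (norm (V i \<omega>))\<^sup>2))"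
proof -
  have upos: "n \<le> N \<Longrightarrow> 0 \<le> u n" for n
    by (induction n) (use u in \<open>auto intro: order_trans less_imp_le Suc_leD\<close>, metis Suc_le_lessD less_eq_real_def order_trans)
  have "n \<le> N \<Longrightarrow> S n \<in> borel_measurable (F (u n)) \<and> integrable M (\<lambda>\<omega>. (norm (S n \<omega>))\<^sup>2) \<and>
    expectation (\<lambda>\<omega>. (norm (S n \<omega>))\<^sup>2) \<le> (\<Sum>i<n. v i * expectation (\<lambda>\<omega>. (norm (V i \<omega>))\<^sup>2))" for n
  proof (induction n)
    case 0
    show ?case by (simp add: S_def)
  next
    case (Suc n)
    then have n: "n < N" and IH: "S n \<in> borel_measurable (F (u n))" "integrable M (\<lambda>\<omega>. (norm (S n \<omega>))\<^sup>2)"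
      "expectation (\<lambda>\<omega>. (norm (S n \<omega>))\<^sup>2) \<le> (\<Sum>i<n. v i * expectation (\<lambda>\<omega>. (norm (V i \<omega>))\<^sup>2))" by auto
    define \<phi> where "\<phi> \<omega> = \<psi> n (B (u (Suc n)) \<omega> - B (u n) \<omega>)" for \<omega>
    have st: "0 \<le> u n" "u n < u (Suc n)" using upos[of n] n u by auto
    have D: "(\<lambda>\<omega>. B (u (Suc n)) \<omega> - B (u n) \<omega>) \<in> borel_measurable (F (u (Suc n)))"
      using st by (intro increment_measurable_F) auto
    have \<phi>F: "\<phi> \<in> borel_measurable (F (u (Suc n)))"
      unfolding \<phi>_def by (rule measurable_compose[OF D \<psi>(1)[OF n]])
    have \<phi>M: "\<phi> \<in> borel_measurable M" by (rule measurable_F_M[OF \<phi>F])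
    have \<phi>2: "integrable M (\<lambda>\<omega>. (\<phi> \<omega>)\<^sup>2)" using \<psi>(2)[OF n] by (simp add: \<phi>_def)
    have \<phi>1: "integrable M \<phi>" by (rule integrable_of_sq[OF \<phi>M \<phi>2])
    have S_eq: "S (Suc n) \<omega> = S n \<omega> + \<phi> \<omega> *\<^sub>R V n \<omega>" for \<omega> by (simp add: S_def \<phi>_def)
    have VM: "V n \<in> borel_measurable M" and SM: "S n \<in> borel_measurable M"
      using V(1)[OF n] IH(1) by (auto intro: measurable_F_M)
    have meas: "S (Suc n) \<in> borel_measurable (F (u (Suc n)))"
      unfolding S_eq[abs_def] using \<phi>F measurable_F_mono[OF IH(1), of "u (Suc n)"] measurable_F_mono[OF V(1)[OF n], of "u (Suc n)"] st
      by (intro borel_measurable_add borel_measurable_scaleR) auto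
    have inner_F: "(\<lambda>\<omega>. S n \<omega> \<bullet> V n \<omega>) \<in> borel_measurable (F (u n))"
      using IH(1) V(1)[OF n] by (rule borel_measurable_inner)
    have V2F: "(\<lambda>\<omega>. (norm (V n \<omega>))\<^sup>2) \<in> borel_measurable (F (u n))"
      using V(1)[OF n] by measurable
    \<comment> \<open>The inner product is known at time \<open>u n\<close> and square integrability
      makes it integrable, so it splits off from the centred weight.\<close>
    have cross: "integrable M (\<lambda>\<omega>. (S n \<omega> \<bullet> V n \<omega>) * \<phi> \<omega>)" "expectation (\<lambda>\<omega>. (S n \<omega> \<bullet> V n \<omega>) * \<phi> \<omega>) = 0"
      using increment_integral[OF st inner_F \<psi>(1)[OF n] integrable_inner[OF SM VM IH(2) V(2)[OF n]]] \<phi>1 \<psi>(3)[OF n]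
      unfolding \<phi>_def by auto
    have \<psi>2: "(\<lambda>D. (\<psi> n D)\<^sup>2) \<in> borel_measurable borel" using \<psi>(1)[OF n] by measurable
    have sq: "integrable M (\<lambda>\<omega>. (norm (V n \<omega>))\<^sup>2 * (\<phi> \<omega>)\<^sup>2)"
      "expectation (\<lambda>\<omega>. (norm (V n \<omega>))\<^sup>2 * (\<phi> \<omega>)\<^sup>2) = expectation (\<lambda>\<omega>. (norm (V n \<omega>))\<^sup>2) * expectation (\<lambda>\<omega>. (\<phi> \<omega>)\<^sup>2)"
      using increment_integral[OF st V2F \<psi>2 V(2)[OF n] \<psi>(2)[OF n]] unfolding \<phi>_def by auto
    have exp: "(norm (S (Suc n) \<omega>))\<^sup>2 = (norm (S n \<omega>))\<^sup>2 + 2 * ((S n \<omega> \<bullet> V n \<omega>) * \<phi> \<omega>) + (norm (V n \<omega>))\<^sup>2 * (\<phi> \<omega>)\<^sup>2" for \<omega>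
      unfolding S_eq power2_norm_eq_inner
      by (simp add: inner_add_left inner_add_right inner_commute power2_eq_square algebra_simps)
    have "expectation (\<lambda>\<omega>. (norm (S (Suc n) \<omega>))\<^sup>2) = expectation (\<lambda>\<omega>. (norm (S n \<omega>))\<^sup>2)
        + expectation (\<lambda>\<omega>. (norm (V n \<omega>))\<^sup>2) * expectation (\<lambda>\<omega>. (\<phi> \<omega>)\<^sup>2)"
      unfolding exp using IH(2) cross sq by simp
    also have "\<dots> \<le> (\<Sum>i<n. v i * expectation (\<lambda>\<omega>. (norm (V i \<omega>))\<^sup>2)) + expectation (\<lambda>\<omega>. (norm (V n \<omega>))\<^sup>2) * v n"
      using \<psi>(4)[OF n] unfolding \<phi>_def by (intro add_mono IH(3) mult_left_mono) auto
    finally have "expectation (\<lambda>\<omega>. (norm (S (Suc n) \<omega>))\<^sup>2) \<le> (\<Sum>i<Suc n. v i * expectation (\<lambda>\<omega>. (norm (V i \<omega>))\<^sup>2))"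
      by (simp add: mult.commute)
    moreover have "integrable M (\<lambda>\<omega>. (norm (S (Suc n) \<omega>))\<^sup>2)"
      unfolding exp using IH(2) cross(1) sq(1) by auto
    ultimately show ?case using meas by simp
  qed
  then show ?thesis by simp
qed

text \<open>One factor \<open>card Q\<close> comes from Cauchy-Schwarz over \<open>Q\<close>, the
  other from adding \<open>card Q\<close> equal bounds.\<close>

lemma weighted_sum_family_L2:
  fixes V :: "'q \<Rightarrow> nat \<Rightarrow> 'a \<Rightarrow> 'e::euclidean_space" and u :: "nat \<Rightarrow> real"
  assumes u: "0 \<le> u 0" "\<And>i. i < N \<Longrightarrow> u i < u (Suc i)"
    and V: "\<And>q i. q \<in> Q \<Longrightarrow> i < N \<Longrightarrow> V q i \<in> borel_measurable (F (u i))"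
      "\<And>q i \<omega>. q \<in> Q \<Longrightarrow> i < N \<Longrightarrow> norm (V q i \<omega>) \<le> g i \<omega>" "\<And>i. i < N \<Longrightarrow> integrable M (\<lambda>\<omega>. (g i \<omega>)\<^sup>2)"
    and \<psi>: "\<And>q i. q \<in> Q \<Longrightarrow> i < N \<Longrightarrow> \<psi> q i \<in> borel_measurable borel"
      "\<And>q i. q \<in> Q \<Longrightarrow> i < N \<Longrightarrow> integrable M (\<lambda>\<omega>. (\<psi> q i (B (u (Suc i)) \<omega> - B (u i) \<omega>))\<^sup>2)"
      "\<And>q i. q \<in> Q \<Longrightarrow> i < N \<Longrightarrow> expectation (\<lambda>\<omega>. \<psi> q i (B (u (Suc i)) \<omega> - B (u i) \<omega>)) = 0"
      "\<And>q i. q \<in> Q \<Longrightarrow> i < N \<Longrightarrow> expectation (\<lambda>\<omega>. (\<psi> q i (B (u (Suc i)) \<omega> - B (u i) \<omega>))\<^sup>2) \<le> v i"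
    and S: "\<And>\<omega>. S \<omega> = (\<Sum>i<N. \<Sum>q\<in>Q. \<psi> q i (B (u (Suc i)) \<omega> - B (u i) \<omega>) *\<^sub>R V q i \<omega>)"
  shows "S \<in> borel_measurable (F (u N))" and "integrable M (\<lambda>\<omega>. (norm (S \<omega>))\<^sup>2)"
    and "expectation (\<lambda>\<omega>. (norm (S \<omega>))\<^sup>2) \<le> (card Q)\<^sup>2 * (\<Sum>i<N. v i * expectation (\<lambda>\<omega>. (g i \<omega>)\<^sup>2))"
proof -
  define Sq where "Sq q \<omega> = (\<Sum>i<N. \<psi> q i (B (u (Suc i)) \<omega> - B (u i) \<omega>) *\<^sub>R V q i \<omega>)" for q \<omega>
  have S': "S = (\<lambda>\<omega>. \<Sum>q\<in>Q. Sq q \<omega>)" unfolding S Sq_def by (rule ext, rule sum.swap)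
  have VM: "V q i \<in> borel_measurable M" if "q \<in> Q" "i < N" for q i
    using V(1)[OF that] by (rule measurable_F_M)
  have V2: "integrable M (\<lambda>\<omega>. (norm (V q i \<omega>))\<^sup>2)" if "q \<in> Q" "i < N" for q i
  proof (rule Bochner_Integration.integrable_bound[OF V(3)[OF that(2)]])
    show "(\<lambda>\<omega>. (norm (V q i \<omega>))\<^sup>2) \<in> borel_measurable M" using VM[OF that] by measurable
    show "AE \<omega> in M. norm ((norm (V q i \<omega>))\<^sup>2) \<le> norm ((g i \<omega>)\<^sup>2)"
      using V(2)[OF that] by (auto intro!: AE_I2 power_mono)
  qed
  have Vg: "expectation (\<lambda>\<omega>. (norm (V q i \<omega>))\<^sup>2) \<le> expectation (\<lambda>\<omega>. (g i \<omega>)\<^sup>2)" if "q \<in> Q" "i < N" for q i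
    using V(2)[OF that] by (intro integral_mono V2 V(3) that power_mono) auto
  have v: "0 \<le> v i" if "q \<in> Q" "i < N" for q i
    by (rule order_trans[OF _ \<psi>(4)[OF that]]) simp
  have *: "Sq q \<in> borel_measurable (F (u N)) \<and> integrable M (\<lambda>\<omega>. (norm (Sq q \<omega>))\<^sup>2) \<and>
    expectation (\<lambda>\<omega>. (norm (Sq q \<omega>))\<^sup>2) \<le> (\<Sum>i<N. v i * expectation (\<lambda>\<omega>. (norm (V q i \<omega>))\<^sup>2))" if "q \<in> Q" for q
    unfolding Sq_def by (rule weighted_sum_L2) (use that u V(1) V2 \<psi> in auto)
  show SF: "S \<in> borel_measurable (F (u N))" unfolding S' using * by (intro borel_measurable_sum) auto
  have le: "(norm (S \<omega>))\<^sup>2 \<le> real (card Q) * (\<Sum>q\<in>Q. (norm (Sq q \<omega>))\<^sup>2)" for \<omega>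
    unfolding S' by (rule norm_sum_sq_le)
  have int: "integrable M (\<lambda>\<omega>. real (card Q) * (\<Sum>q\<in>Q. (norm (Sq q \<omega>))\<^sup>2))"
    using * by (intro integrable_mult_right Bochner_Integration.integrable_sum) auto
  show I: "integrable M (\<lambda>\<omega>. (norm (S \<omega>))\<^sup>2)"
  proof (rule Bochner_Integration.integrable_bound[OF int])
    show "(\<lambda>\<omega>. (norm (S \<omega>))\<^sup>2) \<in> borel_measurable M" using measurable_F_M[OF SF] by measurable
    show "AE \<omega> in M. norm ((norm (S \<omega>))\<^sup>2) \<le> norm (real (card Q) * (\<Sum>q\<in>Q. (norm (Sq q \<omega>))\<^sup>2))"
      using le by (auto intro!: AE_I2 order_trans[OF _ abs_ge_self])
  qed
  have "expectation (\<lambda>\<omega>. (norm (S \<omega>))\<^sup>2) \<le> expectation (\<lambda>\<omega>. real (card Q) * (\<Sum>q\<in>Q. (norm (Sq q \<omega>))\<^sup>2))"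
    by (intro integral_mono I int le)
  also have "\<dots> = real (card Q) * (\<Sum>q\<in>Q. expectation (\<lambda>\<omega>. (norm (Sq q \<omega>))\<^sup>2))"
    by (subst integral_mult_right_zero, subst Bochner_Integration.integral_sum) (use * in auto)
  also have "\<dots> \<le> real (card Q) * (\<Sum>q\<in>Q. \<Sum>i<N. v i * expectation (\<lambda>\<omega>. (g i \<omega>)\<^sup>2))"
  proof (intro mult_left_mono sum_mono)
    fix q assume q: "q \<in> Q"
    have "expectation (\<lambda>\<omega>. (norm (Sq q \<omega>))\<^sup>2) \<le> (\<Sum>i<N. v i * expectation (\<lambda>\<omega>. (norm (V q i \<omega>))\<^sup>2))" using * q by auto
    also have "\<dots> \<le> (\<Sum>i<N. v i * expectation (\<lambda>\<omega>. (g i \<omega>)\<^sup>2))"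
      using Vg v q by (intro sum_mono mult_left_mono) auto
    finally show "expectation (\<lambda>\<omega>. (norm (Sq q \<omega>))\<^sup>2) \<le> (\<Sum>i<N. v i * expectation (\<lambda>\<omega>. (g i \<omega>)\<^sup>2))" .
  qed simp
  finally show "expectation (\<lambda>\<omega>. (norm (S \<omega>))\<^sup>2) \<le> (card Q)\<^sup>2 * (\<Sum>i<N. v i * expectation (\<lambda>\<omega>. (g i \<omega>)\<^sup>2))"
    by (simp add: power2_eq_square)
qed

text \<open>The weights are the single entries of an increment, with mean 0 and variance
  \<open>u (Suc i) - u i\<close>.\<close>

lemma linear_sum_L2:
  fixes L :: "nat \<Rightarrow> 'a \<Rightarrow> real ^ 'p ^ 'n \<Rightarrow> 'e::euclidean_space" and u :: "nat \<Rightarrow> real"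
  assumes u: "0 \<le> u 0" "\<And>i. i < N \<Longrightarrow> u i < u (Suc i)"
    and L: "\<And>i \<omega>. i < N \<Longrightarrow> linear (L i \<omega>)"
      "\<And>i a b. i < N \<Longrightarrow> (\<lambda>\<omega>. L i \<omega> (unit_mat a b)) \<in> borel_measurable (F (u i))"
      "\<And>i \<omega> D. i < N \<Longrightarrow> norm (L i \<omega> D) \<le> g i \<omega> * norm D" "\<And>i. i < N \<Longrightarrow> integrable M (\<lambda>\<omega>. (g i \<omega>)\<^sup>2)"
    and S: "\<And>\<omega>. S \<omega> = (\<Sum>i<N. L i \<omega> (B (u (Suc i)) \<omega> - B (u i) \<omega>))"
  shows "S \<in> borel_measurable (F (u N))" and "integrable M (\<lambda>\<omega>. (norm (S \<omega>))\<^sup>2)"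
    and "expectation (\<lambda>\<omega>. (norm (S \<omega>))\<^sup>2)
      \<le> (real (CARD('n) * CARD('p)))\<^sup>2 * (\<Sum>i<N. (u (Suc i) - u i) * expectation (\<lambda>\<omega>. (g i \<omega>)\<^sup>2))"
proof -
  have upos: "n \<le> N \<Longrightarrow> 0 \<le> u n" for n
    by (induction n) (use u in \<open>auto intro: order_trans less_imp_le Suc_leD\<close>, metis Suc_le_lessD less_eq_real_def order_trans)
  have st: "0 \<le> u i" "u i < u (Suc i)" if "i < N" for i using upos[of i] u that by auto
  have g: "norm (L i \<omega> (unit_mat a b)) \<le> g i \<omega>" if "i < N" for i \<omega> a b using L(3)[OF that, of \<omega> "unit_mat a b"] by simp
  have S2: "S \<omega> = (\<Sum>i<N. \<Sum>q\<in>UNIV. (B (u (Suc i)) \<omega> - B (u i) \<omega>) $ fst q $ snd q *\<^sub>R L i \<omega> (unit_mat (fst q) (snd q)))" for \<omega>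
    unfolding S using L(1)
    by (intro sum.cong refl, subst linear_unit_expansion) (simp_all add: sum.cartesian_product case_prod_unfold)
  note * = weighted_sum_family_L2[where Q="UNIV :: ('n \<times> 'p) set" and \<psi>="\<lambda>q i D. D $ fst q $ snd q" and V="\<lambda>q i \<omega>. L i \<omega> (unit_mat (fst q) (snd q))"
      and v="\<lambda>i. u (Suc i) - u i", OF u L(2) g L(4) component_measurable entry_moment(1)[OF st] entry_moment(3)[OF st] _ S2]
  have **: "expectation (\<lambda>\<omega>. ((B (u (Suc i)) \<omega> - B (u i) \<omega>) $ a $ b)\<^sup>2) \<le> u (Suc i) - u i" if "i < N" for i a b
    using entry_moment(2)[OF st[OF that], of a b 1] by simp
  show "S \<in> borel_measurable (F (u N))" "integrable M (\<lambda>\<omega>. (norm (S \<omega>))\<^sup>2)"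
    using *(1,2) ** by auto
  show "expectation (\<lambda>\<omega>. (norm (S \<omega>))\<^sup>2)
      \<le> (real (CARD('n) * CARD('p)))\<^sup>2 * (\<Sum>i<N. (u (Suc i) - u i) * expectation (\<lambda>\<omega>. (g i \<omega>)\<^sup>2))"
    using *(3) ** by simp
qed

text \<open>The products of two entries of an increment are centred by their covariance, and this is
  what the subtracted sum over unit matrices amounts to. The index set consists of pairs of entries,
  whence the fourth power; the variances are bounded by fourth moments.\<close>

lemma quadratic_sum_L2:
  fixes b :: "nat \<Rightarrow> 'a \<Rightarrow> real ^ 'p ^ 'n \<Rightarrow> real ^ 'p ^ 'n \<Rightarrow> 'e::euclidean_space" and u :: "nat \<Rightarrow> real"
  assumes u: "0 \<le> u 0" "\<And>i. i < N \<Longrightarrow> u i < u (Suc i)"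
    and b: "\<And>i \<omega> D. i < N \<Longrightarrow> linear (b i \<omega> D)" "\<And>i \<omega> D. i < N \<Longrightarrow> linear (\<lambda>E. b i \<omega> E D)"
      "\<And>i k l k' l'. i < N \<Longrightarrow> (\<lambda>\<omega>. b i \<omega> (unit_mat k l) (unit_mat k' l')) \<in> borel_measurable (F (u i))"
      "\<And>i \<omega> D E. i < N \<Longrightarrow> norm (b i \<omega> D E) \<le> g i \<omega> * norm D * norm E" "\<And>i. i < N \<Longrightarrow> integrable M (\<lambda>\<omega>. (g i \<omega>)\<^sup>2)"
    and S: "\<And>\<omega>. S \<omega> = (\<Sum>i<N. b i \<omega> (B (u (Suc i)) \<omega> - B (u i) \<omega>) (B (u (Suc i)) \<omega> - B (u i) \<omega>)
      - (u (Suc i) - u i) *\<^sub>R (\<Sum>k\<in>UNIV. \<Sum>l\<in>UNIV. b i \<omega> (unit_mat k l) (unit_mat k l)))"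
  shows "S \<in> borel_measurable (F (u N))" and "integrable M (\<lambda>\<omega>. (norm (S \<omega>))\<^sup>2)"
    and "expectation (\<lambda>\<omega>. (norm (S \<omega>))\<^sup>2)
      \<le> (real (CARD('n) * CARD('p))) ^ 4 * mom (CARD('n) * CARD('p)) 2 * (\<Sum>i<N. (u (Suc i) - u i)\<^sup>2 * expectation (\<lambda>\<omega>. (g i \<omega>)\<^sup>2))"
proof -
  have upos: "n \<le> N \<Longrightarrow> 0 \<le> u n" for n
    by (induction n) (use u in \<open>auto intro: order_trans less_imp_le Suc_leD\<close>, metis Suc_le_lessD less_eq_real_def order_trans)
  have st: "0 \<le> u i" "u i < u (Suc i)" if "i < N" for i using upos[of i] u that by auto
  have g: "norm (b i \<omega> (unit_mat k l) (unit_mat k' l')) \<le> g i \<omega>" if "i < N" for i \<omega> k l k' l'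
    using b(4)[OF that, of \<omega> "unit_mat k l" "unit_mat k' l'"] by simp
  let ?\<psi> = "\<lambda>q i (D :: real ^ 'p ^ 'n). D $ fst (fst q) $ snd (fst q) * D $ fst (snd q) $ snd (snd q)
      - (if fst q = snd q then u (Suc i) - u i else 0)"
  let ?D = "\<lambda>i \<omega>. B (u (Suc i)) \<omega> - B (u i) \<omega>"
  have S2: "S \<omega> = (\<Sum>i<N. \<Sum>q\<in>UNIV. ?\<psi> q i (?D i \<omega>) *\<^sub>R b i \<omega> (unit_mat (fst (fst q)) (snd (fst q))) (unit_mat (fst (snd q)) (snd (snd q))))" for \<omega>
    unfolding S
  proof (intro sum.cong refl)
    fix i assume "i \<in> {..<N}"
    then have i: "i < N" by simp
    have lin1: "b i \<omega> D E = (\<Sum>q\<in>UNIV. D $ fst q $ snd q *\<^sub>R b i \<omega> (unit_mat (fst q) (snd q)) E)" for D E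
      using linear_unit_expansion[OF b(2)[OF i, of \<omega> E], of D] by (simp add: sum.cartesian_product case_prod_unfold)
    have lin2: "b i \<omega> D E = (\<Sum>q\<in>UNIV. E $ fst q $ snd q *\<^sub>R b i \<omega> D (unit_mat (fst q) (snd q)))" for D E
      using linear_unit_expansion[OF b(1)[OF i, of \<omega> D], of E] by (simp add: sum.cartesian_product case_prod_unfold)
    let ?c = "\<lambda>q q'. b i \<omega> (unit_mat (fst q) (snd q)) (unit_mat (fst q') (snd q'))"
    have "b i \<omega> (?D i \<omega>) (?D i \<omega>) = (\<Sum>q\<in>UNIV. \<Sum>q'\<in>UNIV. (?D i \<omega> $ fst q $ snd q * ?D i \<omega> $ fst q' $ snd q') *\<^sub>R ?c q q')"
      by (subst lin1, subst lin2) (simp add: scaleR_sum_right)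
    moreover have "(u (Suc i) - u i) *\<^sub>R (\<Sum>k\<in>UNIV. \<Sum>l\<in>UNIV. b i \<omega> (unit_mat k l) (unit_mat k l))
        = (\<Sum>q\<in>UNIV. \<Sum>q'\<in>UNIV. (if q = q' then u (Suc i) - u i else 0) *\<^sub>R ?c q q')"
      by (simp add: sum.cartesian_product case_prod_unfold scaleR_sum_right if_distrib[of "\<lambda>c. c *\<^sub>R _"] cong: if_cong)
    ultimately have "b i \<omega> (?D i \<omega>) (?D i \<omega>) - (u (Suc i) - u i) *\<^sub>R (\<Sum>k\<in>UNIV. \<Sum>l\<in>UNIV. b i \<omega> (unit_mat k l) (unit_mat k l))
        = (\<Sum>q\<in>UNIV. \<Sum>q'\<in>UNIV. ?\<psi> (q, q') i (?D i \<omega>) *\<^sub>R ?c q q')"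
      by (simp only: sum_subtractf[symmetric] scaleR_diff_left fst_conv snd_conv)
    then show "b i \<omega> (?D i \<omega>) (?D i \<omega>) - (u (Suc i) - u i) *\<^sub>R (\<Sum>k\<in>UNIV. \<Sum>l\<in>UNIV. b i \<omega> (unit_mat k l) (unit_mat k l))
        = (\<Sum>q\<in>UNIV. ?\<psi> q i (?D i \<omega>) *\<^sub>R b i \<omega> (unit_mat (fst (fst q)) (snd (fst q))) (unit_mat (fst (snd q)) (snd (snd q))))"
      unfolding sum.cartesian_product by (simp add: case_prod_unfold)
  qed
  have DM: "?D i \<in> borel_measurable M" if "i < N" for i using st[OF that] by (intro increment_measurable) auto
  have prod2: "(?D i \<omega> $ k $ l * ?D i \<omega> $ k' $ l')\<^sup>2 \<le> norm (?D i \<omega>) ^ 4" for i \<omega> k l k' l'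
  proof -
    have "\<bar>?D i \<omega> $ k $ l * ?D i \<omega> $ k' $ l'\<bar> \<le> norm (?D i \<omega>) * norm (?D i \<omega>)"
      unfolding abs_mult by (intro mult_mono abs_component_le_norm) auto
    then have "\<bar>?D i \<omega> $ k $ l * ?D i \<omega> $ k' $ l'\<bar>\<^sup>2 \<le> (norm (?D i \<omega>) * norm (?D i \<omega>))\<^sup>2" by (rule power_mono) simp
    also have "\<dots> = norm (?D i \<omega>) ^ 4" by (simp add: power2_eq_square eval_nat_numeral)
    finally show ?thesis by simp
  qed
  have int4: "integrable M (\<lambda>\<omega>. norm (?D i \<omega>) ^ 4)" if "i < N" for i
    using increment_moment(1)[OF st[OF that], of 2] by simp
  have intZ2: "integrable M (\<lambda>\<omega>. (?D i \<omega> $ k $ l * ?D i \<omega> $ k' $ l')\<^sup>2)" if "i < N" for i k l k' l'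
  proof (rule integrable_dominated[OF int4[OF that]])
    show "(\<lambda>\<omega>. (?D i \<omega> $ k $ l * ?D i \<omega> $ k' $ l')\<^sup>2) \<in> borel_measurable M"
      by (intro borel_measurable_power borel_measurable_times measurable_compose[OF DM[OF that]] component_measurable)
    show "norm ((?D i \<omega> $ k $ l * ?D i \<omega> $ k' $ l')\<^sup>2) \<le> norm (?D i \<omega>) ^ 4" for \<omega>
      using prod2[of i \<omega> k l k' l'] by simp
  qed
  have intZ: "integrable M (\<lambda>\<omega>. ?D i \<omega> $ k $ l * ?D i \<omega> $ k' $ l')" if "i < N" for i k l k' l'
    by (rule integrable_of_sq[OF _ intZ2[OF that]])
      (intro borel_measurable_times measurable_compose[OF DM[OF that]] component_measurable)
  have eq2: "(?\<psi> q i (?D i \<omega>))\<^sup>2 = (?D i \<omega> $ fst (fst q) $ snd (fst q) * ?D i \<omega> $ fst (snd q) $ snd (snd q))\<^sup>2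
      - 2 * (if fst q = snd q then u (Suc i) - u i else 0) * (?D i \<omega> $ fst (fst q) $ snd (fst q) * ?D i \<omega> $ fst (snd q) $ snd (snd q))
      + (if fst q = snd q then u (Suc i) - u i else 0)\<^sup>2" for q i \<omega>
    by (simp only: power2_diff) simp
  have cov: "expectation (\<lambda>\<omega>. ?D i \<omega> $ fst (fst q) $ snd (fst q) * ?D i \<omega> $ fst (snd q) $ snd (snd q))
      = (if fst q = snd q then u (Suc i) - u i else 0)" if "i < N" for i and q :: "('n \<times> 'p) \<times> ('n \<times> 'p)"
    using increment_cov[OF st[OF that], of "fst (fst q)" "snd (fst q)" "fst (snd q)" "snd (snd q)"] by (simp add: prod_eq_iff)
  have p1: "?\<psi> q i \<in> borel_measurable borel" for q i
    by (intro borel_measurable_diff borel_measurable_times component_measurable) simp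
  have p2: "integrable M (\<lambda>\<omega>. (?\<psi> q i (?D i \<omega>))\<^sup>2)" if "i < N" for q i
    unfolding eq2 using intZ2[OF that] intZ[OF that] by auto
  have p3: "expectation (\<lambda>\<omega>. ?\<psi> q i (?D i \<omega>)) = 0" if "i < N" for q i
    using cov[OF that, of q] intZ[OF that] by (simp add: prob_space)
  \<comment> \<open>Variance at most second moment, which for a product of two entries is at most
    the fourth moment of the norm.\<close>
  have p4: "expectation (\<lambda>\<omega>. (?\<psi> q i (?D i \<omega>))\<^sup>2) \<le> mom (CARD('n) * CARD('p)) 2 * (u (Suc i) - u i)\<^sup>2" if "i < N" for q i
  proof -
    let ?Z = "\<lambda>\<omega>. ?D i \<omega> $ fst (fst q) $ snd (fst q) * ?D i \<omega> $ fst (snd q) $ snd (snd q)"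
    let ?c = "if fst q = snd q then u (Suc i) - u i else 0"
    have "expectation (\<lambda>\<omega>. (?\<psi> q i (?D i \<omega>))\<^sup>2) = expectation (\<lambda>\<omega>. (?Z \<omega>)\<^sup>2) - 2 * ?c * expectation ?Z + ?c\<^sup>2"
      unfolding eq2 using intZ2[OF that] intZ[OF that] by (simp add: prob_space)
    also have "\<dots> = expectation (\<lambda>\<omega>. (?Z \<omega>)\<^sup>2) - ?c\<^sup>2" using cov[OF that, of q] by (simp add: power2_eq_square)
    also have "\<dots> \<le> expectation (\<lambda>\<omega>. (?Z \<omega>)\<^sup>2)" by simp
    also have "\<dots> \<le> expectation (\<lambda>\<omega>. norm (?D i \<omega>) ^ 4)"
      by (intro integral_mono intZ2 int4 that prod2)
    also have "\<dots> \<le> mom (CARD('n) * CARD('p)) 2 * (u (Suc i) - u i)\<^sup>2"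
      using increment_moment(2)[OF st[OF that], of 2] by simp
    finally show ?thesis .
  qed
  note * = weighted_sum_family_L2[where Q="UNIV :: (('n \<times> 'p) \<times> ('n \<times> 'p)) set" and \<psi>="?\<psi>"
      and V="\<lambda>q i \<omega>. b i \<omega> (unit_mat (fst (fst q)) (snd (fst q))) (unit_mat (fst (snd q)) (snd (snd q)))"
      and v="\<lambda>i. mom (CARD('n) * CARD('p)) 2 * (u (Suc i) - u i)\<^sup>2", OF u b(3) g b(5) p1 p2 p3 p4 S2]
  show "S \<in> borel_measurable (F (u N))" "integrable M (\<lambda>\<omega>. (norm (S \<omega>))\<^sup>2)"
    using *(1,2) by auto
  show "expectation (\<lambda>\<omega>. (norm (S \<omega>))\<^sup>2)
      \<le> (real (CARD('n) * CARD('p))) ^ 4 * mom (CARD('n) * CARD('p)) 2 * (\<Sum>i<N. (u (Suc i) - u i)\<^sup>2 * expectation (\<lambda>\<omega>. (g i \<omega>)\<^sup>2))"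
    using *(3) by (simp add: sum_distrib_left mult_ac power2_eq_square eval_nat_numeral)
qed

end

section \<open>Grids\<close>

lemma discrete_gronwall:
  fixes a h :: "nat \<Rightarrow> real"
  assumes a: "\<And>j. j \<le> N \<Longrightarrow> a j \<le> b + c * (\<Sum>i<j. h i * a i)"
    and h: "\<And>i. i < N \<Longrightarrow> 0 \<le> h i" and "0 \<le> c" and j: "j \<le> N"
    and b: "0 \<le> b"
  shows "a j \<le> b * exp (c * (\<Sum>i<j. h i))"
proof -
  \<comment> \<open>The induction runs on the upper bound instead of on \<open>a\<close>; the
    hypothesis then transfers the result to \<open>a\<close>.\<close>
  have "j \<le> N \<Longrightarrow> b + c * (\<Sum>i<j. h i * a i) \<le> b * exp (c * (\<Sum>i<j. h i))" for j
  proof (induction j)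
    case (Suc j)
    let ?Z = "b + c * (\<Sum>i<j. h i * a i)" and ?X = "b * exp (c * (\<Sum>i<j. h i))"
    have hj: "0 \<le> c * h j" using h[of j] Suc.prems \<open>0 \<le> c\<close> by simp
    have "b + c * (\<Sum>i<Suc j. h i * a i) = ?Z + c * h j * a j" by (simp add: algebra_simps)
    also have "\<dots> \<le> ?X + c * h j * ?X"
      using Suc a[of j] hj by (intro add_mono mult_left_mono) auto
    also have "\<dots> = ?X * (1 + c * h j)" by (simp add: algebra_simps)
    also have "\<dots> \<le> ?X * exp (c * h j)"
      using b by (intro mult_left_mono exp_ge_add_one_self) auto
    also have "\<dots> = b * exp (c * (\<Sum>i<Suc j. h i))" by (simp add: exp_add ring_distribs)
    finally show ?case .
  qed simp
  from this[OF j] a[OF j] show ?thesis by simp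
qed

text \<open>Cauchy-Schwarz with the step sizes as weights. It costs the length of the interval
  instead of the number of steps, so summands of mean square order h^3 add up to the order of the
  mesh.\<close>

lemma norm_sum_weighted_le:
  fixes s :: "nat \<Rightarrow> 'e::real_normed_vector"
  assumes "\<And>i. i < N \<Longrightarrow> 0 < h i"
  shows "(norm (\<Sum>i<N. s i))\<^sup>2 \<le> (\<Sum>i<N. h i) * (\<Sum>i<N. (norm (s i))\<^sup>2 / h i)"
proof -
  have "(norm (\<Sum>i<N. s i))\<^sup>2 \<le> (\<Sum>i<N. norm (s i))\<^sup>2"
    by (intro power_mono norm_sum) simp
  also have "(\<Sum>i<N. norm (s i)) = (\<Sum>i<N. sqrt (h i) * (norm (s i) / sqrt (h i)))"
    using assms by (intro sum.cong refl) (simp add: less_imp_neq[symmetric])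
  also have "\<dots>\<^sup>2 \<le> (\<Sum>i<N. (sqrt (h i))\<^sup>2) * (\<Sum>i<N. (norm (s i) / sqrt (h i))\<^sup>2)"
    by (rule Cauchy_Schwarz_ineq_sum)
  also have "\<dots> = (\<Sum>i<N. h i) * (\<Sum>i<N. (norm (s i))\<^sup>2 / h i)"
    using assms by (intro arg_cong2[of _ _ _ _ "(*)"] sum.cong refl) (auto simp: power_divide less_imp_le)
  finally show ?thesis .
qed

lemma norm_sum_step_le:
  fixes v :: "nat \<Rightarrow> 'e::real_normed_vector"
  assumes "\<And>i. i < N \<Longrightarrow> 0 < h i"
  shows "(norm (\<Sum>i<N. h i *\<^sub>R v i))\<^sup>2 \<le> (\<Sum>i<N. h i) * (\<Sum>i<N. h i * (norm (v i))\<^sup>2)"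
proof -
  have "(\<Sum>i<N. (norm (h i *\<^sub>R v i))\<^sup>2 / h i) = (\<Sum>i<N. h i * (norm (v i))\<^sup>2)"
  proof (intro sum.cong refl)
    fix i assume "i \<in> {..<N}"
    then have "0 < h i" using assms by simp
    then show "(norm (h i *\<^sub>R v i))\<^sup>2 / h i = h i * (norm (v i))\<^sup>2" by (simp add: power2_eq_square)
  qed
  then show ?thesis using norm_sum_weighted_le[of N h "\<lambda>i. h i *\<^sub>R v i"] assms by simp
qed

lemma time_grid_step: "time_grid a b K \<tau> \<Longrightarrow> i < K \<Longrightarrow> \<tau> i < \<tau> (Suc i)"
  by (simp add: time_grid_def)

lemma time_grid_mono:
  assumes "time_grid a b K \<tau>" "i \<le> j" "j \<le> K"
  shows "\<tau> i \<le> \<tau> j"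
  using assms(2,3)
proof (induction j)
  case (Suc j)
  show ?case
  proof (cases "i = Suc j")
    case False
    then show ?thesis using Suc time_grid_step[OF assms(1), of j] by auto
  qed simp
qed simp

lemma time_grid_bounds:
  assumes "time_grid a b K \<tau>" "i \<le> K"
  shows "a \<le> \<tau> i" "\<tau> i \<le> b"
  using time_grid_mono[OF assms(1), of 0 i] time_grid_mono[OF assms(1), of i K] assms
  by (auto simp: time_grid_def)

lemma time_grid_prefix: "time_grid a b K \<tau> \<Longrightarrow> j \<le> K \<Longrightarrow> time_grid a (\<tau> j) j \<tau>"
  by (auto simp: time_grid_def)

lemma sum_steps: "(\<Sum>i<j. \<tau> (Suc i) - \<tau> i) = \<tau> j - (\<tau> 0 :: real)"
  by (rule sum_lessThan_telescope)

lemma step_le_mesh: "k < K \<Longrightarrow> \<tau> (Suc k) - \<tau> k \<le> mesh K \<tau>"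
  unfolding mesh_def by (intro Max_ge) auto

lemma mesh_less: "0 < d \<Longrightarrow> (\<And>k. k < K \<Longrightarrow> \<tau> (Suc k) - \<tau> k < d) \<Longrightarrow> mesh K \<tau> < d"
  unfolding mesh_def by (subst Max_less_iff) auto

text \<open>Dyadic refinement in one formula: an even index returns a point of
  \<open>\<tau>\<close>, an odd index the midpoint of two neighbours. A coarse node \<open>k\<close>
  therefore reappears at index \<open>k * 2 ^ r\<close>, and blocks are handled by
  \<open>div\<close> and \<open>mod\<close>.\<close>

definition refine :: "(nat \<Rightarrow> real) \<Rightarrow> nat \<Rightarrow> real" where
  "refine \<tau> i = (\<tau> (i div 2) + \<tau> ((i + 1) div 2)) / 2"

primrec subgrid :: "(nat \<Rightarrow> real) \<Rightarrow> nat \<Rightarrow> nat \<Rightarrow> real" where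
  "subgrid \<tau> 0 = \<tau>"
| "subgrid \<tau> (Suc m) = refine (subgrid \<tau> m)"

lemma subgrid_subgrid: "subgrid (subgrid \<tau> l) r = subgrid \<tau> (l + r)"
  by (induction r) auto

lemma subgrid_mult: "subgrid \<tau> r (k * 2 ^ r) = \<tau> k"
proof (induction r)
  case (Suc r)
  have "(k * 2 ^ Suc r) div 2 = k * 2 ^ r" "(k * 2 ^ Suc r + 1) div 2 = k * 2 ^ r" by auto
  then show ?case using Suc by (simp only: subgrid.simps refine_def) simp
qed simp

lemma refine_step: "refine \<tau> (Suc i) - refine \<tau> i = (\<tau> (Suc (i div 2)) - \<tau> (i div 2)) / 2"
proof (cases "even i")
  case True
  then have "Suc i div 2 = i div 2" "Suc (Suc i) div 2 = Suc (i div 2)" by auto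
  then show ?thesis by (simp add: refine_def field_simps)
next
  case False
  then have "Suc i div 2 = Suc (i div 2)" "Suc (Suc i) div 2 = Suc (i div 2)" by auto
  then show ?thesis by (simp add: refine_def field_simps)
qed

lemma subgrid_step: "subgrid \<tau> r (Suc i) - subgrid \<tau> r i = (\<tau> (Suc (i div 2 ^ r)) - \<tau> (i div 2 ^ r)) / 2 ^ r"
proof (induction r arbitrary: i)
  case (Suc r)
  show ?case unfolding subgrid.simps refine_step Suc by (simp add: div_mult2_eq[symmetric] mult.commute)
qed simp

lemma time_grid_subgrid:
  assumes "time_grid a b K \<tau>"
  shows "time_grid a b (K * 2 ^ r) (subgrid \<tau> r)"
  unfolding time_grid_def
proof (intro conjI allI impI)
  show "subgrid \<tau> r 0 = a" using subgrid_mult[of \<tau> r 0] assms by (simp add: time_grid_def)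
  show "subgrid \<tau> r (K * 2 ^ r) = b" using subgrid_mult[of \<tau> r K] assms by (simp add: time_grid_def)
  fix k assume "k < K * 2 ^ r"
  then have "k div 2 ^ r < K" by (simp add: less_mult_imp_div_less)
  then have "0 < subgrid \<tau> r (Suc k) - subgrid \<tau> r k"
    unfolding subgrid_step using time_grid_step[OF assms] by simp
  then show "subgrid \<tau> r k < subgrid \<tau> r (Suc k)" by simp
qed

lemma subgrid_step_le:
  assumes "time_grid a b K \<tau>" "\<And>k. k < K \<Longrightarrow> \<tau> (Suc k) - \<tau> k \<le> \<delta>" "i < K * 2 ^ r"
  shows "subgrid \<tau> r (Suc i) - subgrid \<tau> r i \<le> \<delta> / 2 ^ r"
  unfolding subgrid_step using assms(2)[of "i div 2 ^ r"] assms(3)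
  by (intro divide_right_mono) (auto simp: less_mult_imp_div_less)

lemma block_less: "k < K \<Longrightarrow> i < 2 ^ r \<Longrightarrow> k * 2 ^ r + i < K * (2::nat) ^ r"
  by (metis add_less_cancel_left less_imp_le_nat mult_Suc add.commute mult_le_mono1 order_less_le_trans Suc_leI)

lemma sum_blocks: "(\<Sum>i<K * 2 ^ r. g i) = (\<Sum>k<K. \<Sum>i<2 ^ r. g (k * 2 ^ r + i))"
  for g :: "nat \<Rightarrow> 'b::comm_monoid_add"
proof -
  have "(\<Sum>i<K * 2 ^ r. g i) = (\<Sum>k<K. sum g {k * 2 ^ r..<k * 2 ^ r + 2 ^ r})"
    using sum.nat_group[of g "2 ^ r" K] by simp
  also have "\<dots> = (\<Sum>k<K. \<Sum>i<2 ^ r. g (k * 2 ^ r + i))"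
  proof (rule sum.cong[OF refl])
    show "sum g {k * 2 ^ r..<k * 2 ^ r + 2 ^ r} = (\<Sum>i<2 ^ r. g (k * 2 ^ r + i))" for k
      using sum.shift_bounds_nat_ivl[of g 0 "k * 2 ^ r" "2 ^ r"] by (simp add: lessThan_atLeast0 add.commute)
  qed
  finally show ?thesis .
qed

lemma subgrid_in_block:
  assumes "time_grid a b K \<tau>" "k < K" "i \<le> 2 ^ r"
  shows "\<tau> k \<le> subgrid \<tau> r (k * 2 ^ r + i)" "subgrid \<tau> r (k * 2 ^ r + i) \<le> \<tau> (Suc k)"
proof -
  have le: "k * 2 ^ r + i \<le> Suc k * 2 ^ r" "Suc k * 2 ^ r \<le> K * 2 ^ r"
    using assms by (simp, intro mult_right_mono, auto)
  show "\<tau> k \<le> subgrid \<tau> r (k * 2 ^ r + i)"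
    using time_grid_mono[OF time_grid_subgrid[OF assms(1), of r], of "k * 2 ^ r" "k * 2 ^ r + i"] le
    unfolding subgrid_mult by linarith
  show "subgrid \<tau> r (k * 2 ^ r + i) \<le> \<tau> (Suc k)"
    using time_grid_mono[OF time_grid_subgrid[OF assms(1), of r], of "k * 2 ^ r + i" "Suc k * 2 ^ r"] le
    unfolding subgrid_mult by linarith
qed

section \<open>Statements outside small exceptional events\<close>

text \<open>The exceptional event is existentially quantified so that \<open>Q\<close> need not be measurable.\<close>

definition exc :: "'a measure \<Rightarrow> real \<Rightarrow> ('a \<Rightarrow> bool) \<Rightarrow> bool" where
  "exc M \<eta> Q \<longleftrightarrow> (\<exists>E\<in>sets M. measure M E \<le> \<eta> \<and> (\<forall>\<omega>\<in>space M - E. Q \<omega>))"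

lemma exc_mono:
  "exc M \<eta> Q \<Longrightarrow> \<eta> \<le> \<eta>' \<Longrightarrow> (\<And>\<omega>. \<omega> \<in> space M \<Longrightarrow> Q \<omega> \<Longrightarrow> Q' \<omega>) \<Longrightarrow> exc M \<eta>' Q'"
  unfolding exc_def by (meson DiffD1 order_trans)

context prob_space
begin

lemma exc_conj:
  assumes "exc M \<eta> Q" "exc M \<eta>' Q'"
  shows "exc M (\<eta> + \<eta>') (\<lambda>\<omega>. Q \<omega> \<and> Q' \<omega>)"
proof -
  obtain E E' where E: "E \<in> sets M" "prob E \<le> \<eta>" "\<And>\<omega>. \<omega> \<in> space M - E \<Longrightarrow> Q \<omega>"
    and E': "E' \<in> sets M" "prob E' \<le> \<eta>'" "\<And>\<omega>. \<omega> \<in> space M - E' \<Longrightarrow> Q' \<omega>"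
    using assms unfolding exc_def by metis
  have "prob (E \<union> E') \<le> \<eta> + \<eta>'"
    using measure_Un_le[OF E(1) E'(1)] E(2) E'(2) by simp
  then show ?thesis unfolding exc_def using E E' by (intro bexI[of _ "E \<union> E'"]) auto
qed

lemma exc_AE:
  assumes "AE \<omega> in M. Q \<omega>" "0 \<le> \<eta>"
  shows "exc M \<eta> Q"
proof -
  obtain N where "{\<omega> \<in> space M. \<not> Q \<omega>} \<subseteq> N" "emeasure M N = 0" "N \<in> sets M"
    using AE_E[OF assms(1)] by auto
  then show ?thesis unfolding exc_def using assms(2) by (intro bexI[of _ N]) (auto simp: measure_def)
qed

lemma exc_all_finite:
  fixes \<eta> :: real
  assumes "finite A" "\<And>a. a \<in> A \<Longrightarrow> exc M (\<eta> / card A) (Q a)" "0 \<le> \<eta>"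
  shows "exc M \<eta> (\<lambda>\<omega>. \<forall>a\<in>A. Q a \<omega>)"
proof -
  have "finite A' \<Longrightarrow> (\<And>a. a \<in> A' \<Longrightarrow> exc M c (Q a)) \<Longrightarrow> exc M (card A' * c) (\<lambda>\<omega>. \<forall>a\<in>A'. Q a \<omega>)" for A' and c :: real
  proof (induction A' rule: finite_induct)
    case empty
    show ?case unfolding exc_def by (intro bexI[of _ "{}"]) auto
  next
    case (insert a A')
    have "exc M (card A' * c + c) (\<lambda>\<omega>. (\<forall>a\<in>A'. Q a \<omega>) \<and> Q a \<omega>)"
      using insert by (intro exc_conj) auto
    then show ?case by (rule exc_mono) (use insert in \<open>auto simp: algebra_simps\<close>)
  qed
  from this[of A "\<eta> / card A"] assms have *: "exc M (card A * (\<eta> / card A)) (\<lambda>\<omega>. \<forall>a\<in>A. Q a \<omega>)" by blast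
  show ?thesis by (rule exc_mono[OF *]) (use assms in auto)
qed

lemma exc_Markov:
  assumes "integrable M Z" "\<And>\<omega>. 0 \<le> Z \<omega>" "expectation Z \<le> \<epsilon> * \<eta>" "0 < \<epsilon>"
  shows "exc M \<eta> (\<lambda>\<omega>. Z \<omega> \<le> (\<epsilon>::real))"
proof -
  have [measurable]: "Z \<in> borel_measurable M" using assms by auto
  have "prob {\<omega> \<in> space M. \<epsilon> \<le> Z \<omega>} \<le> expectation Z / \<epsilon>"
    using integral_Markov_inequality_measure[OF assms(1), of "{}" \<epsilon>] assms by simp
  also have "\<dots> \<le> \<eta>" using assms by (simp add: field_simps)
  finally show ?thesis unfolding exc_def
    by (intro bexI[of _ "{\<omega> \<in> space M. \<epsilon> \<le> Z \<omega>}"]) auto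
qed

lemma exc_Markov_sq:
  fixes Z :: "'a \<Rightarrow> 'e::real_normed_vector"
  assumes "integrable M (\<lambda>\<omega>. (norm (Z \<omega>))\<^sup>2)" "expectation (\<lambda>\<omega>. (norm (Z \<omega>))\<^sup>2) \<le> \<epsilon>\<^sup>2 * \<eta>" "0 < \<epsilon>"
  shows "exc M \<eta> (\<lambda>\<omega>. norm (Z \<omega>) \<le> \<epsilon>)"
  using assms by (intro exc_mono[OF exc_Markov[OF assms(1), of "\<epsilon>\<^sup>2" \<eta>]]) (auto simp: power2_le_iff_abs_le)

text \<open>Continuity of the measure from below: the events increase to one of full probability.
  This converts a random threshold that is finite almost surely into a fixed one.\<close>

lemma exc_eventually:
  assumes meas: "\<And>m. {\<omega> \<in> space M. Q m \<omega>} \<in> sets M"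
    and mono: "\<And>m \<omega>. Q m \<omega> \<Longrightarrow> Q (Suc m) \<omega>"
    and ae: "AE \<omega> in M. \<exists>m. Q m \<omega>" and "0 < \<eta>"
  obtains m :: nat where "exc M \<eta> (Q m)"
proof -
  let ?A = "\<lambda>m. {\<omega> \<in> space M. Q m \<omega>}"
  have "(\<lambda>m. prob (?A m)) \<longlonglongrightarrow> prob (\<Union>m. ?A m)"
    using meas mono by (intro finite_Lim_measure_incseq) (auto simp: incseq_Suc_iff)
  also have "prob (\<Union>m. ?A m) = 1"
    using ae meas by (intro prob_eq_1[THEN iffD2]) (auto elim!: AE_mp)
  finally have "eventually (\<lambda>m. 1 - \<eta> < prob (?A m)) sequentially"
    using \<open>0 < \<eta>\<close> by (intro order_tendstoD) auto
  then obtain m where "1 - \<eta> < prob (?A m)" by (auto simp: eventually_sequentially)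
  then have "exc M \<eta> (Q m)"
    unfolding exc_def using meas[of m] by (intro bexI[of _ "space M - ?A m"]) (auto simp: prob_compl)
  then show ?thesis by (rule that)
qed

text \<open>The way back from probability to expectation; for a variable bounded by \<open>c\<close>
  the exceptional event contributes at most \<open>c * \<eta>\<close>.\<close>

lemma exc_expectation:
  assumes "exc M \<eta> (\<lambda>\<omega>. Z \<omega> \<le> \<epsilon>)" "Z \<in> borel_measurable M" "\<And>\<omega>. 0 \<le> Z \<omega>" "\<And>\<omega>. Z \<omega> \<le> c" "0 \<le> \<epsilon>" "0 \<le> c"
  shows "expectation Z \<le> \<epsilon> + c * (\<eta>::real)"
proof -
  obtain E where E: "E \<in> sets M" "prob E \<le> \<eta>" "\<And>\<omega>. \<omega> \<in> space M - E \<Longrightarrow> Z \<omega> \<le> \<epsilon>"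
    using assms(1) unfolding exc_def by metis
  have "integrable M Z" using assms by (intro integrable_const_bound[of _ c]) auto
  then have "expectation Z \<le> expectation (\<lambda>\<omega>. \<epsilon> + c * indicator E \<omega>)"
  proof (rule integral_mono)
    show "integrable M (\<lambda>\<omega>. \<epsilon> + c * indicator E \<omega>)" using E by (auto simp: emeasure_eq_measure)
    show "Z \<omega> \<le> \<epsilon> + c * indicator E \<omega>" if "\<omega> \<in> space M" for \<omega>
      using E(3)[of \<omega>] assms(4)[of \<omega>] assms(5) that by (cases "\<omega> \<in> E") auto
  qed
  also have "\<dots> = \<epsilon> + c * prob E" using E by (simp add: prob_space emeasure_eq_measure)
  also have "\<dots> \<le> \<epsilon> + c * \<eta>" using E assms by (intro add_left_mono mult_left_mono) auto
  finally show ?thesis .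
qed

end

section \<open>The one-step defect of the scheme\<close>

lemma cayley_scheme_stiefel: "Y0 \<omega> \<in> stiefel \<Longrightarrow> cayley_scheme f \<sigma> \<tau> B Y0 k \<omega> \<in> stiefel"
  by (induction k) (auto intro: cayley_step_stiefel)

lemma cayley_scheme_cong: "Y0 \<omega> = Y0' \<omega> \<Longrightarrow> cayley_scheme f \<sigma> \<tau> B Y0 k \<omega> = cayley_scheme f \<sigma> \<tau> B Y0' k \<omega>"
  by (induction k) auto

context matrix_bm
begin

lemma cayley_scheme_measurable:
  assumes f: "smooth f" and grid: "time_grid t0 T K \<tau>" and t0: "0 \<le> t0" and Y0: "Y0 \<in> borel_measurable (F t0)" and "k \<le> K"
  shows "cayley_scheme f \<sigma> \<tau> B Y0 k \<in> borel_measurable (F (\<tau> k))"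
  using \<open>k \<le> K\<close>
proof (induction k)
  case 0
  then show ?case using Y0 grid by (simp add: time_grid_def)
next
  case (Suc k)
  have "\<tau> k < \<tau> (Suc k)" "0 \<le> \<tau> k" using Suc.prems grid time_grid_bounds[OF grid, of k] t0 by (auto simp: time_grid_def)
  then have "(\<lambda>\<omega>. (B (\<tau> (Suc k)) \<omega> - B (\<tau> k) \<omega>, cayley_scheme f \<sigma> \<tau> B Y0 k \<omega>)) \<in> borel_measurable (F (\<tau> (Suc k)))"
    by (intro borel_measurable_Pair increment_measurable_F measurable_F_mono[OF Suc.IH])
      (use Suc.prems in auto)
  from measurable_compose[OF this borel_measurable_continuous_onI[OF continuous_cayley_step[OF f]], of \<sigma> "\<tau> (Suc k) - \<tau> k"]
  show ?case by simp
qed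

lemma loclip_measurable: "loclip g \<Longrightarrow> Z \<in> borel_measurable N \<Longrightarrow> (\<lambda>\<omega>. g (Z \<omega>)) \<in> borel_measurable N"
  by (rule measurable_compose[OF _ borel_measurable_continuous_onI[OF loclip_continuous]])

lemma loclip_qf: "loclip (\<lambda>Y. qf Y D E)"
  unfolding qf_def skw_def znoise_def by (intro loclip_intros)

lemma pf_measurable:
  fixes X D :: "'z \<Rightarrow> real ^ 'p ^ 'n"
  assumes "X \<in> borel_measurable N" "D \<in> borel_measurable N"
  shows "(\<lambda>\<omega>. pf (X \<omega>) (D \<omega>)) \<in> borel_measurable N"
proof -
  have "(\<lambda>\<omega>. \<Sum>u\<in>UNIV. \<Sum>v\<in>UNIV. D \<omega> $ u $ v *\<^sub>R pf (X \<omega>) (unit_mat u v)) \<in> borel_measurable N"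
    using assms by (intro borel_measurable_sum borel_measurable_scaleR loclip_measurable[OF loclip_pf]
        measurable_compose[OF assms(2) component_measurable]) auto
  then show ?thesis by (simp add: linear_unit_expansion[OF linear_pf, symmetric])
qed

definition euler_incr :: "(real ^ 'p ^ 'n \<Rightarrow> real) \<Rightarrow> real \<Rightarrow> real \<Rightarrow> real \<Rightarrow> real ^ 'p ^ 'n \<Rightarrow> 'a \<Rightarrow> real ^ 'p ^ 'n" where
  "euler_incr f \<sigma> s t x \<omega> = (t - s) *\<^sub>R drift f \<sigma> x + \<sigma> *\<^sub>R pf x (B t \<omega> - B s \<omega>)"

text \<open>The centred second-order terms \<open>m\<close> are martingale differences with
  variances of order h^2, so their sum has second moment of order \<open>\<delta>\<close>. The
  remainders \<open>s\<close> have second moments of order h^3 and are added by Cauchy-Schwarz with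
  the steps as weights, which again gives order \<open>\<delta>\<close>.\<close>

lemma scheme_defect:
  assumes f: "smooth f" and t0: "0 \<le> t0" and Y0: "Y0 \<in> borel_measurable (F t0)" "\<And>\<omega>. Y0 \<omega> \<in> stiefel"
  obtains C where "0 \<le> C" and "\<And>K \<tau> \<delta> k. time_grid t0 T K \<tau> \<Longrightarrow> (\<And>i. i < K \<Longrightarrow> \<tau> (Suc i) - \<tau> i \<le> \<delta>) \<Longrightarrow> k \<le> K \<Longrightarrow>
    integrable M (\<lambda>\<omega>. (norm (cayley_scheme f \<sigma> \<tau> B Y0 k \<omega> - Y0 \<omega>
       - (\<Sum>l<k. euler_incr f \<sigma> (\<tau> l) (\<tau> (Suc l)) (cayley_scheme f \<sigma> \<tau> B Y0 l \<omega>) \<omega>)))\<^sup>2) \<and>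
    expectation (\<lambda>\<omega>. (norm (cayley_scheme f \<sigma> \<tau> B Y0 k \<omega> - Y0 \<omega>
       - (\<Sum>l<k. euler_incr f \<sigma> (\<tau> l) (\<tau> (Suc l)) (cayley_scheme f \<sigma> \<tau> B Y0 l \<omega>) \<omega>)))\<^sup>2) \<le> C * \<delta>"
proof -
  define H where "H = \<bar>T - t0\<bar>"
  define d where "d = CARD('n) * CARD('p)"
  obtain c where c: "0 \<le> c" "\<And>Y D h. Y \<in> stiefel \<Longrightarrow> 0 \<le> h \<Longrightarrow> h \<le> H \<Longrightarrow>
    norm (cayley_step f \<sigma> h D Y - Y - h *\<^sub>R drift f \<sigma> Y - \<sigma> *\<^sub>R pf Y D - \<sigma>\<^sup>2 *\<^sub>R (qf Y D D - h *\<^sub>R corr Y))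
      \<le> c * (h\<^sup>2 + h * norm D + norm D ^ 3)"
    using cayley_step_remainder[OF f, of H \<sigma>] by metis
  \<comment> \<open>The bound of \<open>norm_qf_le\<close> at the norm that all points of the
    manifold share.\<close>
  define g where "g = 2 * sqrt CARD('p) ^ 3 * (1 + (sqrt CARD('p))\<^sup>2)\<^sup>2"
  \<comment> \<open>Squaring the remainder yields h^4, h^2 |D|^2 and |D|^6, each of expectation at
    most a constant times h^3; the three constants are added here.\<close>
  define c1 where "c1 = 3 * c\<^sup>2 * (H + mom d 1 + mom d 3)"
  define C where "C = 2 * \<sigma> ^ 4 * (real d ^ 4 * mom d 2 * (H * g\<^sup>2)) + 2 * H * c1 * H"
  have pos: "0 \<le> H" "0 \<le> c1" "0 \<le> g" using c(1) mom_nonneg by (auto simp: H_def c1_def g_def)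
  have "integrable M (\<lambda>\<omega>. (norm (cayley_scheme f \<sigma> \<tau> B Y0 k \<omega> - Y0 \<omega>
       - (\<Sum>l<k. euler_incr f \<sigma> (\<tau> l) (\<tau> (Suc l)) (cayley_scheme f \<sigma> \<tau> B Y0 l \<omega>) \<omega>)))\<^sup>2) \<and>
    expectation (\<lambda>\<omega>. (norm (cayley_scheme f \<sigma> \<tau> B Y0 k \<omega> - Y0 \<omega>
       - (\<Sum>l<k. euler_incr f \<sigma> (\<tau> l) (\<tau> (Suc l)) (cayley_scheme f \<sigma> \<tau> B Y0 l \<omega>) \<omega>)))\<^sup>2) \<le> C * \<delta>"
    if grid: "time_grid t0 T K \<tau>" and \<delta>: "\<And>i. i < K \<Longrightarrow> \<tau> (Suc i) - \<tau> i \<le> \<delta>" and k: "k \<le> K" for K \<tau> \<delta> k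
  proof (cases "k = 0")
    case True
    moreover have "0 \<le> C * \<delta>"
    proof (cases "K = 0")
      case True
      \<comment> \<open>For the empty grid nothing keeps \<open>\<delta>\<close> from being
        negative, but then \<open>H\<close> and hence \<open>C\<close> are 0.\<close>
      then have "t0 = T" using grid by (auto simp: time_grid_def)
      then show ?thesis by (simp add: C_def H_def)
    next
      case False
      then have "0 \<le> \<delta>" using \<delta>[of 0] time_grid_step[OF grid, of 0] by auto
      then show ?thesis using pos mom_nonneg by (auto simp: C_def)
    qed
    ultimately show ?thesis by simp
  next
    case False
    define Y where "Y = cayley_scheme f \<sigma> \<tau> B Y0"
    define h where "h l = \<tau> (Suc l) - \<tau> l" for l
    define D where "D l \<omega> = B (\<tau> (Suc l)) \<omega> - B (\<tau> l) \<omega>" for l \<omega>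
    define m where "m l \<omega> = qf (Y l \<omega>) (D l \<omega>) (D l \<omega>) - h l *\<^sub>R corr (Y l \<omega>)" for l \<omega>
    define s where "s l \<omega> = Y (Suc l) \<omega> - Y l \<omega> - h l *\<^sub>R drift f \<sigma> (Y l \<omega>) - \<sigma> *\<^sub>R pf (Y l \<omega>) (D l \<omega>) - \<sigma>\<^sup>2 *\<^sub>R m l \<omega>" for l \<omega>
    have st: "0 \<le> \<tau> l" "\<tau> l < \<tau> (Suc l)" if "l < K" for l
      using time_grid_bounds[OF grid, of l] time_grid_step[OF grid, of l] that t0 by auto
    have h: "0 < h l" "h l \<le> H" "h l \<le> \<delta>" if "l < K" for l
      using time_grid_bounds[OF grid, of l] time_grid_bounds[OF grid, of "Suc l"] st[OF that] \<delta> that by (auto simp: h_def H_def)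
    have sumh: "(\<Sum>l<k. h l) \<le> H"
      using time_grid_bounds[OF grid k] grid unfolding h_def sum_steps by (auto simp: H_def time_grid_def)
    have YS: "Y l \<omega> \<in> stiefel" for l \<omega> unfolding Y_def by (rule cayley_scheme_stiefel) (rule Y0)
    have YF: "Y l \<in> borel_measurable (F (\<tau> l))" if "l \<le> K" for l
      unfolding Y_def by (rule cayley_scheme_measurable[OF f grid t0 Y0(1) that])
    have YM: "Y l \<in> borel_measurable M" if "l \<le> K" for l by (rule measurable_F_M[OF YF[OF that]])
    have DM: "D l \<in> borel_measurable M" if "l < K" for l
      unfolding D_def using st[OF that] by (intro increment_measurable) auto
    have eq: "Y k \<omega> - Y0 \<omega> - (\<Sum>l<k. euler_incr f \<sigma> (\<tau> l) (\<tau> (Suc l)) (Y l \<omega>) \<omega>)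
        = \<sigma>\<^sup>2 *\<^sub>R (\<Sum>l<k. m l \<omega>) + (\<Sum>l<k. s l \<omega>)" for \<omega>
    proof -
      have "Y k \<omega> - Y0 \<omega> = (\<Sum>l<k. Y (Suc l) \<omega> - Y l \<omega>)"
        using sum_lessThan_telescope[of "\<lambda>l. Y l \<omega>" k] by (simp add: Y_def)
      then show ?thesis
        by (simp add: s_def euler_incr_def h_def D_def sum.distrib sum_subtractf scaleR_sum_right)
    qed
    define Sm where "Sm \<omega> = (\<Sum>l<k. m l \<omega>)" for \<omega>
    define Ss where "Ss \<omega> = (\<Sum>l<k. s l \<omega>)" for \<omega>
    \<comment> \<open>On the manifold \<open>sum_qf_eq_corr\<close> identifies the correction with
      the centring term of \<open>quadratic_sum_L2\<close>.\<close>
    have Sm_eq: "Sm \<omega> = (\<Sum>l<k. qf (Y l \<omega>) (B (\<tau> (Suc l)) \<omega> - B (\<tau> l) \<omega>) (B (\<tau> (Suc l)) \<omega> - B (\<tau> l) \<omega>)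
      - (\<tau> (Suc l) - \<tau> l) *\<^sub>R (\<Sum>u\<in>UNIV. \<Sum>v\<in>UNIV. qf (Y l \<omega>) (unit_mat u v) (unit_mat u v)))" for \<omega>
      using YS by (simp add: Sm_def m_def D_def h_def sum_qf_eq_corr)
    have qfb: "norm (qf (Y l \<omega>) D E) \<le> g * norm D * norm E" for l \<omega> D E
      using norm_qf_le[of "Y l \<omega>" D E] norm_stiefel[OF YS, of l \<omega>] by (simp add: g_def)
    have qF: "(\<lambda>\<omega>. qf (Y i \<omega>) (unit_mat a b) (unit_mat a' b')) \<in> borel_measurable (F (\<tau> i))" if "i < k" for i a b a' b'
      using that k by (intro loclip_measurable[OF loclip_qf] YF) simp
    have \<tau>k: "0 \<le> \<tau> 0" "\<And>i. i < k \<Longrightarrow> \<tau> i < \<tau> (Suc i)" using st(1)[of 0] st(2) k False by auto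
    note mL2 = quadratic_sum_L2[where u=\<tau> and N=k and b="\<lambda>l \<omega>. qf (Y l \<omega>)" and g="\<lambda>l \<omega>. g",
        OF \<tau>k linear_qf(1) linear_qf(2) qF qfb integrable_const Sm_eq]
    note mI = mL2(2) and SmF = mL2(1)
    have "expectation (\<lambda>\<omega>. (norm (Sm \<omega>))\<^sup>2) \<le> (real d) ^ 4 * mom d 2 * (\<Sum>l<k. (h l)\<^sup>2 * g\<^sup>2)"
      using mL2(3) by (simp add: d_def h_def prob_space)
    also have "\<dots> \<le> real d ^ 4 * mom d 2 * (\<delta> * H * g\<^sup>2)"
    proof (intro mult_left_mono)
      have "(\<Sum>l<k. (h l)\<^sup>2 * g\<^sup>2) \<le> (\<Sum>l<k. \<delta> * h l * g\<^sup>2)"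
        using h k unfolding power2_eq_square by (intro sum_mono mult_right_mono) (auto simp: less_imp_le)
      also have "\<dots> = \<delta> * (\<Sum>l<k. h l) * g\<^sup>2" by (simp add: sum_distrib_left sum_distrib_right)
      also have "\<dots> \<le> \<delta> * H * g\<^sup>2" using sumh h[of 0] k False
        by (intro mult_right_mono mult_left_mono) auto
      finally show "(\<Sum>l<k. (h l)\<^sup>2 * g\<^sup>2) \<le> \<delta> * H * g\<^sup>2" .
    qed (use mom_nonneg in auto)
    finally have mE: "expectation (\<lambda>\<omega>. (norm (Sm \<omega>))\<^sup>2) \<le> real d ^ 4 * mom d 2 * (H * g\<^sup>2) * \<delta>"
      by (simp add: mult_ac)
    have sM: "s l \<in> borel_measurable M" if "l < K" for l
    proof -
      have "(\<lambda>\<omega>. qf (Y l \<omega>) (D l \<omega>) (D l \<omega>)) \<in> borel_measurable M"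
      proof -
        have "(\<lambda>\<omega>. \<Sum>a\<in>UNIV. \<Sum>b\<in>UNIV. D l \<omega> $ a $ b *\<^sub>R (\<Sum>u\<in>UNIV. \<Sum>v\<in>UNIV. D l \<omega> $ u $ v *\<^sub>R qf (Y l \<omega>) (unit_mat u v) (unit_mat a b))) \<in> borel_measurable M"
          using that by (intro borel_measurable_sum borel_measurable_scaleR loclip_measurable[OF loclip_qf YM]
              measurable_compose[OF DM component_measurable]) auto
        then show ?thesis by (simp add: linear_unit_expansion[OF linear_qf(1), symmetric] linear_unit_expansion[OF linear_qf(2), symmetric])
      qed
      then show ?thesis unfolding s_def m_def using that YM[of l] YM[of "Suc l"] DM[of l]
        by (intro borel_measurable_diff borel_measurable_scaleR loclip_measurable[OF loclip_drift[OF f]]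
            loclip_measurable[OF loclip_corr] pf_measurable) auto
    qed
    have s_le: "(norm (s l \<omega>))\<^sup>2 \<le> 3 * c\<^sup>2 * (h l ^ 4 + (h l)\<^sup>2 * norm (D l \<omega>) ^ 2 + norm (D l \<omega>) ^ 6)" if "l < K" for l \<omega>
    proof -
      have "norm (s l \<omega>) \<le> c * ((h l)\<^sup>2 + h l * norm (D l \<omega>) + norm (D l \<omega>) ^ 3)"
        using c(2)[of "Y l \<omega>" "h l" "D l \<omega>"] YS h[OF that] by (simp add: s_def m_def Y_def h_def D_def)
      then have "(norm (s l \<omega>))\<^sup>2 \<le> (c * ((h l)\<^sup>2 + h l * norm (D l \<omega>) + norm (D l \<omega>) ^ 3))\<^sup>2"
        by (rule power_mono) simp
      also have "\<dots> \<le> c\<^sup>2 * (3 * ((h l)\<^sup>2)\<^sup>2 + 3 * (h l * norm (D l \<omega>))\<^sup>2 + 3 * (norm (D l \<omega>) ^ 3)\<^sup>2)"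
        unfolding power_mult_distrib[of c]
        using norm_add3_sq_le[of "(h l)\<^sup>2" "h l * norm (D l \<omega>)" "norm (D l \<omega>) ^ 3"] by (intro mult_left_mono) auto
      finally show ?thesis by (simp add: power_mult_distrib power_mult[symmetric] algebra_simps)
    qed
    have bI: "integrable M (\<lambda>\<omega>. 3 * c\<^sup>2 * (h l ^ 4 + (h l)\<^sup>2 * norm (D l \<omega>) ^ 2 + norm (D l \<omega>) ^ 6))" if "l < K" for l
      using increment_moment(1)[OF st[OF that], of 1] increment_moment(1)[OF st[OF that], of 3]
      unfolding D_def by (intro integrable_mult_right Bochner_Integration.integrable_add) auto
    have sI: "integrable M (\<lambda>\<omega>. (norm (s l \<omega>))\<^sup>2)" if "l < K" for l
      by (rule integrable_dominated[OF bI[OF that]]) (use sM[OF that] s_le[OF that] in auto)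
    have sE: "expectation (\<lambda>\<omega>. (norm (s l \<omega>))\<^sup>2) \<le> c1 * h l ^ 3" if "l < K" for l
    proof -
      have m1: "expectation (\<lambda>\<omega>. norm (D l \<omega>) ^ 2) \<le> mom d 1 * h l"
        using increment_moment(2)[OF st[OF that], of 1] by (simp add: D_def d_def h_def)
      have m3: "expectation (\<lambda>\<omega>. norm (D l \<omega>) ^ 6) \<le> mom d 3 * h l ^ 3"
        using increment_moment(2)[OF st[OF that], of 3] by (simp add: D_def d_def h_def)
      have "expectation (\<lambda>\<omega>. (norm (s l \<omega>))\<^sup>2) \<le> expectation (\<lambda>\<omega>. 3 * c\<^sup>2 * (h l ^ 4 + (h l)\<^sup>2 * norm (D l \<omega>) ^ 2 + norm (D l \<omega>) ^ 6))"
        by (intro integral_mono sI bI that s_le)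
      also have "\<dots> = 3 * c\<^sup>2 * (h l ^ 4 + (h l)\<^sup>2 * expectation (\<lambda>\<omega>. norm (D l \<omega>) ^ 2) + expectation (\<lambda>\<omega>. norm (D l \<omega>) ^ 6))"
        using increment_moment(1)[OF st[OF that], of 1] increment_moment(1)[OF st[OF that], of 3]
        unfolding D_def by (simp add: prob_space)
      also have "\<dots> \<le> 3 * c\<^sup>2 * (H * h l ^ 3 + (h l)\<^sup>2 * (mom d 1 * h l) + mom d 3 * h l ^ 3)"
      proof (intro mult_left_mono add_mono m1 m3)
        show "h l ^ 4 \<le> H * h l ^ 3" using h[OF that] mult_right_mono[of "h l" H "h l ^ 3"] by (simp add: power_Suc[symmetric] del: power_Suc)
      qed auto
      also have "\<dots> = c1 * h l ^ 3" by (simp add: c1_def power2_eq_square power3_eq_cube algebra_simps)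
      finally show ?thesis .
    qed
    have Ss_le: "(norm (Ss \<omega>))\<^sup>2 \<le> H * (\<Sum>l<k. (norm (s l \<omega>))\<^sup>2 / h l)" for \<omega>
    proof -
      have "(norm (Ss \<omega>))\<^sup>2 \<le> (\<Sum>l<k. h l) * (\<Sum>l<k. (norm (s l \<omega>))\<^sup>2 / h l)"
        unfolding Ss_def using h k by (intro norm_sum_weighted_le) auto
      also have "\<dots> \<le> H * (\<Sum>l<k. (norm (s l \<omega>))\<^sup>2 / h l)"
        using sumh h k by (intro mult_right_mono sum_nonneg divide_nonneg_pos) auto
      finally show ?thesis .
    qed
    have SsM: "Ss \<in> borel_measurable M" unfolding Ss_def using sM k by (intro borel_measurable_sum) auto
    have SbI: "integrable M (\<lambda>\<omega>. H * (\<Sum>l<k. (norm (s l \<omega>))\<^sup>2 / h l))"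
      using sI k by (intro integrable_mult_right Bochner_Integration.integrable_sum integrable_divide) auto
    have SsI: "integrable M (\<lambda>\<omega>. (norm (Ss \<omega>))\<^sup>2)"
      by (rule integrable_dominated[OF SbI]) (use SsM Ss_le in auto)
    have "expectation (\<lambda>\<omega>. (norm (Ss \<omega>))\<^sup>2) \<le> expectation (\<lambda>\<omega>. H * (\<Sum>l<k. (norm (s l \<omega>))\<^sup>2 / h l))"
      by (intro integral_mono SsI SbI Ss_le)
    also have "\<dots> = H * (\<Sum>l<k. expectation (\<lambda>\<omega>. (norm (s l \<omega>))\<^sup>2) / h l)"
      by (subst integral_mult_right_zero, subst Bochner_Integration.integral_sum) (use sI k in auto)
    also have "\<dots> \<le> H * (\<Sum>l<k. c1 * \<delta> * h l)"
    proof (intro mult_left_mono sum_mono)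
      fix l assume "l \<in> {..<k}"
      then have l: "l < K" using k by auto
      have "expectation (\<lambda>\<omega>. (norm (s l \<omega>))\<^sup>2) / h l \<le> c1 * h l ^ 3 / h l"
        using sE[OF l] h[OF l] by (intro divide_right_mono) auto
      also have "\<dots> = c1 * h l * h l" using h[OF l] by (simp add: power3_eq_cube)
      also have "\<dots> \<le> c1 * \<delta> * h l" using h[OF l] pos by (intro mult_right_mono mult_left_mono) auto
      finally show "expectation (\<lambda>\<omega>. (norm (s l \<omega>))\<^sup>2) / h l \<le> c1 * \<delta> * h l" .
    qed (use pos in auto)
    also have "\<dots> = H * (c1 * \<delta> * (\<Sum>l<k. h l))" by (simp add: sum_distrib_left)
    also have "\<dots> \<le> H * (c1 * \<delta> * H)"
      using sumh pos h[of 0] k False by (intro mult_left_mono mult_nonneg_nonneg) auto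
    finally have SsE: "expectation (\<lambda>\<omega>. (norm (Ss \<omega>))\<^sup>2) \<le> H * c1 * H * \<delta>" by (simp add: mult_ac)
    have tot_le: "(norm (\<sigma>\<^sup>2 *\<^sub>R Sm \<omega> + Ss \<omega>))\<^sup>2 \<le> 2 * \<sigma> ^ 4 * (norm (Sm \<omega>))\<^sup>2 + 2 * (norm (Ss \<omega>))\<^sup>2" for \<omega>
      using norm_add_sq_le[of "\<sigma>\<^sup>2 *\<^sub>R Sm \<omega>" "Ss \<omega>"] by (simp add: power_mult_distrib power_mult[symmetric])
    have bI2: "integrable M (\<lambda>\<omega>. 2 * \<sigma> ^ 4 * (norm (Sm \<omega>))\<^sup>2 + 2 * (norm (Ss \<omega>))\<^sup>2)" using mI SsI by auto
    have totI: "integrable M (\<lambda>\<omega>. (norm (\<sigma>\<^sup>2 *\<^sub>R Sm \<omega> + Ss \<omega>))\<^sup>2)"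
      by (rule integrable_dominated[OF bI2]) (use SsM measurable_F_M[OF SmF] tot_le in auto)
    have "expectation (\<lambda>\<omega>. (norm (\<sigma>\<^sup>2 *\<^sub>R Sm \<omega> + Ss \<omega>))\<^sup>2) \<le> expectation (\<lambda>\<omega>. 2 * \<sigma> ^ 4 * (norm (Sm \<omega>))\<^sup>2 + 2 * (norm (Ss \<omega>))\<^sup>2)"
      by (intro integral_mono totI bI2 tot_le)
    also have "\<dots> = 2 * \<sigma> ^ 4 * expectation (\<lambda>\<omega>. (norm (Sm \<omega>))\<^sup>2) + 2 * expectation (\<lambda>\<omega>. (norm (Ss \<omega>))\<^sup>2)"
      using mI SsI by simp
    also have "\<dots> \<le> 2 * \<sigma> ^ 4 * (real d ^ 4 * mom d 2 * (H * g\<^sup>2) * \<delta>) + 2 * (H * c1 * H * \<delta>)"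
      by (intro add_mono mult_left_mono mE SsE) auto
    also have "\<dots> = C * \<delta>" by (simp add: C_def algebra_simps)
    finally show ?thesis using totI eq by (simp add: Y_def[symmetric] Sm_def Ss_def)
  qed
  moreover have "0 \<le> C" using pos mom_nonneg by (auto simp: C_def)
  ultimately show ?thesis using that by blast
qed

end

section \<open>Almost sure regularity of the solution\<close>

lemma rat_sequence:
  fixes a b s :: real
  assumes "a < b" "s \<in> {a..b}"
  obtains q where "\<And>n. q n \<in> \<rat> \<inter> {a<..<b}" "q \<longlonglongrightarrow> s"
proof -
  have "{a<..<b} \<inter> closure \<rat> \<subseteq> closure ({a<..<b} \<inter> \<rat>)" by (rule open_Int_closure_subset) simp
  then have "closure {a<..<b} \<subseteq> closure ({a<..<b} \<inter> \<rat>)"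
    by (simp add: Rats_closure_real closure_minimal)
  then have "s \<in> closure (\<rat> \<inter> {a<..<b})" using assms by (auto simp: Int_commute)
  then show ?thesis using that unfolding closure_sequential by blast
qed

text \<open>Rational times keep events about whole paths measurable; continuity restores the full
  interval.\<close>

lemma le_on_interval_from_rats:
  fixes g :: "real \<Rightarrow> real"
  assumes "continuous_on {a..b} g" "a < b" "\<And>s. s \<in> \<rat> \<inter> {a<..<b} \<Longrightarrow> g s \<le> c" "s \<in> {a..b}"
  shows "g s \<le> c"
proof -
  obtain q where q: "\<And>n. q n \<in> \<rat> \<inter> {a<..<b}" "q \<longlonglongrightarrow> s" using rat_sequence assms by metis
  have "(\<lambda>n. g (q n)) \<longlonglongrightarrow> g s"
    by (rule continuous_on_tendsto_compose[OF assms(1) q(2) assms(4)])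
      (use q(1) in \<open>auto intro!: always_eventually simp: less_imp_le\<close>)
  then show ?thesis by (rule LIMSEQ_le_const2) (use q(1) assms(3) in auto)
qed

text \<open>Countability makes the events "all members are at most \<open>m\<close>" measurable, and
  they increase to full measure as \<open>m\<close> grows.\<close>

lemma (in prob_space) exc_bounded_family:
  fixes g :: "'i \<Rightarrow> 'a \<Rightarrow> real"
  assumes "countable I" "\<And>i. i \<in> I \<Longrightarrow> g i \<in> borel_measurable M"
    and "AE \<omega> in M. \<exists>R. \<forall>i\<in>I. g i \<omega> \<le> R" and "0 < \<eta>"
  obtains R where "0 \<le> R" "exc M \<eta> (\<lambda>\<omega>. \<forall>i\<in>I. g i \<omega> \<le> R)"
proof -
  have "\<exists>m::nat. exc M \<eta> (\<lambda>\<omega>. \<forall>i\<in>I. g i \<omega> \<le> real m)"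
  proof (rule exc_eventually[of "\<lambda>m \<omega>. \<forall>i\<in>I. g i \<omega> \<le> real m" \<eta>])
    show "{\<omega> \<in> space M. \<forall>i\<in>I. g i \<omega> \<le> real m} \<in> sets M" for m
      using assms(1,2) by (intro sets.sets_Collect_countable_All') auto
    show "AE \<omega> in M. \<exists>m. \<forall>i\<in>I. g i \<omega> \<le> real m"
      using assms(3)
    proof eventually_elim
      case (elim \<omega>)
      then obtain R where "\<forall>i\<in>I. g i \<omega> \<le> R" by auto
      moreover obtain m :: nat where "R \<le> real m" using real_arch_simple by auto
      ultimately show ?case by (meson order_trans)
    qed
    show "\<forall>i\<in>I. g i \<omega> \<le> real (Suc m)" if "\<forall>i\<in>I. g i \<omega> \<le> real m" for m \<omega>
      using that by (auto intro: order_trans)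
  qed (rule assms(4), erule exI)
  then obtain m :: nat where "exc M \<eta> (\<lambda>\<omega>. \<forall>i\<in>I. g i \<omega> \<le> real m)" ..
  then show ?thesis by (intro that[of "real m"]) auto
qed

locale stiefel_sde = matrix_bm M F B
  for M :: "'a measure" and F and B :: "real \<Rightarrow> 'a \<Rightarrow> real ^ 'p::finite ^ 'n::finite" +
  fixes f :: "real ^ 'p ^ 'n \<Rightarrow> real" and \<sigma> t0 T :: real and X :: "real \<Rightarrow> 'a \<Rightarrow> real ^ 'p ^ 'n"
  assumes f: "smooth f" and t0: "0 \<le> t0" and tT: "t0 < T"
    and sol: "stiefel_sde_solution M F B f \<sigma> t0 T X"
begin

lemma X_measurable_F: "t \<in> {t0..T} \<Longrightarrow> X t \<in> borel_measurable (F t)"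
  using sol by (auto simp: stiefel_sde_solution_def adapted_on_def)

lemma X_measurable: "t \<in> {t0..T} \<Longrightarrow> X t \<in> borel_measurable M"
  by (rule measurable_F_M[OF X_measurable_F])

lemma X_continuous: "AE \<omega> in M. continuous_on {t0..T} (\<lambda>t. X t \<omega>)"
  using sol by (simp add: stiefel_sde_solution_def)

text \<open>A continuous path is bounded on a compact interval. This substitutes for the missing
  moments of the solution.\<close>

lemma exc_X_bounded:
  assumes "0 < \<eta>"
  obtains R where "0 \<le> R" "exc M \<eta> (\<lambda>\<omega>. continuous_on {t0..T} (\<lambda>t. X t \<omega>) \<and> (\<forall>t\<in>{t0..T}. norm (X t \<omega>) \<le> R))"
proof -
  obtain R where R: "0 \<le> R" "exc M (\<eta> / 2) (\<lambda>\<omega>. \<forall>t\<in>\<rat> \<inter> {t0<..<T}. norm (X t \<omega>) \<le> R)"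
  proof (rule exc_bounded_family[of "\<rat> \<inter> {t0<..<T}" "\<lambda>t \<omega>. norm (X t \<omega>)" "\<eta> / 2"])
    show "countable (\<rat> \<inter> {t0<..<T})" by (rule countable_subset[OF _ countable_rat]) auto
    show "(\<lambda>\<omega>. norm (X t \<omega>)) \<in> borel_measurable M" if "t \<in> \<rat> \<inter> {t0<..<T}" for t
      using X_measurable[of t] that by auto
    show "AE \<omega> in M. \<exists>R. \<forall>t\<in>\<rat> \<inter> {t0<..<T}. norm (X t \<omega>) \<le> R"
      using X_continuous
    proof eventually_elim
      case (elim \<omega>)
      then have "compact ((\<lambda>t. X t \<omega>) ` {t0..T})" by (intro compact_continuous_image) auto
      then show ?case by (fastforce dest!: compact_imp_bounded simp: bounded_iff)
    qed
  qed (use assms that in auto)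
  have "exc M (\<eta> / 2 + \<eta> / 2) (\<lambda>\<omega>. continuous_on {t0..T} (\<lambda>t. X t \<omega>) \<and> (\<forall>t\<in>\<rat> \<inter> {t0<..<T}. norm (X t \<omega>) \<le> R))"
    using assms by (intro exc_conj R exc_AE X_continuous) auto
  then have "exc M \<eta> (\<lambda>\<omega>. continuous_on {t0..T} (\<lambda>t. X t \<omega>) \<and> (\<forall>t\<in>{t0..T}. norm (X t \<omega>) \<le> R))"
  proof (rule exc_mono)
    fix \<omega> assume *: "continuous_on {t0..T} (\<lambda>t. X t \<omega>) \<and> (\<forall>t\<in>\<rat> \<inter> {t0<..<T}. norm (X t \<omega>) \<le> R)"
    then have "continuous_on {t0..T} (\<lambda>t. norm (X t \<omega>))" by (intro continuous_on_norm) simp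
    then have "norm (X t \<omega>) \<le> R" if "t \<in> {t0..T}" for t
      using le_on_interval_from_rats[of t0 T "\<lambda>t. norm (X t \<omega>)" R t] tT * that by simp
    then show "continuous_on {t0..T} (\<lambda>t. X t \<omega>) \<and> (\<forall>t\<in>{t0..T}. norm (X t \<omega>) \<le> R)" using * by simp
  qed simp
  then show ?thesis by (rule that[OF R(1)])
qed

text \<open>Each continuous path is uniformly continuous on the compact interval; the events for the
  scales 1/(m+1) increase in \<open>m\<close>, so one deterministic scale serves outside a small
  event.\<close>

lemma exc_X_modulus:
  assumes "0 < \<eta>" "0 < \<epsilon>"
  obtains d where "0 < d" "exc M \<eta> (\<lambda>\<omega>. \<forall>s\<in>{t0..T}. \<forall>t\<in>{t0..T}. \<bar>s - t\<bar> < d \<longrightarrow> norm (X s \<omega> - X t \<omega>) \<le> \<epsilon>)"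
proof -
  let ?I = "\<rat> \<inter> {t0<..<T}"
  let ?Q = "\<lambda>m \<omega>. \<forall>s\<in>?I. \<forall>t\<in>?I. \<bar>s - t\<bar> < inverse (real (Suc m)) \<longrightarrow> norm (X s \<omega> - X t \<omega>) \<le> \<epsilon>"
  have cI: "countable ?I" by (rule countable_subset[OF _ countable_rat]) auto
  obtain m where m: "exc M (\<eta> / 2) (?Q m)"
  proof (rule exc_eventually[of ?Q "\<eta> / 2"])
    show "{\<omega> \<in> space M. ?Q m \<omega>} \<in> sets M" for m
    proof (intro sets.sets_Collect_countable_All' sets.sets_Collect_imp sets.sets_Collect_const cI)
      fix s t assume "s \<in> ?I" "t \<in> ?I"
      then have [measurable]: "X s \<in> borel_measurable M" "X t \<in> borel_measurable M" by (auto intro: X_measurable)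
      show "{\<omega> \<in> space M. norm (X s \<omega> - X t \<omega>) \<le> \<epsilon>} \<in> sets M" by measurable
    qed
    show "?Q (Suc m) \<omega>" if "?Q m \<omega>" for m \<omega>
    proof -
      have "inverse (real (Suc (Suc m))) \<le> inverse (real (Suc m))" by (intro le_imp_inverse_le) auto
      then show ?thesis using that by (meson order_less_le_trans)
    qed
    show "AE \<omega> in M. \<exists>m. ?Q m \<omega>"
      using X_continuous
    proof eventually_elim
      case (elim \<omega>)
      then have "uniformly_continuous_on {t0..T} (\<lambda>t. X t \<omega>)" by (intro compact_uniformly_continuous) auto
      then obtain d where d: "0 < d" "\<And>s t. s \<in> {t0..T} \<Longrightarrow> t \<in> {t0..T} \<Longrightarrow> dist s t < d \<Longrightarrow> dist (X s \<omega>) (X t \<omega>) < \<epsilon>"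
        unfolding uniformly_continuous_on_def using assms by metis
      obtain m where "inverse (real (Suc m)) < d" using reals_Archimedean[OF d(1)] by auto
      then have "?Q m \<omega>"
        using less_imp_le[OF d(2)] by (auto simp: dist_norm dest: order_less_trans)
      then show ?case by blast
    qed
  qed (use assms in auto)
  define d where "d = inverse (real (Suc m))"
  have "exc M (\<eta> / 2 + \<eta> / 2) (\<lambda>\<omega>. continuous_on {t0..T} (\<lambda>t. X t \<omega>) \<and> ?Q m \<omega>)"
    using assms by (intro exc_conj m exc_AE X_continuous) auto
  then have "exc M \<eta> (\<lambda>\<omega>. \<forall>s\<in>{t0..T}. \<forall>t\<in>{t0..T}. \<bar>s - t\<bar> < d \<longrightarrow> norm (X s \<omega> - X t \<omega>) \<le> \<epsilon>)"
  proof (rule exc_mono)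
    fix \<omega> assume "continuous_on {t0..T} (\<lambda>t. X t \<omega>) \<and> ?Q m \<omega>"
    then have cont: "continuous_on {t0..T} (\<lambda>t. X t \<omega>)" and Q: "?Q m \<omega>" by auto
    show "\<forall>s\<in>{t0..T}. \<forall>t\<in>{t0..T}. \<bar>s - t\<bar> < d \<longrightarrow> norm (X s \<omega> - X t \<omega>) \<le> \<epsilon>"
    proof (intro ballI impI)
      fix s t assume s: "s \<in> {t0..T}" and t: "t \<in> {t0..T}" and st: "\<bar>s - t\<bar> < d"
      obtain p where p: "\<And>n. p n \<in> ?I" "p \<longlonglongrightarrow> s" using rat_sequence[OF tT s] by metis
      obtain q where q: "\<And>n. q n \<in> ?I" "q \<longlonglongrightarrow> t" using rat_sequence[OF tT t] by metis
      have "(\<lambda>n. X (p n) \<omega>) \<longlonglongrightarrow> X s \<omega>"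
        by (rule continuous_on_tendsto_compose[OF cont p(2) s])
          (use p(1) in \<open>auto intro!: always_eventually simp: less_imp_le\<close>)
      moreover have "(\<lambda>n. X (q n) \<omega>) \<longlonglongrightarrow> X t \<omega>"
        by (rule continuous_on_tendsto_compose[OF cont q(2) t])
          (use q(1) in \<open>auto intro!: always_eventually simp: less_imp_le\<close>)
      ultimately have lim: "(\<lambda>n. norm (X (p n) \<omega> - X (q n) \<omega>)) \<longlonglongrightarrow> norm (X s \<omega> - X t \<omega>)" by (intro tendsto_intros)
      have "(\<lambda>n. \<bar>p n - q n\<bar>) \<longlonglongrightarrow> \<bar>s - t\<bar>" using p(2) q(2) by (intro tendsto_intros)
      then have "eventually (\<lambda>n. \<bar>p n - q n\<bar> < d) sequentially" using st by (rule order_tendstoD)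
      then have "eventually (\<lambda>n. norm (X (p n) \<omega> - X (q n) \<omega>) \<le> \<epsilon>) sequentially"
        by eventually_elim (use Q p(1) q(1) in \<open>auto simp: d_def\<close>)
      then show "norm (X s \<omega> - X t \<omega>) \<le> \<epsilon>"
        by (rule tendsto_upperbound[OF lim]) simp
    qed
  qed simp
  moreover have "0 < d" by (simp add: d_def)
  ultimately show ?thesis using that by blast
qed

end

section \<open>Quadratic sums of the noise and of the solution\<close>

context matrix_bm
begin

lemma exc_noise_quadratic:
  assumes "0 \<le> a" "0 < \<eta>"
  shows "\<exists>L>0. \<forall>K \<tau>. time_grid a b K \<tau> \<longrightarrow> exc M \<eta> (\<lambda>\<omega>. (\<Sum>i<K. (norm (B (\<tau> (Suc i)) \<omega> - B (\<tau> i) \<omega>))\<^sup>2) \<le> L)"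
proof -
  let ?m = "mom (CARD('n) * CARD('p)) 1"
  define L where "L = (?m * \<bar>b - a\<bar> + 1) / \<eta>"
  have L: "0 < L" using assms mom_nonneg[of "CARD('n) * CARD('p)" 1] by (auto simp: L_def intro!: divide_pos_pos add_nonneg_pos)
  have "exc M \<eta> (\<lambda>\<omega>. (\<Sum>i<K. (norm (B (\<tau> (Suc i)) \<omega> - B (\<tau> i) \<omega>))\<^sup>2) \<le> L)" if grid: "time_grid a b K \<tau>" for K \<tau>
  proof (rule exc_Markov)
    have st: "0 \<le> \<tau> i" "\<tau> i < \<tau> (Suc i)" if "i < K" for i
      using time_grid_bounds[OF grid, of i] time_grid_step[OF grid, of i] that assms by auto
    show "integrable M (\<lambda>\<omega>. \<Sum>i<K. (norm (B (\<tau> (Suc i)) \<omega> - B (\<tau> i) \<omega>))\<^sup>2)"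
      using increment_moment(1)[OF st, of _ 1] by (intro Bochner_Integration.integrable_sum) auto
    have "expectation (\<lambda>\<omega>. \<Sum>i<K. (norm (B (\<tau> (Suc i)) \<omega> - B (\<tau> i) \<omega>))\<^sup>2)
        = (\<Sum>i<K. expectation (\<lambda>\<omega>. (norm (B (\<tau> (Suc i)) \<omega> - B (\<tau> i) \<omega>))\<^sup>2))"
      using increment_moment(1)[OF st, of _ 1] by (intro Bochner_Integration.integral_sum) auto
    also have "\<dots> \<le> (\<Sum>i<K. ?m * (\<tau> (Suc i) - \<tau> i))"
      using increment_moment(2)[OF st, of _ 1] by (intro sum_mono) auto
    also have "\<dots> = ?m * (b - a)"
      using grid by (simp add: sum_distrib_left[symmetric] sum_steps time_grid_def)
    also have "\<dots> \<le> ?m * \<bar>b - a\<bar>" by (intro mult_left_mono mom_nonneg) simp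
    also have "\<dots> \<le> L * \<eta>" using assms by (simp add: L_def)
    finally show "expectation (\<lambda>\<omega>. \<Sum>i<K. (norm (B (\<tau> (Suc i)) \<omega> - B (\<tau> i) \<omega>))\<^sup>2) \<le> L * \<eta>" .
  qed (use L in \<open>auto intro!: sum_nonneg\<close>)
  then show ?thesis using L by (intro exI[of _ L] conjI allI impI)
qed

text \<open>The fourth moments of the increments sum to something proportional to the mesh, whereas
  second moments would only give a constant; a sum of fourth powers dominates the largest
  one.\<close>

lemma exc_noise_small:
  assumes "0 \<le> a" "0 < \<eta>" "0 < \<epsilon>"
  shows "\<exists>d>0. \<forall>K \<tau>. time_grid a b K \<tau> \<longrightarrow> (\<forall>i<K. \<tau> (Suc i) - \<tau> i \<le> d) \<longrightarrow>
    exc M \<eta> (\<lambda>\<omega>. \<forall>i<K. norm (B (\<tau> (Suc i)) \<omega> - B (\<tau> i) \<omega>) \<le> \<epsilon>)"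
proof -
  let ?m = "mom (CARD('n) * CARD('p)) 2"
  define d where "d = \<epsilon> ^ 4 * \<eta> / (?m * \<bar>b - a\<bar> + 1)"
  have m: "0 \<le> ?m * \<bar>b - a\<bar>" using mom_nonneg[of "CARD('n) * CARD('p)" 2] by simp
  then have d: "0 < d" using assms by (auto simp: d_def intro!: divide_pos_pos add_nonneg_pos)
  have "exc M \<eta> (\<lambda>\<omega>. \<forall>i<K. norm (B (\<tau> (Suc i)) \<omega> - B (\<tau> i) \<omega>) \<le> \<epsilon>)"
    if grid: "time_grid a b K \<tau>" and step: "\<And>i. i < K \<Longrightarrow> \<tau> (Suc i) - \<tau> i \<le> d" for K \<tau>
  proof -
    have "exc M \<eta> (\<lambda>\<omega>. (\<Sum>i<K. norm (B (\<tau> (Suc i)) \<omega> - B (\<tau> i) \<omega>) ^ 4) \<le> \<epsilon> ^ 4)"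
    proof (rule exc_Markov)
      have st: "0 \<le> \<tau> i" "\<tau> i < \<tau> (Suc i)" if "i < K" for i
        using time_grid_bounds[OF grid, of i] time_grid_step[OF grid, of i] that assms by auto
      show "integrable M (\<lambda>\<omega>. \<Sum>i<K. norm (B (\<tau> (Suc i)) \<omega> - B (\<tau> i) \<omega>) ^ 4)"
        using increment_moment(1)[OF st, of _ 2] by (intro Bochner_Integration.integrable_sum) auto
      have "expectation (\<lambda>\<omega>. \<Sum>i<K. norm (B (\<tau> (Suc i)) \<omega> - B (\<tau> i) \<omega>) ^ 4)
          = (\<Sum>i<K. expectation (\<lambda>\<omega>. norm (B (\<tau> (Suc i)) \<omega> - B (\<tau> i) \<omega>) ^ 4))"
        using increment_moment(1)[OF st, of _ 2] by (intro Bochner_Integration.integral_sum) auto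
      also have "\<dots> \<le> (\<Sum>i<K. ?m * d * (\<tau> (Suc i) - \<tau> i))"
      proof (intro sum_mono)
        fix i assume "i \<in> {..<K}"
        then have i: "i < K" by simp
        have "expectation (\<lambda>\<omega>. norm (B (\<tau> (Suc i)) \<omega> - B (\<tau> i) \<omega>) ^ 4) \<le> ?m * ((\<tau> (Suc i) - \<tau> i) * (\<tau> (Suc i) - \<tau> i))"
          using increment_moment(2)[OF st[OF i], of 2] by (simp add: power2_eq_square)
        also have "\<dots> \<le> ?m * (d * (\<tau> (Suc i) - \<tau> i))"
          using step[OF i] st[OF i] by (intro mult_left_mono mult_right_mono mom_nonneg) auto
        finally show "expectation (\<lambda>\<omega>. norm (B (\<tau> (Suc i)) \<omega> - B (\<tau> i) \<omega>) ^ 4) \<le> ?m * d * (\<tau> (Suc i) - \<tau> i)" by simp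
      qed
      also have "\<dots> = ?m * (b - a) * d"
        using grid by (simp add: sum_distrib_left[symmetric] sum_steps time_grid_def)
      also have "\<dots> \<le> (?m * \<bar>b - a\<bar> + 1) * d"
        using d mult_left_mono[OF abs_ge_self[of "b - a"] mom_nonneg[of "CARD('n) * CARD('p)" 2]] by (intro mult_right_mono) auto
      also have "\<dots> = \<epsilon> ^ 4 * \<eta>" using m by (simp add: d_def)
      finally show "expectation (\<lambda>\<omega>. \<Sum>i<K. norm (B (\<tau> (Suc i)) \<omega> - B (\<tau> i) \<omega>) ^ 4) \<le> \<epsilon> ^ 4 * \<eta>" .
    qed (use assms in \<open>auto intro!: sum_nonneg\<close>)
    then show ?thesis
    proof (rule exc_mono)
      fix \<omega> assume le: "(\<Sum>i<K. norm (B (\<tau> (Suc i)) \<omega> - B (\<tau> i) \<omega>) ^ 4) \<le> \<epsilon> ^ 4"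
      show "\<forall>i<K. norm (B (\<tau> (Suc i)) \<omega> - B (\<tau> i) \<omega>) \<le> \<epsilon>"
      proof (intro allI impI)
        fix i assume "i < K"
        then have "norm (B (\<tau> (Suc i)) \<omega> - B (\<tau> i) \<omega>) ^ 4 \<le> (\<Sum>i<K. norm (B (\<tau> (Suc i)) \<omega> - B (\<tau> i) \<omega>) ^ 4)"
          by (intro member_le_sum) auto
        then have "norm (B (\<tau> (Suc i)) \<omega> - B (\<tau> i) \<omega>) ^ 4 \<le> \<epsilon> ^ 4" using le by linarith
        then show "norm (B (\<tau> (Suc i)) \<omega> - B (\<tau> i) \<omega>) \<le> \<epsilon>" using assms(3) by (simp add: power_mono_iff)
      qed
    qed simp
  qed
  then show ?thesis using d by (intro exI[of _ d] conjI allI impI) simp_all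
qed

text \<open>With \<open>c\<close> the projection onto \<open>[-R, R]\<close>, the function \<open>2 c x - c\<^sup>2\<close> is convex and grows linearly, so its
  increments along a martingale control the squared increments within \<open>[-R, R]\<close>. No square integrability and no
  stopping is needed.\<close>

lemma clamped_martingale_quadratic:
  fixes n :: "nat \<Rightarrow> 'a \<Rightarrow> real" and u :: "nat \<Rightarrow> real"
  assumes u: "\<And>i. i < K \<Longrightarrow> u i \<le> u (Suc i)"
    and n: "\<And>i. i \<le> K \<Longrightarrow> n i \<in> borel_measurable (F (u i))" "\<And>i. i \<le> K \<Longrightarrow> integrable M (n i)"
    and mart: "\<And>i. i < K \<Longrightarrow> AE \<omega> in M. real_cond_exp M (F (u i)) (n (Suc i)) \<omega> = n i \<omega>"
    and n0: "\<And>\<omega>. \<omega> \<in> space M \<Longrightarrow> n 0 \<omega> = 0" and "0 \<le> R" "0 < \<eta>"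
    and L: "2 * R * expectation (\<lambda>\<omega>. \<bar>n K \<omega>\<bar>) \<le> L * \<eta>" "0 < L"
  shows "exc M \<eta> (\<lambda>\<omega>. (\<forall>i\<le>K. \<bar>n i \<omega>\<bar> \<le> R) \<longrightarrow> (\<Sum>i<K. (n (Suc i) \<omega> - n i \<omega>)\<^sup>2) \<le> L)"
proof -
  define c where "c x = max (- R) (min R x)" for x :: real
  define \<phi> where "\<phi> x = 2 * c x * x - (c x)\<^sup>2" for x
  \<comment> \<open>The Bregman distance of the convex function \<open>\<phi>\<close>, whose
    derivative is twice \<open>c\<close>; see \<open>b_eq\<close>. It is nonnegative since
    \<open>c y\<close> is the point of the interval nearest to \<open>y\<close>, and it equals
    \<open>(y - x)\<^sup>2\<close> inside the interval.\<close>
  define b where "b x y = (y - c x)\<^sup>2 - (y - c y)\<^sup>2" for x y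
  have cR: "\<bar>c x\<bar> \<le> R" for x using \<open>0 \<le> R\<close> by (auto simp: c_def)
  have b_eq: "b x y = \<phi> y - \<phi> x - 2 * (c x * y - c x * x)" for x y
    by (simp add: b_def \<phi>_def power2_eq_square algebra_simps)
  have b_nonneg: "0 \<le> b x y" for x y
  proof -
    have "\<bar>y - c y\<bar> \<le> \<bar>y - c x\<bar>"
      using cR[of x] \<open>0 \<le> R\<close> unfolding c_def[of y] by (simp add: abs_if max_def min_def split: if_splits)
    then show ?thesis unfolding b_def using power_mono[of "\<bar>y - c y\<bar>" "\<bar>y - c x\<bar>" 2] by simp
  qed
  have b_in: "b x y = (y - x)\<^sup>2" if "\<bar>x\<bar> \<le> R" "\<bar>y\<bar> \<le> R" for x y
    using that by (simp add: b_def c_def)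
  have \<phi>_le: "\<bar>\<phi> x\<bar> \<le> 2 * R * \<bar>x\<bar> + R\<^sup>2" for x
  proof -
    have "\<bar>\<phi> x\<bar> \<le> 2 * \<bar>c x\<bar> * \<bar>x\<bar> + \<bar>c x\<bar>\<^sup>2" unfolding \<phi>_def by (simp add: abs_mult order_trans[OF abs_triangle_ineq4])
    also have "\<dots> \<le> 2 * R * \<bar>x\<bar> + R\<^sup>2" using cR[of x] by (intro add_mono mult_right_mono power_mono) auto
    finally show ?thesis .
  qed
  have \<phi>_le2: "\<phi> x \<le> 2 * R * \<bar>x\<bar>" for x
  proof -
    have "\<phi> x \<le> 2 * (c x * x)" by (simp add: \<phi>_def)
    also have "c x * x \<le> \<bar>c x\<bar> * \<bar>x\<bar>" by (simp add: abs_mult[symmetric])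
    also have "\<dots> \<le> R * \<bar>x\<bar>" using cR[of x] by (intro mult_right_mono) auto
    finally show ?thesis by simp
  qed
  have cm: "c \<in> borel_measurable borel" unfolding c_def by measurable
  have nM: "n i \<in> borel_measurable M" if "i \<le> K" for i by (rule measurable_F_M[OF n(1)[OF that]])
  have cF: "(\<lambda>\<omega>. c (n i \<omega>)) \<in> borel_measurable (F (u i))" if "i \<le> K" for i by (rule measurable_compose[OF n(1)[OF that] cm])
  have cM: "(\<lambda>\<omega>. c (n i \<omega>)) \<in> borel_measurable M" if "i \<le> K" for i by (rule measurable_F_M[OF cF[OF that]])
  have \<phi>I: "integrable M (\<lambda>\<omega>. \<phi> (n i \<omega>))" if "i \<le> K" for i
  proof (rule integrable_dominated[of M "\<lambda>\<omega>. 2 * R * \<bar>n i \<omega>\<bar> + R\<^sup>2"])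
    show "integrable M (\<lambda>\<omega>. 2 * R * \<bar>n i \<omega>\<bar> + R\<^sup>2)" using n(2)[OF that] by auto
    show "(\<lambda>\<omega>. \<phi> (n i \<omega>)) \<in> borel_measurable M" unfolding \<phi>_def using cM[OF that] nM[OF that] by measurable
  qed (use \<phi>_le in auto)
  have cnI: "integrable M (\<lambda>\<omega>. c (n i \<omega>) * n j \<omega>)" if "i \<le> K" "j \<le> K" for i j
  proof (rule integrable_dominated[of M "\<lambda>\<omega>. R * \<bar>n j \<omega>\<bar>"])
    show "integrable M (\<lambda>\<omega>. R * \<bar>n j \<omega>\<bar>)" using n(2)[OF that(2)] by auto
    show "(\<lambda>\<omega>. c (n i \<omega>) * n j \<omega>) \<in> borel_measurable M" using cM[OF that(1)] nM[OF that(2)] by measurable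
    show "norm (c (n i \<omega>) * n j \<omega>) \<le> R * \<bar>n j \<omega>\<bar>" for \<omega>
      using cR[of "n i \<omega>"] by (auto simp: abs_mult intro: mult_right_mono)
  qed
  \<comment> \<open>\<open>c (n i \<omega>)\<close> is bounded and known at time \<open>u i\<close>,
    so the martingale property removes the linear term of \<open>b\<close>.\<close>
  have zero: "expectation (\<lambda>\<omega>. c (n i \<omega>) * n (Suc i) \<omega>) = expectation (\<lambda>\<omega>. c (n i \<omega>) * n i \<omega>)" if i: "i < K" for i
  proof -
    interpret finite_measure_subalgebra M "F (u i)" by unfold_locales (rule subalg)
    have "expectation (\<lambda>\<omega>. c (n i \<omega>) * n (Suc i) \<omega>) = expectation (\<lambda>\<omega>. c (n i \<omega>) * real_cond_exp M (F (u i)) (n (Suc i)) \<omega>)"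
      using i by (intro real_cond_exp_intg(2)[symmetric] cnI cF nM) auto
    also have "\<dots> = expectation (\<lambda>\<omega>. c (n i \<omega>) * n i \<omega>)"
    proof (rule integral_cong_AE)
      show "(\<lambda>\<omega>. c (n i \<omega>) * real_cond_exp M (F (u i)) (n (Suc i)) \<omega>) \<in> borel_measurable M"
        using cM[of i] i by (intro borel_measurable_times borel_measurable_cond_exp2) auto
      show "(\<lambda>\<omega>. c (n i \<omega>) * n i \<omega>) \<in> borel_measurable M" using cM[of i] nM[of i] i by auto
      show "AE \<omega> in M. c (n i \<omega>) * real_cond_exp M (F (u i)) (n (Suc i)) \<omega> = c (n i \<omega>) * n i \<omega>"
        using mart[OF i] by eventually_elim simp
    qed
    finally show ?thesis .
  qed
  have bI: "integrable M (\<lambda>\<omega>. b (n i \<omega>) (n (Suc i) \<omega>))" if "i < K" for i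
    unfolding b_eq using \<phi>I[of i] \<phi>I[of "Suc i"] cnI[of i i] cnI[of i "Suc i"] that by auto
  have bE: "expectation (\<lambda>\<omega>. b (n i \<omega>) (n (Suc i) \<omega>)) = expectation (\<lambda>\<omega>. \<phi> (n (Suc i) \<omega>)) - expectation (\<lambda>\<omega>. \<phi> (n i \<omega>))" if "i < K" for i
    unfolding b_eq using \<phi>I[of i] \<phi>I[of "Suc i"] cnI[of i i] cnI[of i "Suc i"] zero[OF that] that by simp
  have "exc M \<eta> (\<lambda>\<omega>. (\<Sum>i<K. b (n i \<omega>) (n (Suc i) \<omega>)) \<le> L)"
  proof (rule exc_Markov)
    show "integrable M (\<lambda>\<omega>. \<Sum>i<K. b (n i \<omega>) (n (Suc i) \<omega>))" using bI by (intro Bochner_Integration.integrable_sum) auto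
    \<comment> \<open>The sum telescopes, so a first absolute moment at the final time is all that
      enters.\<close>
    have "expectation (\<lambda>\<omega>. \<Sum>i<K. b (n i \<omega>) (n (Suc i) \<omega>)) = (\<Sum>i<K. expectation (\<lambda>\<omega>. \<phi> (n (Suc i) \<omega>)) - expectation (\<lambda>\<omega>. \<phi> (n i \<omega>)))"
      using bI bE by (subst Bochner_Integration.integral_sum) auto
    also have "\<dots> = expectation (\<lambda>\<omega>. \<phi> (n K \<omega>)) - expectation (\<lambda>\<omega>. \<phi> (n 0 \<omega>))"
      by (rule sum_lessThan_telescope)
    also have "expectation (\<lambda>\<omega>. \<phi> (n 0 \<omega>)) = expectation (\<lambda>\<omega>. 0)"
      using \<open>0 \<le> R\<close> by (intro Bochner_Integration.integral_cong refl) (simp add: n0 \<phi>_def c_def)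
    also have "expectation (\<lambda>\<omega>. \<phi> (n K \<omega>)) - expectation (\<lambda>\<omega>. 0) = expectation (\<lambda>\<omega>. \<phi> (n K \<omega>))" by simp
    also have "\<dots> \<le> expectation (\<lambda>\<omega>. 2 * R * \<bar>n K \<omega>\<bar>)"
      by (intro integral_mono \<phi>I \<phi>_le2 order_refl integrable_mult_right integrable_abs n(2))
    also have "\<dots> \<le> L * \<eta>" using L(1) by simp
    finally show "expectation (\<lambda>\<omega>. \<Sum>i<K. b (n i \<omega>) (n (Suc i) \<omega>)) \<le> L * \<eta>" .
  qed (use b_nonneg L in \<open>auto intro!: sum_nonneg\<close>)
  then show ?thesis
  proof (rule exc_mono)
    fix \<omega> assume le: "(\<Sum>i<K. b (n i \<omega>) (n (Suc i) \<omega>)) \<le> L"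
    show "(\<forall>i\<le>K. \<bar>n i \<omega>\<bar> \<le> R) \<longrightarrow> (\<Sum>i<K. (n (Suc i) \<omega> - n i \<omega>)\<^sup>2) \<le> L"
    proof
      assume "\<forall>i\<le>K. \<bar>n i \<omega>\<bar> \<le> R"
      then have "(\<Sum>i<K. b (n i \<omega>) (n (Suc i) \<omega>)) = (\<Sum>i<K. (n (Suc i) \<omega> - n i \<omega>)\<^sup>2)"
        by (intro sum.cong refl b_in) auto
      then show "(\<Sum>i<K. (n (Suc i) \<omega> - n i \<omega>)\<^sup>2) \<le> L" using le by simp
    qed
  qed simp
qed

end

lemma sum_sq_le_sq_sum_abs:
  fixes a :: "'i \<Rightarrow> real"
  assumes "finite I"
  shows "(\<Sum>i\<in>I. (a i)\<^sup>2) \<le> (\<Sum>i\<in>I. \<bar>a i\<bar>)\<^sup>2"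
proof -
  have "(\<Sum>i\<in>I. (a i)\<^sup>2) = (\<Sum>i\<in>I. \<bar>a i\<bar> * \<bar>a i\<bar>)" by (simp add: power2_eq_square)
  also have "\<dots> \<le> (\<Sum>i\<in>I. \<bar>a i\<bar> * (\<Sum>i\<in>I. \<bar>a i\<bar>))"
    using assms by (intro sum_mono mult_left_mono member_le_sum) auto
  also have "\<dots> = (\<Sum>i\<in>I. \<bar>a i\<bar>)\<^sup>2" by (simp add: sum_distrib_right power2_eq_square)
  finally show ?thesis .
qed

context matrix_bm
begin

text \<open>The martingale part is stopped at one localising time that exceeds \<open>b\<close>
  outside a small event and is then treated by \<open>clamped_martingale_quadratic\<close>; the
  squares of the other part sum to at most the square of its variation. Considering only refinements
  of one grid makes the families countable and lets \<open>L\<close> be chosen before the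
  level.\<close>

lemma exc_semimartingale_quadratic:
  assumes H: "continuous_semimartingale_on a b M F H" and grid: "time_grid a b K \<tau>" and "a \<le> b" "0 < \<eta>"
  obtains L where "0 < L" "\<And>m. exc M \<eta> (\<lambda>\<omega>. (\<Sum>i<K * 2 ^ m. (H (subgrid \<tau> m (Suc i)) \<omega> - H (subgrid \<tau> m i) \<omega>)\<^sup>2) \<le> L)"
proof -
  let ?t = "subgrid \<tau>" and ?N = "\<lambda>m. K * 2 ^ m"
  note g = time_grid_subgrid[OF grid]
  have t_in: "?t m i \<in> {a..b}" if "i \<le> ?N m" for m i using time_grid_bounds[OF g that] by simp
  have t_0: "?t m 0 = a" and t_N: "?t m (?N m) = b" for m using g[of m] by (auto simp: time_grid_def)
  obtain N V where N: "continuous_local_martingale_on a b M F N" and VF: "adapted_on {a..b} F V"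
    and V: "AE \<omega> in M. continuous_on {a..b} (\<lambda>t. V t \<omega>) \<and> bounded_variation_on a b (\<lambda>t. V t \<omega>)"
    and HNV: "AE \<omega> in M. \<forall>t\<in>{a..b}. H t \<omega> = N t \<omega> + V t \<omega>"
    using H unfolding continuous_semimartingale_on_def by (elim conjE exE) (rule that)
  have VM: "V t \<in> borel_measurable M" if "t \<in> {a..b}" for t
    using VF that by (auto simp: adapted_on_def intro: measurable_F_M)
  have NM: "N t \<in> borel_measurable M" if "t \<in> {a..b}" for t
    using N that by (auto simp: adapted_on_def continuous_local_martingale_on_def intro: measurable_F_M)
  have \<eta>5: "0 < \<eta> / 5" using \<open>0 < \<eta>\<close> by simp
  obtain LV where LV: "0 \<le> LV" "exc M (\<eta> / 5) (\<lambda>\<omega>. \<forall>m\<in>UNIV. (\<Sum>i<?N m. \<bar>V (?t m (Suc i)) \<omega> - V (?t m i) \<omega>\<bar>) \<le> LV)"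
  proof (rule exc_bounded_family[of UNIV "\<lambda>m \<omega>. \<Sum>i<?N m. \<bar>V (?t m (Suc i)) \<omega> - V (?t m i) \<omega>\<bar>" "\<eta> / 5"])
    show "countable (UNIV :: nat set)" by (rule countableI_type)
    show "(\<lambda>\<omega>. \<Sum>i<?N m. \<bar>V (?t m (Suc i)) \<omega> - V (?t m i) \<omega>\<bar>) \<in> borel_measurable M" for m
      using VM t_in[of _ m] by (intro borel_measurable_sum borel_measurable_abs borel_measurable_diff) auto
    show "AE \<omega> in M. \<exists>R. \<forall>m\<in>UNIV. (\<Sum>i<?N m. \<bar>V (?t m (Suc i)) \<omega> - V (?t m i) \<omega>\<bar>) \<le> R"
      using V by eventually_elim (use g in \<open>auto simp: bounded_variation_on_def\<close>)
  qed (rule \<eta>5, erule (1) that)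
  let ?I = "{(m, i). i \<le> ?N m}"
  obtain R where R: "0 \<le> R" "exc M (\<eta> / 5) (\<lambda>\<omega>. \<forall>q\<in>?I. \<bar>N (?t (fst q) (snd q)) \<omega> - N a \<omega>\<bar> \<le> R)"
  proof (rule exc_bounded_family[of ?I "\<lambda>q \<omega>. \<bar>N (?t (fst q) (snd q)) \<omega> - N a \<omega>\<bar>" "\<eta> / 5"])
    show "countable ?I" by (rule countableI_type)
    show "(\<lambda>\<omega>. \<bar>N (?t (fst q) (snd q)) \<omega> - N a \<omega>\<bar>) \<in> borel_measurable M" if "q \<in> ?I" for q
      using that t_in \<open>a \<le> b\<close> by (intro borel_measurable_abs borel_measurable_diff NM) auto
    have "AE \<omega> in M. continuous_on {a..b} (\<lambda>t. N t \<omega>)"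
      using N by (simp add: continuous_local_martingale_on_def)
    then show "AE \<omega> in M. \<exists>R. \<forall>q\<in>?I. \<bar>N (?t (fst q) (snd q)) \<omega> - N a \<omega>\<bar> \<le> R"
    proof eventually_elim
      case (elim \<omega>)
      then have "compact ((\<lambda>t. N t \<omega> - N a \<omega>) ` {a..b})" by (intro compact_continuous_image continuous_intros) auto
      then obtain R where "\<forall>t\<in>{a..b}. \<bar>N t \<omega> - N a \<omega>\<bar> \<le> R" by (auto dest!: compact_imp_bounded simp: bounded_iff)
      then show ?case using t_in by (intro exI[of _ R]) auto
    qed
  qed (rule \<eta>5, erule (1) that)
  obtain S :: "nat \<Rightarrow> 'a \<Rightarrow> real" where S: "\<And>m. stopping_time F (S m)" "\<And>m \<omega>. \<omega> \<in> space M \<Longrightarrow> a \<le> S m \<omega>"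
    and S_inc: "AE \<omega> in M. incseq (\<lambda>m. S m \<omega>) \<and> (\<exists>m. b \<le> S m \<omega>)"
    and S_mart: "\<And>m. martingale_on a b M F (\<lambda>t \<omega>. N (min t (S m \<omega>)) \<omega> - N a \<omega>)"
  proof -
    obtain S :: "nat \<Rightarrow> 'a \<Rightarrow> real" where "(\<forall>m. stopping_time F (S m) \<and> (\<forall>\<omega>\<in>space M. a \<le> S m \<omega>)) \<and>
        (AE \<omega> in M. incseq (\<lambda>m. S m \<omega>) \<and> (\<exists>m. b \<le> S m \<omega>)) \<and>
        (\<forall>m. martingale_on a b M F (\<lambda>t \<omega>. N (min t (S m \<omega>)) \<omega> - N a \<omega>))"
      using N unfolding continuous_local_martingale_on_def by (elim conjE exE) (rule that, intro conjI)
    then show ?thesis by (intro that[of S]) auto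
  qed
  have SM: "S m \<in> borel_measurable M" for m
    by (rule measurable_stopping_time[OF S(1)]) (use sets_F_M in auto)
  \<comment> \<open>The localising sequence increases only almost surely, while
    \<open>exc_eventually\<close> requires events that increase at every point; the quantifier over
    \<open>m \<le> m0\<close> provides this.\<close>
  obtain m0 where m0: "exc M (\<eta> / 5) (\<lambda>\<omega>. \<exists>m\<le>m0. b \<le> S m \<omega>)"
  proof (rule exc_eventually[of "\<lambda>m0 \<omega>. \<exists>m\<le>m0. b \<le> S m \<omega>" "\<eta> / 5"])
    show "{\<omega> \<in> space M. \<exists>m\<le>m0. b \<le> S m \<omega>} \<in> sets M" for m0 using SM by measurable
    show "AE \<omega> in M. \<exists>m0. \<exists>m\<le>m0. b \<le> S m \<omega>" using S_inc by eventually_elim blast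
    show "\<exists>m\<le>Suc m0. b \<le> S m \<omega>" if "\<exists>m\<le>m0. b \<le> S m \<omega>" for m0 \<omega>
      using that le_SucI by blast
  qed (rule \<eta>5, rule that)
  let ?n = "\<lambda>m i \<omega>. N (min (?t m i) (S m0 \<omega>)) \<omega> - N a \<omega>"
  \<comment> \<open>All levels end at \<open>b\<close>, so this moment is the same for each of them,
    and \<open>L1\<close>, built from it for Markov's inequality, does not depend on the
    level.\<close>
  define c where "c = expectation (\<lambda>\<omega>. \<bar>N (min b (S m0 \<omega>)) \<omega> - N a \<omega>\<bar>)"
  have c: "0 \<le> c" unfolding c_def by (rule integral_nonneg_AE) simp
  define L1 where "L1 = (2 * R * c + 1) / (\<eta> / 5)"
  have L1: "0 < L1" using c R(1) \<eta>5 unfolding L1_def by (intro divide_pos_pos add_nonneg_pos) auto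
  have mart: "exc M (\<eta> / 5) (\<lambda>\<omega>. (\<forall>i\<le>?N m. \<bar>?n m i \<omega>\<bar> \<le> R) \<longrightarrow> (\<Sum>i<?N m. (?n m (Suc i) \<omega> - ?n m i \<omega>)\<^sup>2) \<le> L1)" for m
  proof (rule clamped_martingale_quadratic[where u="?t m"])
    note mm = S_mart[of m0, unfolded martingale_on_def adapted_on_def]
    show le: "?t m i \<le> ?t m (Suc i)" if "i < ?N m" for i using time_grid_step[OF g that] by simp
    show "?n m i \<in> borel_measurable (F (?t m i))" if "i \<le> ?N m" for i using mm t_in[OF that] by blast
    show "integrable M (?n m i)" if "i \<le> ?N m" for i using mm t_in[OF that] by blast
    show "AE \<omega> in M. real_cond_exp M (F (?t m i)) (?n m (Suc i)) \<omega> = ?n m i \<omega>" if "i < ?N m" for i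
      using mm le[OF that] t_in[of i m] t_in[of "Suc i" m] that by force
    show "?n m 0 \<omega> = 0" if "\<omega> \<in> space M" for \<omega> using S(2)[OF that, of m0] t_0[of m] by simp
    show "2 * R * expectation (\<lambda>\<omega>. \<bar>?n m (?N m) \<omega>\<bar>) \<le> L1 * (\<eta> / 5)"
      unfolding t_N c_def[symmetric] using \<eta>5 by (simp add: L1_def)
  qed (use R L1 \<eta>5 in auto)
  define L where "L = 2 * L1 + 2 * LV\<^sup>2"
  have "exc M \<eta> (\<lambda>\<omega>. (\<Sum>i<?N m. (H (?t m (Suc i)) \<omega> - H (?t m i) \<omega>)\<^sup>2) \<le> L)" for m
  proof -
    have ae: "AE \<omega> in M. incseq (\<lambda>m. S m \<omega>) \<and> (\<forall>t\<in>{a..b}. H t \<omega> = N t \<omega> + V t \<omega>)"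
      using S_inc HNV by eventually_elim auto
    show ?thesis
    proof (rule exc_mono[OF exc_conj[OF exc_conj[OF exc_conj[OF exc_conj[OF LV(2) R(2)] m0] mart[of m]] exc_AE[OF ae less_imp_le[OF \<eta>5]]]])
      fix \<omega> assume "\<omega> \<in> space M" and *: "((((\<forall>m\<in>UNIV. (\<Sum>i<?N m. \<bar>V (?t m (Suc i)) \<omega> - V (?t m i) \<omega>\<bar>) \<le> LV) \<and>
         (\<forall>q\<in>?I. \<bar>N (?t (fst q) (snd q)) \<omega> - N a \<omega>\<bar> \<le> R)) \<and> (\<exists>m\<le>m0. b \<le> S m \<omega>)) \<and>
         ((\<forall>i\<le>?N m. \<bar>?n m i \<omega>\<bar> \<le> R) \<longrightarrow> (\<Sum>i<?N m. (?n m (Suc i) \<omega> - ?n m i \<omega>)\<^sup>2) \<le> L1)) \<and>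
         incseq (\<lambda>m. S m \<omega>) \<and> (\<forall>t\<in>{a..b}. H t \<omega> = N t \<omega> + V t \<omega>)"
      then obtain m' where "m' \<le> m0" "b \<le> S m' \<omega>" by blast
      moreover have "incseq (\<lambda>m. S m \<omega>)" using * by blast
      ultimately have "b \<le> S m0 \<omega>" using incseqD[of "\<lambda>m. S m \<omega>" m' m0] by simp
      then have n_eq: "?n m i \<omega> = N (?t m i) \<omega> - N a \<omega>" if "i \<le> ?N m" for i
        using t_in[OF that] by (simp add: min_def)
      have "\<forall>i\<le>?N m. \<bar>?n m i \<omega>\<bar> \<le> R" using * by (auto simp: n_eq)
      then have "(\<Sum>i<?N m. (?n m (Suc i) \<omega> - ?n m i \<omega>)\<^sup>2) \<le> L1" using * by blast
      also have "(\<Sum>i<?N m. (?n m (Suc i) \<omega> - ?n m i \<omega>)\<^sup>2) = (\<Sum>i<?N m. (N (?t m (Suc i)) \<omega> - N (?t m i) \<omega>)\<^sup>2)"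
        by (intro sum.cong refl) (simp only: n_eq lessThan_iff Suc_le_eq less_imp_le, simp)
      finally have Nle: "(\<Sum>i<?N m. (N (?t m (Suc i)) \<omega> - N (?t m i) \<omega>)\<^sup>2) \<le> L1" .
      have "(\<Sum>i<?N m. (V (?t m (Suc i)) \<omega> - V (?t m i) \<omega>)\<^sup>2) \<le> (\<Sum>i<?N m. \<bar>V (?t m (Suc i)) \<omega> - V (?t m i) \<omega>\<bar>)\<^sup>2"
        by (rule sum_sq_le_sq_sum_abs) simp
      also have "\<dots> \<le> LV\<^sup>2" using * by (intro power_mono sum_nonneg) auto
      finally have Vle: "(\<Sum>i<?N m. (V (?t m (Suc i)) \<omega> - V (?t m i) \<omega>)\<^sup>2) \<le> LV\<^sup>2" .
      have "(\<Sum>i<?N m. (H (?t m (Suc i)) \<omega> - H (?t m i) \<omega>)\<^sup>2)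
          \<le> (\<Sum>i<?N m. 2 * (N (?t m (Suc i)) \<omega> - N (?t m i) \<omega>)\<^sup>2 + 2 * (V (?t m (Suc i)) \<omega> - V (?t m i) \<omega>)\<^sup>2)"
      proof (rule sum_mono)
        fix i assume "i \<in> {..<?N m}"
        then have "H (?t m i) \<omega> = N (?t m i) \<omega> + V (?t m i) \<omega>" "H (?t m (Suc i)) \<omega> = N (?t m (Suc i)) \<omega> + V (?t m (Suc i)) \<omega>"
          using * t_in[of i m] t_in[of "Suc i" m] by auto
        then show "(H (?t m (Suc i)) \<omega> - H (?t m i) \<omega>)\<^sup>2 \<le> 2 * (N (?t m (Suc i)) \<omega> - N (?t m i) \<omega>)\<^sup>2 + 2 * (V (?t m (Suc i)) \<omega> - V (?t m i) \<omega>)\<^sup>2"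
          using norm_add_sq_le[of "N (?t m (Suc i)) \<omega> - N (?t m i) \<omega>" "V (?t m (Suc i)) \<omega> - V (?t m i) \<omega>"]
          by (simp add: algebra_simps)
      qed
      also have "\<dots> \<le> L" using Nle Vle by (simp add: sum.distrib sum_distrib_left[symmetric] L_def)
      finally show "(\<Sum>i<?N m. (H (?t m (Suc i)) \<omega> - H (?t m i) \<omega>)\<^sup>2) \<le> L" .
    qed simp
  qed
  moreover have "0 < L" using L1 by (simp add: L_def add_pos_nonneg)
  ultimately show ?thesis by (intro that)
qed

end

context stiefel_sde
begin

lemma exc_X_quadratic:
  assumes grid: "time_grid t0 T K \<tau>" and "0 < \<eta>"
  shows "\<exists>L>0. \<forall>m. exc M \<eta> (\<lambda>\<omega>. (\<Sum>i<K * 2 ^ m. (norm (X (subgrid \<tau> m (Suc i)) \<omega> - X (subgrid \<tau> m i) \<omega>))\<^sup>2) \<le> L)"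
proof -
  let ?c = "card (UNIV :: ('n \<times> 'p) set)"
  have "\<exists>L>0. \<forall>m. exc M (\<eta> / ?c) (\<lambda>\<omega>. (\<Sum>i<K * 2 ^ m. (X (subgrid \<tau> m (Suc i)) \<omega> $ fst q $ snd q - X (subgrid \<tau> m i) \<omega> $ fst q $ snd q)\<^sup>2) \<le> L)" for q
  proof -
    have "continuous_semimartingale_on t0 T M F (\<lambda>t \<omega>. X t \<omega> $ fst q $ snd q)"
      using sol by (simp add: stiefel_sde_solution_def)
    moreover have "0 < \<eta> / ?c" using \<open>0 < \<eta>\<close> by (simp add: zero_less_divide_iff)
    ultimately show ?thesis
      by (rule exc_semimartingale_quadratic[OF _ grid less_imp_le[OF tT]]) (intro exI conjI allI; assumption)
  qed
  from choice[OF allI[OF this]] obtain L where "\<forall>q. 0 < L q \<and> (\<forall>m. exc M (\<eta> / ?c) (\<lambda>\<omega>. (\<Sum>i<K * 2 ^ m. (X (subgrid \<tau> m (Suc i)) \<omega> $ fst q $ snd q - X (subgrid \<tau> m i) \<omega> $ fst q $ snd q)\<^sup>2) \<le> L q))" ..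
  then have L: "\<And>q. 0 < L q" "\<And>q m. exc M (\<eta> / ?c) (\<lambda>\<omega>. (\<Sum>i<K * 2 ^ m. (X (subgrid \<tau> m (Suc i)) \<omega> $ fst q $ snd q - X (subgrid \<tau> m i) \<omega> $ fst q $ snd q)\<^sup>2) \<le> L q)"
    by auto
  have "exc M \<eta> (\<lambda>\<omega>. (\<Sum>i<K * 2 ^ m. (norm (X (subgrid \<tau> m (Suc i)) \<omega> - X (subgrid \<tau> m i) \<omega>))\<^sup>2) \<le> (\<Sum>q\<in>UNIV. L q))" for m
  proof (rule exc_mono[OF exc_all_finite[OF finite_class.finite_UNIV L(2) less_imp_le[OF \<open>0 < \<eta>\<close>]] order_refl])
    fix \<omega> assume *: "\<forall>q\<in>UNIV. (\<Sum>i<K * 2 ^ m. (X (subgrid \<tau> m (Suc i)) \<omega> $ fst q $ snd q - X (subgrid \<tau> m i) \<omega> $ fst q $ snd q)\<^sup>2) \<le> L q"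
    have "(\<Sum>i<K * 2 ^ m. (norm (X (subgrid \<tau> m (Suc i)) \<omega> - X (subgrid \<tau> m i) \<omega>))\<^sup>2)
      = (\<Sum>i<K * 2 ^ m. \<Sum>q\<in>UNIV. (X (subgrid \<tau> m (Suc i)) \<omega> $ fst q $ snd q - X (subgrid \<tau> m i) \<omega> $ fst q $ snd q)\<^sup>2)"
      unfolding norm_sq_matrix by (simp add: sum.cartesian_product case_prod_unfold)
    also have "\<dots> = (\<Sum>q\<in>UNIV. \<Sum>i<K * 2 ^ m. (X (subgrid \<tau> m (Suc i)) \<omega> $ fst q $ snd q - X (subgrid \<tau> m i) \<omega> $ fst q $ snd q)\<^sup>2)"
      by (rule sum.swap)
    also have "\<dots> \<le> (\<Sum>q\<in>UNIV. L q)" using * by (intro sum_mono) auto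
    finally show "(\<Sum>i<K * 2 ^ m. (norm (X (subgrid \<tau> m (Suc i)) \<omega> - X (subgrid \<tau> m i) \<omega>))\<^sup>2) \<le> (\<Sum>q\<in>UNIV. L q)" .
  qed
  moreover have "0 < (\<Sum>q\<in>UNIV. L q)" using L(1) by (intro sum_pos) auto
  ultimately show ?thesis by (intro exI[of _ "\<Sum>q\<in>UNIV. L q"] conjI allI)
qed

text \<open>One step of the trapezoidal rule with all directions of the noise combined, which is
  possible because \<open>pf\<close> is linear in the noise.\<close>

definition trap :: "real \<Rightarrow> real \<Rightarrow> 'a \<Rightarrow> real ^ 'p ^ 'n" where
  "trap s t \<omega> = (1/2) *\<^sub>R (pf (X s \<omega>) (B t \<omega> - B s \<omega>) + pf (X t \<omega>) (B t \<omega> - B s \<omega>))"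

lemma sum_trapezoidal:
  "(\<Sum>u\<in>UNIV. \<Sum>v\<in>UNIV. trapezoidal_sum (\<lambda>s \<omega>. P_field u v (X s \<omega>)) (\<lambda>s \<omega>. B s \<omega> $ u $ v) K \<tau> \<omega>)
    = (\<Sum>k<K. trap (\<tau> k) (\<tau> (Suc k)) \<omega>)"
proof -
  have "trap s t \<omega> = (\<Sum>u\<in>UNIV. \<Sum>v\<in>UNIV. (B t \<omega> $ u $ v - B s \<omega> $ u $ v) *\<^sub>R ((1/2) *\<^sub>R (P_field u v (X s \<omega>) + P_field u v (X t \<omega>))))" for s t
    unfolding trap_def linear_unit_expansion[OF linear_pf, of _ "B t \<omega> - B s \<omega>"] P_field_eq_pf
    by (simp add: sum.distrib[symmetric] scaleR_sum_right algebra_simps)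
  then have "(\<Sum>k<K. trap (\<tau> k) (\<tau> (Suc k)) \<omega>) = (\<Sum>k<K. \<Sum>u\<in>UNIV. \<Sum>v\<in>UNIV. (B (\<tau> (Suc k)) \<omega> $ u $ v - B (\<tau> k) \<omega> $ u $ v) *\<^sub>R ((1/2) *\<^sub>R (P_field u v (X (\<tau> k) \<omega>) + P_field u v (X (\<tau> (Suc k)) \<omega>))))"
    by simp
  also have "\<dots> = (\<Sum>u\<in>UNIV. \<Sum>k<K. \<Sum>v\<in>UNIV. (B (\<tau> (Suc k)) \<omega> $ u $ v - B (\<tau> k) \<omega> $ u $ v) *\<^sub>R ((1/2) *\<^sub>R (P_field u v (X (\<tau> k) \<omega>) + P_field u v (X (\<tau> (Suc k)) \<omega>))))"
    by (rule sum.swap)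
  also have "\<dots> = (\<Sum>u\<in>UNIV. \<Sum>v\<in>UNIV. \<Sum>k<K. (B (\<tau> (Suc k)) \<omega> $ u $ v - B (\<tau> k) \<omega> $ u $ v) *\<^sub>R ((1/2) *\<^sub>R (P_field u v (X (\<tau> k) \<omega>) + P_field u v (X (\<tau> (Suc k)) \<omega>))))"
    by (intro sum.cong refl sum.swap)
  finally show ?thesis by (simp add: trapezoidal_sum_def)
qed

text \<open>Finitely many integrals, one for each entry of the noise, are approximated at once; the
  almost sure equation then replaces their sum by the solution.\<close>

lemma exc_sde:
  assumes t: "t \<in> {t0..T}" and "0 < \<eta>" "0 < \<epsilon>"
  shows "\<exists>d>0. \<forall>K \<tau>. time_grid t0 t K \<tau> \<longrightarrow> (\<forall>i<K. \<tau> (Suc i) - \<tau> i < d) \<longrightarrow>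
    exc M \<eta> (\<lambda>\<omega>. norm (X t \<omega> - X t0 \<omega> + integral {t0..t} (\<lambda>s. stiefel_grad f (X s \<omega>))
      - \<sigma> *\<^sub>R (\<Sum>i<K. trap (\<tau> i) (\<tau> (Suc i)) \<omega>)) \<le> \<epsilon>)"
proof -
  let ?U = "UNIV :: ('n \<times> 'p) set"
  let ?c = "real (card ?U)"
  let ?S = "\<lambda>q K \<tau> \<omega>. trapezoidal_sum (\<lambda>s \<omega>. P_field (fst q) (snd q) (X s \<omega>)) (\<lambda>s \<omega>. B s \<omega> $ fst q $ snd q) K \<tau> \<omega>"
  have c: "0 < ?c" by simp
  obtain J where J: "\<And>u v. has_stratonovich_integral M (\<lambda>s \<omega>. P_field u v (X s \<omega>)) (\<lambda>s \<omega>. B s \<omega> $ u $ v) t0 t (J u v)"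
    and eq: "AE \<omega> in M. X t \<omega> = X t0 \<omega> - integral {t0..t} (\<lambda>s. stiefel_grad f (X s \<omega>)) + \<sigma> *\<^sub>R (\<Sum>u\<in>UNIV. \<Sum>v\<in>UNIV. J u v \<omega>)"
    using sol t unfolding stiefel_sde_solution_def by blast
  \<comment> \<open>The tolerance is shared among the integrals, and \<open>+ 1\<close> covers
    \<open>\<sigma> = 0\<close>. Half of \<open>\<eta>\<close> is reserved for the null set on which
    the equation may fail.\<close>
  define \<epsilon>' where "\<epsilon>' = \<epsilon> / ((\<bar>\<sigma>\<bar> + 1) * ?c)"
  define \<eta>' where "\<eta>' = \<eta> / 2 / ?c"
  have \<epsilon>': "0 < \<epsilon>'" and \<eta>': "0 < \<eta>'" unfolding \<epsilon>'_def \<eta>'_def using c assms by (intro divide_pos_pos mult_pos_pos; simp)+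
  have "\<exists>d>0. \<forall>K \<tau>. time_grid t0 t K \<tau> \<and> mesh K \<tau> < d \<longrightarrow>
        prob {\<omega> \<in> space M. \<epsilon>' < norm (?S q K \<tau> \<omega> - J (fst q) (snd q) \<omega>)} < \<eta>'" for q
    using J[of "fst q" "snd q"] \<epsilon>' \<eta>' unfolding has_stratonovich_integral_def by blast
  from choice[OF allI[OF this]] obtain dq where "\<forall>q. 0 < dq q \<and> (\<forall>K \<tau>. time_grid t0 t K \<tau> \<and> mesh K \<tau> < dq q \<longrightarrow>
        prob {\<omega> \<in> space M. \<epsilon>' < norm (?S q K \<tau> \<omega> - J (fst q) (snd q) \<omega>)} < \<eta>')" ..
  then have dq: "\<And>q. 0 < dq q" "\<And>q K \<tau>. time_grid t0 t K \<tau> \<Longrightarrow> mesh K \<tau> < dq q \<Longrightarrow>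
        prob {\<omega> \<in> space M. \<epsilon>' < norm (?S q K \<tau> \<omega> - J (fst q) (snd q) \<omega>)} < \<eta>'"
    by auto
  define d where "d = Min (range dq)"
  have d: "0 < d" "d \<le> dq q" for q using dq(1) by (auto simp: d_def)
  have "exc M \<eta> (\<lambda>\<omega>. norm (X t \<omega> - X t0 \<omega> + integral {t0..t} (\<lambda>s. stiefel_grad f (X s \<omega>))
      - \<sigma> *\<^sub>R (\<Sum>i<K. trap (\<tau> i) (\<tau> (Suc i)) \<omega>)) \<le> \<epsilon>)"
    if grid: "time_grid t0 t K \<tau>" and step: "\<And>i. i < K \<Longrightarrow> \<tau> (Suc i) - \<tau> i < d" for K \<tau>
  proof -
    have mesh: "mesh K \<tau> < dq q" for q
      using mesh_less[of d K \<tau>, OF d(1) step] d(2)[of q] by linarith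
    have \<tau>_in: "\<tau> i \<in> {t0..T}" if "i \<le> K" for i using time_grid_bounds[OF grid that] t by auto
    have SM: "?S q K \<tau> \<in> borel_measurable M" for q
    proof -
      have "(\<lambda>\<omega>. P_field (fst q) (snd q) (X (\<tau> i) \<omega>)) \<in> borel_measurable M" if "i \<le> K" for i
        unfolding P_field_eq_pf by (intro loclip_measurable[OF loclip_pf] X_measurable \<tau>_in that)
      moreover have "(\<lambda>\<omega>. B (\<tau> i) \<omega> $ fst q $ snd q) \<in> borel_measurable M" if "i \<le> K" for i
        using \<tau>_in[OF that] t0 by (intro measurable_compose[OF B_measurable component_measurable]) auto
      ultimately show ?thesis unfolding trapezoidal_sum_def
        by (intro borel_measurable_sum borel_measurable_scaleR borel_measurable_diff borel_measurable_add) auto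
    qed
    have e: "exc M (\<eta> / 2 / ?c) (\<lambda>\<omega>. norm (?S q K \<tau> \<omega> - J (fst q) (snd q) \<omega>) \<le> \<epsilon>')" for q
    proof -
      have [measurable]: "J (fst q) (snd q) \<in> borel_measurable M" using J by (simp add: has_stratonovich_integral_def)
      note [measurable] = SM[of q]
      have "prob {\<omega> \<in> space M. \<epsilon>' < norm (?S q K \<tau> \<omega> - J (fst q) (snd q) \<omega>)} \<le> \<eta>'"
        using dq(2)[OF grid mesh, of q] by simp
      then show ?thesis unfolding exc_def \<eta>'_def
        by (intro bexI[of _ "{\<omega> \<in> space M. \<epsilon>' < norm (?S q K \<tau> \<omega> - J (fst q) (snd q) \<omega>)}"]) auto
    qed
    have all: "exc M (\<eta> / 2) (\<lambda>\<omega>. \<forall>q\<in>?U. norm (?S q K \<tau> \<omega> - J (fst q) (snd q) \<omega>) \<le> \<epsilon>')"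
      by (rule exc_all_finite) (use e assms in auto)
    show ?thesis
    proof (rule exc_mono[OF exc_conj[OF all exc_AE[OF eq, of "\<eta> / 2"]]])
      fix \<omega> assume *: "(\<forall>q\<in>?U. norm (?S q K \<tau> \<omega> - J (fst q) (snd q) \<omega>) \<le> \<epsilon>') \<and>
        X t \<omega> = X t0 \<omega> - integral {t0..t} (\<lambda>s. stiefel_grad f (X s \<omega>)) + \<sigma> *\<^sub>R (\<Sum>u\<in>UNIV. \<Sum>v\<in>UNIV. J u v \<omega>)"
      have "X t \<omega> - X t0 \<omega> + integral {t0..t} (\<lambda>s. stiefel_grad f (X s \<omega>)) - \<sigma> *\<^sub>R (\<Sum>i<K. trap (\<tau> i) (\<tau> (Suc i)) \<omega>)
          = - \<sigma> *\<^sub>R (\<Sum>q\<in>?U. ?S q K \<tau> \<omega> - J (fst q) (snd q) \<omega>)"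
        using * unfolding sum_trapezoidal[symmetric] by (simp add: sum_subtractf sum.cartesian_product case_prod_unfold algebra_simps)
      also have "norm \<dots> \<le> \<bar>\<sigma>\<bar> * (?c * \<epsilon>')"
      proof -
        have "norm (\<Sum>q\<in>?U. ?S q K \<tau> \<omega> - J (fst q) (snd q) \<omega>) \<le> ?c * \<epsilon>'"
          by (rule order_trans[OF norm_sum]) (use * sum_bounded_above[of ?U "\<lambda>q. norm (?S q K \<tau> \<omega> - J (fst q) (snd q) \<omega>)" \<epsilon>'] in auto)
        then show ?thesis by (simp add: mult_left_mono)
      qed
      also have "\<dots> \<le> (\<bar>\<sigma>\<bar> + 1) * ?c * \<epsilon>'" using c \<epsilon>' by (simp add: algebra_simps)
      also have "\<dots> = \<epsilon>"
      proof -
        have "(\<bar>\<sigma>\<bar> + 1) * ?c \<noteq> 0" using c by (simp add: add_nonneg_eq_0_iff)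
        then show ?thesis by (simp add: \<epsilon>'_def)
      qed
      finally show "norm (X t \<omega> - X t0 \<omega> + integral {t0..t} (\<lambda>s. stiefel_grad f (X s \<omega>)) - \<sigma> *\<^sub>R (\<Sum>i<K. trap (\<tau> i) (\<tau> (Suc i)) \<omega>)) \<le> \<epsilon>" .
    qed (use assms in auto)
  qed
  then show ?thesis using d(1) by (intro exI[of _ d] conjI allI impI) simp_all
qed

end

section \<open>The solution as a limit of Euler sums\<close>

text \<open>The grid \<open>\<tau>\<close> stays fixed while the auxiliary levels \<open>m\<close>
  halve its steps repeatedly.\<close>

locale sde_grid = stiefel_sde M F B f \<sigma> t0 T X
  for M :: "'a measure" and F and B :: "real \<Rightarrow> 'a \<Rightarrow> real ^ 'p::finite ^ 'n::finite" and f \<sigma> t0 T X +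
  fixes K :: nat and \<tau> :: "nat \<Rightarrow> real"
  assumes grid: "time_grid t0 T K \<tau>"
begin

abbreviation "tt \<equiv> subgrid \<tau>"
abbreviation "NN m \<equiv> K * 2 ^ m"
definition "XX m i = X (tt m i)"
definition "DD m i \<omega> = B (tt m (Suc i)) \<omega> - B (tt m i) \<omega>"
definition "hh m i = tt m (Suc i) - tt m i"
definition "len = T - t0"

lemma len_pos: "0 < len" using tT by (simp add: len_def)

lemma tt_grid: "time_grid t0 T (NN m) (tt m)" by (rule time_grid_subgrid[OF grid])

lemma tt_in: "i \<le> NN m \<Longrightarrow> tt m i \<in> {t0..T}" using time_grid_bounds[OF tt_grid] by simp

lemma tt_nonneg: "i \<le> NN m \<Longrightarrow> 0 \<le> tt m i" using tt_in[of i m] t0 by simp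

lemma tt_less: "i < NN m \<Longrightarrow> tt m i < tt m (Suc i)" by (rule time_grid_step[OF tt_grid])

lemma tt_0: "tt m 0 = t0" using tt_grid[of m] by (simp add: time_grid_def)

lemma tt_coarse: "tt (l + r) (k * 2 ^ r) = tt l k"
  by (simp add: subgrid_subgrid[symmetric] subgrid_mult)

lemma NN_add: "NN (l + r) = NN l * 2 ^ r" by (simp add: power_add)

lemma NN_coarse: "k \<le> NN l \<Longrightarrow> k * 2 ^ r \<le> NN (l + r)"
  unfolding NN_add by (rule mult_right_mono) auto

lemma XX_coarse: "XX (l + r) (k * 2 ^ r) = XX l k"
  by (simp add: XX_def tt_coarse)

lemma hh_pos: "i < NN m \<Longrightarrow> 0 < hh m i" using tt_less by (simp add: hh_def)

lemma hh_le: "i < NN m \<Longrightarrow> hh m i \<le> len / 2 ^ m"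
proof -
  assume i: "i < NN m"
  have "\<tau> (Suc k) - \<tau> k \<le> len" if "k < K" for k
    using time_grid_bounds[OF grid, of k] time_grid_bounds[OF grid, of "Suc k"] that by (simp add: len_def)
  from subgrid_step_le[OF grid this i] show ?thesis by (simp add: hh_def)
qed

lemma sum_hh: "(\<Sum>i<j. hh m i) = tt m j - t0"
  unfolding hh_def sum_steps by (simp add: tt_0)

lemma sum_hh_le: "j \<le> NN m \<Longrightarrow> (\<Sum>i<j. hh m i) \<le> len"
  unfolding sum_hh using tt_in[of j m] by (simp add: len_def)

lemma len_div_eventually:
  assumes "0 < d"
  obtains m0 where "\<And>m. m0 \<le> m \<Longrightarrow> len / 2 ^ m < d"
proof -
  obtain m0 where "len / d < 2 ^ m0" using real_arch_pow[of 2 "len / d"] by auto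
  then have *: "len / 2 ^ m0 < d" using assms by (simp add: field_simps)
  have "len / 2 ^ m < d" if "m0 \<le> m" for m
  proof -
    have "len / 2 ^ m \<le> len / 2 ^ m0" using that len_pos by (intro divide_left_mono power_increasing) auto
    then show ?thesis using * by simp
  qed
  then show ?thesis by (rule that)
qed

lemma XX_F: "i \<le> NN m \<Longrightarrow> XX m i \<in> borel_measurable (F (tt m i))"
  unfolding XX_def by (rule X_measurable_F[OF tt_in])

lemma XX_F_mono: "j \<le> i \<Longrightarrow> i \<le> NN m \<Longrightarrow> XX m j \<in> borel_measurable (F (tt m i))"
  using XX_F[of j m] by (rule measurable_F_mono) (use time_grid_mono[OF tt_grid] in auto)

lemma block_le: "k < NN l \<Longrightarrow> i < 2 ^ r \<Longrightarrow> k * 2 ^ r + i < NN (l + r)"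
  unfolding NN_add by (rule block_less)

lemma DD_block: "(\<Sum>i<2 ^ r. DD (l + r) (k * 2 ^ r + i) \<omega>) = DD l k \<omega>"
proof -
  have "(\<Sum>i<2 ^ r. DD (l + r) (k * 2 ^ r + i) \<omega>) = B (tt (l + r) (k * 2 ^ r + 2 ^ r)) \<omega> - B (tt (l + r) (k * 2 ^ r)) \<omega>"
    unfolding DD_def using sum_lessThan_telescope[of "\<lambda>i. B (tt (l + r) (k * 2 ^ r + i)) \<omega>" "2 ^ r"] by simp
  also have "k * 2 ^ r + 2 ^ r = Suc k * 2 ^ r" by simp
  finally show ?thesis unfolding tt_coarse DD_def .
qed

lemma hh_block: "(\<Sum>i<2 ^ r. hh (l + r) (k * 2 ^ r + i)) = hh l k"
proof -
  have "(\<Sum>i<2 ^ r. hh (l + r) (k * 2 ^ r + i)) = tt (l + r) (k * 2 ^ r + 2 ^ r) - tt (l + r) (k * 2 ^ r)"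
    unfolding hh_def using sum_lessThan_telescope[of "\<lambda>i. tt (l + r) (k * 2 ^ r + i)" "2 ^ r"] by simp
  also have "k * 2 ^ r + 2 ^ r = Suc k * 2 ^ r" by simp
  finally show ?thesis unfolding tt_coarse hh_def .
qed

lemma block_dist:
  assumes "k < NN l" "i \<le> 2 ^ r"
  shows "\<bar>tt (l + r) (k * 2 ^ r + i) - tt l k\<bar> \<le> len / 2 ^ l"
  using subgrid_in_block[OF tt_grid[of l] assms] hh_le[OF assms(1)]
  by (simp add: hh_def subgrid_subgrid)

subsection \<open>Averaging within blocks\<close>

text \<open>Error of freezing the noise coefficient at the start of each block: block
  \<open>k\<close> of level \<open>l\<close> consists of \<open>2 ^ r\<close> steps of level
  \<open>l + r\<close>.\<close>

definition "block_err l r \<omega> = (\<Sum>k<NN l. (norm (\<Sum>i<2 ^ r.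
    pf (XX (l + r) (k * 2 ^ r + i) \<omega>) (DD (l + r) (k * 2 ^ r + i) \<omega>) - pf (XX l k \<omega>) (DD (l + r) (k * 2 ^ r + i) \<omega>)))\<^sup>2)"

text \<open>In each block this is a martingale sum whose coefficients are small by the modulus of
  continuity of the path. Its second moment depends on the length of the block but not on the number
  of fine steps, so \<open>l0\<close> works for every \<open>r\<close>.\<close>

lemma exc_block_martingale:
  assumes "0 < \<eta>" "0 < \<epsilon>"
  shows "\<exists>l0. \<forall>l\<ge>l0. \<forall>r. exc M \<eta> (\<lambda>\<omega>. block_err l r \<omega> \<le> \<epsilon>)"
proof -
  have \<eta>3: "0 < \<eta> / 3" using assms by simp
  obtain R where R: "0 \<le> R" "exc M (\<eta> / 3) (\<lambda>\<omega>. continuous_on {t0..T} (\<lambda>t. X t \<omega>) \<and> (\<forall>t\<in>{t0..T}. norm (X t \<omega>) \<le> R))"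
    by (rule exc_X_bounded[OF \<eta>3])
  define \<kappa> where "\<kappa> = (real (CARD('n) * CARD('p)))\<^sup>2"
  have \<kappa>: "0 \<le> \<kappa>" by (simp add: \<kappa>_def)
  \<comment> \<open>Makes the total second moment, at most
    \<open>\<kappa> * len * (2 * R * \<epsilon>')\<^sup>2\<close>, small enough for Markov's
    inequality with threshold \<open>\<epsilon>\<close> and probability
    \<open>\<eta> / 3\<close>.\<close>
  define \<epsilon>' where "\<epsilon>' = sqrt (\<epsilon> * (\<eta> / 3) / (\<kappa> * len * (2 * R)\<^sup>2 + 1))"
  have den: "0 < \<kappa> * len * (2 * R)\<^sup>2 + 1" using \<kappa> len_pos by (intro add_nonneg_pos) auto
  have \<epsilon>'2: "\<epsilon>'\<^sup>2 = \<epsilon> * (\<eta> / 3) / (\<kappa> * len * (2 * R)\<^sup>2 + 1)" and \<epsilon>': "0 < \<epsilon>'"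
    unfolding \<epsilon>'_def using den assms \<eta>3 by (auto intro!: divide_pos_pos mult_pos_pos divide_nonneg_pos)
  obtain d where d: "0 < d" "exc M (\<eta> / 3) (\<lambda>\<omega>. \<forall>s\<in>{t0..T}. \<forall>t\<in>{t0..T}. \<bar>s - t\<bar> < d \<longrightarrow> norm (X s \<omega> - X t \<omega>) \<le> \<epsilon>')"
    by (rule exc_X_modulus[OF \<eta>3 \<epsilon>'])
  obtain l0 where l0: "\<And>m. l0 \<le> m \<Longrightarrow> len / 2 ^ m < d" using len_div_eventually[OF d(1)] by blast
  have "exc M \<eta> (\<lambda>\<omega>. block_err l r \<omega> \<le> \<epsilon>)"
    if l: "l0 \<le> l" for l r
  proof -
    \<comment> \<open>\<open>G\<close> looks only at nodes up to the current one, so switching a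
      summand off by it keeps it adapted and makes it bounded. Outside the exceptional event nothing
      is switched off.\<close>
    define G where "G k i \<omega> \<longleftrightarrow> norm (XX (l + r) (k * 2 ^ r + i) \<omega>) \<le> R \<and> norm (XX l k \<omega>) \<le> R
      \<and> norm (XX (l + r) (k * 2 ^ r + i) \<omega> - XX l k \<omega>) \<le> \<epsilon>'" for k i \<omega>
    define L where "L k i \<omega> D = (if G k i \<omega> then 1 else 0) *\<^sub>R (pf (XX (l + r) (k * 2 ^ r + i) \<omega>) D - pf (XX l k \<omega>) D)" for k i \<omega> D
    define S where "S k \<omega> = (\<Sum>i<2 ^ r. L k i \<omega> (DD (l + r) (k * 2 ^ r + i) \<omega>))" for k \<omega>
    have XF: "XX (l + r) (k * 2 ^ r + i) \<in> borel_measurable (F (tt (l + r) (k * 2 ^ r + i)))"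
       "XX l k \<in> borel_measurable (F (tt (l + r) (k * 2 ^ r + i)))" if "k < NN l" "i < 2 ^ r" for k i
    proof -
      have le: "k * 2 ^ r + i \<le> NN (l + r)" using block_le[OF that] by simp
      show "XX (l + r) (k * 2 ^ r + i) \<in> borel_measurable (F (tt (l + r) (k * 2 ^ r + i)))" by (rule XX_F[OF le])
      show "XX l k \<in> borel_measurable (F (tt (l + r) (k * 2 ^ r + i)))"
        using XX_F_mono[OF _ le, of "k * 2 ^ r"] by (simp add: XX_coarse)
    qed
    have L_le: "norm (L k i \<omega> D) \<le> 2 * R * \<epsilon>' * norm D" for k i \<omega> D
    proof (cases "G k i \<omega>")
      case True
      then have "norm (L k i \<omega> D) \<le> (norm (XX (l + r) (k * 2 ^ r + i) \<omega>) + norm (XX l k \<omega>)) * norm (XX (l + r) (k * 2 ^ r + i) \<omega> - XX l k \<omega>) * norm D"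
        using norm_pf_diff_le by (simp add: L_def)
      also have "\<dots> \<le> (R + R) * \<epsilon>' * norm D"
        using True R(1) \<epsilon>' unfolding G_def by (intro mult_right_mono mult_mono add_mono) auto
      finally show ?thesis by simp
    next
      case False
      then show ?thesis using R(1) \<epsilon>' by (simp add: L_def)
    qed
    have S_I: "integrable M (\<lambda>\<omega>. (norm (S k \<omega>))\<^sup>2)" and S_E: "expectation (\<lambda>\<omega>. (norm (S k \<omega>))\<^sup>2) \<le> \<kappa> * (hh l k * (2 * R * \<epsilon>')\<^sup>2)"
      if k: "k < NN l" for k
    proof -
      let ?u = "\<lambda>i. tt (l + r) (k * 2 ^ r + i)"
      have u0: "0 \<le> ?u 0" using tt_nonneg[of "k * 2 ^ r" "l + r"] block_le[OF k, of 0 r] by simp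
      have u1: "?u i < ?u (Suc i)" if "i < 2 ^ r" for i using tt_less[OF block_le[OF k that]] by simp
      have lin: "linear (L k i \<omega>)" for i \<omega>
        unfolding L_def by (intro linear_compose_scale_right linear_compose_sub linear_pf)
      have LF: "(\<lambda>\<omega>. L k i \<omega> (unit_mat a b)) \<in> borel_measurable (F (?u i))" if i: "i < 2 ^ r" for i a b
      proof -
        note [measurable] = XF[OF k i]
        have "(\<lambda>\<omega>. pf (XX (l + r) (k * 2 ^ r + i) \<omega>) (unit_mat a b) - pf (XX l k \<omega>) (unit_mat a b)) \<in> borel_measurable (F (?u i))"
          by (intro borel_measurable_diff loclip_measurable[OF loclip_pf] XF k i)
        then show ?thesis unfolding L_def G_def by measurable
      qed
      have SS: "S k \<omega> = (\<Sum>i<2 ^ r. L k i \<omega> (B (?u (Suc i)) \<omega> - B (?u i) \<omega>))" for \<omega>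
        by (simp add: S_def DD_def)
      note * = linear_sum_L2[where u="?u" and N="2 ^ r" and L="L k" and g="\<lambda>i \<omega>. 2 * R * \<epsilon>'", OF u0 u1 lin LF L_le integrable_const SS]
      show "integrable M (\<lambda>\<omega>. (norm (S k \<omega>))\<^sup>2)" by (rule *(2))
      have "expectation (\<lambda>\<omega>. (norm (S k \<omega>))\<^sup>2) \<le> \<kappa> * (\<Sum>i<2 ^ r. hh (l + r) (k * 2 ^ r + i) * (2 * R * \<epsilon>')\<^sup>2)"
        using *(3) by (simp add: \<kappa>_def hh_def prob_space)
      also have "\<dots> = \<kappa> * (hh l k * (2 * R * \<epsilon>')\<^sup>2)"
        by (simp only: sum_distrib_right[symmetric] hh_block)
      finally show "expectation (\<lambda>\<omega>. (norm (S k \<omega>))\<^sup>2) \<le> \<kappa> * (hh l k * (2 * R * \<epsilon>')\<^sup>2)" .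
    qed
    have Mk: "exc M (\<eta> / 3) (\<lambda>\<omega>. (\<Sum>k<NN l. (norm (S k \<omega>))\<^sup>2) \<le> \<epsilon>)"
    proof (rule exc_Markov)
      show "integrable M (\<lambda>\<omega>. \<Sum>k<NN l. (norm (S k \<omega>))\<^sup>2)" using S_I by (intro Bochner_Integration.integrable_sum) auto
      have "expectation (\<lambda>\<omega>. \<Sum>k<NN l. (norm (S k \<omega>))\<^sup>2) = (\<Sum>k<NN l. expectation (\<lambda>\<omega>. (norm (S k \<omega>))\<^sup>2))"
        using S_I by (intro Bochner_Integration.integral_sum) auto
      also have "\<dots> \<le> (\<Sum>k<NN l. \<kappa> * (hh l k * (2 * R * \<epsilon>')\<^sup>2))" using S_E by (intro sum_mono) auto
      also have "\<dots> = \<kappa> * ((\<Sum>k<NN l. hh l k) * (2 * R * \<epsilon>')\<^sup>2)" by (simp add: sum_distrib_left sum_distrib_right)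
      also have "\<dots> \<le> \<kappa> * (len * (2 * R * \<epsilon>')\<^sup>2)"
        using sum_hh_le[of "NN l" l] \<kappa> by (intro mult_left_mono mult_right_mono) auto
      also have "\<dots> \<le> (\<kappa> * len * (2 * R)\<^sup>2 + 1) * \<epsilon>'\<^sup>2" by (simp add: power_mult_distrib algebra_simps)
      also have "\<dots> = \<epsilon> * (\<eta> / 3)"
      proof -
        have "c * (x / c) = x" if "0 < c" for c x :: real using that by simp
        then show ?thesis unfolding \<epsilon>'2 using den .
      qed
      finally show "expectation (\<lambda>\<omega>. \<Sum>k<NN l. (norm (S k \<omega>))\<^sup>2) \<le> \<epsilon> * (\<eta> / 3)" .
    qed (use assms in \<open>auto intro!: sum_nonneg\<close>)
    show ?thesis
    proof (rule exc_mono[OF exc_conj[OF exc_conj[OF R(2) d(2)] Mk]])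
      fix \<omega> assume *: "((continuous_on {t0..T} (\<lambda>t. X t \<omega>) \<and> (\<forall>t\<in>{t0..T}. norm (X t \<omega>) \<le> R))
        \<and> (\<forall>s\<in>{t0..T}. \<forall>t\<in>{t0..T}. \<bar>s - t\<bar> < d \<longrightarrow> norm (X s \<omega> - X t \<omega>) \<le> \<epsilon>')) \<and> (\<Sum>k<NN l. (norm (S k \<omega>))\<^sup>2) \<le> \<epsilon>"
      have "G k i \<omega>" if "k < NN l" "i < 2 ^ r" for k i
      proof -
        have "\<bar>tt (l + r) (k * 2 ^ r + i) - tt l k\<bar> < d"
          using block_dist[OF that(1), of i r] that(2) l0[OF l] by simp
        moreover have "tt (l + r) (k * 2 ^ r + i) \<in> {t0..T}" "tt l k \<in> {t0..T}"
          using tt_in[of "k * 2 ^ r + i" "l + r"] block_le[OF that] tt_in[of k l] that by auto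
        ultimately show ?thesis using * unfolding G_def XX_def by blast
      qed
      then have "S k \<omega> = (\<Sum>i<2 ^ r.
    pf (XX (l + r) (k * 2 ^ r + i) \<omega>) (DD (l + r) (k * 2 ^ r + i) \<omega>) - pf (XX l k \<omega>) (DD (l + r) (k * 2 ^ r + i) \<omega>))" if "k < NN l" for k
        using that unfolding S_def L_def by (intro sum.cong refl) auto
      then show "block_err l r \<omega> \<le> \<epsilon>"
        using conjunct2[OF *] by (simp add: block_err_def)
    qed simp
  qed
  then show ?thesis by (intro exI[of _ l0] allI impI)
qed

text \<open>Defect of the integrated equation at node \<open>k\<close> of level \<open>l\<close>
  when the noise integral is evaluated by the trapezoidal rule on level
  \<open>l + r\<close>.\<close>

definition "sde_err l r k \<omega> = XX l k \<omega> - X t0 \<omega> + integral {t0..tt l k} (\<lambda>s. stiefel_grad f (X s \<omega>))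
      - \<sigma> *\<^sub>R (\<Sum>i<k * 2 ^ r. trap (tt (l + r) i) (tt (l + r) (Suc i)) \<omega>)"

text \<open>The convergence of trapezoidal sums comes without uniformity in the end point, so
  finitely many nodes are treated together and \<open>r0\<close> depends on
  \<open>l\<close>.\<close>

lemma exc_sde_nodes:
  assumes "0 < \<eta>" "0 < \<epsilon>"
  shows "\<exists>r0. \<forall>r\<ge>r0. exc M \<eta> (\<lambda>\<omega>. \<forall>k\<in>{..NN l}. norm (sde_err l r k \<omega>) \<le> \<epsilon>)"
proof -
  let ?\<eta> = "\<eta> / card {..NN l}"
  have \<eta>: "0 < ?\<eta>" using assms by (simp add: add_pos_nonneg)
  have "\<exists>d>0. \<forall>K' \<tau>'. time_grid t0 (tt l k) K' \<tau>' \<longrightarrow> (\<forall>i<K'. \<tau>' (Suc i) - \<tau>' i < d) \<longrightarrow>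
      exc M ?\<eta> (\<lambda>\<omega>. norm (X (tt l k) \<omega> - X t0 \<omega> + integral {t0..tt l k} (\<lambda>s. stiefel_grad f (X s \<omega>))
      - \<sigma> *\<^sub>R (\<Sum>i<K'. trap (\<tau>' i) (\<tau>' (Suc i)) \<omega>)) \<le> \<epsilon>)" if "k \<le> NN l" for k
    by (rule exc_sde[OF tt_in[OF that] \<eta> assms(2)])
  then have "\<forall>k\<in>{..NN l}. \<exists>d>0. \<forall>K' \<tau>'. time_grid t0 (tt l k) K' \<tau>' \<longrightarrow> (\<forall>i<K'. \<tau>' (Suc i) - \<tau>' i < d) \<longrightarrow>
      exc M ?\<eta> (\<lambda>\<omega>. norm (X (tt l k) \<omega> - X t0 \<omega> + integral {t0..tt l k} (\<lambda>s. stiefel_grad f (X s \<omega>))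
      - \<sigma> *\<^sub>R (\<Sum>i<K'. trap (\<tau>' i) (\<tau>' (Suc i)) \<omega>)) \<le> \<epsilon>)" by simp
  from bchoice[OF this] obtain d where d: "\<forall>k\<in>{..NN l}. 0 < d k \<and> (\<forall>K' \<tau>'. time_grid t0 (tt l k) K' \<tau>' \<longrightarrow> (\<forall>i<K'. \<tau>' (Suc i) - \<tau>' i < d k) \<longrightarrow>
      exc M ?\<eta> (\<lambda>\<omega>. norm (X (tt l k) \<omega> - X t0 \<omega> + integral {t0..tt l k} (\<lambda>s. stiefel_grad f (X s \<omega>))
      - \<sigma> *\<^sub>R (\<Sum>i<K'. trap (\<tau>' i) (\<tau>' (Suc i)) \<omega>)) \<le> \<epsilon>))" ..
  define dm where "dm = Min (d ` {..NN l})"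
  have dm: "0 < dm" "k \<le> NN l \<Longrightarrow> dm \<le> d k" for k using d by (auto simp: dm_def)
  obtain m0 where m0: "\<And>m. m0 \<le> m \<Longrightarrow> len / 2 ^ m < dm" using len_div_eventually[OF dm(1)] by blast
  have "exc M \<eta> (\<lambda>\<omega>. \<forall>k\<in>{..NN l}. norm (sde_err l r k \<omega>) \<le> \<epsilon>)" if r: "m0 \<le> r" for r
  proof (rule exc_all_finite)
    fix k assume k: "k \<in> {..NN l}"
    have k2: "k * 2 ^ r \<le> NN (l + r)" using k by (intro NN_coarse) simp
    have g: "time_grid t0 (tt l k) (k * 2 ^ r) (tt (l + r))"
      using time_grid_prefix[OF tt_grid k2] by (simp only: tt_coarse)
    have s: "\<forall>i<k * 2 ^ r. tt (l + r) (Suc i) - tt (l + r) i < d k"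
    proof (intro allI impI)
      fix i assume "i < k * 2 ^ r"
      then have "hh (l + r) i \<le> len / 2 ^ (l + r)" using k2 by (intro hh_le) simp
      also have "\<dots> < dm" using r by (intro m0) simp
      also have "\<dots> \<le> d k" using k by (intro dm) simp
      finally show "tt (l + r) (Suc i) - tt (l + r) i < d k" by (simp add: hh_def)
    qed
    show "exc M ?\<eta> (\<lambda>\<omega>. norm (sde_err l r k \<omega>) \<le> \<epsilon>)"
      using d[rule_format, OF k, THEN conjunct2, rule_format, OF g] s by (simp only: XX_def sde_err_def)
  qed (use assms in auto)
  then show ?thesis by (intro exI[of _ m0] allI impI)
qed

lemma grad_integral_block:
  assumes cont: "continuous_on {t0..T} (\<lambda>t. X t \<omega>)" and k: "k < NN l"
  shows "continuous_on {tt l k..tt l (Suc k)} (\<lambda>s. stiefel_grad f (X s \<omega>))"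
    and "(\<lambda>s. stiefel_grad f (X s \<omega>)) integrable_on {tt l k..tt l (Suc k)}"
    and "integral {t0..tt l (Suc k)} (\<lambda>s. stiefel_grad f (X s \<omega>)) = integral {t0..tt l k} (\<lambda>s. stiefel_grad f (X s \<omega>))
      + integral {tt l k..tt l (Suc k)} (\<lambda>s. stiefel_grad f (X s \<omega>))"
proof -
  have "continuous_on UNIV (stiefel_grad f)" by (rule loclip_continuous[OF loclip_stiefel_grad[OF f]])
  then have g: "continuous_on {t0..T} (\<lambda>s. stiefel_grad f (X s \<omega>))"
    by (rule continuous_on_compose2[OF _ cont]) simp
  have int: "(\<lambda>s. stiefel_grad f (X s \<omega>)) integrable_on {a..b}" if "t0 \<le> a" "b \<le> T" for a b
    using that by (intro integrable_continuous_interval continuous_on_subset[OF g]) auto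
  show "continuous_on {tt l k..tt l (Suc k)} (\<lambda>s. stiefel_grad f (X s \<omega>))"
    using tt_in[of k l] tt_in[of "Suc k" l] k by (intro continuous_on_subset[OF g]) auto
  show "(\<lambda>s. stiefel_grad f (X s \<omega>)) integrable_on {tt l k..tt l (Suc k)}"
    using tt_in[of k l] tt_in[of "Suc k" l] k by (intro int) auto
  show "integral {t0..tt l (Suc k)} (\<lambda>s. stiefel_grad f (X s \<omega>)) = integral {t0..tt l k} (\<lambda>s. stiefel_grad f (X s \<omega>))
      + integral {tt l k..tt l (Suc k)} (\<lambda>s. stiefel_grad f (X s \<omega>))"
    using tt_in[of k l] tt_in[of "Suc k" l] k tt_less[OF k]
    by (intro Henstock_Kurzweil_Integration.integral_combine[symmetric] int) auto
qed

end

lemma sum_lessThan_add: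
  fixes g :: "nat \<Rightarrow> 'b::comm_monoid_add"
  shows "(\<Sum>i<a + b. g i) = (\<Sum>i<a. g i) + (\<Sum>i<b. g (a + i))"
  by (induction b) (simp_all add: add.assoc)

context sde_grid
begin

definition "dX m i \<omega> = XX m (Suc i) \<omega> - XX m i \<omega>"
text \<open>What remains of an increment of the solution after its leading noise term is
  removed.\<close>

definition "inc m k \<omega> = dX m k \<omega> - \<sigma> *\<^sub>R pf (XX m k \<omega>) (DD m k \<omega>)"
definition "qX m \<omega> = (\<Sum>i<NN m. (norm (dX m i \<omega>))\<^sup>2)"
definition "qB m \<omega> = (\<Sum>i<NN m. (norm (DD m i \<omega>))\<^sup>2)"
text \<open>The weight \<open>norm (DD m k \<omega>)\<close> is the factor that accompanies
  \<open>inc\<close> in the Taylor expansion of the trapezoidal rule.\<close>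

definition "inc_err m \<omega> = (\<Sum>k<NN m. norm (inc m k \<omega>) * norm (DD m k \<omega>))"

lemma trap_eq: "trap (tt m i) (tt m (Suc i)) \<omega>
    = pf (XX m i \<omega>) (DD m i \<omega>) + (1/2) *\<^sub>R (pf (XX m (Suc i) \<omega>) (DD m i \<omega>) - pf (XX m i \<omega>) (DD m i \<omega>))"
proof -
  have "(1/2) *\<^sub>R (a + b) = a + (1/2) *\<^sub>R (b - a)" for a b :: "real ^ 'p ^ 'n"
    by (simp add: vec_eq_iff field_simps)
  then show ?thesis by (simp add: trap_def XX_def DD_def)
qed

lemma exc_qX: "0 < \<eta> \<Longrightarrow> \<exists>L>0. \<forall>m. exc M \<eta> (\<lambda>\<omega>. qX m \<omega> \<le> L)"
  unfolding qX_def dX_def XX_def by (rule exc_X_quadratic[OF grid])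

lemma exc_qB: assumes "0 < \<eta>" shows "\<exists>L>0. \<forall>m. exc M \<eta> (\<lambda>\<omega>. qB m \<omega> \<le> L)"
proof -
  from exc_noise_quadratic[OF t0 assms, of T]
  obtain L where "0 < L" "\<forall>K \<tau>. time_grid t0 T K \<tau> \<longrightarrow> exc M \<eta> (\<lambda>\<omega>. (\<Sum>i<K. (norm (B (\<tau> (Suc i)) \<omega> - B (\<tau> i) \<omega>))\<^sup>2) \<le> L)"
    by (elim exE conjE)
  then show ?thesis unfolding qB_def DD_def by (intro exI[of _ L] conjI allI) (simp_all add: tt_grid)
qed

lemma exc_DD_small:
  assumes "0 < \<eta>" "0 < \<epsilon>"
  shows "\<exists>l0. \<forall>l\<ge>l0. exc M \<eta> (\<lambda>\<omega>. \<forall>i<NN l. norm (DD l i \<omega>) \<le> \<epsilon>)"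
proof -
  from exc_noise_small[OF t0 assms, of T]
  obtain d where d: "0 < d" "\<forall>K \<tau>. time_grid t0 T K \<tau> \<longrightarrow> (\<forall>i<K. \<tau> (Suc i) - \<tau> i \<le> d) \<longrightarrow> exc M \<eta> (\<lambda>\<omega>. \<forall>i<K. norm (B (\<tau> (Suc i)) \<omega> - B (\<tau> i) \<omega>) \<le> \<epsilon>)"
    by (elim exE conjE)
  obtain l0 where l0: "\<And>m. l0 \<le> m \<Longrightarrow> len / 2 ^ m < d" using len_div_eventually[OF d(1)] by blast
  have "\<forall>i<NN l. tt l (Suc i) - tt l i \<le> d" if "l0 \<le> l" for l
    using hh_le[of _ l] l0[OF that] by (auto simp: hh_def intro: order_trans less_imp_le)
  then show ?thesis using d(2) unfolding DD_def by (intro exI[of _ l0] allI impI) (simp add: tt_grid)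
qed

subsection \<open>Increments of the solution to leading order\<close>

lemma inc_err_pathwise:
  fixes R G LX LB m \<epsilon>6 \<epsilon>7 :: real
  assumes cont: "continuous_on {t0..T} (\<lambda>t. X t \<omega>)" and XR: "\<And>t. t \<in> {t0..T} \<Longrightarrow> norm (X t \<omega>) \<le> R"
    and G: "\<And>x. norm x \<le> R \<Longrightarrow> norm (stiefel_grad f x) \<le> G" and R: "0 \<le> R"
    and qX: "qX (l + r) \<omega> \<le> LX" and qB: "qB (l + r) \<omega> \<le> LB" "qB l \<omega> \<le> LB"
    and m: "\<And>i. i < NN l \<Longrightarrow> norm (DD l i \<omega>) \<le> m" "0 \<le> m" "m \<le> 1"
    and blk: "block_err l r \<omega> \<le> \<epsilon>7" and sde: "\<And>k. k \<le> NN l \<Longrightarrow> norm (sde_err l r k \<omega>) \<le> \<epsilon>6"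
  shows "inc_err l \<omega> \<le> 2 * NN l * \<epsilon>6 + G * len * m + \<bar>\<sigma>\<bar> * sqrt (\<epsilon>7 * LB) + \<bar>\<sigma>\<bar> * R * m * (LX + LB)"
proof -
  define g where "g k i = k * 2 ^ r + i" for k i :: nat
  define Mk where "Mk k = (\<Sum>i<2 ^ r. pf (XX (l + r) (g k i) \<omega>) (DD (l + r) (g k i) \<omega>) - pf (XX l k \<omega>) (DD (l + r) (g k i) \<omega>))" for k
  define Qk where "Qk k = (\<Sum>i<2 ^ r. (1/2) *\<^sub>R (pf (XX (l + r) (Suc (g k i)) \<omega>) (DD (l + r) (g k i) \<omega>) - pf (XX (l + r) (g k i) \<omega>) (DD (l + r) (g k i) \<omega>)))" for k
  define q where "q k = (\<Sum>i<2 ^ r. (norm (dX (l + r) (g k i) \<omega>))\<^sup>2 + (norm (DD (l + r) (g k i) \<omega>))\<^sup>2)" for k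
  define Ik where "Ik k = integral {tt l k..tt l (Suc k)} (\<lambda>s. stiefel_grad f (X s \<omega>))" for k
  have XXR: "norm (XX m i \<omega>) \<le> R" if "i \<le> NN m" for m i unfolding XX_def by (rule XR[OF tt_in[OF that]])
  have eq: "inc l k \<omega> = sde_err l r (Suc k) \<omega> - sde_err l r k \<omega> - Ik k + \<sigma> *\<^sub>R Mk k + \<sigma> *\<^sub>R Qk k" if k: "k < NN l" for k
  proof -
    have "(\<Sum>i<Suc k * 2 ^ r. trap (tt (l + r) i) (tt (l + r) (Suc i)) \<omega>) - (\<Sum>i<k * 2 ^ r. trap (tt (l + r) i) (tt (l + r) (Suc i)) \<omega>)
        = (\<Sum>i<2 ^ r. trap (tt (l + r) (g k i)) (tt (l + r) (Suc (g k i))) \<omega>)"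
      using sum_lessThan_add[of "\<lambda>i. trap (tt (l + r) i) (tt (l + r) (Suc i)) \<omega>" "k * 2 ^ r" "2 ^ r"] by (simp add: g_def add.commute)
    also have "\<dots> = (\<Sum>i<2 ^ r. pf (XX (l + r) (g k i) \<omega>) (DD (l + r) (g k i) \<omega>)) + Qk k"
      unfolding trap_eq Qk_def by (rule sum.distrib)
    also have "(\<Sum>i<2 ^ r. pf (XX (l + r) (g k i) \<omega>) (DD (l + r) (g k i) \<omega>)) = Mk k + (\<Sum>i<2 ^ r. pf (XX l k \<omega>) (DD (l + r) (g k i) \<omega>))"
      unfolding Mk_def by (simp add: sum_subtractf)
    also have "(\<Sum>i<2 ^ r. pf (XX l k \<omega>) (DD (l + r) (g k i) \<omega>)) = pf (XX l k \<omega>) (DD l k \<omega>)"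
      unfolding linear_sum[OF linear_pf, symmetric] g_def DD_block ..
    finally have tr: "(\<Sum>i<Suc k * 2 ^ r. trap (tt (l + r) i) (tt (l + r) (Suc i)) \<omega>) = (\<Sum>i<k * 2 ^ r. trap (tt (l + r) i) (tt (l + r) (Suc i)) \<omega>)
        + (Mk k + pf (XX l k \<omega>) (DD l k \<omega>) + Qk k)" by (simp add: algebra_simps)
    show ?thesis
      unfolding sde_err_def tr grad_integral_block(3)[OF cont k] inc_def dX_def Ik_def
      by (simp only: scaleR_add_right) simp
  qed
  have I_le: "norm (Ik k) \<le> G * hh l k" if k: "k < NN l" for k
    unfolding Ik_def hh_def
  proof (rule integral_bound)
    show "tt l k \<le> tt l (Suc k)" using tt_less[OF k] by simp
    show "continuous_on {tt l k..tt l (Suc k)} (\<lambda>s. stiefel_grad f (X s \<omega>))" by (rule grad_integral_block(1)[OF cont k])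
    show "norm (stiefel_grad f (X s \<omega>)) \<le> G" if "s \<in> {tt l k..tt l (Suc k)}" for s
      using that tt_in[of k l] tt_in[of "Suc k" l] k by (intro G XR) auto
  qed
  have Q_le: "norm (Qk k) \<le> R * q k" if k: "k < NN l" for k
  proof -
    have "norm (Qk k) \<le> (\<Sum>i<2 ^ r. R * ((norm (dX (l + r) (g k i) \<omega>))\<^sup>2 + (norm (DD (l + r) (g k i) \<omega>))\<^sup>2))"
      unfolding Qk_def
    proof (rule sum_norm_le)
      fix i :: nat assume "i \<in> {..<2 ^ r}"
      then have le: "g k i < NN (l + r)" unfolding g_def using block_le[OF k] by simp
      let ?a = "norm (dX (l + r) (g k i) \<omega>)" and ?b = "norm (DD (l + r) (g k i) \<omega>)"
      have "norm (pf (XX (l + r) (Suc (g k i)) \<omega>) (DD (l + r) (g k i) \<omega>) - pf (XX (l + r) (g k i) \<omega>) (DD (l + r) (g k i) \<omega>))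
        \<le> (norm (XX (l + r) (Suc (g k i)) \<omega>) + norm (XX (l + r) (g k i) \<omega>)) * ?a * ?b"
        unfolding dX_def by (rule norm_pf_diff_le)
      also have "\<dots> \<le> (R + R) * ?a * ?b"
        using XXR[of "Suc (g k i)" "l + r"] XXR[of "g k i" "l + r"] le by (intro mult_right_mono add_mono) auto
      finally have "norm ((1/2) *\<^sub>R (pf (XX (l + r) (Suc (g k i)) \<omega>) (DD (l + r) (g k i) \<omega>) - pf (XX (l + r) (g k i) \<omega>) (DD (l + r) (g k i) \<omega>)))
          \<le> R * (?a * ?b)" by simp
      also have "?a * ?b \<le> ?a\<^sup>2 + ?b\<^sup>2"
        using zero_le_power2[of "?a - ?b"] zero_le_power2[of ?a] zero_le_power2[of ?b] unfolding power2_diff by linarith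
      finally show "norm ((1/2) *\<^sub>R (pf (XX (l + r) (Suc (g k i)) \<omega>) (DD (l + r) (g k i) \<omega>) - pf (XX (l + r) (g k i) \<omega>) (DD (l + r) (g k i) \<omega>)))
          \<le> R * (?a\<^sup>2 + ?b\<^sup>2)" using R by (simp add: mult_left_mono)
    qed
    then show ?thesis by (simp add: q_def sum_distrib_left)
  qed
  have q0: "0 \<le> q k" for k unfolding q_def by (intro sum_nonneg) simp
  have sumq: "(\<Sum>k<NN l. q k) = qX (l + r) \<omega> + qB (l + r) \<omega>"
    unfolding q_def qX_def qB_def sum.distrib[symmetric] NN_add
    by (simp only: sum_blocks g_def)
  have \<epsilon>6: "0 \<le> \<epsilon>6" using order_trans[OF norm_ge_zero sde[of 0]] by simp
  have "inc_err l \<omega> \<le> (\<Sum>k<NN l. 2 * \<epsilon>6 + G * m * hh l k + \<bar>\<sigma>\<bar> * (norm (Mk k) * norm (DD l k \<omega>)) + \<bar>\<sigma>\<bar> * R * m * q k)"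
    unfolding inc_err_def
  proof (rule sum_mono)
    fix k assume "k \<in> {..<NN l}"
    then have k: "k < NN l" by simp
    have "norm (inc l k \<omega>) \<le> norm (sde_err l r (Suc k) \<omega>) + norm (sde_err l r k \<omega>) + norm (Ik k) + \<bar>\<sigma>\<bar> * norm (Mk k) + \<bar>\<sigma>\<bar> * norm (Qk k)"
      unfolding eq[OF k] by (intro order_trans[OF norm_triangle_ineq] order_trans[OF norm_triangle_ineq4] add_mono order_refl) simp_all
    also have "\<dots> \<le> 2 * \<epsilon>6 + G * hh l k + \<bar>\<sigma>\<bar> * norm (Mk k) + \<bar>\<sigma>\<bar> * (R * q k)"
      using sde[of "Suc k"] sde[of k] k I_le[OF k] mult_left_mono[OF Q_le[OF k], of "\<bar>\<sigma>\<bar>"] by simp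
    finally have *: "norm (inc l k \<omega>) * norm (DD l k \<omega>) \<le> (2 * \<epsilon>6 + G * hh l k + \<bar>\<sigma>\<bar> * norm (Mk k) + \<bar>\<sigma>\<bar> * (R * q k)) * norm (DD l k \<omega>)"
      by (rule mult_right_mono) simp
    have G0: "0 \<le> G" using order_trans[OF norm_ge_zero G[of 0]] R by simp
    have d: "norm (DD l k \<omega>) \<le> m" "norm (DD l k \<omega>) \<le> 1" using m(1)[OF k] m(3) by auto
    have "2 * \<epsilon>6 * norm (DD l k \<omega>) \<le> 2 * \<epsilon>6 * 1" using \<epsilon>6 d by (intro mult_left_mono) auto
    moreover have "G * hh l k * norm (DD l k \<omega>) \<le> G * hh l k * m" using G0 hh_pos[OF k] d by (intro mult_left_mono) auto
    moreover have "\<bar>\<sigma>\<bar> * (R * q k) * norm (DD l k \<omega>) \<le> \<bar>\<sigma>\<bar> * (R * q k) * m" using q0 R d by (intro mult_left_mono) auto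
    ultimately show "norm (inc l k \<omega>) * norm (DD l k \<omega>) \<le> 2 * \<epsilon>6 + G * m * hh l k + \<bar>\<sigma>\<bar> * (norm (Mk k) * norm (DD l k \<omega>)) + \<bar>\<sigma>\<bar> * R * m * q k"
      using * by (simp add: algebra_simps)
  qed
  also have "\<dots> = 2 * NN l * \<epsilon>6 + G * m * (\<Sum>k<NN l. hh l k) + \<bar>\<sigma>\<bar> * (\<Sum>k<NN l. norm (Mk k) * norm (DD l k \<omega>)) + \<bar>\<sigma>\<bar> * R * m * (\<Sum>k<NN l. q k)"
    by (simp add: sum.distrib sum_distrib_left)
  also have "\<dots> \<le> 2 * NN l * \<epsilon>6 + G * m * len + \<bar>\<sigma>\<bar> * sqrt (\<epsilon>7 * LB) + \<bar>\<sigma>\<bar> * R * m * (LX + LB)"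
  proof (intro add_mono mult_left_mono order_refl)
    show "(\<Sum>k<NN l. hh l k) \<le> len" by (rule sum_hh_le) simp
    show "(\<Sum>k<NN l. q k) \<le> LX + LB" unfolding sumq using qX qB(1) by simp
    have b: "(\<Sum>k<NN l. (norm (Mk k))\<^sup>2) \<le> \<epsilon>7" using blk unfolding block_err_def Mk_def g_def .
    have "(\<Sum>k<NN l. norm (Mk k) * norm (DD l k \<omega>))\<^sup>2 \<le> (\<Sum>k<NN l. (norm (Mk k))\<^sup>2) * (\<Sum>k<NN l. (norm (DD l k \<omega>))\<^sup>2)"
      by (rule Cauchy_Schwarz_ineq_sum)
    also have "\<dots> \<le> \<epsilon>7 * LB"
      using b qB(2) unfolding qB_def by (intro mult_mono) (auto intro!: sum_nonneg intro: order_trans[OF _ b])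
    finally show "(\<Sum>k<NN l. norm (Mk k) * norm (DD l k \<omega>)) \<le> sqrt (\<epsilon>7 * LB)" by (rule real_le_rsqrt)
    show "0 \<le> G * m" using order_trans[OF norm_ge_zero G[of 0]] R m by simp
    show "0 \<le> \<bar>\<sigma>\<bar> * R * m" using R m by simp
  qed simp_all
  finally show ?thesis by (simp add: mult_ac)
qed

text \<open>The order of choices is essential: first \<open>R\<close>, \<open>LX\<close> and
  \<open>LB\<close>, valid on all levels; then \<open>m\<close> and \<open>\<epsilon>7\<close>; then
  the coarse level \<open>l\<close>; only then the tolerance at its nodes and the fine level that
  achieves it.\<close>

lemma exc_inc_err:
  assumes "0 < \<eta>" "0 < \<epsilon>"
  shows "\<exists>l0. \<forall>l\<ge>l0. exc M \<eta> (\<lambda>\<omega>. inc_err l \<omega> \<le> \<epsilon>)"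
proof -
  have \<eta>: "0 < \<eta> / 7" using assms by simp
  obtain R where R: "0 \<le> R" "exc M (\<eta> / 7) (\<lambda>\<omega>. continuous_on {t0..T} (\<lambda>t. X t \<omega>) \<and> (\<forall>t\<in>{t0..T}. norm (X t \<omega>) \<le> R))"
    by (rule exc_X_bounded[OF \<eta>])
  obtain G where G: "0 \<le> G" "\<And>x. norm x \<le> R \<Longrightarrow> norm (stiefel_grad f x) \<le> G"
    using loclip_bounded[OF loclip_stiefel_grad[OF f]] by metis
  from exc_qX[OF \<eta>] obtain LX where LX: "0 < LX" "\<forall>m. exc M (\<eta> / 7) (\<lambda>\<omega>. qX m \<omega> \<le> LX)" by (elim exE conjE)
  from exc_qB[OF \<eta>] obtain LB where LB: "0 < LB" "\<forall>m. exc M (\<eta> / 7) (\<lambda>\<omega>. qB m \<omega> \<le> LB)" by (elim exE conjE)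
  define s where "s = \<epsilon> / (4 * (\<bar>\<sigma>\<bar> + 1))"
  define \<epsilon>7 where "\<epsilon>7 = s\<^sup>2 / LB"
  define W where "W = G * len + \<bar>\<sigma>\<bar> * R * (LX + LB)"
  define m where "m = min 1 (\<epsilon> / (4 * (W + 1)))"
  have s: "0 < s" using assms unfolding s_def by (intro divide_pos_pos mult_pos_pos) auto
  have \<epsilon>7: "0 < \<epsilon>7" "sqrt (\<epsilon>7 * LB) = s" using s LB by (auto simp: \<epsilon>7_def)
  have W: "0 \<le> W" using G R LX LB len_pos by (simp add: W_def)
  have m: "0 < m" "m \<le> 1" "W * m \<le> \<epsilon> / 4"
  proof -
    show "0 < m" using assms W by (auto simp: m_def intro!: divide_pos_pos)
    show "m \<le> 1" by (simp add: m_def)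
    have "W * m \<le> (W + 1) * (\<epsilon> / (4 * (W + 1)))" using W \<open>0 < m\<close> by (intro mult_mono) (auto simp: m_def)
    also have "\<dots> = \<epsilon> / 4" using W by (simp add: field_simps)
    finally show "W * m \<le> \<epsilon> / 4" .
  qed
  from exc_block_martingale[OF \<eta> \<epsilon>7(1)] obtain l1 where l1: "\<forall>l\<ge>l1. \<forall>r. exc M (\<eta> / 7) (\<lambda>\<omega>. block_err l r \<omega> \<le> \<epsilon>7)" ..
  from exc_DD_small[OF \<eta> m(1)] obtain l2 where l2: "\<forall>l\<ge>l2. exc M (\<eta> / 7) (\<lambda>\<omega>. \<forall>i<NN l. norm (DD l i \<omega>) \<le> m)" ..
  have "exc M \<eta> (\<lambda>\<omega>. inc_err l \<omega> \<le> \<epsilon>)" if l: "max l1 l2 \<le> l" for l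
  proof -
    \<comment> \<open>There are about \<open>NN l\<close> defects to add up, so the tolerance for
      each is divided by that number.\<close>
    define \<epsilon>6 where "\<epsilon>6 = \<epsilon> / (8 * (real (NN l) + 1))"
    have \<epsilon>6: "0 < \<epsilon>6" using assms unfolding \<epsilon>6_def by (intro divide_pos_pos) (simp_all add: add_nonneg_pos)
    from exc_sde_nodes[OF \<eta> \<epsilon>6, of l] obtain r0 where "\<forall>r\<ge>r0. exc M (\<eta> / 7) (\<lambda>\<omega>. \<forall>k\<in>{..NN l}. norm (sde_err l r k \<omega>) \<le> \<epsilon>6)" ..
    then have E7: "exc M (\<eta> / 7) (\<lambda>\<omega>. \<forall>k\<in>{..NN l}. norm (sde_err l r0 k \<omega>) \<le> \<epsilon>6)" by simp
    have E6: "exc M (\<eta> / 7) (\<lambda>\<omega>. block_err l r0 \<omega> \<le> \<epsilon>7)" using l1 l by simp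
    have E5: "exc M (\<eta> / 7) (\<lambda>\<omega>. \<forall>i<NN l. norm (DD l i \<omega>) \<le> m)" using l2 l by simp
    show ?thesis
    proof (rule exc_mono[OF exc_conj[OF exc_conj[OF exc_conj[OF exc_conj[OF exc_conj[OF exc_conj[OF R(2) LX(2)[rule_format, of "l + r0"]]
            LB(2)[rule_format, of "l + r0"]] LB(2)[rule_format, of l]] E5] E6] E7]])
      fix \<omega> assume *: "((((((continuous_on {t0..T} (\<lambda>t. X t \<omega>) \<and> (\<forall>t\<in>{t0..T}. norm (X t \<omega>) \<le> R)) \<and> qX (l + r0) \<omega> \<le> LX) \<and>
          qB (l + r0) \<omega> \<le> LB) \<and> qB l \<omega> \<le> LB) \<and> (\<forall>i<NN l. norm (DD l i \<omega>) \<le> m)) \<and> block_err l r0 \<omega> \<le> \<epsilon>7) \<and>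
          (\<forall>k\<in>{..NN l}. norm (sde_err l r0 k \<omega>) \<le> \<epsilon>6)"
      have "inc_err l \<omega> \<le> 2 * NN l * \<epsilon>6 + G * len * m + \<bar>\<sigma>\<bar> * sqrt (\<epsilon>7 * LB) + \<bar>\<sigma>\<bar> * R * m * (LX + LB)"
        by (rule inc_err_pathwise[where r=r0]) (use * G R m in auto)
      also have "\<dots> = 2 * NN l * \<epsilon>6 + W * m + \<bar>\<sigma>\<bar> * s" unfolding \<epsilon>7 by (simp add: W_def algebra_simps)
      also have "\<dots> \<le> \<epsilon> / 4 + \<epsilon> / 4 + \<epsilon> / 4"
      proof (intro add_mono m)
        have "2 * real (NN l) * \<epsilon>6 \<le> 2 * (real (NN l) + 1) * \<epsilon>6" using \<epsilon>6 by (intro mult_right_mono) auto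
        also have "\<dots> = \<epsilon> / 4"
        proof -
          have "2 * (x + 1) * (\<epsilon> / (8 * (x + 1))) = \<epsilon> / 4" if "0 \<le> x" for x :: real using that by (simp add: field_simps)
          from this[of "real (NN l)"] show ?thesis unfolding \<epsilon>6_def by (simp only: of_nat_0_le_iff)
        qed
        finally show "2 * NN l * \<epsilon>6 \<le> \<epsilon> / 4" by simp
        have "\<bar>\<sigma>\<bar> * s \<le> (\<bar>\<sigma>\<bar> + 1) * s" using s by (intro mult_right_mono) auto
        also have "\<dots> = \<epsilon> / 4"
        proof -
          have "(x + 1) * (\<epsilon> / (4 * (x + 1))) = \<epsilon> / 4" if "0 \<le> x" for x :: real using that by (simp add: field_simps)
          then show ?thesis unfolding s_def by simp
        qed
        finally show "\<bar>\<sigma>\<bar> * s \<le> \<epsilon> / 4" .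
      qed
      also have "\<dots> \<le> \<epsilon>" using assms by simp
      finally show "inc_err l \<omega> \<le> \<epsilon>" .
    qed simp
  qed
  then show ?thesis by (intro exI[of _ "max l1 l2"] allI impI)
qed

subsection \<open>From the trapezoidal rule to the Ito drift\<close>

text \<open>Deviation of the quadratic noise terms from their conditional means, a sum of centred
  terms.\<close>

definition "corr_err m j \<omega> = (\<Sum>k<j. (1/2) *\<^sub>R dpf (XX m k \<omega>) (DD m k \<omega>) (pf (XX m k \<omega>) (DD m k \<omega>)) - hh m k *\<^sub>R corr (XX m k \<omega>))"

text \<open>Excess of the trapezoidal over the left-point rule, compared with the correction of the
  drift; one factor \<open>\<sigma>\<close> is still left out.\<close>

definition "strat_err m j \<omega> = (\<Sum>k<j. (1/2) *\<^sub>R (pf (XX m (Suc k) \<omega>) (DD m k \<omega>) - pf (XX m k \<omega>) (DD m k \<omega>)) - \<sigma> *\<^sub>R hh m k *\<^sub>R corr (XX m k \<omega>))"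

text \<open>\<open>quadratic_sum_L2\<close> for the form in the definition of \<open>corr\<close>,
  switched off outside a ball; the second moment is of the order of the step. The node
  \<open>j\<close> stays outside the exceptional event, which suffices since expectations are later
  taken at one node at a time.\<close>

lemma exc_corr_err:
  assumes "0 < \<eta>" "0 < \<epsilon>"
  shows "\<exists>l0. \<forall>l\<ge>l0. \<forall>j\<le>NN l. exc M \<eta> (\<lambda>\<omega>. norm (corr_err l j \<omega>) \<le> \<epsilon>)"
proof -
  have \<eta>: "0 < \<eta> / 2" using assms by simp
  obtain R where R: "0 \<le> R" "exc M (\<eta> / 2) (\<lambda>\<omega>. continuous_on {t0..T} (\<lambda>t. X t \<omega>) \<and> (\<forall>t\<in>{t0..T}. norm (X t \<omega>) \<le> R))"
    by (rule exc_X_bounded[OF \<eta>])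
  define g where "g = R * (1 + R\<^sup>2)"
  define \<kappa> where "\<kappa> = (real (CARD('n) * CARD('p))) ^ 4 * mom (CARD('n) * CARD('p)) 2"
  have \<kappa>: "0 \<le> \<kappa>" by (simp add: \<kappa>_def mom_nonneg)
  define d where "d = \<epsilon>\<^sup>2 * (\<eta> / 2) / (\<kappa> * len * g\<^sup>2 + 1)"
  have den: "0 < \<kappa> * len * g\<^sup>2 + 1" using \<kappa> len_pos by (intro add_nonneg_pos) auto
  have d: "0 < d" unfolding d_def using assms den by (intro divide_pos_pos) auto
  obtain l0 where l0: "\<And>m. l0 \<le> m \<Longrightarrow> len / 2 ^ m < d" using len_div_eventually[OF d] by blast
  have "exc M \<eta> (\<lambda>\<omega>. norm (corr_err l j \<omega>) \<le> \<epsilon>)" if l: "l0 \<le> l" and j: "j \<le> NN l" for l j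
  proof -
    define b where "b k \<omega> D E = (if norm (XX l k \<omega>) \<le> R then 1 else 0) *\<^sub>R ((1/2) *\<^sub>R dpf (XX l k \<omega>) D (pf (XX l k \<omega>) E))" for k \<omega> D E
    define S where "S \<omega> = (\<Sum>k<j. b k \<omega> (B (tt l (Suc k)) \<omega> - B (tt l k) \<omega>) (B (tt l (Suc k)) \<omega> - B (tt l k) \<omega>)
      - (tt l (Suc k) - tt l k) *\<^sub>R (\<Sum>u\<in>UNIV. \<Sum>v\<in>UNIV. b k \<omega> (unit_mat u v) (unit_mat u v)))" for \<omega>
    have lin: "linear (b k \<omega> D)" "linear (\<lambda>E. b k \<omega> E D)" for k \<omega> D
      unfolding b_def
      by (intro linear_compose_scale_right linear_compose[OF linear_pf linear_dpf(1), unfolded o_def] linear_dpf(2))+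
    have bF: "(\<lambda>\<omega>. b k \<omega> (unit_mat a a') (unit_mat c c')) \<in> borel_measurable (F (tt l k))" if "k < j" for k a a' c c'
    proof -
      have XF: "XX l k \<in> borel_measurable (F (tt l k))" using that j by (intro XX_F) simp
      have [measurable]: "(\<lambda>\<omega>. dpf (XX l k \<omega>) (unit_mat a a') (pf (XX l k \<omega>) (unit_mat c c'))) \<in> borel_measurable (F (tt l k))"
        by (rule loclip_measurable[OF loclip_dpf_pf XF])
      note [measurable] = XF
      show ?thesis unfolding b_def by measurable
    qed
    have b_le: "norm (b k \<omega> D E) \<le> g * norm D * norm E" for k \<omega> D E
    proof (cases "norm (XX l k \<omega>) \<le> R")
      case True
      then have "norm (b k \<omega> D E) \<le> (1/2) * (2 * norm (XX l k \<omega>) * norm D * norm (pf (XX l k \<omega>) E))"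
        using norm_dpf_le[of "XX l k \<omega>" D "pf (XX l k \<omega>) E"] by (simp add: b_def)
      also have "\<dots> \<le> (1/2) * (2 * R * norm D * ((1 + R\<^sup>2) * norm E))"
      proof (intro mult_left_mono mult_mono mult_nonneg_nonneg norm_ge_zero R True order_refl)
        have "norm (pf (XX l k \<omega>) E) \<le> (1 + (norm (XX l k \<omega>))\<^sup>2) * norm E" by (rule norm_pf_le)
        also have "\<dots> \<le> (1 + R\<^sup>2) * norm E" using True by (intro mult_right_mono add_mono power_mono) auto
        finally show "norm (pf (XX l k \<omega>) E) \<le> (1 + R\<^sup>2) * norm E" .
      qed auto
      also have "\<dots> = g * norm D * norm E" by (simp add: g_def)
      finally show ?thesis .
    next
      case False
      then show ?thesis using R(1) by (simp add: b_def g_def)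
    qed
    have u: "0 \<le> tt l 0" "\<And>k. k < j \<Longrightarrow> tt l k < tt l (Suc k)" using t0 tt_less j by (auto simp: tt_0)
    note * = quadratic_sum_L2[where u="tt l" and N=j and b=b and g="\<lambda>k \<omega>. g", OF u lin bF b_le integrable_const S_def]
    have "expectation (\<lambda>\<omega>. (norm (S \<omega>))\<^sup>2) \<le> \<kappa> * (\<Sum>k<j. (hh l k)\<^sup>2 * g\<^sup>2)"
      using *(3) by (simp add: \<kappa>_def hh_def prob_space)
    also have "\<dots> \<le> \<kappa> * (\<Sum>k<j. d * hh l k * g\<^sup>2)"
    proof (intro mult_left_mono sum_mono mult_right_mono \<kappa>)
      fix k assume "k \<in> {..<j}"
      then have k: "k < NN l" using j by simp
      show "(hh l k)\<^sup>2 \<le> d * hh l k"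
        unfolding power2_eq_square using hh_le[OF k] l0[OF l] hh_pos[OF k] by (intro mult_right_mono) auto
    qed simp
    also have "\<dots> = \<kappa> * (d * (\<Sum>k<j. hh l k) * g\<^sup>2)" by (simp add: sum_distrib_left sum_distrib_right)
    also have "\<dots> \<le> \<kappa> * (d * len * g\<^sup>2)"
      using sum_hh_le[OF j] d \<kappa> by (intro mult_left_mono mult_right_mono) auto
    also have "\<dots> \<le> (\<kappa> * len * g\<^sup>2 + 1) * d" using d by (simp add: algebra_simps)
    also have "\<dots> = \<epsilon>\<^sup>2 * (\<eta> / 2)"
    proof -
      have "c * (x / c) = x" if "0 < c" for c x :: real using that by simp
      then show ?thesis unfolding d_def using den .
    qed
    finally have E: "expectation (\<lambda>\<omega>. (norm (S \<omega>))\<^sup>2) \<le> \<epsilon>\<^sup>2 * (\<eta> / 2)" .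
    have Mk: "exc M (\<eta> / 2) (\<lambda>\<omega>. norm (S \<omega>) \<le> \<epsilon>)" by (rule exc_Markov_sq[OF *(2) E assms(2)])
    show ?thesis
    proof (rule exc_mono[OF exc_conj[OF R(2) Mk]])
      fix \<omega> assume *: "(continuous_on {t0..T} (\<lambda>t. X t \<omega>) \<and> (\<forall>t\<in>{t0..T}. norm (X t \<omega>) \<le> R)) \<and> norm (S \<omega>) \<le> \<epsilon>"
      have XR: "norm (XX l k \<omega>) \<le> R" if "k < j" for k using * tt_in[of k l] that j unfolding XX_def by simp
      have "S \<omega> = corr_err l j \<omega>"
        unfolding S_def corr_err_def
      proof (intro sum.cong refl)
        fix k assume "k \<in> {..<j}"
        then have "norm (XX l k \<omega>) \<le> R" using XR by simp
        then show "b k \<omega> (B (tt l (Suc k)) \<omega> - B (tt l k) \<omega>) (B (tt l (Suc k)) \<omega> - B (tt l k) \<omega>)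
          - (tt l (Suc k) - tt l k) *\<^sub>R (\<Sum>u\<in>UNIV. \<Sum>v\<in>UNIV. b k \<omega> (unit_mat u v) (unit_mat u v))
          = (1/2) *\<^sub>R dpf (XX l k \<omega>) (DD l k \<omega>) (pf (XX l k \<omega>) (DD l k \<omega>)) - hh l k *\<^sub>R corr (XX l k \<omega>)"
          by (simp add: b_def corr_def DD_def hh_def scaleR_sum_right)
      qed
      then show "norm (corr_err l j \<omega>) \<le> \<epsilon>" using * by simp
    qed simp
  qed
  then show ?thesis by (intro exI[of _ l0] allI impI)
qed

text \<open>Taylor expansion of the half difference at the left node. The remainder gives
  \<open>m * LX\<close>; in the first-order term the increment splits into \<open>inc\<close> and
  the leading noise term, which lead to \<open>inc_err\<close> and \<open>corr_err\<close>.\<close>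

lemma strat_err_pathwise:
  assumes XR: "\<And>k. k \<le> NN l \<Longrightarrow> norm (XX l k \<omega>) \<le> R" and R: "0 \<le> R" and j: "j \<le> NN l"
    and qX: "qX l \<omega> \<le> LX" and m: "\<And>i. i < NN l \<Longrightarrow> norm (DD l i \<omega>) \<le> m" "0 \<le> m"
  shows "norm (strat_err l j \<omega>) \<le> m * LX + R * inc_err l \<omega> + \<bar>\<sigma>\<bar> * norm (corr_err l j \<omega>)"
proof -
  let ?x = "\<lambda>k. XX l k \<omega>" and ?D = "\<lambda>k. DD l k \<omega>"
  define A where "A k = (1/2) *\<^sub>R (pf (?x k + dX l k \<omega>) (?D k) - pf (?x k) (?D k) - dpf (?x k) (?D k) (dX l k \<omega>))" for k
  define E where "E k = (1/2) *\<^sub>R dpf (?x k) (?D k) (inc l k \<omega>)" for k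
  have dpf_inc: "dpf (?x k) (?D k) (inc l k \<omega>) = dpf (?x k) (?D k) (dX l k \<omega>) - \<sigma> *\<^sub>R dpf (?x k) (?D k) (pf (?x k) (?D k))" for k
    unfolding inc_def by (simp only: linear_diff[OF linear_dpf(1)] linear_scale[OF linear_dpf(1)])
  have "strat_err l j \<omega> = (\<Sum>k<j. A k) + (\<Sum>k<j. E k) + \<sigma> *\<^sub>R corr_err l j \<omega>"
    unfolding strat_err_def corr_err_def A_def E_def dpf_inc scaleR_sum_right sum.distrib[symmetric]
    by (intro sum.cong refl) (simp add: dX_def vec_eq_iff field_simps)
  also have "norm \<dots> \<le> norm (\<Sum>k<j. A k) + norm (\<Sum>k<j. E k) + \<bar>\<sigma>\<bar> * norm (corr_err l j \<omega>)"
    by (intro order_trans[OF norm_triangle_ineq] add_mono order_refl norm_triangle_ineq) simp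
  also have "norm (\<Sum>k<j. A k) \<le> m * LX"
  proof -
    have "norm (\<Sum>k<j. A k) \<le> (\<Sum>k<j. m * (norm (dX l k \<omega>))\<^sup>2)"
    proof (rule sum_norm_le)
      fix k assume "k \<in> {..<j}"
      then have k: "k < NN l" using j by simp
      have "norm (A k) \<le> norm (pf (?x k + dX l k \<omega>) (?D k) - pf (?x k) (?D k) - dpf (?x k) (?D k) (dX l k \<omega>))" by (simp add: A_def)
      also have "\<dots> \<le> (norm (dX l k \<omega>))\<^sup>2 * norm (?D k)" by (rule norm_pf_second_order)
      also have "\<dots> \<le> (norm (dX l k \<omega>))\<^sup>2 * m" by (intro mult_left_mono m k) simp
      finally show "norm (A k) \<le> m * (norm (dX l k \<omega>))\<^sup>2" by (simp add: mult.commute)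
    qed
    also have "\<dots> = m * (\<Sum>k<j. (norm (dX l k \<omega>))\<^sup>2)" by (simp add: sum_distrib_left)
    also have "\<dots> \<le> m * LX"
    proof (intro mult_left_mono m)
      have "(\<Sum>k<j. (norm (dX l k \<omega>))\<^sup>2) \<le> qX l \<omega>" unfolding qX_def using j by (intro sum_mono2) auto
      then show "(\<Sum>k<j. (norm (dX l k \<omega>))\<^sup>2) \<le> LX" using qX by simp
    qed
    finally show ?thesis .
  qed
  also have "norm (\<Sum>k<j. E k) \<le> R * inc_err l \<omega>"
  proof -
    have "norm (\<Sum>k<j. E k) \<le> (\<Sum>k<j. R * (norm (inc l k \<omega>) * norm (?D k)))"
    proof (rule sum_norm_le)
      fix k assume "k \<in> {..<j}"
      then have k: "k \<le> NN l" using j by simp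
      have "norm (E k) \<le> (1/2) * (2 * norm (?x k) * norm (?D k) * norm (inc l k \<omega>))"
        unfolding E_def using norm_dpf_le[of "?x k" "?D k" "inc l k \<omega>"] by simp
      also have "\<dots> = norm (?x k) * (norm (inc l k \<omega>) * norm (?D k))" by simp
      also have "\<dots> \<le> R * (norm (inc l k \<omega>) * norm (?D k))" by (intro mult_right_mono XR k) simp
      finally show "norm (E k) \<le> R * (norm (inc l k \<omega>) * norm (?D k))" .
    qed
    also have "\<dots> = R * (\<Sum>k<j. norm (inc l k \<omega>) * norm (?D k))" by (simp add: sum_distrib_left)
    also have "\<dots> \<le> R * inc_err l \<omega>" unfolding inc_err_def using j by (intro mult_left_mono sum_mono2 R) auto
    finally show ?thesis .
  qed
  finally show ?thesis by simp
qed

lemma exc_strat_err: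
  assumes "0 < \<eta>" "0 < \<epsilon>"
  shows "\<exists>l0. \<forall>l\<ge>l0. \<forall>j\<le>NN l. exc M \<eta> (\<lambda>\<omega>. norm (strat_err l j \<omega>) \<le> \<epsilon>)"
proof -
  have \<eta>: "0 < \<eta> / 5" using assms by simp
  obtain R where R: "0 \<le> R" "exc M (\<eta> / 5) (\<lambda>\<omega>. continuous_on {t0..T} (\<lambda>t. X t \<omega>) \<and> (\<forall>t\<in>{t0..T}. norm (X t \<omega>) \<le> R))"
    by (rule exc_X_bounded[OF \<eta>])
  from exc_qX[OF \<eta>] obtain LX where LX: "0 < LX" "\<forall>m. exc M (\<eta> / 5) (\<lambda>\<omega>. qX m \<omega> \<le> LX)" by (elim exE conjE)
  have small: "x * (\<epsilon> / (3 * (x + 1))) \<le> \<epsilon> / 3" if "0 \<le> x" for x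
  proof -
    have "x * (\<epsilon> / (3 * (x + 1))) \<le> (x + 1) * (\<epsilon> / (3 * (x + 1)))" using that assms by (intro mult_right_mono) auto
    also have "\<dots> = \<epsilon> / 3" using that by (simp add: field_simps)
    finally show ?thesis .
  qed
  have pos: "0 < \<epsilon> / (3 * (x + 1))" if "0 \<le> x" for x using that assms by (intro divide_pos_pos) auto
  let ?m = "\<epsilon> / (3 * (LX + 1))" and ?a = "\<epsilon> / (3 * (R + 1))" and ?c = "\<epsilon> / (3 * (\<bar>\<sigma>\<bar> + 1))"
  have mac: "0 < ?m" "0 < ?a" "0 < ?c" by (rule pos[OF less_imp_le[OF LX(1)]], rule pos[OF R(1)], rule pos[OF abs_ge_zero])
  from exc_DD_small[OF \<eta> mac(1)] obtain l1 where l1: "\<forall>l\<ge>l1. exc M (\<eta> / 5) (\<lambda>\<omega>. \<forall>i<NN l. norm (DD l i \<omega>) \<le> ?m)" ..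
  from exc_inc_err[OF \<eta> mac(2)] obtain l2 where l2: "\<forall>l\<ge>l2. exc M (\<eta> / 5) (\<lambda>\<omega>. inc_err l \<omega> \<le> ?a)" ..
  from exc_corr_err[OF \<eta> mac(3)] obtain l3 where l3: "\<forall>l\<ge>l3. \<forall>j\<le>NN l. exc M (\<eta> / 5) (\<lambda>\<omega>. norm (corr_err l j \<omega>) \<le> ?c)" ..
  have "exc M \<eta> (\<lambda>\<omega>. norm (strat_err l j \<omega>) \<le> \<epsilon>)" if l: "max l1 (max l2 l3) \<le> l" and j: "j \<le> NN l" for l j
  proof -
    have E3: "exc M (\<eta> / 5) (\<lambda>\<omega>. \<forall>i<NN l. norm (DD l i \<omega>) \<le> ?m)" using l1 l by simp
    have E4: "exc M (\<eta> / 5) (\<lambda>\<omega>. inc_err l \<omega> \<le> ?a)" using l2 l by simp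
    have E5: "exc M (\<eta> / 5) (\<lambda>\<omega>. norm (corr_err l j \<omega>) \<le> ?c)" using l3 l j by simp
    show ?thesis
    proof (rule exc_mono[OF exc_conj[OF exc_conj[OF exc_conj[OF exc_conj[OF R(2) LX(2)[rule_format, of l]] E3] E4] E5]])
      fix \<omega> assume *: "((((continuous_on {t0..T} (\<lambda>t. X t \<omega>) \<and> (\<forall>t\<in>{t0..T}. norm (X t \<omega>) \<le> R)) \<and> qX l \<omega> \<le> LX) \<and>
        (\<forall>i<NN l. norm (DD l i \<omega>) \<le> ?m)) \<and> inc_err l \<omega> \<le> ?a) \<and> norm (corr_err l j \<omega>) \<le> ?c"
      have "norm (strat_err l j \<omega>) \<le> ?m * LX + R * inc_err l \<omega> + \<bar>\<sigma>\<bar> * norm (corr_err l j \<omega>)"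
      proof (rule strat_err_pathwise[OF _ R(1) j])
        show "norm (XX l k \<omega>) \<le> R" if "k \<le> NN l" for k using * tt_in[OF that] by (simp add: XX_def)
      qed (use * mac in auto)
      also have "\<dots> \<le> LX * ?m + R * ?a + \<bar>\<sigma>\<bar> * ?c"
        unfolding mult.commute[of ?m LX] using * R(1) by (intro add_mono mult_left_mono order_refl) auto
      also have "\<dots> \<le> \<epsilon> / 3 + \<epsilon> / 3 + \<epsilon> / 3" using LX(1) R(1) by (intro add_mono small) auto
      finally show "norm (strat_err l j \<omega>) \<le> \<epsilon>" by simp
    qed simp
  qed
  then show ?thesis by (intro exI[of _ "max l1 (max l2 l3)"] allI impI)
qed

end

context sde_grid
begin

subsection \<open>The Euler sums along the solution\<close>

definition "riem_err m j \<omega> = integral {t0..tt m j} (\<lambda>s. stiefel_grad f (X s \<omega>)) - (\<Sum>k<j. hh m k *\<^sub>R stiefel_grad f (XX m k \<omega>))"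

text \<open>Defect of the solution in the explicit Euler sum with the Ito drift. From here on the
  Stratonovich integral no longer occurs.\<close>

definition "euler_err m j \<omega> = XX m j \<omega> - X t0 \<omega> - (\<Sum>k<j. euler_incr f \<sigma> (tt m k) (tt m (Suc k)) (XX m k \<omega>) \<omega>)"

lemma riem_err_pathwise:
  assumes cont: "continuous_on {t0..T} (\<lambda>t. X t \<omega>)" and XR: "\<And>t. t \<in> {t0..T} \<Longrightarrow> norm (X t \<omega>) \<le> R"
    and L: "0 \<le> L" "\<And>x y. norm x \<le> R \<Longrightarrow> norm y \<le> R \<Longrightarrow> norm (stiefel_grad f x - stiefel_grad f y) \<le> L * norm (x - y)"
    and mod: "\<And>s t. s \<in> {t0..T} \<Longrightarrow> t \<in> {t0..T} \<Longrightarrow> \<bar>s - t\<bar> < d \<Longrightarrow> norm (X s \<omega> - X t \<omega>) \<le> \<epsilon>"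
    and d: "len / 2 ^ m < d" and j: "j \<le> NN m" and \<epsilon>: "0 \<le> \<epsilon>"
  shows "norm (riem_err m j \<omega>) \<le> L * \<epsilon> * len"
proof -
  have "j \<le> NN m \<Longrightarrow> norm (riem_err m j \<omega>) \<le> L * \<epsilon> * (\<Sum>k<j. hh m k)" for j
  proof (induction j)
    case 0
    show ?case by (simp add: riem_err_def tt_0)
  next
    case (Suc j)
    then have j: "j < NN m" by simp
    let ?g = "\<lambda>s. stiefel_grad f (X s \<omega>)" and ?I = "{tt m j..tt m (Suc j)}"
    have "integral ?I (\<lambda>s. ?g s - stiefel_grad f (XX m j \<omega>)) = integral ?I ?g - hh m j *\<^sub>R stiefel_grad f (XX m j \<omega>)"
      using tt_less[OF j] by (subst Henstock_Kurzweil_Integration.integral_diff[OF grad_integral_block(2)[OF cont j]]) (auto simp: hh_def)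
    then have eq: "riem_err m (Suc j) \<omega> = riem_err m j \<omega> + integral ?I (\<lambda>s. ?g s - stiefel_grad f (XX m j \<omega>))"
      unfolding riem_err_def grad_integral_block(3)[OF cont j] by simp
    have "norm (integral ?I (\<lambda>s. ?g s - stiefel_grad f (XX m j \<omega>))) \<le> L * \<epsilon> * (tt m (Suc j) - tt m j)"
    proof (rule integral_bound)
      show "tt m j \<le> tt m (Suc j)" using tt_less[OF j] by simp
      show "continuous_on ?I (\<lambda>s. ?g s - stiefel_grad f (XX m j \<omega>))"
        by (intro continuous_on_diff grad_integral_block(1)[OF cont j] continuous_on_const)
      fix s assume s: "s \<in> ?I"
      have in1: "s \<in> {t0..T}" "tt m j \<in> {t0..T}" using s tt_in[of j m] tt_in[of "Suc j" m] j by auto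
      have "\<bar>s - tt m j\<bar> < d" using s hh_le[OF j] d by (simp add: hh_def)
      then have X: "norm (X s \<omega> - XX m j \<omega>) \<le> \<epsilon>" unfolding XX_def by (intro mod in1)
      have "norm (?g s - stiefel_grad f (XX m j \<omega>)) \<le> L * norm (X s \<omega> - XX m j \<omega>)"
        unfolding XX_def by (intro L XR in1)
      also have "\<dots> \<le> L * \<epsilon>" using X L by (intro mult_left_mono) auto
      finally show "norm (?g s - stiefel_grad f (XX m j \<omega>)) \<le> L * \<epsilon>" .
    qed
    then have "norm (riem_err m (Suc j) \<omega>) \<le> L * \<epsilon> * (\<Sum>k<j. hh m k) + L * \<epsilon> * hh m j"
      unfolding eq hh_def[of m j] using Suc j by (intro order_trans[OF norm_triangle_ineq] add_mono) auto
    then show ?case by (simp add: algebra_simps)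
  qed
  from this[OF j] have "norm (riem_err m j \<omega>) \<le> L * \<epsilon> * (\<Sum>k<j. hh m k)" .
  also have "\<dots> \<le> L * \<epsilon> * len" using L \<epsilon> sum_hh_le[OF j] by (intro mult_left_mono) auto
  finally show ?thesis .
qed

lemma exc_riem_err:
  assumes "0 < \<eta>" "0 < \<epsilon>"
  shows "\<exists>l0. \<forall>l\<ge>l0. exc M \<eta> (\<lambda>\<omega>. \<forall>j\<le>NN l. norm (riem_err l j \<omega>) \<le> \<epsilon>)"
proof -
  have \<eta>: "0 < \<eta> / 2" using assms by simp
  obtain R where R: "0 \<le> R" "exc M (\<eta> / 2) (\<lambda>\<omega>. continuous_on {t0..T} (\<lambda>t. X t \<omega>) \<and> (\<forall>t\<in>{t0..T}. norm (X t \<omega>) \<le> R))"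
    by (rule exc_X_bounded[OF \<eta>])
  obtain L where L: "0 \<le> L" "\<And>x y. norm x \<le> R \<Longrightarrow> norm y \<le> R \<Longrightarrow> norm (stiefel_grad f x - stiefel_grad f y) \<le> L * norm (x - y)"
    using loclipD[OF loclip_stiefel_grad[OF f]] by metis
  define \<epsilon>' where "\<epsilon>' = \<epsilon> / (L * len + 1)"
  have den: "0 < L * len + 1" using L len_pos by (intro add_nonneg_pos) auto
  have \<epsilon>': "0 < \<epsilon>'" using assms den by (simp add: \<epsilon>'_def)
  have "L * \<epsilon>' * len \<le> (L * len + 1) * \<epsilon>'" using \<epsilon>' by (simp add: algebra_simps)
  also have "\<dots> = \<epsilon>" using den by (simp add: \<epsilon>'_def)
  finally have le: "L * \<epsilon>' * len \<le> \<epsilon>" .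
  obtain d where d: "0 < d" "exc M (\<eta> / 2) (\<lambda>\<omega>. \<forall>s\<in>{t0..T}. \<forall>t\<in>{t0..T}. \<bar>s - t\<bar> < d \<longrightarrow> norm (X s \<omega> - X t \<omega>) \<le> \<epsilon>')"
    by (rule exc_X_modulus[OF \<eta> \<epsilon>'])
  obtain l0 where l0: "\<And>m. l0 \<le> m \<Longrightarrow> len / 2 ^ m < d" using len_div_eventually[OF d(1)] by blast
  have "exc M \<eta> (\<lambda>\<omega>. \<forall>j\<le>NN l. norm (riem_err l j \<omega>) \<le> \<epsilon>)" if l: "l0 \<le> l" for l
  proof (rule exc_mono[OF exc_conj[OF R(2) d(2)]])
    fix \<omega> assume *: "(continuous_on {t0..T} (\<lambda>t. X t \<omega>) \<and> (\<forall>t\<in>{t0..T}. norm (X t \<omega>) \<le> R)) \<and>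
      (\<forall>s\<in>{t0..T}. \<forall>t\<in>{t0..T}. \<bar>s - t\<bar> < d \<longrightarrow> norm (X s \<omega> - X t \<omega>) \<le> \<epsilon>')"
    show "\<forall>j\<le>NN l. norm (riem_err l j \<omega>) \<le> \<epsilon>"
    proof (intro allI impI)
      fix j assume j: "j \<le> NN l"
      have "norm (riem_err l j \<omega>) \<le> L * \<epsilon>' * len"
        by (rule riem_err_pathwise[OF _ _ L(1) L(2) _ l0[OF l] j]) (use * \<epsilon>' in auto)
      then show "norm (riem_err l j \<omega>) \<le> \<epsilon>" using le by simp
    qed
  qed simp
  then show ?thesis by (intro exI[of _ l0] allI impI)
qed

lemma euler_err_node:
  "euler_err (l + r) (k * 2 ^ r) \<omega> = sde_err l r k \<omega> - riem_err (l + r) (k * 2 ^ r) \<omega> + \<sigma> *\<^sub>R strat_err (l + r) (k * 2 ^ r) \<omega>"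
proof -
  let ?m = "l + r" and ?j = "k * 2 ^ r"
  have "euler_incr f \<sigma> (tt ?m i) (tt ?m (Suc i)) (XX ?m i \<omega>) \<omega>
      = \<sigma> *\<^sub>R trap (tt ?m i) (tt ?m (Suc i)) \<omega> - hh ?m i *\<^sub>R stiefel_grad f (XX ?m i \<omega>)
        - \<sigma> *\<^sub>R ((1/2) *\<^sub>R (pf (XX ?m (Suc i) \<omega>) (DD ?m i \<omega>) - pf (XX ?m i \<omega>) (DD ?m i \<omega>)) - \<sigma> *\<^sub>R hh ?m i *\<^sub>R corr (XX ?m i \<omega>))" for i
    unfolding trap_eq euler_incr_def drift_def hh_def[symmetric] DD_def[symmetric]
    by (simp add: algebra_simps power2_eq_square)
  then have "(\<Sum>i<?j. euler_incr f \<sigma> (tt ?m i) (tt ?m (Suc i)) (XX ?m i \<omega>) \<omega>)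
      = \<sigma> *\<^sub>R (\<Sum>i<?j. trap (tt ?m i) (tt ?m (Suc i)) \<omega>) - (\<Sum>i<?j. hh ?m i *\<^sub>R stiefel_grad f (XX ?m i \<omega>)) - \<sigma> *\<^sub>R strat_err ?m ?j \<omega>"
    unfolding strat_err_def scaleR_sum_right sum_subtractf[symmetric] by simp
  then show ?thesis unfolding euler_err_def sde_err_def riem_err_def XX_coarse tt_coarse by simp
qed

text \<open>Still restricted to the nodes inherited from the coarse level \<open>l\<close>, because
  \<open>sde_err\<close> is controlled only there.\<close>

lemma exc_euler_err_node:
  assumes "0 < \<eta>" "0 < \<epsilon>"
  shows "\<exists>r0. \<forall>r\<ge>r0. \<forall>k\<le>NN l. exc M \<eta> (\<lambda>\<omega>. norm (euler_err (l + r) (k * 2 ^ r) \<omega>) \<le> \<epsilon>)"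
proof -
  have \<eta>: "0 < \<eta> / 3" and \<epsilon>: "0 < \<epsilon> / 3" using assms by auto
  define \<epsilon>' where "\<epsilon>' = \<epsilon> / (3 * (\<bar>\<sigma>\<bar> + 1))"
  have \<epsilon>': "0 < \<epsilon>'" unfolding \<epsilon>'_def using assms by (intro divide_pos_pos) auto
  have "\<bar>\<sigma>\<bar> * \<epsilon>' \<le> (\<bar>\<sigma>\<bar> + 1) * \<epsilon>'" using \<epsilon>' by simp
  also have "\<dots> = \<epsilon> / 3"
  proof -
    have "(x + 1) * (\<epsilon> / (3 * (x + 1))) = \<epsilon> / 3" if "0 \<le> x" for x :: real using that by (simp add: field_simps)
    then show ?thesis unfolding \<epsilon>'_def by simp
  qed
  finally have \<sigma>: "\<bar>\<sigma>\<bar> * \<epsilon>' \<le> \<epsilon> / 3" .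
  from exc_sde_nodes[OF \<eta> \<epsilon>, of l] obtain r1 where r1: "\<forall>r\<ge>r1. exc M (\<eta> / 3) (\<lambda>\<omega>. \<forall>k\<in>{..NN l}. norm (sde_err l r k \<omega>) \<le> \<epsilon> / 3)" ..
  from exc_riem_err[OF \<eta> \<epsilon>] obtain r2 where r2: "\<forall>l\<ge>r2. exc M (\<eta> / 3) (\<lambda>\<omega>. \<forall>j\<le>NN l. norm (riem_err l j \<omega>) \<le> \<epsilon> / 3)" ..
  from exc_strat_err[OF \<eta> \<epsilon>'] obtain r3 where r3: "\<forall>l\<ge>r3. \<forall>j\<le>NN l. exc M (\<eta> / 3) (\<lambda>\<omega>. norm (strat_err l j \<omega>) \<le> \<epsilon>')" ..
  have "exc M \<eta> (\<lambda>\<omega>. norm (euler_err (l + r) (k * 2 ^ r) \<omega>) \<le> \<epsilon>)" if r: "max r1 (max r2 r3) \<le> r" and k: "k \<le> NN l" for r k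
  proof -
    have k2: "k * 2 ^ r \<le> NN (l + r)" by (rule NN_coarse[OF k])
    have E1: "exc M (\<eta> / 3) (\<lambda>\<omega>. \<forall>k\<in>{..NN l}. norm (sde_err l r k \<omega>) \<le> \<epsilon> / 3)" using r1 r by simp
    have E2: "exc M (\<eta> / 3) (\<lambda>\<omega>. \<forall>j\<le>NN (l + r). norm (riem_err (l + r) j \<omega>) \<le> \<epsilon> / 3)" using r2[rule_format, of "l + r"] r by simp
    have E3: "exc M (\<eta> / 3) (\<lambda>\<omega>. norm (strat_err (l + r) (k * 2 ^ r) \<omega>) \<le> \<epsilon>')" using r3[rule_format, of "l + r", OF _ k2] r by simp
    show ?thesis
    proof (rule exc_mono[OF exc_conj[OF exc_conj[OF E1 E2] E3]])
      fix \<omega> assume *: "((\<forall>k\<in>{..NN l}. norm (sde_err l r k \<omega>) \<le> \<epsilon> / 3) \<and> (\<forall>j\<le>NN (l + r). norm (riem_err (l + r) j \<omega>) \<le> \<epsilon> / 3))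
        \<and> norm (strat_err (l + r) (k * 2 ^ r) \<omega>) \<le> \<epsilon>'"
      have "norm (euler_err (l + r) (k * 2 ^ r) \<omega>) \<le> norm (sde_err l r k \<omega>) + norm (riem_err (l + r) (k * 2 ^ r) \<omega>) + \<bar>\<sigma>\<bar> * norm (strat_err (l + r) (k * 2 ^ r) \<omega>)"
        unfolding euler_err_node by (intro order_trans[OF norm_triangle_ineq] add_mono norm_triangle_ineq4) simp
      also have "\<dots> \<le> \<epsilon> / 3 + \<epsilon> / 3 + \<bar>\<sigma>\<bar> * \<epsilon>'" using * k k2 by (intro add_mono mult_left_mono) auto
      finally show "norm (euler_err (l + r) (k * 2 ^ r) \<omega>) \<le> \<epsilon>" using \<sigma> by simp
    qed simp
  qed
  then show ?thesis by (intro exI[of _ "max r1 (max r2 r3)"] allI impI)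
qed

text \<open>The Gronwall argument needs every node of the fine level. Between two coarse nodes the
  solution moves little by its modulus of continuity, and the Euler sum moves little since the drift
  is bounded and the noise has small variance over a short block.\<close>

lemma exc_euler_err:
  assumes "0 < \<eta>" "0 < \<epsilon>"
  shows "\<exists>m0. \<forall>m\<ge>m0. \<forall>j\<le>NN m. exc M \<eta> (\<lambda>\<omega>. norm (euler_err m j \<omega>) \<le> \<epsilon>)"
proof -
  have \<eta>: "0 < \<eta> / 4" and \<epsilon>: "0 < \<epsilon> / 3" "0 < \<epsilon> / 6" using assms by auto
  obtain R where R: "0 \<le> R" "exc M (\<eta> / 4) (\<lambda>\<omega>. continuous_on {t0..T} (\<lambda>t. X t \<omega>) \<and> (\<forall>t\<in>{t0..T}. norm (X t \<omega>) \<le> R))"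
    by (rule exc_X_bounded[OF \<eta>])
  obtain d1 where d1: "0 < d1" "exc M (\<eta> / 4) (\<lambda>\<omega>. \<forall>s\<in>{t0..T}. \<forall>t\<in>{t0..T}. \<bar>s - t\<bar> < d1 \<longrightarrow> norm (X s \<omega> - X t \<omega>) \<le> \<epsilon> / 3)"
    by (rule exc_X_modulus[OF \<eta> \<epsilon>(1)])
  obtain A where A: "0 \<le> A" "\<And>x. norm x \<le> R \<Longrightarrow> norm (drift f \<sigma> x) \<le> A"
    using loclip_bounded[OF loclip_drift[OF f]] by metis
  define g where "g = \<bar>\<sigma>\<bar> * (1 + R\<^sup>2)"
  define \<kappa> where "\<kappa> = (real (CARD('n) * CARD('p)))\<^sup>2"
  define c where "c = \<kappa> * g\<^sup>2 + 1"
  have c: "0 < c" by (simp add: c_def \<kappa>_def add_nonneg_pos)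
  \<comment> \<open>The three bounds on the block length serve the movement of the path, the drift
    and the noise. With the coarse node itself, the shares of \<open>\<epsilon>\<close> are 1/3 for
    the movement, 1/6, 1/6 and 1/3.\<close>
  define d where "d = min d1 (min (\<epsilon> / 6 / (A + 1)) ((\<epsilon> / 6)\<^sup>2 * (\<eta> / 4) / c))"
  have d: "0 < d" using d1 A c assms by (simp add: d_def)
  obtain l where "\<And>m. l \<le> m \<Longrightarrow> len / 2 ^ m < d" using len_div_eventually[OF d] by blast
  then have ld: "len / 2 ^ l < d" by simp
  have h_small: "len / 2 ^ l < d1" "A * (len / 2 ^ l) \<le> \<epsilon> / 6" "c * (len / 2 ^ l) \<le> (\<epsilon> / 6)\<^sup>2 * (\<eta> / 4)"
  proof -
    show "len / 2 ^ l < d1" using ld by (simp add: d_def)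
    have "A * (len / 2 ^ l) \<le> (A + 1) * (\<epsilon> / 6 / (A + 1))"
      using ld A len_pos by (intro mult_mono) (auto simp: d_def)
    also have "\<dots> = \<epsilon> / 6" using A(1) by (intro nonzero_mult_div_cancel_left[of "A + 1" "\<epsilon> / 6", unfolded times_divide_eq_right[symmetric]]) simp
    finally show "A * (len / 2 ^ l) \<le> \<epsilon> / 6" .
    have "c * (len / 2 ^ l) \<le> c * ((\<epsilon> / 6)\<^sup>2 * (\<eta> / 4) / c)" using ld c by (intro mult_left_mono) (auto simp: d_def)
    also have "\<dots> = (\<epsilon> / 6)\<^sup>2 * (\<eta> / 4)" using c by simp
    finally show "c * (len / 2 ^ l) \<le> (\<epsilon> / 6)\<^sup>2 * (\<eta> / 4)" .
  qed
  from exc_euler_err_node[OF \<eta> \<epsilon>(1), of l] obtain r0 where r0: "\<forall>r\<ge>r0. \<forall>k\<le>NN l. exc M (\<eta> / 4) (\<lambda>\<omega>. norm (euler_err (l + r) (k * 2 ^ r) \<omega>) \<le> \<epsilon> / 3)" ..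
  have "exc M \<eta> (\<lambda>\<omega>. norm (euler_err m j \<omega>) \<le> \<epsilon>)" if m: "l + r0 \<le> m" and j: "j \<le> NN m" for m j
  proof -
    define r where "r = m - l"
    have mr: "m = l + r" and r: "r0 \<le> r" using m by (auto simp: r_def)
    define k where "k = j div 2 ^ r"
    define n where "n = j mod 2 ^ r"
    let ?a = "k * 2 ^ r"
    have jkn: "j = ?a + n" by (simp only: k_def n_def div_mult_mod_eq)
    have n: "n < 2 ^ r" by (simp add: n_def)
    have "j \<le> NN l * 2 ^ r" using j unfolding mr NN_add .
    then have k: "k \<le> NN l" unfolding k_def by (metis div_le_mono nonzero_mult_div_cancel_right power_not_zero zero_neq_numeral)
    have i_less: "?a + q < NN m" if "q < n" for q using that j jkn by simp
    have sum_h: "(\<Sum>q<n. hh m (?a + q)) \<le> len / 2 ^ l"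
    proof (cases "n = 0")
      case True
      then show ?thesis using len_pos by simp
    next
      case False
      then have "k < NN l" using k j jkn unfolding mr NN_add by (cases "k = NN l") auto
      have "(\<Sum>q<n. hh m (?a + q)) \<le> (\<Sum>q<2 ^ r. hh m (?a + q))"
        using n less_imp_le[OF hh_pos[OF block_le[OF \<open>k < NN l\<close>]]] unfolding mr by (intro sum_mono2) auto
      also have "\<dots> = hh l k" unfolding mr by (rule hh_block)
      also have "\<dots> \<le> len / 2 ^ l" by (rule hh_le) fact
      finally show ?thesis .
    qed
    define L where "L q \<omega> D = (if norm (XX m (?a + q) \<omega>) \<le> R then 1 else 0) *\<^sub>R (\<sigma> *\<^sub>R pf (XX m (?a + q) \<omega>) D)" for q \<omega> D
    define S where "S \<omega> = (\<Sum>q<n. L q \<omega> (B (tt m (?a + Suc q)) \<omega> - B (tt m (?a + q)) \<omega>))" for \<omega>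
    have u: "0 \<le> tt m (?a + 0)" "\<And>q. q < n \<Longrightarrow> tt m (?a + q) < tt m (?a + Suc q)"
      using tt_nonneg[of ?a m] j jkn tt_less[OF i_less] by auto
    have lin: "linear (L q \<omega>)" for q \<omega> unfolding L_def by (intro linear_compose_scale_right linear_pf)
    have LF: "(\<lambda>\<omega>. L q \<omega> (unit_mat a b)) \<in> borel_measurable (F (tt m (?a + q)))" if "q < n" for q a b
    proof -
      have XF: "XX m (?a + q) \<in> borel_measurable (F (tt m (?a + q)))" using i_less[OF that] by (intro XX_F) simp
      have [measurable]: "(\<lambda>\<omega>. pf (XX m (?a + q) \<omega>) (unit_mat a b)) \<in> borel_measurable (F (tt m (?a + q)))"
        by (rule loclip_measurable[OF loclip_pf XF])
      note [measurable] = XF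
      show ?thesis unfolding L_def by measurable
    qed
    have L_le: "norm (L q \<omega> D) \<le> g * norm D" for q \<omega> D
    proof (cases "norm (XX m (?a + q) \<omega>) \<le> R")
      case True
      have "norm (pf (XX m (?a + q) \<omega>) D) \<le> (1 + (norm (XX m (?a + q) \<omega>))\<^sup>2) * norm D" by (rule norm_pf_le)
      also have "\<dots> \<le> (1 + R\<^sup>2) * norm D" using True by (intro mult_right_mono add_mono power_mono) auto
      finally show ?thesis using True by (simp add: L_def g_def mult_left_mono mult.assoc)
    next
      case False
      then show ?thesis by (simp add: L_def g_def)
    qed
    note * = linear_sum_L2[where u="\<lambda>q. tt m (?a + q)" and N=n and L=L and g="\<lambda>q \<omega>. g", OF u lin LF L_le integrable_const S_def]
    have "expectation (\<lambda>\<omega>. (norm (S \<omega>))\<^sup>2) \<le> \<kappa> * (\<Sum>q<n. hh m (?a + q) * g\<^sup>2)"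
      using *(3) by (simp add: \<kappa>_def hh_def prob_space)
    also have "\<dots> = \<kappa> * g\<^sup>2 * (\<Sum>q<n. hh m (?a + q))" by (simp add: sum_distrib_left sum_distrib_right mult_ac)
    also have "\<dots> \<le> \<kappa> * g\<^sup>2 * (len / 2 ^ l)" using sum_h by (intro mult_left_mono) (auto simp: \<kappa>_def)
    also have "\<dots> \<le> c * (len / 2 ^ l)" using len_pos by (intro mult_right_mono) (auto simp: c_def)
    also have "\<dots> \<le> (\<epsilon> / 6)\<^sup>2 * (\<eta> / 4)" by (rule h_small)
    finally have E: "expectation (\<lambda>\<omega>. (norm (S \<omega>))\<^sup>2) \<le> (\<epsilon> / 6)\<^sup>2 * (\<eta> / 4)" .
    have Mk: "exc M (\<eta> / 4) (\<lambda>\<omega>. norm (S \<omega>) \<le> \<epsilon> / 6)" by (rule exc_Markov_sq[OF *(2) E \<epsilon>(2)])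
    have Nd: "exc M (\<eta> / 4) (\<lambda>\<omega>. norm (euler_err m ?a \<omega>) \<le> \<epsilon> / 3)" using r0 r k unfolding mr by simp
    show ?thesis
    proof (rule exc_mono[OF exc_conj[OF exc_conj[OF exc_conj[OF R(2) d1(2)] Mk] Nd]])
      fix \<omega> assume *: "(((continuous_on {t0..T} (\<lambda>t. X t \<omega>) \<and> (\<forall>t\<in>{t0..T}. norm (X t \<omega>) \<le> R)) \<and>
        (\<forall>s\<in>{t0..T}. \<forall>t\<in>{t0..T}. \<bar>s - t\<bar> < d1 \<longrightarrow> norm (X s \<omega> - X t \<omega>) \<le> \<epsilon> / 3)) \<and> norm (S \<omega>) \<le> \<epsilon> / 6) \<and> norm (euler_err m ?a \<omega>) \<le> \<epsilon> / 3"
      have XR: "norm (XX m (?a + q) \<omega>) \<le> R" if "q < n" for q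
        using * tt_in[of "?a + q" m] i_less[OF that] by (simp add: XX_def)
      have "(\<Sum>q<n. euler_incr f \<sigma> (tt m (?a + q)) (tt m (Suc (?a + q))) (XX m (?a + q) \<omega>) \<omega>)
          = (\<Sum>q<n. hh m (?a + q) *\<^sub>R drift f \<sigma> (XX m (?a + q) \<omega>)) + S \<omega>"
        unfolding S_def sum.distrib[symmetric] using XR by (intro sum.cong refl) (simp add: euler_incr_def hh_def L_def)
      then have eq: "euler_err m j \<omega> = euler_err m ?a \<omega> + (XX m j \<omega> - XX m ?a \<omega>)
          - (\<Sum>q<n. hh m (?a + q) *\<^sub>R drift f \<sigma> (XX m (?a + q) \<omega>)) - S \<omega>"
        unfolding euler_err_def jkn sum_lessThan_add by simp
      have "norm (\<Sum>q<n. hh m (?a + q) *\<^sub>R drift f \<sigma> (XX m (?a + q) \<omega>)) \<le> (\<Sum>q<n. A * hh m (?a + q))"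
      proof (rule sum_norm_le)
        fix q assume "q \<in> {..<n}"
        then have q: "q < n" by simp
        show "norm (hh m (?a + q) *\<^sub>R drift f \<sigma> (XX m (?a + q) \<omega>)) \<le> A * hh m (?a + q)"
          using A(2)[OF XR[OF q]] hh_pos[OF i_less[OF q]] by (simp add: mult.commute)
      qed
      also have "\<dots> = A * (\<Sum>q<n. hh m (?a + q))" by (simp add: sum_distrib_left)
      also have "\<dots> \<le> A * (len / 2 ^ l)" using A sum_h by (intro mult_left_mono) auto
      also have "\<dots> \<le> \<epsilon> / 6" by (rule h_small)
      finally have dr: "norm (\<Sum>q<n. hh m (?a + q) *\<^sub>R drift f \<sigma> (XX m (?a + q) \<omega>)) \<le> \<epsilon> / 6" .
      have "tt m j - tt m ?a = (\<Sum>q<n. hh m (?a + q))"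
        using sum_lessThan_add[of "hh m" ?a n] unfolding jkn[symmetric] sum_hh by simp
      moreover have "tt m ?a \<le> tt m j" using time_grid_mono[OF tt_grid, of ?a j m] j jkn by simp
      ultimately have "\<bar>tt m j - tt m ?a\<bar> < d1" using sum_h h_small(1) by simp
      then have "norm (XX m j \<omega> - XX m ?a \<omega>) \<le> \<epsilon> / 3"
        using * tt_in[OF j] tt_in[of ?a m] j jkn unfolding XX_def by simp
      moreover have "norm (a + b - c - s) \<le> norm a + norm b + norm c + norm s" for a b c s :: "real ^ 'p ^ 'n"
        by norm
      ultimately have "norm (euler_err m j \<omega>) \<le> \<epsilon> / 3 + \<epsilon> / 3 + \<epsilon> / 6 + \<epsilon> / 6"
        unfolding eq using conjunct2[OF *] conjunct2[OF conjunct1[OF *]] dr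
        by (meson add_mono order_trans)
      then show "norm (euler_err m j \<omega>) \<le> \<epsilon>" by simp
    qed simp
  qed
  then show ?thesis by (intro exI[of _ "l + r0"] allI impI)
qed

end

section \<open>Comparison of the scheme with the solution\<close>

text \<open>With a frozen state the Euler increment is additive in time. This lets a step of the
  scheme be split over the auxiliary fine grid.\<close>

lemma (in matrix_bm) sum_euler_incr:
  "(\<Sum>i<n. euler_incr f \<sigma> (u i) (u (Suc i)) x \<omega>) = euler_incr f \<sigma> (u 0) (u n) x \<omega>"
proof (induction n)
  case 0
  show ?case by (simp add: euler_incr_def)
next
  case (Suc n)
  have "pf x (a + b) = pf x a + pf x b" for a b by (rule linear_add[OF linear_pf])
  from this[of "B (u n) \<omega> - B (u 0) \<omega>" "B (u (Suc n)) \<omega> - B (u n) \<omega>"]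
  show ?case unfolding sum.lessThan_Suc Suc by (simp add: euler_incr_def algebra_simps)
qed

lemma (in matrix_bm) euler_incr_measurable:
  assumes f: "smooth f" and st: "0 \<le> s" "0 \<le> t" and Z: "Z \<in> borel_measurable M"
  shows "(\<lambda>\<omega>. euler_incr f \<sigma> s t (Z \<omega>) \<omega>) \<in> borel_measurable M"
  unfolding euler_incr_def using B_measurable[OF st(1)] B_measurable[OF st(2)]
  by (intro borel_measurable_add borel_measurable_scaleR loclip_measurable[OF loclip_drift[OF f] Z]
      pf_measurable Z borel_measurable_diff borel_measurable_const)

context sde_grid
begin

context
  fixes Y0 :: "'a \<Rightarrow> real ^ 'p ^ 'n" and R \<delta> :: real
  assumes Y0: "Y0 \<in> borel_measurable (F t0)" "\<And>\<omega>. Y0 \<omega> \<in> stiefel" "AE \<omega> in M. X t0 \<omega> = Y0 \<omega>"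
    and R: "sqrt CARD('p) \<le> R" and \<delta>: "\<And>i. i < K \<Longrightarrow> \<tau> (Suc i) - \<tau> i \<le> \<delta>"
begin

text \<open>The scheme as a step function on level \<open>m\<close>: index \<open>i\<close> belongs
  to step \<open>i div 2 ^ m\<close> of the original grid.\<close>

definition "Yc m i = cayley_scheme f \<sigma> \<tau> B Y0 (i div 2 ^ m)"
text \<open>Takes the place of a stopping time: it is known at node \<open>j\<close>, and the value
  1 there forces the value 1 at all earlier nodes.\<close>

definition "chi m j \<omega> = (if \<forall>i\<le>j. norm (XX m i \<omega>) \<le> R then 1 else 0 :: real)"
definition "dev m j \<omega> = (norm (XX m j \<omega> - Yc m j \<omega>))\<^sup>2"
text \<open>Each summand carries the indicator of its own node, so it stays adapted; where
  \<open>chi m j \<omega> = 1\<close> all these indicators are 1.\<close>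

definition "gap m j \<omega> = (\<Sum>i<j. chi m i \<omega> *\<^sub>R (euler_incr f \<sigma> (tt m i) (tt m (Suc i)) (XX m i \<omega>) \<omega>
    - euler_incr f \<sigma> (tt m i) (tt m (Suc i)) (Yc m i \<omega>) \<omega>))"
definition "scheme_err m j \<omega> = Y0 \<omega> + (\<Sum>i<j. euler_incr f \<sigma> (tt m i) (tt m (Suc i)) (Yc m i \<omega>) \<omega>) - Yc m j \<omega>"

lemma Yc_stiefel: "Yc m i \<omega> \<in> stiefel" unfolding Yc_def by (rule cayley_scheme_stiefel) (rule Y0)

lemma norm_Yc: "norm (Yc m i \<omega>) \<le> R" using norm_stiefel[OF Yc_stiefel, of m i \<omega>] R by simp

lemma Yc_F:
  assumes "i \<le> NN m" shows "Yc m i \<in> borel_measurable (F (tt m i))"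
proof (rule measurable_F_mono)
  have q: "i div 2 ^ m \<le> K" using div_le_mono[OF assms, of "2 ^ m"] by simp
  show "Yc m i \<in> borel_measurable (F (\<tau> (i div 2 ^ m)))"
    unfolding Yc_def by (rule cayley_scheme_measurable[OF f grid t0 Y0(1) q])
  have "tt m (i div 2 ^ m * 2 ^ m) \<le> tt m i" using assms by (intro time_grid_mono[OF tt_grid]) auto
  then show "\<tau> (i div 2 ^ m) \<le> tt m i" by (simp only: subgrid_mult)
qed

lemma chi_bounds: "0 \<le> chi m j \<omega>" "chi m j \<omega> \<le> 1" "chi m j \<omega> * chi m j \<omega> = chi m j \<omega>"
  by (auto simp: chi_def)

lemma chi_1: "chi m j \<omega> \<noteq> 0 \<Longrightarrow> i \<le> j \<Longrightarrow> norm (XX m i \<omega>) \<le> R \<and> chi m i \<omega> = 1"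
  by (auto simp: chi_def split: if_splits)

lemma chi_F:
  assumes "j \<le> NN m" shows "chi m j \<in> borel_measurable (F (tt m j))"
proof -
  have set: "{\<omega> \<in> space (F (tt m j)). \<forall>i\<in>{..j}. norm (XX m i \<omega>) \<le> R} \<in> sets (F (tt m j))"
  proof (rule sets.sets_Collect_finite_All)
    fix i assume "i \<in> {..j}"
    then have [measurable]: "XX m i \<in> borel_measurable (F (tt m j))" using assms by (intro XX_F_mono) auto
    show "{\<omega> \<in> space (F (tt m j)). norm (XX m i \<omega>) \<le> R} \<in> sets (F (tt m j))" by measurable
  qed simp
  have "(\<lambda>\<omega>. if \<forall>i\<in>{..j}. norm (XX m i \<omega>) \<le> R then 1 else 0 :: real) \<in> borel_measurable (F (tt m j))"
    by (rule measurable_If[OF _ _ set]) simp_all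
  then show ?thesis unfolding chi_def[abs_def] Ball_def atMost_iff .
qed

lemma dev_F:
  assumes "j \<le> NN m" shows "dev m j \<in> borel_measurable (F (tt m j))"
proof -
  note [measurable] = XX_F[OF assms] Yc_F[OF assms]
  show ?thesis unfolding dev_def[abs_def] by measurable
qed

lemma chi_dev_le: "chi m j \<omega> * dev m j \<omega> \<le> (2 * R)\<^sup>2"
proof (cases "chi m j \<omega> = 0")
  case False
  then have "norm (XX m j \<omega> - Yc m j \<omega>) \<le> 2 * R"
    using chi_1[OF False, of j] norm_Yc[of m j \<omega>] norm_triangle_ineq4[of "XX m j \<omega>" "Yc m j \<omega>"] by linarith
  then have "dev m j \<omega> \<le> (2 * R)\<^sup>2" unfolding dev_def by (rule power_mono) simp
  then show ?thesis using chi_1[OF False, of j] by (simp only: mult_1_left)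
qed (simp)

lemma chi_dev_integrable: "j \<le> NN m \<Longrightarrow> integrable M (\<lambda>\<omega>. chi m j \<omega> * dev m j \<omega>)"
proof (rule integrable_const_bound[of _ "(2 * R)\<^sup>2"])
  assume j: "j \<le> NN m"
  show "AE \<omega> in M. norm (chi m j \<omega> * dev m j \<omega>) \<le> (2 * R)\<^sup>2"
    using chi_dev_le chi_bounds by (intro AE_I2) (simp add: dev_def abs_mult)
  show "(\<lambda>\<omega>. chi m j \<omega> * dev m j \<omega>) \<in> borel_measurable M"
    by (intro borel_measurable_times measurable_F_M[OF chi_F[OF j]] measurable_F_M[OF dev_F[OF j]])
qed

text \<open>The drift part is treated by Cauchy-Schwarz in time and the noise part by
  \<open>linear_sum_L2\<close>, which gives the two summands of the constant. On the ball,
  \<open>drift\<close> is Lipschitz with constant \<open>La\<close> and \<open>pf\<close> with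
  constant \<open>2 * R\<close>.\<close>

lemma gap_bound:
  assumes La: "0 \<le> La" "\<And>x y. norm x \<le> R \<Longrightarrow> norm y \<le> R \<Longrightarrow> norm (drift f \<sigma> x - drift f \<sigma> y) \<le> La * norm (x - y)"
    and j: "j \<le> NN m"
  shows "integrable M (\<lambda>\<omega>. (norm (gap m j \<omega>))\<^sup>2)"
    and "expectation (\<lambda>\<omega>. (norm (gap m j \<omega>))\<^sup>2) \<le> (2 * len * La\<^sup>2 + 2 * (real (CARD('n) * CARD('p)))\<^sup>2 * (\<sigma> * (2 * R))\<^sup>2)
      * (\<Sum>i<j. hh m i * expectation (\<lambda>\<omega>. chi m i \<omega> * dev m i \<omega>))"
proof -
  let ?\<kappa> = "(real (CARD('n) * CARD('p)))\<^sup>2"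
  define S1 where "S1 \<omega> = (\<Sum>i<j. hh m i *\<^sub>R (chi m i \<omega> *\<^sub>R (drift f \<sigma> (XX m i \<omega>) - drift f \<sigma> (Yc m i \<omega>))))" for \<omega>
  define L where "L i \<omega> D = chi m i \<omega> *\<^sub>R (\<sigma> *\<^sub>R (pf (XX m i \<omega>) D - pf (Yc m i \<omega>) D))" for i \<omega> D
  define S2 where "S2 \<omega> = (\<Sum>i<j. L i \<omega> (B (tt m (Suc i)) \<omega> - B (tt m i) \<omega>))" for \<omega>
  define g where "g i \<omega> = \<bar>\<sigma>\<bar> * (2 * R) * (chi m i \<omega> * norm (XX m i \<omega> - Yc m i \<omega>))" for i \<omega>
  have gap: "gap m j \<omega> = S1 \<omega> + S2 \<omega>" for \<omega>
    unfolding gap_def S1_def S2_def L_def sum.distrib[symmetric]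
    by (intro sum.cong refl) (simp add: euler_incr_def hh_def algebra_simps)
  \<comment> \<open>The indicator is idempotent, so a single factor survives the squaring.\<close>
  have chidev: "(chi m i \<omega> * norm (XX m i \<omega> - Yc m i \<omega>))\<^sup>2 = chi m i \<omega> * dev m i \<omega>" for i \<omega>
    unfolding dev_def power_mult_distrib power2_eq_square[of "chi m i \<omega>"] chi_bounds(3) ..
  have g2: "(g i \<omega>)\<^sup>2 = (\<sigma> * (2 * R))\<^sup>2 * (chi m i \<omega> * dev m i \<omega>)" for i \<omega>
    unfolding g_def power_mult_distrib[of _ "chi m i \<omega> * norm (XX m i \<omega> - Yc m i \<omega>)"] chidev
    by (simp add: power_mult_distrib)
  have u: "0 \<le> tt m 0" "\<And>i. i < j \<Longrightarrow> tt m i < tt m (Suc i)" using t0 tt_less j by (auto simp: tt_0)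
  have lin: "linear (L i \<omega>)" for i \<omega>
    unfolding L_def by (intro linear_compose_scale_right linear_compose_sub linear_pf)
  have LF: "(\<lambda>\<omega>. L i \<omega> (unit_mat a b)) \<in> borel_measurable (F (tt m i))" if "i < j" for i a b
    unfolding L_def using that j
    by (intro borel_measurable_scaleR borel_measurable_diff borel_measurable_const chi_F
        loclip_measurable[OF loclip_pf XX_F] loclip_measurable[OF loclip_pf Yc_F]) auto
  have L_le: "norm (L i \<omega> D) \<le> g i \<omega> * norm D" for i \<omega> D
  proof (cases "chi m i \<omega> = 0")
    case False
    have "norm (pf (XX m i \<omega>) D - pf (Yc m i \<omega>) D) \<le> (norm (XX m i \<omega>) + norm (Yc m i \<omega>)) * norm (XX m i \<omega> - Yc m i \<omega>) * norm D"
      by (rule norm_pf_diff_le)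
    also have "\<dots> \<le> (R + R) * norm (XX m i \<omega> - Yc m i \<omega>) * norm D"
      using chi_1[OF False, of i] norm_Yc by (intro mult_right_mono add_mono) auto
    finally have "\<bar>\<sigma>\<bar> * norm (pf (XX m i \<omega>) D - pf (Yc m i \<omega>) D) \<le> \<bar>\<sigma>\<bar> * ((R + R) * norm (XX m i \<omega> - Yc m i \<omega>) * norm D)"
      by (rule mult_left_mono) simp
    moreover have "norm (L i \<omega> D) = \<bar>\<sigma>\<bar> * norm (pf (XX m i \<omega>) D - pf (Yc m i \<omega>) D)"
      using chi_1[OF False, of i] by (simp add: L_def)
    moreover have "g i \<omega> * norm D = \<bar>\<sigma>\<bar> * ((R + R) * norm (XX m i \<omega> - Yc m i \<omega>) * norm D)"
      using chi_1[OF False, of i] by (simp add: g_def)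
    ultimately show ?thesis by (simp only:)
  qed (simp add: L_def g_def)
  have gI: "integrable M (\<lambda>\<omega>. (g i \<omega>)\<^sup>2)" if "i < j" for i
    unfolding g2 using chi_dev_integrable[of i m] that j by (intro integrable_mult_right) simp
  note S2 = linear_sum_L2[where u="tt m" and N=j and L=L and g=g, OF u lin LF L_le gI S2_def]
  have S2E: "expectation (\<lambda>\<omega>. (norm (S2 \<omega>))\<^sup>2) \<le> ?\<kappa> * (\<sigma> * (2 * R))\<^sup>2 * (\<Sum>i<j. hh m i * expectation (\<lambda>\<omega>. chi m i \<omega> * dev m i \<omega>))"
  proof -
    have "expectation (\<lambda>\<omega>. (norm (S2 \<omega>))\<^sup>2) \<le> ?\<kappa> * (\<Sum>i<j. hh m i * ((\<sigma> * (2 * R))\<^sup>2 * expectation (\<lambda>\<omega>. chi m i \<omega> * dev m i \<omega>)))"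
      using S2(3) unfolding g2 hh_def integral_mult_right_zero .
    also have "\<dots> = ?\<kappa> * (\<sigma> * (2 * R))\<^sup>2 * (\<Sum>i<j. hh m i * expectation (\<lambda>\<omega>. chi m i \<omega> * dev m i \<omega>))"
      by (simp only: sum_distrib_left mult.assoc mult.left_commute)
    finally show ?thesis .
  qed
  have S1_le: "(norm (S1 \<omega>))\<^sup>2 \<le> len * La\<^sup>2 * (\<Sum>i<j. hh m i * (chi m i \<omega> * dev m i \<omega>))" for \<omega>
  proof -
    let ?v = "\<lambda>i. chi m i \<omega> *\<^sub>R (drift f \<sigma> (XX m i \<omega>) - drift f \<sigma> (Yc m i \<omega>))"
    have v: "(norm (?v i))\<^sup>2 \<le> La\<^sup>2 * (chi m i \<omega> * dev m i \<omega>)" for i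
    proof -
      have "norm (?v i) \<le> La * (chi m i \<omega> * norm (XX m i \<omega> - Yc m i \<omega>))"
      proof (cases "chi m i \<omega> = 0")
        case False
        then show ?thesis using chi_1[OF False, of i] La(2)[of "XX m i \<omega>" "Yc m i \<omega>"] norm_Yc by simp
      qed simp
      then have "(norm (?v i))\<^sup>2 \<le> (La * (chi m i \<omega> * norm (XX m i \<omega> - Yc m i \<omega>)))\<^sup>2" by (rule power_mono) simp
      then show ?thesis unfolding power_mult_distrib[of La] chidev .
    qed
    have "(norm (S1 \<omega>))\<^sup>2 \<le> (\<Sum>i<j. hh m i) * (\<Sum>i<j. hh m i * (norm (?v i))\<^sup>2)"
      unfolding S1_def using hh_pos j by (intro norm_sum_step_le) auto
    also have "\<dots> \<le> len * (\<Sum>i<j. hh m i * (La\<^sup>2 * (chi m i \<omega> * dev m i \<omega>)))"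
      using sum_hh_le[OF j] less_imp_le[OF hh_pos] j v len_pos
      by (intro mult_mono sum_mono mult_left_mono) (auto intro!: sum_nonneg mult_nonneg_nonneg)
    also have "\<dots> = len * La\<^sup>2 * (\<Sum>i<j. hh m i * (chi m i \<omega> * dev m i \<omega>))"
      by (simp only: sum_distrib_left mult.assoc mult.left_commute)
    finally show ?thesis .
  qed
  have sumI: "integrable M (\<lambda>\<omega>. \<Sum>i<j. hh m i * (chi m i \<omega> * dev m i \<omega>))"
    using chi_dev_integrable j by (intro Bochner_Integration.integrable_sum integrable_mult_right) auto
  have sumE: "expectation (\<lambda>\<omega>. \<Sum>i<j. hh m i * (chi m i \<omega> * dev m i \<omega>)) = (\<Sum>i<j. hh m i * expectation (\<lambda>\<omega>. chi m i \<omega> * dev m i \<omega>))"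
    using chi_dev_integrable j by (subst Bochner_Integration.integral_sum) auto
  have S1M: "S1 \<in> borel_measurable M"
    unfolding S1_def[abs_def]
    using j by (intro borel_measurable_sum borel_measurable_scaleR borel_measurable_const borel_measurable_diff
        measurable_F_M[OF chi_F] loclip_measurable[OF loclip_drift[OF f]] measurable_F_M[OF XX_F] measurable_F_M[OF Yc_F]) auto
  have tot_le: "(norm (gap m j \<omega>))\<^sup>2 \<le> 2 * (len * La\<^sup>2 * (\<Sum>i<j. hh m i * (chi m i \<omega> * dev m i \<omega>))) + 2 * (norm (S2 \<omega>))\<^sup>2" for \<omega>
    unfolding gap using norm_add_sq_le[of "S1 \<omega>" "S2 \<omega>"] S1_le[of \<omega>] by linarith
  have bI: "integrable M (\<lambda>\<omega>. 2 * (len * La\<^sup>2 * (\<Sum>i<j. hh m i * (chi m i \<omega> * dev m i \<omega>))) + 2 * (norm (S2 \<omega>))\<^sup>2)"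
    using sumI S2(2) by (intro Bochner_Integration.integrable_add integrable_mult_right)
  show I: "integrable M (\<lambda>\<omega>. (norm (gap m j \<omega>))\<^sup>2)"
  proof (rule integrable_dominated[OF bI])
    show "(\<lambda>\<omega>. (norm (gap m j \<omega>))\<^sup>2) \<in> borel_measurable M"
      unfolding gap using S1M measurable_F_M[OF S2(1)] by measurable
  qed (use tot_le in simp)
  have "expectation (\<lambda>\<omega>. (norm (gap m j \<omega>))\<^sup>2) \<le> expectation (\<lambda>\<omega>. 2 * (len * La\<^sup>2 * (\<Sum>i<j. hh m i * (chi m i \<omega> * dev m i \<omega>))) + 2 * (norm (S2 \<omega>))\<^sup>2)"
    by (intro integral_mono I bI tot_le)
  also have "\<dots> = 2 * (len * La\<^sup>2 * (\<Sum>i<j. hh m i * expectation (\<lambda>\<omega>. chi m i \<omega> * dev m i \<omega>))) + 2 * expectation (\<lambda>\<omega>. (norm (S2 \<omega>))\<^sup>2)"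
    using sumI S2(2) by (subst Bochner_Integration.integral_add) (simp_all add: sumE)
  also have "\<dots> \<le> 2 * (len * La\<^sup>2 * (\<Sum>i<j. hh m i * expectation (\<lambda>\<omega>. chi m i \<omega> * dev m i \<omega>)))
      + 2 * (?\<kappa> * (\<sigma> * (2 * R))\<^sup>2 * (\<Sum>i<j. hh m i * expectation (\<lambda>\<omega>. chi m i \<omega> * dev m i \<omega>)))"
    using S2E by simp
  finally show "expectation (\<lambda>\<omega>. (norm (gap m j \<omega>))\<^sup>2) \<le> (2 * len * La\<^sup>2 + 2 * ?\<kappa> * (\<sigma> * (2 * R))\<^sup>2)
      * (\<Sum>i<j. hh m i * expectation (\<lambda>\<omega>. chi m i \<omega> * dev m i \<omega>))"
    by (simp add: ring_distribs mult.assoc)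
qed

text \<open>The scheme is frozen during each coarse step, so the fine Euler increments collapse.
  What remains is one partial step and the defect at the last coarse node.\<close>

lemma scheme_err_eq:
  assumes n: "n < 2 ^ m"
  shows "scheme_err m (q * 2 ^ m + n) \<omega> = euler_incr f \<sigma> (\<tau> q) (tt m (q * 2 ^ m + n)) (cayley_scheme f \<sigma> \<tau> B Y0 q \<omega>) \<omega>
    - (cayley_scheme f \<sigma> \<tau> B Y0 q \<omega> - Y0 \<omega> - (\<Sum>l<q. euler_incr f \<sigma> (\<tau> l) (\<tau> (Suc l)) (cayley_scheme f \<sigma> \<tau> B Y0 l \<omega>) \<omega>))"
proof -
  let ?Y = "cayley_scheme f \<sigma> \<tau> B Y0"
  have blk: "(\<Sum>i<n'. euler_incr f \<sigma> (tt m (l * 2 ^ m + i)) (tt m (Suc (l * 2 ^ m + i))) (Yc m (l * 2 ^ m + i) \<omega>) \<omega>)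
      = euler_incr f \<sigma> (\<tau> l) (tt m (l * 2 ^ m + n')) (?Y l \<omega>) \<omega>" if "n' \<le> 2 ^ m" for l n'
  proof -
    have "(\<Sum>i<n'. euler_incr f \<sigma> (tt m (l * 2 ^ m + i)) (tt m (Suc (l * 2 ^ m + i))) (Yc m (l * 2 ^ m + i) \<omega>) \<omega>)
      = (\<Sum>i<n'. euler_incr f \<sigma> (tt m (l * 2 ^ m + i)) (tt m (l * 2 ^ m + Suc i)) (?Y l \<omega>) \<omega>)"
      using that by (intro sum.cong refl) (simp add: Yc_def)
    then show ?thesis using sum_euler_incr[of f \<sigma> "\<lambda>i. tt m (l * 2 ^ m + i)" "?Y l \<omega>" \<omega> n'] by (simp add: subgrid_mult)
  qed
  have "(\<Sum>i<q * 2 ^ m. euler_incr f \<sigma> (tt m i) (tt m (Suc i)) (Yc m i \<omega>) \<omega>)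
      = (\<Sum>l<q. euler_incr f \<sigma> (\<tau> l) (\<tau> (Suc l)) (?Y l \<omega>) \<omega>)"
    unfolding sum_blocks
  proof (intro sum.cong refl)
    fix l
    have "tt m (l * 2 ^ m + 2 ^ m) = \<tau> (Suc l)" using subgrid_mult[of \<tau> m "Suc l"] by (simp add: add.commute)
    then show "(\<Sum>i<2 ^ m. euler_incr f \<sigma> (tt m (l * 2 ^ m + i)) (tt m (Suc (l * 2 ^ m + i))) (Yc m (l * 2 ^ m + i) \<omega>) \<omega>)
      = euler_incr f \<sigma> (\<tau> l) (\<tau> (Suc l)) (?Y l \<omega>) \<omega>"
      using blk[of "2 ^ m" l] by simp
  qed
  moreover have "Yc m (q * 2 ^ m + n) = ?Y q" using n by (simp add: Yc_def)
  ultimately show ?thesis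
    unfolding scheme_err_def sum_lessThan_add using blk[of n q] n by simp
qed

text \<open>The partial step has length at most \<open>\<delta>\<close>, so its drift and noise have
  second moment of order \<open>\<delta>\<close>, just as the defect \<open>C * \<delta>\<close> at
  the coarse node.\<close>

lemma scheme_err_bound:
  assumes A: "\<And>x. norm x \<le> R \<Longrightarrow> norm (drift f \<sigma> x) \<le> A"
    and C: "0 \<le> C" "\<And>k. k \<le> K \<Longrightarrow> integrable M (\<lambda>\<omega>. (norm (cayley_scheme f \<sigma> \<tau> B Y0 k \<omega> - Y0 \<omega>
       - (\<Sum>l<k. euler_incr f \<sigma> (\<tau> l) (\<tau> (Suc l)) (cayley_scheme f \<sigma> \<tau> B Y0 l \<omega>) \<omega>)))\<^sup>2) \<and>
      expectation (\<lambda>\<omega>. (norm (cayley_scheme f \<sigma> \<tau> B Y0 k \<omega> - Y0 \<omega>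
       - (\<Sum>l<k. euler_incr f \<sigma> (\<tau> l) (\<tau> (Suc l)) (cayley_scheme f \<sigma> \<tau> B Y0 l \<omega>) \<omega>)))\<^sup>2) \<le> C * \<delta>"
    and j: "j \<le> NN m" and \<delta>0: "0 \<le> \<delta>"
  shows "integrable M (\<lambda>\<omega>. (norm (scheme_err m j \<omega>))\<^sup>2)"
    and "expectation (\<lambda>\<omega>. (norm (scheme_err m j \<omega>))\<^sup>2) \<le> (2 * C + 4 * (len * A\<^sup>2 + \<sigma>\<^sup>2 * (1 + R\<^sup>2)\<^sup>2 * mom (CARD('n) * CARD('p)) 1)) * \<delta>"
proof -
  let ?Y = "cayley_scheme f \<sigma> \<tau> B Y0" and ?m1 = "mom (CARD('n) * CARD('p)) 1"
  define q where "q = j div 2 ^ m"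
  define n where "n = j mod 2 ^ m"
  have jq: "j = q * 2 ^ m + n" by (simp only: q_def n_def div_mult_mod_eq)
  have n: "n < 2 ^ m" by (simp add: n_def)
  have q: "q \<le> K" unfolding q_def using div_le_mono[OF j, of "2 ^ m"] by simp
  define E1 where "E1 \<omega> = euler_incr f \<sigma> (\<tau> q) (tt m j) (?Y q \<omega>) \<omega>" for \<omega>
  define E2 where "E2 \<omega> = ?Y q \<omega> - Y0 \<omega> - (\<Sum>l<q. euler_incr f \<sigma> (\<tau> l) (\<tau> (Suc l)) (?Y l \<omega>) \<omega>)" for \<omega>
  have eq: "scheme_err m j \<omega> = E1 \<omega> - E2 \<omega>" for \<omega>
    using scheme_err_eq[OF n, of q \<omega>] unfolding jq[symmetric] E1_def E2_def .
  have E2: "integrable M (\<lambda>\<omega>. (norm (E2 \<omega>))\<^sup>2)" "expectation (\<lambda>\<omega>. (norm (E2 \<omega>))\<^sup>2) \<le> C * \<delta>"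
    using C(2)[OF q] unfolding E2_def by auto
  have YM: "?Y l \<in> borel_measurable M" if "l \<le> K" for l
    by (rule measurable_F_M[OF cayley_scheme_measurable[OF f grid t0 Y0(1) that]])
  have \<tau>0: "0 \<le> \<tau> l" if "l \<le> K" for l using time_grid_bounds[OF grid that] t0 by simp
  have E1M: "E1 \<in> borel_measurable M"
    unfolding E1_def[abs_def] by (intro euler_incr_measurable f \<tau>0 q tt_nonneg j YM)
  have E2M: "E2 \<in> borel_measurable M"
    unfolding E2_def[abs_def] using q
    by (intro borel_measurable_diff borel_measurable_sum euler_incr_measurable f \<tau>0 YM measurable_F_M[OF Y0(1)]) auto
  have E1: "integrable M (\<lambda>\<omega>. (norm (E1 \<omega>))\<^sup>2) \<and> expectation (\<lambda>\<omega>. (norm (E1 \<omega>))\<^sup>2) \<le> 2 * (len * A\<^sup>2 + \<sigma>\<^sup>2 * (1 + R\<^sup>2)\<^sup>2 * ?m1) * \<delta>"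
  proof (cases "n = 0")
    case True
    then have "tt m j = \<tau> q" unfolding jq by (simp add: subgrid_mult)
    then have "E1 \<omega> = 0" for \<omega> by (simp add: E1_def euler_incr_def)
    then show ?thesis using \<delta>0 len_pos by (simp add: mom_nonneg)
  next
    case False
    define h where "h = tt m j - \<tau> q"
    have qK: "q < K" using q j False unfolding jq by (cases "q = K") auto
    have "tt m (q * 2 ^ m) < tt m j"
      using qK tt_less[of "q * 2 ^ m" m] time_grid_mono[OF tt_grid, of "Suc (q * 2 ^ m)" j m] j False unfolding jq by simp
    then have h0: "0 < h" by (simp add: h_def subgrid_mult)
    have "tt m j \<le> \<tau> (Suc q)" unfolding jq using n by (intro subgrid_in_block(2)[OF grid qK]) simp
    then have h\<delta>: "h \<le> \<delta>" using \<delta>[OF qK] by (simp add: h_def)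
    have hl: "h \<le> len" using tt_in[OF j] time_grid_bounds[OF grid q] by (simp add: h_def len_def)
    let ?D = "\<lambda>\<omega>. B (tt m j) \<omega> - B (\<tau> q) \<omega>"
    have st: "0 \<le> \<tau> q" "\<tau> q < tt m j" using \<tau>0[OF q] h0 by (auto simp: h_def)
    have le: "(norm (E1 \<omega>))\<^sup>2 \<le> 2 * (h * A)\<^sup>2 + 2 * (\<sigma>\<^sup>2 * (1 + R\<^sup>2)\<^sup>2) * (norm (?D \<omega>))\<^sup>2" for \<omega>
    proof -
      have Yn: "norm (?Y q \<omega>) \<le> R" using norm_Yc[of m "q * 2 ^ m" \<omega>] by (simp add: Yc_def)
      have "norm (h *\<^sub>R drift f \<sigma> (?Y q \<omega>)) \<le> h * A" using h0 A[OF Yn] by (simp add: mult_left_mono)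
      then have 1: "(norm (h *\<^sub>R drift f \<sigma> (?Y q \<omega>)))\<^sup>2 \<le> (h * A)\<^sup>2" by (rule power_mono) simp
      have "norm (pf (?Y q \<omega>) (?D \<omega>)) \<le> (1 + (norm (?Y q \<omega>))\<^sup>2) * norm (?D \<omega>)" by (rule norm_pf_le)
      also have "\<dots> \<le> (1 + R\<^sup>2) * norm (?D \<omega>)" using Yn by (intro mult_right_mono add_mono power_mono) auto
      finally have "\<bar>\<sigma>\<bar> * norm (pf (?Y q \<omega>) (?D \<omega>)) \<le> \<bar>\<sigma>\<bar> * ((1 + R\<^sup>2) * norm (?D \<omega>))" by (rule mult_left_mono) simp
      then have "(norm (\<sigma> *\<^sub>R pf (?Y q \<omega>) (?D \<omega>)))\<^sup>2 \<le> (\<bar>\<sigma>\<bar> * ((1 + R\<^sup>2) * norm (?D \<omega>)))\<^sup>2" by (intro power_mono) auto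
      also have "\<dots> = \<sigma>\<^sup>2 * (1 + R\<^sup>2)\<^sup>2 * (norm (?D \<omega>))\<^sup>2" by (simp add: power_mult_distrib)
      finally have 2: "(norm (\<sigma> *\<^sub>R pf (?Y q \<omega>) (?D \<omega>)))\<^sup>2 \<le> \<sigma>\<^sup>2 * (1 + R\<^sup>2)\<^sup>2 * (norm (?D \<omega>))\<^sup>2" .
      show ?thesis
        using norm_add_sq_le[of "h *\<^sub>R drift f \<sigma> (?Y q \<omega>)" "\<sigma> *\<^sub>R pf (?Y q \<omega>) (?D \<omega>)"] 1 2
        by (simp add: E1_def euler_incr_def h_def)
    qed
    have DI: "integrable M (\<lambda>\<omega>. (norm (?D \<omega>))\<^sup>2)" and DE: "expectation (\<lambda>\<omega>. (norm (?D \<omega>))\<^sup>2) \<le> ?m1 * h"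
      using increment_moment[OF st, of 1] by (simp_all add: h_def)
    have bI: "integrable M (\<lambda>\<omega>. 2 * (h * A)\<^sup>2 + 2 * (\<sigma>\<^sup>2 * (1 + R\<^sup>2)\<^sup>2) * (norm (?D \<omega>))\<^sup>2)"
      by (intro Bochner_Integration.integrable_add integrable_mult_right DI integrable_const)
    have I: "integrable M (\<lambda>\<omega>. (norm (E1 \<omega>))\<^sup>2)"
      by (rule integrable_dominated[OF bI]) (use E1M le in auto)
    have "expectation (\<lambda>\<omega>. (norm (E1 \<omega>))\<^sup>2) \<le> expectation (\<lambda>\<omega>. 2 * (h * A)\<^sup>2 + 2 * (\<sigma>\<^sup>2 * (1 + R\<^sup>2)\<^sup>2) * (norm (?D \<omega>))\<^sup>2)"
      by (intro integral_mono I bI le)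
    also have "\<dots> = 2 * (h * A)\<^sup>2 + 2 * (\<sigma>\<^sup>2 * (1 + R\<^sup>2)\<^sup>2) * expectation (\<lambda>\<omega>. (norm (?D \<omega>))\<^sup>2)"
      using DI by (subst Bochner_Integration.integral_add) (simp_all add: prob_space)
    also have "\<dots> \<le> 2 * (len * \<delta> * A\<^sup>2) + 2 * (\<sigma>\<^sup>2 * (1 + R\<^sup>2)\<^sup>2) * (?m1 * \<delta>)"
    proof (intro add_mono mult_left_mono)
      have "(h * A)\<^sup>2 = h * h * A\<^sup>2" by (simp add: power2_eq_square)
      also have "\<dots> \<le> len * \<delta> * A\<^sup>2" using hl h\<delta> h0 by (intro mult_right_mono mult_mono) auto
      finally show "(h * A)\<^sup>2 \<le> len * \<delta> * A\<^sup>2" .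
      show "expectation (\<lambda>\<omega>. (norm (?D \<omega>))\<^sup>2) \<le> ?m1 * \<delta>"
        using DE mult_left_mono[OF h\<delta> mom_nonneg[of "CARD('n) * CARD('p)" 1]] by linarith
    qed auto
    finally show ?thesis using I by (simp add: algebra_simps)
  qed
  have le: "(norm (scheme_err m j \<omega>))\<^sup>2 \<le> 2 * (norm (E1 \<omega>))\<^sup>2 + 2 * (norm (E2 \<omega>))\<^sup>2" for \<omega>
    unfolding eq using norm_add_sq_le[of "E1 \<omega>" "- E2 \<omega>"] by simp
  have bI: "integrable M (\<lambda>\<omega>. 2 * (norm (E1 \<omega>))\<^sup>2 + 2 * (norm (E2 \<omega>))\<^sup>2)"
    using E1 E2 by (intro Bochner_Integration.integrable_add integrable_mult_right) auto
  show I: "integrable M (\<lambda>\<omega>. (norm (scheme_err m j \<omega>))\<^sup>2)"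
  proof (rule integrable_dominated[OF bI])
    show "(\<lambda>\<omega>. (norm (scheme_err m j \<omega>))\<^sup>2) \<in> borel_measurable M"
      unfolding eq using E1M E2M by measurable
  qed (use le in simp)
  have "expectation (\<lambda>\<omega>. (norm (scheme_err m j \<omega>))\<^sup>2) \<le> expectation (\<lambda>\<omega>. 2 * (norm (E1 \<omega>))\<^sup>2 + 2 * (norm (E2 \<omega>))\<^sup>2)"
    by (intro integral_mono I bI le)
  also have "\<dots> = 2 * expectation (\<lambda>\<omega>. (norm (E1 \<omega>))\<^sup>2) + 2 * expectation (\<lambda>\<omega>. (norm (E2 \<omega>))\<^sup>2)"
    using E1 E2 by (subst Bochner_Integration.integral_add) simp_all
  also have "\<dots> \<le> 2 * (2 * (len * A\<^sup>2 + \<sigma>\<^sup>2 * (1 + R\<^sup>2)\<^sup>2 * ?m1) * \<delta>) + 2 * (C * \<delta>)"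
    using E1 E2 by (intro add_mono mult_left_mono) auto
  finally show "expectation (\<lambda>\<omega>. (norm (scheme_err m j \<omega>))\<^sup>2) \<le> (2 * C + 4 * (len * A\<^sup>2 + \<sigma>\<^sup>2 * (1 + R\<^sup>2)\<^sup>2 * ?m1)) * \<delta>"
    by (simp add: algebra_simps)
qed

lemma euler_err_measurable:
  assumes j: "j \<le> NN m" shows "euler_err m j \<in> borel_measurable M"
proof -
  have XM: "XX m i \<in> borel_measurable M" if "i \<le> NN m" for i by (rule measurable_F_M[OF XX_F[OF that]])
  have "X t0 \<in> borel_measurable M" using tT by (intro X_measurable) simp
  then show ?thesis unfolding euler_err_def[abs_def] using j
    by (intro borel_measurable_diff borel_measurable_sum XM euler_incr_measurable f tt_nonneg) auto
qed

text \<open>As long as \<open>chi = 1\<close>, the difference \<open>X - Y\<close> is the sum of \<open>gap\<close>, the Euler defect of \<open>X\<close>, which vanishes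
  as the auxiliary grid is refined, and the defect of the scheme, which is of order \<open>\<delta>\<close> in mean square.\<close>

lemma stability_on_grid:
  assumes La: "0 \<le> La" "\<And>x y. norm x \<le> R \<Longrightarrow> norm y \<le> R \<Longrightarrow> norm (drift f \<sigma> x - drift f \<sigma> y) \<le> La * norm (x - y)"
    and A: "\<And>x. norm x \<le> R \<Longrightarrow> norm (drift f \<sigma> x) \<le> A"
    and C: "0 \<le> C" "\<And>k. k \<le> K \<Longrightarrow> integrable M (\<lambda>\<omega>. (norm (cayley_scheme f \<sigma> \<tau> B Y0 k \<omega> - Y0 \<omega>
       - (\<Sum>l<k. euler_incr f \<sigma> (\<tau> l) (\<tau> (Suc l)) (cayley_scheme f \<sigma> \<tau> B Y0 l \<omega>) \<omega>)))\<^sup>2) \<and>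
      expectation (\<lambda>\<omega>. (norm (cayley_scheme f \<sigma> \<tau> B Y0 k \<omega> - Y0 \<omega>
       - (\<Sum>l<k. euler_incr f \<sigma> (\<tau> l) (\<tau> (Suc l)) (cayley_scheme f \<sigma> \<tau> B Y0 l \<omega>) \<omega>)))\<^sup>2) \<le> C * \<delta>"
    and \<delta>0: "0 \<le> \<delta>" and k: "k \<le> K" and \<Omega>: "\<Omega> \<in> sets M" "AE \<omega> in M. \<omega> \<in> \<Omega> \<longrightarrow> (\<forall>s\<in>{t0..\<tau> k}. norm (X s \<omega>) \<le> R)"
  defines "c1 \<equiv> 2 * len * La\<^sup>2 + 2 * (real (CARD('n) * CARD('p)))\<^sup>2 * (\<sigma> * (2 * R))\<^sup>2"
    and "c2 \<equiv> 2 * C + 4 * (len * A\<^sup>2 + \<sigma>\<^sup>2 * (1 + R\<^sup>2)\<^sup>2 * mom (CARD('n) * CARD('p)) 1)"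
  shows "expectation (\<lambda>\<omega>. indicator \<Omega> \<omega> * (norm (X (\<tau> k) \<omega> - cayley_scheme f \<sigma> \<tau> B Y0 k \<omega>))\<^sup>2) \<le> 3 * c2 * exp (3 * c1 * len) * \<delta>"
\<comment> \<open>The constants \<open>c1\<close> and \<open>c2\<close> do not involve the level
  \<open>m\<close>, so \<open>m\<close> may be chosen after \<open>e\<close> and the Euler defect of
  the solution disappears into \<open>e\<close>.\<close>
proof (rule field_le_epsilon)
  fix e :: real assume e: "0 < e"
  have c1: "0 \<le> c1" using len_pos by (simp add: c1_def)
  have c2: "0 \<le> c2" using C(1) len_pos mom_nonneg[of "CARD('n) * CARD('p)" 1] by (simp add: c2_def)
  define \<zeta> where "\<zeta> = e / (3 * exp (3 * c1 * len))"
  have \<zeta>: "0 < \<zeta>" using e by (simp add: \<zeta>_def)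
  define R2 where "R2 = (2 * R)\<^sup>2"
  have R2: "0 \<le> R2" by (simp add: R2_def)
  define \<epsilon> where "\<epsilon> = sqrt (\<zeta> / 2)"
  define \<eta> where "\<eta> = \<zeta> / 2 / (R2 + 1)"
  have \<epsilon>: "0 < \<epsilon>" "\<epsilon>\<^sup>2 = \<zeta> / 2" and \<eta>: "0 < \<eta>" using \<zeta> R2 by (auto simp: \<epsilon>_def \<eta>_def)
  have R2\<eta>: "R2 * \<eta> \<le> \<zeta> / 2"
  proof -
    have "R2 * \<eta> \<le> (R2 + 1) * \<eta>" using \<eta> by simp
    also have "\<dots> = \<zeta> / 2" unfolding \<eta>_def
      by (rule nonzero_mult_div_cancel_left[of "R2 + 1" "\<zeta> / 2", unfolded times_divide_eq_right[symmetric]]) (use R2 in simp)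
    finally show ?thesis .
  qed
  from exc_euler_err[OF \<eta> \<epsilon>(1)] obtain m where "\<forall>m'\<ge>m. \<forall>j\<le>NN m'. exc M \<eta> (\<lambda>\<omega>. norm (euler_err m' j \<omega>) \<le> \<epsilon>)" ..
  then have m: "exc M \<eta> (\<lambda>\<omega>. norm (euler_err m j \<omega>) \<le> \<epsilon>)" if "j \<le> NN m" for j using that by simp
  \<comment> \<open>The Euler defect is small only in probability. Capping it at the bound for the
    truncated error loses nothing and makes its expectation small.\<close>
  define \<rho> where "\<rho> j \<omega> = min R2 ((norm (euler_err m j \<omega>))\<^sup>2)" for j \<omega>
  have \<rho>0: "0 \<le> \<rho> j \<omega>" "\<rho> j \<omega> \<le> R2" for j \<omega> using R2 by (auto simp: \<rho>_def)
  have \<rho>M: "\<rho> j \<in> borel_measurable M" if "j \<le> NN m" for j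
    unfolding \<rho>_def[abs_def] using euler_err_measurable[OF that] by measurable
  have \<rho>I: "integrable M (\<rho> j)" if "j \<le> NN m" for j
    by (rule integrable_const_bound[of _ R2]) (use \<rho>0 \<rho>M[OF that] in auto)
  have \<rho>E: "expectation (\<rho> j) \<le> \<zeta>" if j: "j \<le> NN m" for j
  proof -
    have "exc M \<eta> (\<lambda>\<omega>. \<rho> j \<omega> \<le> \<zeta> / 2)"
    proof (rule exc_mono[OF m[OF j] order_refl])
      fix \<omega> assume "norm (euler_err m j \<omega>) \<le> \<epsilon>"
      then have "(norm (euler_err m j \<omega>))\<^sup>2 \<le> \<epsilon>\<^sup>2" by (rule power_mono) simp
      then show "\<rho> j \<omega> \<le> \<zeta> / 2" unfolding \<epsilon>(2) by (simp add: \<rho>_def)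
    qed
    then have "expectation (\<rho> j) \<le> \<zeta> / 2 + R2 * \<eta>"
      by (rule exc_expectation) (use \<rho>0 \<rho>M[OF j] \<zeta> R2 in auto)
    then show ?thesis using R2\<eta> by simp
  qed
  define u where "u j = expectation (\<lambda>\<omega>. chi m j \<omega> * dev m j \<omega>)" for j
  have u_le: "u j \<le> (3 * \<zeta> + 3 * (c2 * \<delta>)) + 3 * c1 * (\<Sum>i<j. hh m i * u i)" if j: "j \<le> NN m" for j
  proof -
    note gI = gap_bound(1)[OF La j] and gE = gap_bound(2)[OF La j, folded c1_def u_def]
    note sI = scheme_err_bound(1)[OF A C j \<delta>0] and sE = scheme_err_bound(2)[OF A C j \<delta>0, folded c2_def]
    have bI: "integrable M (\<lambda>\<omega>. 3 * (norm (gap m j \<omega>))\<^sup>2 + 3 * \<rho> j \<omega> + 3 * (norm (scheme_err m j \<omega>))\<^sup>2)"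
      by (intro Bochner_Integration.integrable_add integrable_mult_right gI sI \<rho>I j)
    have "u j \<le> expectation (\<lambda>\<omega>. 3 * (norm (gap m j \<omega>))\<^sup>2 + 3 * \<rho> j \<omega> + 3 * (norm (scheme_err m j \<omega>))\<^sup>2)"
      unfolding u_def
    proof (rule integral_mono_AE[OF chi_dev_integrable[OF j] bI])
      show "AE \<omega> in M. chi m j \<omega> * dev m j \<omega> \<le> 3 * (norm (gap m j \<omega>))\<^sup>2 + 3 * \<rho> j \<omega> + 3 * (norm (scheme_err m j \<omega>))\<^sup>2"
        using Y0(3)
      proof eventually_elim
        case (elim \<omega>)
        show ?case
        proof (cases "chi m j \<omega> = 0")
          case True
          then show ?thesis using \<rho>0[of j \<omega>] by simp
        next
          case False
          note c = chi_1[OF False]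
          have "gap m j \<omega> = (\<Sum>i<j. euler_incr f \<sigma> (tt m i) (tt m (Suc i)) (XX m i \<omega>) \<omega>)
              - (\<Sum>i<j. euler_incr f \<sigma> (tt m i) (tt m (Suc i)) (Yc m i \<omega>) \<omega>)"
            unfolding gap_def sum_subtractf[symmetric] using c by (intro sum.cong refl) simp
          then have eq: "XX m j \<omega> - Yc m j \<omega> = gap m j \<omega> + euler_err m j \<omega> + scheme_err m j \<omega>"
            unfolding euler_err_def scheme_err_def elim by simp
          have le: "dev m j \<omega> \<le> 3 * (norm (gap m j \<omega>))\<^sup>2 + 3 * (norm (euler_err m j \<omega>))\<^sup>2 + 3 * (norm (scheme_err m j \<omega>))\<^sup>2"
            unfolding dev_def eq by (rule norm_add3_sq_le)
          have "dev m j \<omega> \<le> R2" using chi_dev_le[of m j \<omega>] c[OF order_refl] by (simp add: R2_def)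
          then have "dev m j \<omega> \<le> 3 * (norm (gap m j \<omega>))\<^sup>2 + 3 * \<rho> j \<omega> + 3 * (norm (scheme_err m j \<omega>))\<^sup>2"
          proof (cases "(norm (euler_err m j \<omega>))\<^sup>2 \<le> R2")
            case True
            then have "\<rho> j \<omega> = (norm (euler_err m j \<omega>))\<^sup>2" by (simp add: \<rho>_def)
            then show ?thesis using le by simp
          next
            case False
            \<comment> \<open>Where the cap is active, it alone already dominates the truncated
              error.\<close>
            then have "\<rho> j \<omega> = R2" by (simp add: \<rho>_def)
            then show ?thesis
              using \<open>dev m j \<omega> \<le> R2\<close> R2 zero_le_power2[of "norm (gap m j \<omega>)"] zero_le_power2[of "norm (scheme_err m j \<omega>)"]
              by linarith
          qed
          then show ?thesis using c[OF order_refl] by simp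
        qed
      qed
    qed
    also have "\<dots> = 3 * expectation (\<lambda>\<omega>. (norm (gap m j \<omega>))\<^sup>2) + 3 * expectation (\<rho> j) + 3 * expectation (\<lambda>\<omega>. (norm (scheme_err m j \<omega>))\<^sup>2)"
      using gI sI \<rho>I[OF j] by simp
    also have "\<dots> \<le> 3 * (c1 * (\<Sum>i<j. hh m i * u i)) + 3 * \<zeta> + 3 * (c2 * \<delta>)"
      by (intro add_mono mult_left_mono gE sE \<rho>E j) auto
    finally show ?thesis by simp
  qed
  define J where "J = k * 2 ^ m"
  have J: "J \<le> NN m" unfolding J_def using k by simp
  have tJ: "tt m J = \<tau> k" unfolding J_def by (rule subgrid_mult)
  have "u J \<le> (3 * \<zeta> + 3 * (c2 * \<delta>)) * exp (3 * c1 * (\<Sum>i<J. hh m i))"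
    by (rule discrete_gronwall[where N="NN m", OF u_le]) (use hh_pos c1 c2 \<zeta> \<delta>0 J in \<open>auto intro: less_imp_le\<close>)
  also have "\<dots> \<le> (3 * \<zeta> + 3 * (c2 * \<delta>)) * exp (3 * c1 * len)"
    using sum_hh_le[OF J] c1 c2 \<zeta> \<delta>0 by (intro mult_left_mono) (auto intro!: mult_left_mono)
  also have "\<dots> = 3 * c2 * exp (3 * c1 * len) * \<delta> + e" by (simp add: \<zeta>_def field_simps)
  finally have uJ: "u J \<le> 3 * c2 * exp (3 * c1 * len) * \<delta> + e" .
  have dev_eq: "dev m J \<omega> = (norm (X (\<tau> k) \<omega> - cayley_scheme f \<sigma> \<tau> B Y0 k \<omega>))\<^sup>2" for \<omega>
    unfolding dev_def XX_def tJ by (simp add: Yc_def J_def)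
  \<comment> \<open>On \<open>\<Omega>\<close> the indicator \<open>chi\<close> equals 1 at this
    node, so the expectation over \<open>\<Omega>\<close> is at most \<open>u J\<close>.\<close>
  have ae: "AE \<omega> in M. indicator \<Omega> \<omega> * dev m J \<omega> \<le> chi m J \<omega> * dev m J \<omega>"
    using \<Omega>(2)
  proof eventually_elim
    case (elim \<omega>)
    show ?case
    proof (cases "\<omega> \<in> \<Omega>")
      case True
      have "norm (XX m i \<omega>) \<le> R" if "i \<le> J" for i
        using elim True time_grid_mono[OF tt_grid that J] tt_in[of i m] that J unfolding XX_def tJ by auto
      then show ?thesis using True by (simp add: chi_def)
    next
      case False
      then show ?thesis using chi_bounds(1)[of m J \<omega>] by (simp add: dev_def)
    qed
  qed
  have "integrable M (\<lambda>\<omega>. indicator \<Omega> \<omega> * dev m J \<omega>)"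
  proof (rule Bochner_Integration.integrable_bound[OF chi_dev_integrable[OF J]])
    show "(\<lambda>\<omega>. indicator \<Omega> \<omega> * dev m J \<omega>) \<in> borel_measurable M"
      using \<Omega>(1) measurable_F_M[OF dev_F[OF J]] by measurable
    show "AE \<omega> in M. norm (indicator \<Omega> \<omega> * dev m J \<omega>) \<le> norm (chi m J \<omega> * dev m J \<omega>)"
      using ae by eventually_elim (auto simp: indicator_def dev_def)
  qed
  then have "expectation (\<lambda>\<omega>. indicator \<Omega> \<omega> * dev m J \<omega>) \<le> u J"
    unfolding u_def by (rule integral_mono_AE[OF _ chi_dev_integrable[OF J] ae])
  then show "expectation (\<lambda>\<omega>. indicator \<Omega> \<omega> * (norm (X (\<tau> k) \<omega> - cayley_scheme f \<sigma> \<tau> B Y0 k \<omega>))\<^sup>2) \<le> 3 * c2 * exp (3 * c1 * len) * \<delta> + e"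
    unfolding dev_eq using uJ by simp
qed

end

end

section \<open>Uniformity over all grids and removal of the truncation\<close>

context stiefel_sde
begin

text \<open>The constant is fixed before grid, node and event. The event \<open>\<Omega>\<close>
  makes the estimate usable while the solution is not yet known to be bounded.\<close>

lemma stability:
  assumes Y0: "Y0 \<in> borel_measurable (F t0)" "\<And>\<omega>. Y0 \<omega> \<in> stiefel" "AE \<omega> in M. X t0 \<omega> = Y0 \<omega>"
    and R: "sqrt CARD('p) \<le> R"
  shows "\<exists>C\<ge>0. \<forall>K \<tau> \<delta> k \<Omega>. time_grid t0 T K \<tau> \<longrightarrow> (\<forall>i<K. \<tau> (Suc i) - \<tau> i \<le> \<delta>) \<longrightarrow> k \<le> K \<longrightarrow> \<Omega> \<in> sets M \<longrightarrow>
    (AE \<omega> in M. \<omega> \<in> \<Omega> \<longrightarrow> (\<forall>s\<in>{t0..\<tau> k}. norm (X s \<omega>) \<le> R)) \<longrightarrow>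
    expectation (\<lambda>\<omega>. indicator \<Omega> \<omega> * (norm (X (\<tau> k) \<omega> - cayley_scheme f \<sigma> \<tau> B Y0 k \<omega>))\<^sup>2) \<le> C * \<delta>"
proof -
  obtain La where La: "0 \<le> La" "\<And>x y. norm x \<le> R \<Longrightarrow> norm y \<le> R \<Longrightarrow> norm (drift f \<sigma> x - drift f \<sigma> y) \<le> La * norm (x - y)"
    using loclipD[OF loclip_drift[OF f]] by metis
  obtain A where A: "0 \<le> A" "\<And>x. norm x \<le> R \<Longrightarrow> norm (drift f \<sigma> x) \<le> A"
    using loclip_bounded[OF loclip_drift[OF f]] by metis
  obtain C where C: "0 \<le> C" "\<And>K \<tau> \<delta> k. time_grid t0 T K \<tau> \<Longrightarrow> (\<And>i. i < K \<Longrightarrow> \<tau> (Suc i) - \<tau> i \<le> \<delta>) \<Longrightarrow> k \<le> K \<Longrightarrow>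
    integrable M (\<lambda>\<omega>. (norm (cayley_scheme f \<sigma> \<tau> B Y0 k \<omega> - Y0 \<omega>
       - (\<Sum>l<k. euler_incr f \<sigma> (\<tau> l) (\<tau> (Suc l)) (cayley_scheme f \<sigma> \<tau> B Y0 l \<omega>) \<omega>)))\<^sup>2) \<and>
    expectation (\<lambda>\<omega>. (norm (cayley_scheme f \<sigma> \<tau> B Y0 k \<omega> - Y0 \<omega>
       - (\<Sum>l<k. euler_incr f \<sigma> (\<tau> l) (\<tau> (Suc l)) (cayley_scheme f \<sigma> \<tau> B Y0 l \<omega>) \<omega>)))\<^sup>2) \<le> C * \<delta>"
    using scheme_defect[OF f t0 Y0(1,2), of T \<sigma>] by blast
  define c1 where "c1 = 2 * (T - t0) * La\<^sup>2 + 2 * (real (CARD('n) * CARD('p)))\<^sup>2 * (\<sigma> * (2 * R))\<^sup>2"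
  define c2 where "c2 = 2 * C + 4 * ((T - t0) * A\<^sup>2 + \<sigma>\<^sup>2 * (1 + R\<^sup>2)\<^sup>2 * mom (CARD('n) * CARD('p)) 1)"
  define C' where "C' = 3 * c2 * exp (3 * c1 * (T - t0))"
  have "0 \<le> c2" using C(1) tT mom_nonneg[of "CARD('n) * CARD('p)" 1] by (simp add: c2_def)
  then have C': "0 \<le> C'" by (simp add: C'_def)
  have "expectation (\<lambda>\<omega>. indicator \<Omega> \<omega> * (norm (X (\<tau> k) \<omega> - cayley_scheme f \<sigma> \<tau> B Y0 k \<omega>))\<^sup>2) \<le> C' * \<delta>"
    if grid: "time_grid t0 T K \<tau>" and step: "\<forall>i<K. \<tau> (Suc i) - \<tau> i \<le> \<delta>" and k: "k \<le> K" and \<Omega>: "\<Omega> \<in> sets M"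
      "AE \<omega> in M. \<omega> \<in> \<Omega> \<longrightarrow> (\<forall>s\<in>{t0..\<tau> k}. norm (X s \<omega>) \<le> R)" for K \<tau> \<delta> k \<Omega>
  proof -
    interpret sde_grid M F B f \<sigma> t0 T X K \<tau> by unfold_locales (rule grid)
    have "K \<noteq> 0" using grid tT unfolding time_grid_def by (metis less_irrefl)
    then have \<delta>: "0 \<le> \<delta>" using step[rule_format, of 0] time_grid_step[OF grid, of 0] by simp
    have st: "\<tau> (Suc i) - \<tau> i \<le> \<delta>" if "i < K" for i using step that by simp
    show ?thesis
      using stability_on_grid[OF Y0 R st La A(2) C(1) C(2)[OF grid st] \<delta> k \<Omega>]
      unfolding C'_def c1_def c2_def len_def by simp
  qed
  then show ?thesis using C' by (intro exI[of _ C'] conjI allI impI)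
qed

text \<open>The scheme has to start on the manifold at every sample point. A case distinction on
  \<open>X t0\<close> itself, rather than on a null set, keeps measurability with respect to
  \<open>F t0\<close>, which need not contain the null sets.\<close>

lemma initial_value_version:
  assumes X0: "AE \<omega> in M. X t0 \<omega> \<in> stiefel"
  obtains Y0 where "Y0 \<in> borel_measurable (F t0)" "\<And>\<omega>. Y0 \<omega> \<in> stiefel" "AE \<omega> in M. X t0 \<omega> = Y0 \<omega>"
proof -
  \<comment> \<open>Falsehood is not almost sure in a probability space, so \<open>X t0\<close>
    meets the manifold somewhere.\<close>
  obtain y :: "real ^ 'p ^ 'n" where y: "y \<in> stiefel"
  proof (rule ccontr)
    assume "\<not> thesis"
    then have "\<And>\<omega>. X t0 \<omega> \<notin> stiefel" using that by blast
    then have "AE \<omega> in M. False" using X0 by simp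
    then show False by simp
  qed
  have cl: "closed (stiefel :: (real ^ 'p ^ 'n) set)"
  proof -
    have "continuous_on UNIV (\<lambda>X :: real ^ 'p ^ 'n. transpose X ** X)"
      by (rule loclip_continuous) (intro loclip_intros)
    then show ?thesis unfolding stiefel_def by (intro closed_Collect_eq continuous_on_const)
  qed
  define Y0 where "Y0 \<omega> = (if X t0 \<omega> \<in> stiefel then X t0 \<omega> else y)" for \<omega>
  have [measurable]: "X t0 \<in> borel_measurable (F t0)" using tT by (intro X_measurable_F) simp
  have [measurable]: "(stiefel :: (real ^ 'p ^ 'n) set) \<in> sets borel" using cl by simp
  have "Y0 \<in> borel_measurable (F t0)" unfolding Y0_def[abs_def] by measurable
  moreover have "Y0 \<omega> \<in> stiefel" for \<omega> using y by (simp add: Y0_def)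
  moreover have "AE \<omega> in M. X t0 \<omega> = Y0 \<omega>" using X0 by eventually_elim (simp add: Y0_def)
  ultimately show ?thesis by (rule that)
qed

text \<open>The scheme lives on the Stiefel manifold, so the stability estimate forces the solution to stay there as
  long as it is bounded by \<open>R\<close>.\<close>

lemma solution_on_stiefel:
  assumes X0: "AE \<omega> in M. X t0 \<omega> \<in> stiefel" and R: "sqrt CARD('p) \<le> R" and t: "t0 < t" "t < T"
  shows "AE \<omega> in M. (\<forall>s\<in>\<rat> \<inter> {t0<..<t}. norm (X s \<omega>) \<le> R) \<longrightarrow> norm (X t \<omega>) = sqrt CARD('p)"
proof -
  obtain Y0 where Y0: "Y0 \<in> borel_measurable (F t0)" "\<And>\<omega>. Y0 \<omega> \<in> stiefel" "AE \<omega> in M. X t0 \<omega> = Y0 \<omega>"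
    using initial_value_version[OF X0] by metis
  from stability[OF Y0 R] obtain C where C: "0 \<le> C" "\<forall>K \<tau> \<delta> k \<Omega>. time_grid t0 T K \<tau> \<longrightarrow> (\<forall>i<K. \<tau> (Suc i) - \<tau> i \<le> \<delta>) \<longrightarrow> k \<le> K \<longrightarrow> \<Omega> \<in> sets M \<longrightarrow>
    (AE \<omega> in M. \<omega> \<in> \<Omega> \<longrightarrow> (\<forall>s\<in>{t0..\<tau> k}. norm (X s \<omega>) \<le> R)) \<longrightarrow>
    expectation (\<lambda>\<omega>. indicator \<Omega> \<omega> * (norm (X (\<tau> k) \<omega> - cayley_scheme f \<sigma> \<tau> B Y0 k \<omega>))\<^sup>2) \<le> C * \<delta>"
    by (elim exE conjE)
  have R0: "0 \<le> R" by (rule order_trans[OF _ R]) simp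
  \<comment> \<open>Rational times make the event measurable; by continuity it means, up to a null
    set, that the path stays in the ball on \<open>{t0..t}\<close>.\<close>
  define \<Omega> where "\<Omega> = {\<omega> \<in> space M. \<forall>s\<in>\<rat> \<inter> {t0<..<t}. norm (X s \<omega>) \<le> R}"
  have \<Omega>M: "\<Omega> \<in> sets M"
    unfolding \<Omega>_def
  proof (rule sets.sets_Collect_countable_All')
    show "countable (\<rat> \<inter> {t0<..<t})" by (rule countable_subset[OF _ countable_rat]) auto
    fix s assume "s \<in> \<rat> \<inter> {t0<..<t}"
    then have [measurable]: "X s \<in> borel_measurable M" using t by (intro X_measurable) auto
    show "{\<omega> \<in> space M. norm (X s \<omega>) \<le> R} \<in> sets M" by measurable
  qed
  have bd: "AE \<omega> in M. \<omega> \<in> \<Omega> \<longrightarrow> (\<forall>s\<in>{t0..t}. norm (X s \<omega>) \<le> R)"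
    using X_continuous
  proof eventually_elim
    case (elim \<omega>)
    have "continuous_on {t0..t} (\<lambda>s. norm (X s \<omega>))"
      using t by (intro continuous_on_norm continuous_on_subset[OF elim]) auto
    then show ?case using le_on_interval_from_rats[of t0 t "\<lambda>s. norm (X s \<omega>)" R] t by (simp add: \<Omega>_def)
  qed
  \<comment> \<open>The coarsest grid with node \<open>t\<close>. Its refinement of order
    \<open>l\<close> has \<open>t\<close> at index \<open>2 ^ l\<close> and steps of at most
    \<open>(T - t0) / 2 ^ l\<close>.\<close>
  define \<tau> :: "nat \<Rightarrow> real" where "\<tau> i = (if i = 0 then t0 else if i = 1 then t else T)" for i
  have grid: "time_grid t0 T 2 \<tau>" using t by (auto simp: time_grid_def \<tau>_def less_2_cases_iff)
  have step: "\<tau> (Suc i) - \<tau> i \<le> T - t0" if "i < 2" for i using t that by (auto simp: \<tau>_def less_2_cases_iff)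
  define V where "V \<omega> = indicator \<Omega> \<omega> * (norm (transpose (X t \<omega>) ** X t \<omega> - mat 1))\<^sup>2" for \<omega>
  have XtM: "X t \<in> borel_measurable M" using t by (intro X_measurable) simp
  have VM: "V \<in> borel_measurable M"
  proof -
    have "loclip (\<lambda>X :: real ^ 'p ^ 'n. transpose X ** X - mat 1)" by (intro loclip_intros)
    from loclip_measurable[OF this XtM]
    have [measurable]: "(\<lambda>\<omega>. transpose (X t \<omega>) ** X t \<omega> - mat 1) \<in> borel_measurable M" .
    note [measurable] = \<Omega>M
    show ?thesis unfolding V_def[abs_def] by measurable
  qed
  have V0: "0 \<le> V \<omega>" for \<omega> by (simp add: V_def)
  \<comment> \<open>The expression inside \<open>V\<close> vanishes on the manifold and is Lipschitz
    with constant \<open>2 * R\<close> on the ball, so it is controlled by the distance to the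
    scheme. \<open>V\<close> does not involve \<open>l\<close>, hence its expectation is 0.\<close>
  have EV: "integrable M V \<and> expectation V \<le> ((2 * R)\<^sup>2 * C * (T - t0)) / 2 ^ l" for l
  proof -
    let ?Y = "cayley_scheme f \<sigma> (subgrid \<tau> l) B Y0 (2 ^ l)"
    have tl: "subgrid \<tau> l (2 ^ l) = t" using subgrid_mult[of \<tau> l 1] by (simp add: \<tau>_def)
    have gl: "time_grid t0 T (2 * 2 ^ l) (subgrid \<tau> l)" by (rule time_grid_subgrid[OF grid])
    have st: "\<forall>i<2 * 2 ^ l. subgrid \<tau> l (Suc i) - subgrid \<tau> l i \<le> (T - t0) / 2 ^ l"
      using subgrid_step_le[OF grid step] by blast
    have E: "expectation (\<lambda>\<omega>. indicator \<Omega> \<omega> * (norm (X t \<omega> - ?Y \<omega>))\<^sup>2) \<le> C * ((T - t0) / 2 ^ l)"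
      using C(2)[rule_format, OF gl, of "(T - t0) / 2 ^ l" "2 ^ l" \<Omega>] st \<Omega>M bd unfolding tl by simp
    have YS: "?Y \<omega> \<in> stiefel" for \<omega> by (rule cayley_scheme_stiefel) (rule Y0)
    have Yn: "norm (?Y \<omega>) \<le> R" for \<omega> using norm_stiefel[OF YS, of \<omega>] R by simp
    have YM: "?Y \<in> borel_measurable M"
      by (rule measurable_F_M[OF cayley_scheme_measurable[OF f gl t0 Y0(1)]]) simp
    have WM: "(\<lambda>\<omega>. indicator \<Omega> \<omega> * (norm (X t \<omega> - ?Y \<omega>))\<^sup>2) \<in> borel_measurable M"
      using XtM YM \<Omega>M by measurable
    have aeW: "AE \<omega> in M. norm (indicator \<Omega> \<omega> * (norm (X t \<omega> - ?Y \<omega>))\<^sup>2) \<le> (2 * R)\<^sup>2"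
      using bd
    proof eventually_elim
      case (elim \<omega>)
      show ?case
      proof (cases "\<omega> \<in> \<Omega>")
        case True
        then have "norm (X t \<omega>) \<le> R" using elim t by simp
        then have "norm (X t \<omega> - ?Y \<omega>) \<le> 2 * R" using Yn[of \<omega>] norm_triangle_ineq4[of "X t \<omega>" "?Y \<omega>"] by linarith
        then have "(norm (X t \<omega> - ?Y \<omega>))\<^sup>2 \<le> (2 * R)\<^sup>2" by (rule power_mono) simp
        then show ?thesis using True by simp
      qed simp
    qed
    have WI: "integrable M (\<lambda>\<omega>. indicator \<Omega> \<omega> * (norm (X t \<omega> - ?Y \<omega>))\<^sup>2)"
      by (rule integrable_const_bound[OF aeW WM])
    have ae: "AE \<omega> in M. V \<omega> \<le> (2 * R)\<^sup>2 * (indicator \<Omega> \<omega> * (norm (X t \<omega> - ?Y \<omega>))\<^sup>2)"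
      using bd
    proof eventually_elim
      case (elim \<omega>)
      show ?case
      proof (cases "\<omega> \<in> \<Omega>")
        case True
        then have Xn: "norm (X t \<omega>) \<le> R" using elim t by simp
        have eq: "transpose (X t \<omega>) ** X t \<omega> - mat 1 = transpose (X t \<omega>) ** (X t \<omega> - ?Y \<omega>) + transpose (X t \<omega> - ?Y \<omega>) ** ?Y \<omega>"
          using stiefelD[OF YS, of \<omega>] by (simp add: transpose_simps matrix_ring_simps)
        have "norm (transpose (X t \<omega>) ** X t \<omega> - mat 1) \<le> norm (X t \<omega>) * norm (X t \<omega> - ?Y \<omega>) + norm (X t \<omega> - ?Y \<omega>) * norm (?Y \<omega>)"
          unfolding eq using norm_triangle_ineq[of "transpose (X t \<omega>) ** (X t \<omega> - ?Y \<omega>)" "transpose (X t \<omega> - ?Y \<omega>) ** ?Y \<omega>"]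
            norm_matrix_mult_le[of "transpose (X t \<omega>)" "X t \<omega> - ?Y \<omega>"] norm_matrix_mult_le[of "transpose (X t \<omega> - ?Y \<omega>)" "?Y \<omega>"]
          unfolding norm_transpose by linarith
        also have "\<dots> \<le> R * norm (X t \<omega> - ?Y \<omega>) + norm (X t \<omega> - ?Y \<omega>) * R"
          by (rule add_mono[OF mult_right_mono[OF Xn norm_ge_zero] mult_left_mono[OF Yn norm_ge_zero]])
        also have "\<dots> = (2 * R) * norm (X t \<omega> - ?Y \<omega>)" by algebra
        finally have "norm (transpose (X t \<omega>) ** X t \<omega> - mat 1) \<le> (2 * R) * norm (X t \<omega> - ?Y \<omega>)" .
        then have "(norm (transpose (X t \<omega>) ** X t \<omega> - mat 1))\<^sup>2 \<le> ((2 * R) * norm (X t \<omega> - ?Y \<omega>))\<^sup>2" by (rule power_mono) simp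
        then show ?thesis using True by (simp add: V_def power_mult_distrib)
      qed (simp add: V_def)
    qed
    have VI: "integrable M V"
    proof (rule Bochner_Integration.integrable_bound[OF integrable_mult_right[OF WI, of "(2 * R)\<^sup>2"] VM])
      show "AE \<omega> in M. norm (V \<omega>) \<le> norm ((2 * R)\<^sup>2 * (indicator \<Omega> \<omega> * (norm (X t \<omega> - ?Y \<omega>))\<^sup>2))"
        using ae by eventually_elim (use V0 in simp)
    qed
    have "expectation V \<le> expectation (\<lambda>\<omega>. (2 * R)\<^sup>2 * (indicator \<Omega> \<omega> * (norm (X t \<omega> - ?Y \<omega>))\<^sup>2))"
      by (rule integral_mono_AE[OF VI integrable_mult_right[OF WI] ae])
    also have "\<dots> \<le> (2 * R)\<^sup>2 * (C * ((T - t0) / 2 ^ l))"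
      unfolding integral_mult_right_zero by (intro mult_left_mono E) simp
    finally show ?thesis using VI by simp
  qed
  have "(\<lambda>l. ((2 * R)\<^sup>2 * C * (T - t0)) / 2 ^ l) \<longlonglongrightarrow> 0"
    by (rule LIMSEQ_divide_realpow_zero) simp
  then have "expectation V \<le> 0" using EV by (intro LIMSEQ_le_const) auto
  then have "expectation V = 0" using V0 by (intro antisym Bochner_Integration.integral_nonneg)
  then have "AE \<omega> in M. V \<omega> = 0" using EV V0 by (subst (asm) integral_nonneg_eq_0_iff_AE) auto
  then show ?thesis
    using AE_space
  proof eventually_elim
    case (elim \<omega>)
    show ?case
    proof
      assume "\<forall>s\<in>\<rat> \<inter> {t0<..<t}. norm (X s \<omega>) \<le> R"
      then have "\<omega> \<in> \<Omega>" using elim by (simp add: \<Omega>_def)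
      then have "transpose (X t \<omega>) ** X t \<omega> = mat 1" using elim by (simp add: V_def)
      then have "X t \<omega> \<in> stiefel" by (simp add: stiefel_def)
      then show "norm (X t \<omega>) = sqrt CARD('p)" by (rule norm_stiefel)
    qed
  qed
qed

text \<open>A continuity argument. Before the first time \<open>a\<close> at which \<open>x\<close>
  reaches \<open>R\<close>, the return hypothesis yields \<open>x t \<le> r\<close> at rational
  times, so \<open>x a \<le> r\<close> by continuity, contrary to \<open>r < R\<close>. Rational
  times are used because the hypothesis will come from countably many almost sure
  statements.\<close>

lemma bounded_if_returns:
  fixes x :: "real \<Rightarrow> real"
  assumes cont: "continuous_on {t0..T} x" and x0: "x t0 \<le> r" and r: "r < R"
    and ret: "\<And>t. t \<in> \<rat> \<inter> {t0<..<T} \<Longrightarrow> (\<forall>s\<in>\<rat> \<inter> {t0<..<t}. x s \<le> R) \<Longrightarrow> x t \<le> r"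
    and s: "s \<in> {t0..T}"
  shows "x s \<le> R"
proof (rule ccontr)
  assume "\<not> x s \<le> R"
  define S where "S = {s \<in> {t0..T}. R \<le> x s}"
  have "s \<in> S" using s \<open>\<not> x s \<le> R\<close> by (simp add: S_def)
  have "closed S" unfolding S_def by (intro continuous_on_closed_Collect_le continuous_on_const cont) simp
  moreover have bb: "bdd_below S" by (rule bdd_belowI[of _ t0]) (simp add: S_def)
  ultimately have a: "Inf S \<in> S" using \<open>s \<in> S\<close> by (intro closed_contains_Inf) auto
  define a where "a = Inf S"
  have aS: "a \<in> {t0..T}" "R \<le> x a" using a by (auto simp: S_def a_def)
  have "a \<noteq> t0" using x0 r aS by auto
  then have a0: "t0 < a" using aS by simp
  have below: "x t < R" if "t0 \<le> t" "t < a" for t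
  proof (rule ccontr)
    assume "\<not> x t < R"
    then have "t \<in> S" using that aS by (simp add: S_def)
    then have "a \<le> t" unfolding a_def by (rule cInf_lower[OF _ bb])
    then show False using that by simp
  qed
  have "x a \<le> r"
  proof (rule le_on_interval_from_rats[of t0 a x r a])
    show "continuous_on {t0..a} x" using aS by (intro continuous_on_subset[OF cont]) auto
    fix t assume t: "t \<in> \<rat> \<inter> {t0<..<a}"
    show "x t \<le> r"
    proof (rule ret)
      show "t \<in> \<rat> \<inter> {t0<..<T}" using t aS by auto
      show "\<forall>s\<in>\<rat> \<inter> {t0<..<t}. x s \<le> R" using below t by (auto intro!: less_imp_le)
    qed
  qed (use a0 in auto)
  then show False using aS r by simp
qed

text \<open>The summand 1 creates the gap between the norm on the manifold and the truncation radius
  that \<open>bounded_if_returns\<close> exploits.\<close>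

lemma solution_bounded:
  assumes X0: "AE \<omega> in M. X t0 \<omega> \<in> stiefel"
  shows "AE \<omega> in M. \<forall>s\<in>{t0..T}. norm (X s \<omega>) \<le> sqrt CARD('p) + 1"
proof -
  let ?r = "sqrt CARD('p)"
  have "AE \<omega> in M. \<forall>t\<in>\<rat> \<inter> {t0<..<T}. (\<forall>s\<in>\<rat> \<inter> {t0<..<t}. norm (X s \<omega>) \<le> ?r + 1) \<longrightarrow> norm (X t \<omega>) = ?r"
  proof (rule AE_ball_countable[THEN iffD2])
    show "countable (\<rat> \<inter> {t0<..<T})" by (rule countable_subset[OF _ countable_rat]) auto
    show "\<forall>t\<in>\<rat> \<inter> {t0<..<T}. AE \<omega> in M. (\<forall>s\<in>\<rat> \<inter> {t0<..<t}. norm (X s \<omega>) \<le> ?r + 1) \<longrightarrow> norm (X t \<omega>) = ?r"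
      by (intro ballI solution_on_stiefel[OF X0]) auto
  qed
  then show ?thesis
    using X_continuous X0
  proof eventually_elim
    case (elim \<omega>)
    show ?case
    proof
      fix s assume s: "s \<in> {t0..T}"
      show "norm (X s \<omega>) \<le> ?r + 1"
      proof (rule bounded_if_returns[of "\<lambda>s. norm (X s \<omega>)" ?r])
        show "continuous_on {t0..T} (\<lambda>s. norm (X s \<omega>))" using elim by (intro continuous_on_norm)
      qed (use elim norm_stiefel[OF elim(3)] s in auto)
    qed
  qed
qed

text \<open>The solution is now bounded almost surely, so \<open>\<Omega>\<close> can be the whole
  space and truncation disappears. The schemes started from \<open>X t0\<close> and from its version
  \<open>Y0\<close> agree almost surely.\<close>

lemma strong_convergence:
  assumes X0: "AE \<omega> in M. X t0 \<omega> \<in> stiefel"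
  shows "\<exists>C>0. \<forall>K \<tau>. time_grid t0 T K \<tau> \<longrightarrow>
      integrable M (\<lambda>\<omega>. (norm2 (X T \<omega> - cayley_scheme f \<sigma> \<tau> B (X t0) K \<omega>))\<^sup>2) \<and>
      expectation (\<lambda>\<omega>. (norm2 (X T \<omega> - cayley_scheme f \<sigma> \<tau> B (X t0) K \<omega>))\<^sup>2) \<le> C * mesh K \<tau>"
proof -
  define R where "R = sqrt CARD('p) + 1"
  have R: "sqrt CARD('p) \<le> R" by (simp add: R_def)
  obtain Y0 where Y0: "Y0 \<in> borel_measurable (F t0)" "\<And>\<omega>. Y0 \<omega> \<in> stiefel" "AE \<omega> in M. X t0 \<omega> = Y0 \<omega>"
    using initial_value_version[OF X0] by metis
  from stability[OF Y0 R] obtain C where C: "0 \<le> C" "\<forall>K \<tau> \<delta> k \<Omega>. time_grid t0 T K \<tau> \<longrightarrow> (\<forall>i<K. \<tau> (Suc i) - \<tau> i \<le> \<delta>) \<longrightarrow> k \<le> K \<longrightarrow> \<Omega> \<in> sets M \<longrightarrow>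
    (AE \<omega> in M. \<omega> \<in> \<Omega> \<longrightarrow> (\<forall>s\<in>{t0..\<tau> k}. norm (X s \<omega>) \<le> R)) \<longrightarrow>
    expectation (\<lambda>\<omega>. indicator \<Omega> \<omega> * (norm (X (\<tau> k) \<omega> - cayley_scheme f \<sigma> \<tau> B Y0 k \<omega>))\<^sup>2) \<le> C * \<delta>"
    by (elim exE conjE)
  have bd: "AE \<omega> in M. \<forall>s\<in>{t0..T}. norm (X s \<omega>) \<le> R"
    unfolding R_def by (rule solution_bounded[OF X0])
  have XTM: "X T \<in> borel_measurable M" and X0M: "X t0 \<in> borel_measurable (F t0)"
    using tT by (auto intro: X_measurable X_measurable_F)
  have "integrable M (\<lambda>\<omega>. (norm2 (X T \<omega> - cayley_scheme f \<sigma> \<tau> B (X t0) K \<omega>))\<^sup>2) \<and>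
      expectation (\<lambda>\<omega>. (norm2 (X T \<omega> - cayley_scheme f \<sigma> \<tau> B (X t0) K \<omega>))\<^sup>2) \<le> (C + 1) * mesh K \<tau>"
    if grid: "time_grid t0 T K \<tau>" for K \<tau>
  proof -
    let ?Y = "cayley_scheme f \<sigma> \<tau> B Y0 K" and ?Z = "cayley_scheme f \<sigma> \<tau> B (X t0) K"
    have TK: "\<tau> K = T" using grid by (simp add: time_grid_def)
    have step: "\<forall>i<K. \<tau> (Suc i) - \<tau> i \<le> mesh K \<tau>" using step_le_mesh by blast
    have mesh0: "0 \<le> mesh K \<tau>" unfolding mesh_def by (rule Max_ge) auto
    have "AE \<omega> in M. \<omega> \<in> space M \<longrightarrow> (\<forall>s\<in>{t0..\<tau> K}. norm (X s \<omega>) \<le> R)" unfolding TK using bd by eventually_elim simp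
    then have "expectation (\<lambda>\<omega>. indicator (space M) \<omega> * (norm (X (\<tau> K) \<omega> - ?Y \<omega>))\<^sup>2) \<le> C * mesh K \<tau>"
      using C(2)[rule_format, OF grid, of "mesh K \<tau>" K "space M"] step by simp
    also have "expectation (\<lambda>\<omega>. indicator (space M) \<omega> * (norm (X (\<tau> K) \<omega> - ?Y \<omega>))\<^sup>2) = expectation (\<lambda>\<omega>. (norm (X T \<omega> - ?Y \<omega>))\<^sup>2)"
      by (intro Bochner_Integration.integral_cong refl) (simp add: TK)
    finally have E: "expectation (\<lambda>\<omega>. (norm (X T \<omega> - ?Y \<omega>))\<^sup>2) \<le> C * mesh K \<tau>" .
    have YM: "?Y \<in> borel_measurable M" and ZM: "?Z \<in> borel_measurable M"
      by (rule measurable_F_M[OF cayley_scheme_measurable[OF f grid t0 _ order_refl]], rule Y0 X0M)+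
    have YI: "integrable M (\<lambda>\<omega>. (norm (X T \<omega> - ?Y \<omega>))\<^sup>2)"
    proof (rule integrable_const_bound[of _ "(2 * R)\<^sup>2"])
      show "AE \<omega> in M. norm ((norm (X T \<omega> - ?Y \<omega>))\<^sup>2) \<le> (2 * R)\<^sup>2"
        using bd
      proof eventually_elim
        case (elim \<omega>)
        have "?Y \<omega> \<in> stiefel" by (rule cayley_scheme_stiefel) (rule Y0(2))
        then have "norm (?Y \<omega>) \<le> R" using norm_stiefel[of "?Y \<omega>"] R by simp
        moreover have "norm (X T \<omega>) \<le> R" using elim tT by simp
        ultimately have "norm (X T \<omega> - ?Y \<omega>) \<le> 2 * R" using norm_triangle_ineq4[of "X T \<omega>" "?Y \<omega>"] by linarith
        then have "(norm (X T \<omega> - ?Y \<omega>))\<^sup>2 \<le> (2 * R)\<^sup>2" by (rule power_mono) simp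
        then show ?case by simp
      qed
      show "(\<lambda>\<omega>. (norm (X T \<omega> - ?Y \<omega>))\<^sup>2) \<in> borel_measurable M" using XTM YM by measurable
    qed
    have ae: "AE \<omega> in M. (norm2 (X T \<omega> - ?Z \<omega>))\<^sup>2 \<le> (norm (X T \<omega> - ?Y \<omega>))\<^sup>2"
      using Y0(3)
    proof eventually_elim
      case (elim \<omega>)
      have "?Z \<omega> = ?Y \<omega>" by (rule cayley_scheme_cong) (rule elim)
      then show ?case by (simp add: power_mono norm2_le_norm norm2_nonneg)
    qed
    have NI: "integrable M (\<lambda>\<omega>. (norm2 (X T \<omega> - ?Z \<omega>))\<^sup>2)"
    proof (rule Bochner_Integration.integrable_bound[OF YI])
      have "(\<lambda>\<omega>. norm2 (X T \<omega> - ?Z \<omega>)) \<in> borel_measurable M"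
        by (rule measurable_compose[OF borel_measurable_diff[OF XTM ZM] borel_measurable_continuous_onI[OF continuous_norm2]])
      then show "(\<lambda>\<omega>. (norm2 (X T \<omega> - ?Z \<omega>))\<^sup>2) \<in> borel_measurable M" by (rule borel_measurable_power)
      show "AE \<omega> in M. norm ((norm2 (X T \<omega> - ?Z \<omega>))\<^sup>2) \<le> norm ((norm (X T \<omega> - ?Y \<omega>))\<^sup>2)"
        using ae by eventually_elim simp
    qed
    have "expectation (\<lambda>\<omega>. (norm2 (X T \<omega> - ?Z \<omega>))\<^sup>2) \<le> C * mesh K \<tau>"
      by (rule order_trans[OF integral_mono_AE[OF NI YI ae] E])
    \<comment> \<open>The constant from \<open>stability\<close> may be 0, whereas a positive one is
      demanded.\<close>
    also have "\<dots> \<le> (C + 1) * mesh K \<tau>" using mesh0 by (intro mult_right_mono) auto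
    finally show ?thesis using NI by simp
  qed
  then show ?thesis using C(1) by (intro exI[of _ "C + 1"] conjI allI impI) simp_all
qed

end

theorem theorem3p2:
  fixes f :: "real ^ 'p::finite ^ 'n::finite \<Rightarrow> real"
    and M :: "'a measure" and \<F> :: "real \<Rightarrow> 'a measure"
    and B X :: "real \<Rightarrow> 'a \<Rightarrow> real ^ 'p ^ 'n"
    and \<sigma>0 t0 T :: real
  assumes "CARD('p) \<le> CARD('n)"
    and "smooth f"
    and "0 \<le> t0" and "t0 < T"
    and "filtered_prob_space M \<F>"
    and "matrix_brownian_motion M \<F> B"
    and "stiefel_sde_solution M \<F> B f \<sigma>0 t0 T X"
    and "AE \<omega> in M. X t0 \<omega> \<in> stiefel"
  shows "\<exists>C>0. \<exists>\<delta>0>0. \<forall>K \<tau>.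
    time_grid t0 T K \<tau> \<and> mesh K \<tau> \<in> {0<..<\<delta>0} \<longrightarrow>
      integrable M (\<lambda>\<omega>. (norm2 (X T \<omega> - cayley_scheme f \<sigma>0 \<tau> B (X t0) K \<omega>))\<^sup>2) \<and>
      (\<integral>\<omega>. (norm2 (X T \<omega> - cayley_scheme f \<sigma>0 \<tau> B (X t0) K \<omega>))\<^sup>2 \<partial>M) \<le> C * mesh K \<tau>"
proof -
  interpret stiefel_sde M \<F> B f \<sigma>0 t0 T X
    using assms by unfold_locales auto
  from strong_convergence[OF assms(8)] obtain C where "0 < C" and C: "\<forall>K \<tau>. time_grid t0 T K \<tau> \<longrightarrow>
      integrable M (\<lambda>\<omega>. (norm2 (X T \<omega> - cayley_scheme f \<sigma>0 \<tau> B (X t0) K \<omega>))\<^sup>2) \<and>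
      (\<integral>\<omega>. (norm2 (X T \<omega> - cayley_scheme f \<sigma>0 \<tau> B (X t0) K \<omega>))\<^sup>2 \<partial>M) \<le> C * mesh K \<tau>"
    by (elim exE conjE)
  \<comment> \<open>The estimate holds for every mesh, so the threshold 1 for
    \<open>\<delta>0\<close> is arbitrary.\<close>
  then show ?thesis by (intro exI[of _ C] exI[of _ 1] conjI allI impI) simp_all
qed

end
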